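(* Let $q\in\mathbb{C}^*$ not be a root of unity, fix a square root $q^{1/2}$, let $\dot z\in\mathbb{C}^*$, and let $\xi=q^{\frac12+\mathbb{Z}}$. Then: (1) The module $\Delta(q^{-\frac32},\dot z)$ is the unique simple object (up to isomorphism) in $\mathcal{O}[q^{\frac12+\mathbb{Z}},\tilde c_{q^{-3/2}},\dot z]$. Moreover, the block $\mathcal{O}[q^{\frac12+\mathbb{Z}},\tilde c_{q^{-3/2}},\dot z]$ is semisimple. (2) For $n\in\mathbb{Z}_{\ge0}$, the modules $\Delta(q^{-n-\frac52},\dot z)$ and $L(q^{n-\frac12},\dot z)$ are all the simple objects (up to isomorphism) in $\mathcal{O}[q^{\frac12+\mathbb{Z}},\tilde c_{q^{n-1/2}},\dot z]$. (3) For $n\in\mathbb{Z}_{\ge0}$, the category $\mathcal{O}[q^{\frac12+\mathbb{Z}},\tilde c_{q^{n-1/2}},\dot z]$ is equivalent to the category of finite dimensional representations over $\mathbb{C}$ of the quiver with two vertices $1,2$ and two arrows $a:1\to2$, $b:2\to1$, subject to the relation $ab=0$.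
   Context: $U_q(\mathfrak{s})$ (the quantum Schrödinger algebra) is the unital associative $\mathbb{C}$-algebra generated by $E,F,K,K^{-1},X,Y,Z$ with relations: $KK^{-1}=K^{-1}K=1$, $Z$ central, $EF-FE=\frac{K-K^{-1}}{q-q^{-1}}$, $KEK^{-1}=q^2E$, $KFK^{-1}=q^{-2}F$, $KXK^{-1}=qX$, $KYK^{-1}=q^{-1}Y$, $qYX-XY=Z$, $EX=qXE$, $EY=X+q^{-1}YE$, $FX=YK^{-1}+XF$, $FY=YF$. A $U_q(\mathfrak{s})$-module $V$ is a weight module if $V=\bigoplus_{\lambda\in\mathbb{C}^*}V_\lambda$, $V_\lambda=\{v: Kv=\lambda v\}$; $\mathrm{supp}(V)=\{\lambda:V_\lambda\neq0\}$. The category $\mathcal{O}$ is the full subcategory of left $U_q(\mathfrak{s})$-modules that are finitely generated, weight, and on which the subalgebra generated by $E,X$ acts locally finitely. For $\lambda\in\mathbb{C}^*$, the Verma module $\Delta(\lambda,\dot z)$ is the universal module generated by a vector $v_\lambda$ with $Ev_\lambda=Xv_\lambda=0$, $Kv_\lambda=\lambda v_\lambda$, $Zv_\lambda=\dot zv_\lambda$ (it has basis $Y^kF^lv_\lambda$, $k,l\ge0$), and $L(\lambda,\dot z)$ is its unique simple quotient. Let $C=FE+\frac{qK+q^{-1}K^{-1}}{(q-q^{-1})^2}$ and $$\tilde C=Z\big((1+q^{-1})C+\tfrac{1}{q^2-1}K^{-1}\big)+X^2F-Y^2EK^{-1}+XY(q^{-1}FE-qEF),$$ which is a central element of $U_q(\mathfrak{s})$.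 The scalar $\tilde c_\lambda$ is the one by which $\tilde C$ acts on the highest weight vector of $L(\lambda,\dot z)$, namely $\tilde c_\lambda=\frac{\dot z}{(q-q^{-1})^2}\big((q+q^2)\lambda+(q^{-1}+q^{-2})\lambda^{-1}\big)$. For a coset $\xi\in\mathbb{C}^*/q^{\mathbb{Z}}$ and $\dot c\in\mathbb{C}$, $\mathcal{O}[\xi,\dot c,\dot z]$ denotes the full subcategory of $\mathcal{O}$ of modules $M$ with $\mathrm{supp}(M)\subset\xi$ which are annihilated by some power of the maximal ideal $\langle\tilde C-\dot c,\,Z-\dot z\rangle$ of $\mathbb{C}[Z,\tilde C]$. Here $q^{\frac12+\mathbb{Z}}=\{q^{1/2}q^m:m\in\mathbb{Z}\}$.
   Formalization: The semisimplicity in (1) and the equivalence in (3) are stated for the modules of the block on which Z acts by the scalar ż; for the block as defined both fail (Verma module over C[e]/(e²) with Z = ż+e). *)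

theory Defs
  imports
    Complex_Main
    "HOL-Library.Poly_Mapping"
    "HOL-Library.FuncSet"
    "HOL-Algebra.Module"
    "HOL-Algebra.QuotRing"
    "HOL-Algebra.Ideal_Product"
    "HOL-Algebra.Generated_Rings"
begin

section \<open>Left modules over a ring\<close>

text \<open>The library locale \<open>module\<close> requires a commutative base ring.  Left modules over an
  arbitrary ring are carried by the same record type, so that the library's \<open>submodule\<close> applies.\<close>

locale left_module = R?: ring R + M?: abelian_group M
  for R :: "('a, 'c) ring_scheme" (structure) and M :: "('a, 'b, 'd) module_scheme" (structure) +
  assumes smult_closed [simp, intro]:
      "\<lbrakk>a \<in> carrier R; x \<in> carrier M\<rbrakk> \<Longrightarrow> a \<odot>\<^bsub>M\<^esub> x \<in> carrier M"
    and smult_l_distr: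
      "\<lbrakk>a \<in> carrier R; b \<in> carrier R; x \<in> carrier M\<rbrakk>
        \<Longrightarrow> (a \<oplus>\<^bsub>R\<^esub> b) \<odot>\<^bsub>M\<^esub> x = a \<odot>\<^bsub>M\<^esub> x \<oplus>\<^bsub>M\<^esub> b \<odot>\<^bsub>M\<^esub> x"
    and smult_r_distr:
      "\<lbrakk>a \<in> carrier R; x \<in> carrier M; y \<in> carrier M\<rbrakk>
        \<Longrightarrow> a \<odot>\<^bsub>M\<^esub> (x \<oplus>\<^bsub>M\<^esub> y) = a \<odot>\<^bsub>M\<^esub> x \<oplus>\<^bsub>M\<^esub> a \<odot>\<^bsub>M\<^esub> y"
    and smult_assoc1:
      "\<lbrakk>a \<in> carrier R; b \<in> carrier R; x \<in> carrier M\<rbrakk>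
        \<Longrightarrow> (a \<otimes>\<^bsub>R\<^esub> b) \<odot>\<^bsub>M\<^esub> x = a \<odot>\<^bsub>M\<^esub> (b \<odot>\<^bsub>M\<^esub> x)"
    and smult_one [simp]:
      "x \<in> carrier M \<Longrightarrow> \<one>\<^bsub>R\<^esub> \<odot>\<^bsub>M\<^esub> x = x"

definition generated_submodule :: "('a, 'c) ring_scheme \<Rightarrow> ('a, 'b) module \<Rightarrow> 'b set \<Rightarrow> 'b set" where
  "generated_submodule R M S = \<Inter>{N. submodule N R M \<and> S \<subseteq> N}"

definition finitely_generated :: "('a, 'c) ring_scheme \<Rightarrow> ('a, 'b) module \<Rightarrow> bool" where
  "finitely_generated R M \<longleftrightarrow>
     (\<exists>S. finite S \<and> S \<subseteq> carrier M \<and> generated_submodule R M S = carrier M)"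

definition linear_maps ::
    "('a, 'c) ring_scheme \<Rightarrow> ('a, 'b) module \<Rightarrow> ('a, 'd) module \<Rightarrow> ('b \<Rightarrow> 'd) set" where
  "linear_maps R M N =
     {f \<in> carrier M \<rightarrow> carrier N.
        (\<forall>x\<in>carrier M. \<forall>y\<in>carrier M. f (x \<oplus>\<^bsub>M\<^esub> y) = f x \<oplus>\<^bsub>N\<^esub> f y) \<and>
        (\<forall>a\<in>carrier R. \<forall>x\<in>carrier M. f (a \<odot>\<^bsub>M\<^esub> x) = a \<odot>\<^bsub>N\<^esub> f x)}"

definition module_iso :: "('a, 'c) ring_scheme \<Rightarrow> ('a, 'b) module \<Rightarrow> ('a, 'd) module \<Rightarrow> bool" where
  "module_iso R M N \<longleftrightarrow> (\<exists>f\<in>linear_maps R M N. bij_betw f (carrier M) (carrier N))"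

definition simple_module :: "('a, 'c) ring_scheme \<Rightarrow> ('a, 'b) module \<Rightarrow> bool" where
  "simple_module R M \<longleftrightarrow>
     carrier M \<noteq> {\<zero>\<^bsub>M\<^esub>} \<and> (\<forall>N. submodule N R M \<longrightarrow> N = {\<zero>\<^bsub>M\<^esub>} \<or> N = carrier M)"

definition regular_module :: "('a, 'c) ring_scheme \<Rightarrow> ('a, 'a) module" where
  "regular_module R =
     \<lparr>carrier = carrier R, mult = mult R, one = one R, zero = zero R, add = add R, smult = mult R\<rparr>"

text \<open>The fields \<open>mult\<close> and \<open>one\<close> of a module record play no role.\<close>

definition quotient_module :: "('a, 'b) module \<Rightarrow> 'b set \<Rightarrow> ('a, 'b set) module" where
  "quotient_module M N =
     \<lparr>carrier = a_rcosets\<^bsub>M\<^esub> N, mult = undefined, one = undefined, zero = N, add = set_add M,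
      smult = (\<lambda>a A. \<Union>x\<in>A. N +>\<^bsub>M\<^esub> (a \<odot>\<^bsub>M\<^esub> x))\<rparr>"

definition internal_direct_sum :: "('a, 'b) module \<Rightarrow> 'i set \<Rightarrow> ('i \<Rightarrow> 'b set) \<Rightarrow> bool" where
  "internal_direct_sum M I N \<longleftrightarrow>
     (\<forall>i\<in>I. subgroup (N i) (add_monoid M)) \<and>
     (\<forall>x\<in>carrier M. \<exists>!f. f \<in> (\<Pi>\<^sub>E i\<in>I. N i) \<and> finite {i \<in> I. f i \<noteq> \<zero>\<^bsub>M\<^esub>} \<and>
        x = finsum M f {i \<in> I. f i \<noteq> \<zero>\<^bsub>M\<^esub>})"

definition semisimple_module :: "('a, 'c) ring_scheme \<Rightarrow> ('a, 'b) module \<Rightarrow> bool" where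
  "semisimple_module R M \<longleftrightarrow>
     (\<exists>\<S>. (\<forall>N\<in>\<S>. submodule N R M \<and> simple_module R (M\<lparr>carrier := N\<rparr>)) \<and>
          internal_direct_sum M \<S> (\<lambda>N. N))"

definition univ_ring :: "'a :: ring_1 ring" where
  "univ_ring = \<lparr>carrier = UNIV, mult = (*), one = 1, zero = 0, add = (+)\<rparr>"

abbreviation complex_field :: "complex ring" where
  "complex_field \<equiv> univ_ring"


section \<open>The quantum Schroedinger algebra\<close>

datatype gen = gE | gF | gK | gKi | gX | gY | gZ

text \<open>Words form the free monoid on the generators (written additively, as convolution in
  \<open>Poly_Mapping\<close> requires), so \<open>word \<Rightarrow>\<^sub>0 complex\<close> is the free associative algebra.\<close>

datatype word = Word (letters: "gen list")

instantiation word :: monoid_add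
begin

definition zero_word :: word where "0 = Word []"

definition plus_word :: "word \<Rightarrow> word \<Rightarrow> word" where "u + v = Word (letters u @ letters v)"

instance by standard (auto simp: zero_word_def plus_word_def)

end

type_synonym free_alg = "word \<Rightarrow>\<^sub>0 complex"

definition scalar :: "complex \<Rightarrow> free_alg" where
  "scalar c = Poly_Mapping.single 0 c"

definition letter :: "gen \<Rightarrow> free_alg" where
  "letter g = Poly_Mapping.single (Word [g]) 1"

abbreviation "eE \<equiv> letter gE"
abbreviation "eF \<equiv> letter gF"
abbreviation "eK \<equiv> letter gK"
abbreviation "eKi \<equiv> letter gKi"
abbreviation "eX \<equiv> letter gX"
abbreviation "eY \<equiv> letter gY"
abbreviation "eZ \<equiv> letter gZ"

definition relators :: "complex \<Rightarrow> free_alg set" where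
  "relators q =
     {eK * eKi - 1,
      eKi * eK - 1,
      (eE * eF - eF * eE) - scalar (1 / (q - 1 / q)) * (eK - eKi),
      eK * eE * eKi - scalar (q ^ 2) * eE,
      eK * eF * eKi - scalar (1 / q ^ 2) * eF,
      eK * eX * eKi - scalar q * eX,
      eK * eY * eKi - scalar (1 / q) * eY,
      (scalar q * eY * eX - eX * eY) - eZ,
      eE * eX - scalar q * eX * eE,
      eE * eY - (eX + scalar (1 / q) * eY * eE),
      eF * eX - (eY * eKi + eX * eF),
      eF * eY - eY * eF}
     \<union> {eZ * letter g - letter g * eZ | g. True}"

definition relation_ideal :: "complex \<Rightarrow> free_alg set" where
  "relation_ideal q = genideal univ_ring (relators q)"

type_synonym ualg = "free_alg set"

definition U :: "complex \<Rightarrow> ualg ring" where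
  "U q = univ_ring Quot relation_ideal q"

definition cls :: "complex \<Rightarrow> free_alg \<Rightarrow> ualg" where
  "cls q a = relation_ideal q +>\<^bsub>univ_ring\<^esub> a"

definition subalgebra_generated :: "complex \<Rightarrow> ualg set \<Rightarrow> ualg set" where
  "subalgebra_generated q S = generate_ring (U q) (range (\<lambda>c. cls q (scalar c)) \<union> S)"

definition elemC :: "complex \<Rightarrow> free_alg" where
  "elemC q = eF * eE + scalar (1 / (q - 1 / q) ^ 2) * (scalar q * eK + scalar (1 / q) * eKi)"

definition elemCtilde :: "complex \<Rightarrow> free_alg" where
  "elemCtilde q =
     eZ * (scalar (1 + 1 / q) * elemC q + scalar (1 / (q ^ 2 - 1)) * eKi)
     + eX ^ 2 * eF - eY ^ 2 * eE * eKi
     + eX * eY * (scalar (1 / q) * eF * eE - scalar q * eE * eF)"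


section \<open>Weight modules and category O\<close>

definition vector_space_of :: "complex \<Rightarrow> (ualg, 'v) module \<Rightarrow> (complex, 'v) module" where
  "vector_space_of q M =
     \<lparr>carrier = carrier M, mult = mult M, one = one M, zero = zero M, add = add M,
      smult = (\<lambda>c v. cls q (scalar c) \<odot>\<^bsub>M\<^esub> v)\<rparr>"

definition weight_space :: "complex \<Rightarrow> (ualg, 'v) module \<Rightarrow> complex \<Rightarrow> 'v set" where
  "weight_space q M l = {v \<in> carrier M. cls q eK \<odot>\<^bsub>M\<^esub> v = cls q (scalar l) \<odot>\<^bsub>M\<^esub> v}"

definition weight_module :: "complex \<Rightarrow> (ualg, 'v) module \<Rightarrow> bool" where
  "weight_module q M \<longleftrightarrow> internal_direct_sum M (UNIV - {0}) (weight_space q M)"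

definition supp :: "complex \<Rightarrow> (ualg, 'v) module \<Rightarrow> complex set" where
  "supp q M = {l. l \<noteq> 0 \<and> weight_space q M l \<noteq> {\<zero>\<^bsub>M\<^esub>}}"

definition locally_finite :: "complex \<Rightarrow> ualg set \<Rightarrow> (ualg, 'v) module \<Rightarrow> bool" where
  "locally_finite q A M \<longleftrightarrow>
     (\<forall>v\<in>carrier M. finitely_generated complex_field
        ((vector_space_of q M)\<lparr>carrier := (\<lambda>a. a \<odot>\<^bsub>M\<^esub> v) ` A\<rparr>))"

definition category_O :: "complex \<Rightarrow> (ualg, 'v) module set" where
  "category_O q =
     {M. left_module (U q) M \<and> finitely_generated (U q) M \<and> weight_module q M \<and>
         locally_finite q (subalgebra_generated q {cls q eE, cls q eX}) M}"

definition verma :: "complex \<Rightarrow> complex \<Rightarrow> complex \<Rightarrow> (ualg, ualg set) module" where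
  "verma q l z =
     quotient_module (regular_module (U q))
       (generated_submodule (U q) (regular_module (U q))
          {cls q eE, cls q eX, cls q (eK - scalar l), cls q (eZ - scalar z)})"

definition simple_quotient :: "complex \<Rightarrow> complex \<Rightarrow> complex \<Rightarrow> (ualg, ualg set set) module" where
  "simple_quotient q l z =
     quotient_module (verma q l z)
       (THE N. submodule N (U q) (verma q l z) \<and>
               simple_module (U q) (quotient_module (verma q l z) N))"

definition ctilde :: "complex \<Rightarrow> complex \<Rightarrow> complex \<Rightarrow> complex" where
  "ctilde q z l =
     z / (q - 1 / q) ^ 2 * ((q + q ^ 2) * l + (1 / q + 1 / q ^ 2) * (1 / l))"

text \<open>The coset \<open>q\<^sup>1\<^sup>/\<^sup>2 q\<^sup>\<int>\<close>, where \<open>s\<close> is the chosen square root of \<open>q\<close>.\<close>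

definition half_coset :: "complex \<Rightarrow> complex \<Rightarrow> complex set" where
  "half_coset q s = {s * q powi m | m. True}"

definition central_subalgebra :: "complex \<Rightarrow> ualg ring" where
  "central_subalgebra q =
     (U q)\<lparr>carrier := subalgebra_generated q {cls q eZ, cls q (elemCtilde q)}\<rparr>"

definition central_ideal :: "complex \<Rightarrow> complex \<Rightarrow> complex \<Rightarrow> ualg set" where
  "central_ideal q c z =
     genideal (central_subalgebra q) {cls q (elemCtilde q - scalar c), cls q (eZ - scalar z)}"

definition block :: "complex \<Rightarrow> complex set \<Rightarrow> complex \<Rightarrow> complex \<Rightarrow> (ualg, 'v) module set" where
  "block q \<xi> c z =
     {M \<in> category_O q. supp q M \<subseteq> \<xi> \<and>
        (\<exists>k::nat. \<forall>a \<in> central_ideal q c z [^]\<^bsub>ideals_set (central_subalgebra q)\<^esub> k.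
           \<forall>v\<in>carrier M. a \<odot>\<^bsub>M\<^esub> v = \<zero>\<^bsub>M\<^esub>)}"

text \<open>Objects of \<^const>\<open>block\<close> of central charge \<open>z\<close>.  On a simple object of
  \<^const>\<open>block\<close> the central element \<open>Z\<close> is automatically the scalar \<open>z\<close>, but not on
  a general one: the Verma module over \<open>\<complex>[e]/(e\<^sup>2)\<close> with \<open>Z\<close> acting by \<open>z + e\<close>
  lies in \<^const>\<open>block\<close> and is a non-split self-extension of a Verma module.\<close>

definition charged_block ::
    "complex \<Rightarrow> complex set \<Rightarrow> complex \<Rightarrow> complex \<Rightarrow> (ualg, 'v) module set" where
  "charged_block q \<xi> c z =
     {M \<in> block q \<xi> c z. \<forall>v\<in>carrier M. cls q eZ \<odot>\<^bsub>M\<^esub> v = cls q (scalar z) \<odot>\<^bsub>M\<^esub> v}"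


section \<open>Linear categories and equivalences\<close>

text \<open>\<open>Comp C x y z g f\<close> is the composite of \<open>f : x \<rightarrow> y\<close> and \<open>g : y \<rightarrow> z\<close>.\<close>

record ('o, 'm) lin_cat =
  Ob :: "'o set"
  Hom :: "'o \<Rightarrow> 'o \<Rightarrow> (complex, 'm) module"
  Id :: "'o \<Rightarrow> 'm"
  Comp :: "'o \<Rightarrow> 'o \<Rightarrow> 'o \<Rightarrow> 'm \<Rightarrow> 'm \<Rightarrow> 'm"

locale linear_category =
  fixes C :: "('o, 'm) lin_cat"
  assumes hom_space: "\<lbrakk>x \<in> Ob C; y \<in> Ob C\<rbrakk> \<Longrightarrow> Module.module complex_field (Hom C x y)"
    and id_in_hom: "x \<in> Ob C \<Longrightarrow> Id C x \<in> carrier (Hom C x x)"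
    and comp_left_linear:
      "\<lbrakk>x \<in> Ob C; y \<in> Ob C; z \<in> Ob C; f \<in> carrier (Hom C x y)\<rbrakk>
        \<Longrightarrow> (\<lambda>g. Comp C x y z g f) \<in> linear_maps complex_field (Hom C y z) (Hom C x z)"
    and comp_right_linear:
      "\<lbrakk>x \<in> Ob C; y \<in> Ob C; z \<in> Ob C; g \<in> carrier (Hom C y z)\<rbrakk>
        \<Longrightarrow> (\<lambda>f. Comp C x y z g f) \<in> linear_maps complex_field (Hom C x y) (Hom C x z)"
    and comp_id_left:
      "\<lbrakk>x \<in> Ob C; y \<in> Ob C; f \<in> carrier (Hom C x y)\<rbrakk> \<Longrightarrow> Comp C x y y (Id C y) f = f"
    and comp_id_right:
      "\<lbrakk>x \<in> Ob C; y \<in> Ob C; f \<in> carrier (Hom C x y)\<rbrakk> \<Longrightarrow> Comp C x x y f (Id C x) = f"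
    and comp_assoc:
      "\<lbrakk>w \<in> Ob C; x \<in> Ob C; y \<in> Ob C; z \<in> Ob C;
        f \<in> carrier (Hom C w x); g \<in> carrier (Hom C x y); h \<in> carrier (Hom C y z)\<rbrakk>
        \<Longrightarrow> Comp C w x z (Comp C x y z h g) f = Comp C w y z h (Comp C w x y g f)"

definition cat_iso :: "('o, 'm) lin_cat \<Rightarrow> 'o \<Rightarrow> 'o \<Rightarrow> 'm \<Rightarrow> bool" where
  "cat_iso C x y f \<longleftrightarrow>
     f \<in> carrier (Hom C x y) \<and>
     (\<exists>g\<in>carrier (Hom C y x). Comp C x y x g f = Id C x \<and> Comp C y x y f g = Id C y)"

definition linear_functor ::
    "('o, 'm) lin_cat \<Rightarrow> ('p, 'n) lin_cat \<Rightarrow> ('o \<Rightarrow> 'p) \<Rightarrow> ('o \<Rightarrow> 'o \<Rightarrow> 'm \<Rightarrow> 'n) \<Rightarrow> bool" where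
  "linear_functor C D Fo Fm \<longleftrightarrow>
     Fo ` Ob C \<subseteq> Ob D \<and>
     (\<forall>x\<in>Ob C. \<forall>y\<in>Ob C.
        Fm x y \<in> linear_maps complex_field (Hom C x y) (Hom D (Fo x) (Fo y))) \<and>
     (\<forall>x\<in>Ob C. Fm x x (Id C x) = Id D (Fo x)) \<and>
     (\<forall>x\<in>Ob C. \<forall>y\<in>Ob C. \<forall>z\<in>Ob C. \<forall>f\<in>carrier (Hom C x y). \<forall>g\<in>carrier (Hom C y z).
        Fm x z (Comp C x y z g f) = Comp D (Fo x) (Fo y) (Fo z) (Fm y z g) (Fm x y f))"

definition natural_iso ::
    "('o, 'm) lin_cat \<Rightarrow> ('p, 'n) lin_cat \<Rightarrow> ('o \<Rightarrow> 'p) \<Rightarrow> ('o \<Rightarrow> 'o \<Rightarrow> 'm \<Rightarrow> 'n) \<Rightarrow>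
     ('o \<Rightarrow> 'p) \<Rightarrow> ('o \<Rightarrow> 'o \<Rightarrow> 'm \<Rightarrow> 'n) \<Rightarrow> ('o \<Rightarrow> 'n) \<Rightarrow> bool" where
  "natural_iso C D Fo Fm Go Gm \<eta> \<longleftrightarrow>
     (\<forall>x\<in>Ob C. cat_iso D (Fo x) (Go x) (\<eta> x)) \<and>
     (\<forall>x\<in>Ob C. \<forall>y\<in>Ob C. \<forall>f\<in>carrier (Hom C x y).
        Comp D (Fo x) (Fo y) (Go y) (\<eta> y) (Fm x y f) =
        Comp D (Fo x) (Go x) (Go y) (Gm x y f) (\<eta> x))"

definition equivalent_categories :: "('o, 'm) lin_cat \<Rightarrow> ('p, 'n) lin_cat \<Rightarrow> bool" where
  "equivalent_categories C D \<longleftrightarrow>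
     linear_category C \<and> linear_category D \<and>
     (\<exists>Fo Fm Go Gm \<eta> \<epsilon>.
        linear_functor C D Fo Fm \<and> linear_functor D C Go Gm \<and>
        natural_iso C C (\<lambda>x. x) (\<lambda>x y f. f)
          (\<lambda>x. Go (Fo x)) (\<lambda>x y f. Gm (Fo x) (Fo y) (Fm x y f)) \<eta> \<and>
        natural_iso D D (\<lambda>x. Fo (Go x)) (\<lambda>x y f. Fm (Go x) (Go y) (Gm x y f))
          (\<lambda>x. x) (\<lambda>x y f. f) \<epsilon>)"


section \<open>The two categories\<close>

text \<open>Morphisms are extensional functions, so that equality of morphisms is equality on the
  carrier.\<close>

definition ualg_hom_space ::
    "complex \<Rightarrow> (ualg, 'v) module \<Rightarrow> (ualg, 'v) module \<Rightarrow> (complex, 'v \<Rightarrow> 'v) module" where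
  "ualg_hom_space q M N =
     \<lparr>carrier = linear_maps (U q) M N \<inter> extensional (carrier M),
      mult = undefined, one = undefined,
      zero = (\<lambda>v\<in>carrier M. \<zero>\<^bsub>N\<^esub>),
      add = (\<lambda>f g. \<lambda>v\<in>carrier M. f v \<oplus>\<^bsub>N\<^esub> g v),
      smult = (\<lambda>c f. \<lambda>v\<in>carrier M. cls q (scalar c) \<odot>\<^bsub>N\<^esub> f v)\<rparr>"

definition full_module_category ::
    "complex \<Rightarrow> (ualg, 'v) module set \<Rightarrow> ((ualg, 'v) module, 'v \<Rightarrow> 'v) lin_cat" where
  "full_module_category q \<M> =
     \<lparr>Ob = \<M>,
      Hom = ualg_hom_space q,
      Id = (\<lambda>M. \<lambda>v\<in>carrier M. v),
      Comp = (\<lambda>L M N g f. compose (carrier L) g f)\<rparr>"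

text \<open>Representations of the quiver with arrows \<open>a : 1 \<rightarrow> 2\<close>, \<open>b : 2 \<rightarrow> 1\<close> and
  relation \<open>ab = 0\<close>, read as: first \<open>b\<close>, then \<open>a\<close>.  The opposite reading
  gives the same category up to exchanging the names of the two vertices.\<close>

record 'w quiver_rep =
  sp1 :: "(complex, 'w) module"
  sp2 :: "(complex, 'w) module"
  arr_a :: "'w \<Rightarrow> 'w"
  arr_b :: "'w \<Rightarrow> 'w"

definition quiver_reps :: "'w quiver_rep set" where
  "quiver_reps =
     {V. Module.module complex_field (sp1 V) \<and> finitely_generated complex_field (sp1 V) \<and>
         Module.module complex_field (sp2 V) \<and> finitely_generated complex_field (sp2 V) \<and>
         arr_a V \<in> linear_maps complex_field (sp1 V) (sp2 V) \<and>
         arr_b V \<in> linear_maps complex_field (sp2 V) (sp1 V) \<and>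
         (\<forall>v\<in>carrier (sp2 V). arr_a V (arr_b V v) = \<zero>\<^bsub>sp2 V\<^esub>)}"

definition quiver_hom_space ::
    "'w quiver_rep \<Rightarrow> 'w quiver_rep \<Rightarrow> (complex, ('w \<Rightarrow> 'w) \<times> ('w \<Rightarrow> 'w)) module" where
  "quiver_hom_space V W =
     \<lparr>carrier =
        {(f1, f2).
           f1 \<in> linear_maps complex_field (sp1 V) (sp1 W) \<inter> extensional (carrier (sp1 V)) \<and>
           f2 \<in> linear_maps complex_field (sp2 V) (sp2 W) \<inter> extensional (carrier (sp2 V)) \<and>
           (\<forall>v\<in>carrier (sp1 V). f2 (arr_a V v) = arr_a W (f1 v)) \<and>
           (\<forall>v\<in>carrier (sp2 V). f1 (arr_b V v) = arr_b W (f2 v))},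
      mult = undefined, one = undefined,
      zero = (\<lambda>v\<in>carrier (sp1 V). \<zero>\<^bsub>sp1 W\<^esub>, \<lambda>v\<in>carrier (sp2 V). \<zero>\<^bsub>sp2 W\<^esub>),
      add = (\<lambda>f g. (\<lambda>v\<in>carrier (sp1 V). fst f v \<oplus>\<^bsub>sp1 W\<^esub> fst g v,
                    \<lambda>v\<in>carrier (sp2 V). snd f v \<oplus>\<^bsub>sp2 W\<^esub> snd g v)),
      smult = (\<lambda>c f. (\<lambda>v\<in>carrier (sp1 V). c \<odot>\<^bsub>sp1 W\<^esub> fst f v,
                      \<lambda>v\<in>carrier (sp2 V). c \<odot>\<^bsub>sp2 W\<^esub> snd f v))\<rparr>"

definition quiver_category :: "('w quiver_rep, ('w \<Rightarrow> 'w) \<times> ('w \<Rightarrow> 'w)) lin_cat" where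
  "quiver_category =
     \<lparr>Ob = quiver_reps,
      Hom = quiver_hom_space,
      Id = (\<lambda>V. (\<lambda>v\<in>carrier (sp1 V). v, \<lambda>v\<in>carrier (sp2 V). v)),
      Comp = (\<lambda>V W X g f. (compose (carrier (sp1 V)) (fst g) (fst f),
                           compose (carrier (sp2 V)) (snd g) (snd f)))\<rparr>"

end

theory Submission
 imports Defs "HOL-Library.Function_Algebras" "HOL-Library.Product_Plus"
begin

text \<open>Put \<open>F' = F - Y\<^sup>2 K\<^sup>-\<^sup>1 / (z (1 + q))\<close> and \<open>th l = (q l + q\<^sup>-\<^sup>2 l\<^sup>-\<^sup>1) / (q - q\<^sup>-\<^sup>1)\<^sup>2\<close>.  Both \<open>E\<close> and
 \<open>F'\<close> preserve the kernel of \<open>X\<close>, on whose vectors of weight \<open>l\<close> one has \<open>E F' - F' E = th l - th (l / q\<^sup>2)\<close>,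
 while the central element acts there as \<open>z (1 + q) (F' E + th l)\<close>.  A module of central charge \<open>z\<close> on which
 \<open>X\<close> is locally nilpotent is freely generated over \<open>\<complex>[Y]\<close> by the kernel of \<open>X\<close>, so that everything happens
 inside this kernel.

 In the block with parameter \<open>N\<close> (\<open>N = 0\<close> in part (1), \<open>N = n + 1\<close> in the other parts) the only
 weights \<open>l\<close> in the coset for which \<open>th l\<close> has the required value are \<open>l\<^sub>0 = s\<^bsup>2N-3\<^esup>\<close> and
 \<open>l\<^sub>1 = l\<^sub>0 / q\<^bsup>2N\<^esup>\<close>.  Hence a module is spanned by the \<open>Y\<^sup>k F'\<^sup>i v\<close> with \<open>v\<close> a vector of one of these weights in the
 kernel of \<open>X\<close>, and every nonzero submodule contains such a vector.  The module is therefore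
 determined by these two weight spaces and the maps \<open>a = E\<^sup>N\<close> and \<open>b = F'\<^sup>N\<close> between them.  The
 product formula for \<open>E\<^sup>N F'\<^sup>N\<close> on weight \<open>l\<^sub>0\<close> has the factor \<open>th l\<^sub>0 - th l\<^sub>1 = 0\<close>, which is the
 relation \<open>a b = 0\<close>; conversely every representation of the quiver arises.\<close>

section \<open>Complex vector spaces as a type class\<close>

text \<open>On the kernel of \<open>X\<close> one has \<open>X (F w) = - Y (Ki w)\<close>, while
  \<open>X\<close> takes \<open>Y (Y u)\<close> to \<open>- z (1 + q) Y u\<close>. The constant in
  \<open>F'\<close> makes the two cancel; it exists because \<open>z\<close> and
  \<open>1 + q\<close> are nonzero. The function \<open>th\<close> is a primitive of the resulting
  commutator, so commutators with powers of \<open>F'\<close> telescope. Away from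
  \<open>l\<^sub>0\<close> and \<open>l\<^sub>1\<close>, the operator \<open>F' E\<close> on a
  weight space of the kernel is nilpotent plus a nonzero scalar, hence bijective: such weight spaces
  carry no information of their own. A basis of the algebra is never computed. Verma modules are
  seen to be nonzero by mapping them to an explicit model built from a quiver representation.
  Modules are records with carriers in arbitrary types, so linear algebra takes place in copies of
  them inside vector space types. Neither these copies nor the representation belonging to a module
  are canonical. The equivalence is therefore built from all identifications at once, with functors
  chosen only at the very end, and module maps are produced by generating their graphs.\<close>

class cvec = ab_group_add +
 fixes cscale :: "complex \<Rightarrow> 'a \<Rightarrow> 'a" (infixr "*s" 75)
 assumes cscale_add_right: "a *s (x + y) = a *s x + a *s y"
  and cscale_add_left: "(a + b) *s x = a *s x + b *s x"
  and cscale_cscale: "a *s (b *s x) = (a * b) *s x"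
  and cscale_one: "1 *s x = x"

global_interpretation cv: vector_space "cscale :: complex \<Rightarrow> 'a \<Rightarrow> 'a::cvec"
 by unfold_locales (simp_all add: cscale_add_right cscale_add_left cscale_cscale cscale_one)

global_interpretation cvp: vector_space_pair "cscale :: complex \<Rightarrow> 'a \<Rightarrow> 'a::cvec"
  "cscale :: complex \<Rightarrow> 'b \<Rightarrow> 'b::cvec"
 by unfold_locales

abbreviation clinear :: "('a::cvec \<Rightarrow> 'b::cvec) \<Rightarrow> bool" where
 "clinear f \<equiv> Vector_Spaces.linear cscale cscale f"

instantiation "fun" :: (type, cvec) cvec
begin
definition cscale_fun :: "complex \<Rightarrow> ('a \<Rightarrow> 'b) \<Rightarrow> 'a \<Rightarrow> 'b" where
 "c *s f = (\<lambda>x. c *s f x)"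
instance
 by standard (auto simp: cscale_fun_def fun_eq_iff cscale_add_right cscale_add_left cscale_cscale cscale_one)
end

instantiation prod :: (cvec, cvec) cvec
begin
definition cscale_prod :: "complex \<Rightarrow> 'a \<times> 'b \<Rightarrow> 'a \<times> 'b" where
 "c *s p = (c *s fst p, c *s snd p)"
instance
 by standard (auto simp: cscale_prod_def prod_eq_iff cscale_add_right cscale_add_left cscale_cscale cscale_one)
end

instantiation complex :: cvec
begin
definition cscale_complex :: "complex \<Rightarrow> complex \<Rightarrow> complex" where
 "c *s d = c * d"
instance
 by standard (auto simp: cscale_complex_def algebra_simps)
end

text \<open>The type \<open>'v \<Rightarrow>\<^sub>0 complex\<close> of formal combinations houses
  the copy of a module whose carrier lies in \<open>'v\<close>.\<close>

instantiation poly_mapping :: (type, cvec) cvec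
begin
definition cscale_poly_mapping :: "complex \<Rightarrow> ('a \<Rightarrow>\<^sub>0 'b) \<Rightarrow> 'a \<Rightarrow>\<^sub>0 'b" where
 "c *s p = Poly_Mapping.map (cscale c) p"

lemma lookup_cscale: "poly_mapping.lookup (c *s p) x = c *s poly_mapping.lookup (p :: 'a \<Rightarrow>\<^sub>0 'b) x"
 by (simp add: cscale_poly_mapping_def Poly_Mapping.map.rep_eq when_def)

instance
 by standard (auto intro!: poly_mapping_eqI
   simp: lookup_cscale lookup_add cscale_add_right cscale_add_left cscale_cscale cscale_one)
end

lemma cscale_fun_apply: "(c *s f) x = c *s f x"
 by (simp add: cscale_fun_def)

lemma fst_cscale [simp]: "fst (c *s p) = c *s fst p"
 and snd_cscale [simp]: "snd (c *s p) = c *s snd p"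
 by (simp_all add: cscale_prod_def)

lemma clinearI:
 assumes "\<And>x y. f (x + y) = f x + f y" and "\<And>c x. f (c *s x) = c *s f x"
 shows "clinear f"
 using assms by (simp add: Vector_Spaces.linear_iff cv.vector_space_axioms)

lemma clinear_add: "clinear f \<Longrightarrow> f (x + y) = f x + f y"
 and clinear_scale: "clinear f \<Longrightarrow> f (c *s x) = c *s f x"
 and clinear_0: "clinear f \<Longrightarrow> f 0 = 0"
 and clinear_diff: "clinear f \<Longrightarrow> f (x - y) = f x - f y"
 and clinear_neg: "clinear f \<Longrightarrow> f (- x) = - f x"
 by (simp_all add: cvp.linear_add cvp.linear_scale cvp.linear_0 cvp.linear_diff cvp.linear_neg)

lemmas clin = clinear_add clinear_scale clinear_0 clinear_diff clinear_neg

lemma clinear_comp: "clinear f \<Longrightarrow> clinear g \<Longrightarrow> clinear (\<lambda>x. g (f x))"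
 by (rule clinearI) (simp_all add: clin)

lemma clinear_pow: "clinear f \<Longrightarrow> clinear ((f :: 'a::cvec \<Rightarrow> 'a) ^^ n)"
 by (induct n) (auto intro!: clinearI simp: clin)

lemma clinear_id: "clinear (\<lambda>x. x)"
 by (rule clinearI) auto

lemma clinear_cscale: "clinear (\<lambda>x. c *s x)"
 by (rule clinearI) (simp_all add: cv.scale_right_distrib mult.commute)

lemma clinear_combine:
 "clinear f \<Longrightarrow> clinear g \<Longrightarrow> clinear (\<lambda>x. f x + g x)"
 "clinear f \<Longrightarrow> clinear g \<Longrightarrow> clinear (\<lambda>x. f x - g x)"
 "clinear f \<Longrightarrow> clinear (\<lambda>x. c *s f x)"
 by (rule clinearI; simp add: clin algebra_simps cv.scale_right_distrib cv.scale_right_diff_distrib)+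

text \<open>The standard way below to pass from generators to a span. With \<open>{0}\<close> for
  \<open>P\<close> it shows that a linear map vanishes on a span, with the identity for
  \<open>f\<close> that one span lies in another.\<close>

lemma span_image_subset:
 assumes "clinear f" "cv.subspace P" "\<And>b. b \<in> B \<Longrightarrow> f b \<in> P" "x \<in> cv.span B"
 shows "f x \<in> P"
 using assms(4)
proof (induct rule: cv.span_induct_alt)
 case base
 show ?case using assms by (simp add: clin cv.subspace_0)
next
 case (step c x y)
 then show ?case using assms by (simp add: clin cv.subspace_add cv.subspace_scale)
qed

lemma span_subset_subspace: "B \<subseteq> P \<Longrightarrow> cv.subspace P \<Longrightarrow> cv.span B \<subseteq> P"
 by (rule cv.span_minimal)

lemma span_finite_subset:
 assumes "x \<in> cv.span B"
 shows "\<exists>B0. finite B0 \<and> B0 \<subseteq> B \<and> x \<in> cv.span B0"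
 using assms
proof (induct rule: cv.span_induct_alt)
 case base
 show ?case by (rule exI[of _ "{}"]) (simp add: cv.span_zero)
next
 case (step c x y)
 then obtain B0 where B0: "finite B0" "B0 \<subseteq> B" "y \<in> cv.span B0" by auto
 have "c *s x + y \<in> cv.span (insert x B0)"
  using B0(3) by (meson cv.span_add cv.span_base cv.span_mono cv.span_scale insertI1 subset_iff subset_insertI)
 then show ?case using B0 step by (intro exI[of _ "insert x B0"]) auto
qed

lemma span_finite_subset_set:
 assumes "finite G" "G \<subseteq> cv.span B"
 shows "\<exists>B0. finite B0 \<and> B0 \<subseteq> B \<and> G \<subseteq> cv.span B0"
 using assms
proof (induct rule: finite_induct)
 case empty
 then show ?case by auto
next
 case (insert x G)
 then obtain B0 B1 where "finite B0" "B0 \<subseteq> B" "G \<subseteq> cv.span B0"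
  "finite B1" "B1 \<subseteq> B" "x \<in> cv.span B1"
  using span_finite_subset[of x B] by auto
 moreover have "cv.span B0 \<subseteq> cv.span (B0 \<union> B1)" "cv.span B1 \<subseteq> cv.span (B0 \<union> B1)"
  by (auto intro: cv.span_mono[THEN subsetD])
 ultimately show ?case by (intro exI[of _ "B0 \<union> B1"]) auto
qed

subsection \<open>Eigenvectors\<close>

text \<open>Induction on the number of eigenvalues: \<open>A - m\<close> removes the component of
  eigenvalue \<open>m\<close> and multiplies each other component by the nonzero number
  \<open>l - m\<close>, without leaving \<open>P\<close>.\<close>

lemma eig_closed:
 assumes A: "clinear A" and P: "cv.subspace P" "\<And>x. x \<in> P \<Longrightarrow> A x \<in> P"
  and "finite L" "\<And>l. l \<in> L \<Longrightarrow> A (y l) = l *s y l" "(\<Sum>l\<in>L. y l) \<in> P" "l \<in> L"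
 shows "y l \<in> P"
 using assms(4-)
proof (induct L arbitrary: y l rule: finite_induct)
 case (insert m L)
 define x where "x = (\<Sum>l\<in>insert m L. y l)"
 have x: "x = y m + (\<Sum>l\<in>L. y l)" using insert by (simp add: x_def)
 have xP: "x \<in> P" using insert by (simp add: x_def)
 have "A x - m *s x = (\<Sum>l\<in>L. (l - m) *s y l)"
 proof -
  have "A x = m *s y m + (\<Sum>l\<in>L. l *s y l)"
   unfolding x using insert by (simp add: clin[OF A] cvp.linear_sum[OF A])
  then show ?thesis
   unfolding x by (simp add: cv.scale_right_distrib cv.scale_sum_right cv.scale_left_diff_distrib sum_subtractf)
 qed
 then have "(\<Sum>l\<in>L. (l - m) *s y l) \<in> P"
  using P xP by (metis cv.subspace_diff cv.subspace_scale)
 moreover have "A ((l - m) *s y l) = l *s ((l - m) *s y l)" if "l \<in> L" for l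
  using insert that by (simp add: clin[OF A] mult.commute)
 ultimately have *: "(l - m) *s y l \<in> P" if "l \<in> L" for l
  using insert.hyps(3)[of "\<lambda>l. (l - m) *s y l" l] that by blast
 have yL: "y l \<in> P" if "l \<in> L" for l
 proof -
  have "l - m \<noteq> 0" using that insert by auto
  then have "y l = (1 / (l - m)) *s ((l - m) *s y l)" by simp
  then show ?thesis using *[OF that] P(1) cv.subspace_scale by metis
 qed
 have "y m = x - (\<Sum>l\<in>L. y l)" using x by simp
 then have "y m \<in> P" using xP yL P(1) by (simp add: cv.subspace_diff cv.subspace_sum)
 then show ?case using yL insert by auto
qed auto

lemma eig_indep:
 assumes "clinear A" "finite L" "\<And>l. l \<in> L \<Longrightarrow> A (y l) = l *s y l" "(\<Sum>l\<in>L. y l) = 0" "l \<in> L"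
 shows "y l = 0"
 using eig_closed[of A "{0}" L y l] assms by (simp add: clin)

lemma eig_decomp:
 assumes "x \<in> cv.span B" and "\<And>b. b \<in> B \<Longrightarrow> \<exists>l\<in>\<Lambda>. A b = l *s b"
 shows "\<exists>L y. finite L \<and> L \<subseteq> \<Lambda> \<and> (\<forall>l\<in>L. y l \<in> cv.span {b \<in> B. A b = l *s b}) \<and> x = (\<Sum>l\<in>L. y l)"
 using assms(1)
proof (induct rule: cv.span_induct_alt)
 case base
 show ?case by (rule exI[of _ "{}"]) auto
next
 case (step c b x)
 then obtain L y where L: "finite L" "L \<subseteq> \<Lambda>" "\<forall>l\<in>L. y l \<in> cv.span {b \<in> B. A b = l *s b}"
  "x = (\<Sum>l\<in>L. y l)" by auto
 obtain m where m: "m \<in> \<Lambda>" "A b = m *s b" using step(1) assms(2) by blast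
 \<comment> \<open>The new term joins the component of eigenvalue \<open>m\<close>, whether or not
   \<open>m\<close> already occurs in \<open>L\<close>.\<close>
 define y' where "y' l = (if l = m then c *s b else 0) + (if l \<in> L then y l else 0)" for l
 have "c *s b \<in> cv.span {b \<in> B. A b = m *s b}"
  using m step by (auto intro: cv.span_base cv.span_scale)
 then have 1: "\<forall>l\<in>insert m L. y' l \<in> cv.span {b \<in> B. A b = l *s b}"
  using L(3) by (auto simp: y'_def cv.span_zero intro: cv.span_add)
 have "(\<Sum>l\<in>insert m L. y' l) = (\<Sum>l\<in>insert m L. if l = m then c *s b else 0)
   + (\<Sum>l\<in>insert m L. if l \<in> L then y l else 0)"
  by (simp only: y'_def sum.distrib)
 also have "(\<Sum>l\<in>insert m L. if l = m then c *s b else 0) = c *s b"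
  using L(1) by simp
 also have "(\<Sum>l\<in>insert m L. if l \<in> L then y l else 0) = (\<Sum>l\<in>L. y l)"
  using L(1) by (intro sum.mono_neutral_cong_right) auto
 finally have "c *s b + x = (\<Sum>l\<in>insert m L. y' l)" using L(4) by simp
 then show ?case using L m 1 by (intro exI[of _ "insert m L"] exI[of _ y']) auto
qed

lemma eig_in_span:
 assumes A: "clinear A" "y \<in> cv.span {b \<in> B. A b = l *s b}"
 shows "A y = l *s y"
 using assms(2)
 by (induct rule: cv.span_induct_alt)
  (auto simp: clin[OF A(1)] cv.scale_right_distrib mult.commute)

text \<open>A decomposition into eigenvectors and the one-term decomposition \<open>x\<close> of
  eigenvalue \<open>m\<close> must agree, because eigenvectors for distinct eigenvalues are
  independent.\<close>

lemma eig_component: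
 assumes A: "clinear A" and B: "\<And>b. b \<in> B \<Longrightarrow> \<exists>l. A b = l *s b"
  and x: "x \<in> cv.span B" "A x = m *s x"
 shows "x \<in> cv.span {b \<in> B. A b = m *s b}"
proof -
 obtain L y where L: "finite L" "\<forall>l\<in>L. y l \<in> cv.span {b \<in> B. A b = l *s b}" "x = (\<Sum>l\<in>L. y l)"
  using eig_decomp[OF x(1), of UNIV A] B by blast
 \<comment> \<open>Difference of the two decompositions of \<open>x\<close>: its components are
   eigenvectors with sum zero.\<close>
 define y' where "y' l = (if l \<in> L then y l else 0) - (if l = m then x else 0)" for l
 have ev: "A (y' l) = l *s y' l" if "l \<in> insert m L" for l
 proof -
  have "A (y l) = l *s y l" if "l \<in> L" for l
   using eig_in_span[OF A(1)] L(2) that by blast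
  then show ?thesis
   using that x(2) by (simp add: y'_def clin[OF A(1)] cv.scale_right_diff_distrib)
 qed
 have "(\<Sum>l\<in>insert m L. y' l) = (\<Sum>l\<in>insert m L. if l \<in> L then y l else 0)
   - (\<Sum>l\<in>insert m L. if l = m then x else 0)"
  by (simp only: y'_def sum_subtractf)
 also have "(\<Sum>l\<in>insert m L. if l = m then x else 0) = x"
  using L(1) by simp
 also have "(\<Sum>l\<in>insert m L. if l \<in> L then y l else 0) = (\<Sum>l\<in>L. y l)"
  using L(1) by (intro sum.mono_neutral_cong_right) auto
 finally have "(\<Sum>l\<in>insert m L. y' l) = 0" using L(3) by simp
 then have "y' m = 0" using eig_indep[of A "insert m L" y' m] A ev L(1) by auto
 then have "x = (if m \<in> L then y m else 0)" by (simp add: y'_def)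
 then show ?thesis using L(2) by (auto simp: cv.span_zero split: if_splits)
qed

text \<open>The components of a vector of \<open>P\<close>, taken in \<open>S\<close>, already lie
  in \<open>P\<close> by \<open>eig_closed\<close>. This makes submodules of weight modules weight
  modules.\<close>

lemma eig_subspace:
 assumes A: "clinear A" and P: "cv.subspace P" "\<And>x. x \<in> P \<Longrightarrow> A x \<in> P"
  and S: "cv.subspace S" "P \<subseteq> S" "S \<subseteq> cv.span (\<Union>l\<in>\<Lambda>. {x \<in> S. A x = l *s x})"
 shows "P \<subseteq> cv.span (\<Union>l\<in>\<Lambda>. {x \<in> P. A x = l *s x})"
proof
 fix x assume x: "x \<in> P"
 then have "x \<in> cv.span (\<Union>l\<in>\<Lambda>. {x \<in> S. A x = l *s x})" using S by auto
 then obtain L y where L: "finite L" "L \<subseteq> \<Lambda>"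
  "\<forall>l\<in>L. y l \<in> cv.span {b \<in> (\<Union>l\<in>\<Lambda>. {x \<in> S. A x = l *s x}). A b = l *s b}" "x = (\<Sum>l\<in>L. y l)"
  using eig_decomp[of x _ \<Lambda> A] by blast
 have ev: "A (y l) = l *s y l" if "l \<in> L" for l
  using eig_in_span[OF A] L(3) that by blast
 have "y l \<in> P" if "l \<in> L" for l
  using eig_closed[OF A P L(1) ev] L(4) x that by auto
 then have "y l \<in> cv.span (\<Union>l\<in>\<Lambda>. {x \<in> P. A x = l *s x})" if "l \<in> L" for l
  using that ev L(2) by (intro cv.span_base) auto
 then show "x \<in> cv.span (\<Union>l\<in>\<Lambda>. {x \<in> P. A x = l *s x})"
  unfolding L(4) by (intro cv.span_sum)
qed

section \<open>Modules of central charge z\<close>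

lemmas vs = cv.scale_right_distrib cv.scale_right_diff_distrib cv.scale_left_distrib cv.scale_left_diff_distrib

section \<open>Scalars: q-integers, the coefficients of the commutation formulas, and the function
  th\<close>

locale qparam =
 fixes q z :: complex
 assumes q0: "q \<noteq> 0" and qn: "\<And>n::nat. n > 0 \<Longrightarrow> q ^ n \<noteq> 1" and z0: "z \<noteq> 0"
begin

lemma q1: "q \<noteq> 1" using qn[of 1] by simp
lemma q2: "q ^ 2 \<noteq> 1" using qn[of 2] by simp
lemma q1p: "1 + q \<noteq> 0"
proof
 assume "1 + q = 0" then have "q = -1" by (simp add: add_eq_0_iff)
 then show False using q2 by simp
qed
lemma qd: "q - 1 / q \<noteq> 0"
 using q0 q2 by (auto simp: field_simps power2_eq_square)
lemma qq1: "q * q \<noteq> 1" using q2 by (simp add: power2_eq_square)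

lemma qpow_inj: "q ^ m = q ^ n \<longleftrightarrow> m = n"
proof -
 have "q ^ m \<noteq> q ^ n" if "m < n" for m n
 proof
  assume "q ^ m = q ^ n"
  moreover have "q ^ n = q ^ m * q ^ (n - m)" using that by (simp flip: power_add)
  ultimately have "q ^ (n - m) = 1" using q0 by simp
  then show False using qn[of "n - m"] that by simp
 qed
 then show ?thesis by (metis linorder_neqE_nat)
qed

text \<open>The q-integer \<open>1 + q + ... + q ^ (k - 1)\<close>, which appears when
  \<open>X\<close> is moved past \<open>Y ^^ k\<close>.\<close>

definition qi :: "nat \<Rightarrow> complex" where "qi k = (q ^ k - 1) / (q - 1)"

lemma qi_0 [simp]: "qi 0 = 0" by (simp add: qi_def)
lemma qi_Suc: "qi (Suc k) = q * qi k + 1" using q1 by (simp add: qi_def field_simps)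
lemma qi_1: "qi (Suc 0) = 1" by (simp add: qi_Suc)
lemma qi_nz: "k > 0 \<Longrightarrow> qi k \<noteq> 0" using q1 qn by (simp add: qi_def)

text \<open>The coefficient of \<open>(Y ^^ (k - 2)) w\<close> in \<open>E ((Y ^^ k) w)\<close> when
  \<open>X w = 0\<close>. The recursion is the relation \<open>E Y = X + Y E / q\<close>, with
  \<open>X\<close> producing the q-integer.\<close>

fun eps :: "nat \<Rightarrow> complex" where
 "eps 0 = 0" | "eps (Suc k) = - z * qi k + eps k / q"

text \<open>\<open>1 + q\<close> is \<open>qi 2\<close>, the q-integer met when \<open>X\<close>
  passes \<open>Y ^^ 2\<close>.\<close>

definition kap :: complex where "kap = 1 / (z * (1 + q))"

definition th :: "complex \<Rightarrow> complex" where "th l = (q * l + 1 / (q ^ 2 * l)) / (q - 1 / q) ^ 2"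

lemma ctilde_th: "l \<noteq> 0 \<Longrightarrow> ctilde q z l = z * (1 + q) * th l"
 using q0 by (simp add: ctilde_def th_def field_simps power2_eq_square)

text \<open>The left side is the scalar by which \<open>E\<close> and \<open>F'\<close> fail to
  commute on weight \<open>l\<close>; the second summand is the contribution of the correction term
  in \<open>F'\<close>. Written as a difference of one function at neighbouring weights, it
  telescopes along a chain.\<close>

lemma th_step:
 assumes "l \<noteq> 0"
 shows "(l - 1 / l) / (q - 1 / q) + kap * z / l = th l - th (l / q ^ 2)"
proof -
 define d where "d = q - 1 / q"
 have d: "d \<noteq> 0" "d * q = q * q - 1" using qd q0 by (auto simp: d_def field_simps)
 have kz: "kap * z = (q - 1) / (q * d)"
 proof -
  have "q * d = (q - 1) * (1 + q)" using d by (simp add: algebra_simps)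
  then show ?thesis using z0 q1p q1 by (simp add: kap_def)
 qed
 have "(l - 1 / l) / d + kap * z / l = ((l - 1 / l) + (q - 1) / (q * l)) / d"
  unfolding kz by (simp add: add_divide_distrib ac_simps)
 also have "(l - 1 / l) + (q - 1) / (q * l) = l - 1 / (q * l)"
  using q0 assms by (simp add: field_simps)
 also have "(l - 1 / (q * l)) / d = th l - th (l / q ^ 2)"
 proof -
  have 1: "q * (l / (q * q)) = l / q" "1 / (q * q * (l / (q * q))) = 1 / l"
   using q0 by simp_all
  have "th l - th (l / q ^ 2) = (q * l + 1 / (q * q * l) - l / q - 1 / l) / (d * d)"
   unfolding th_def d_def[symmetric] power2_eq_square 1
   by (simp add: diff_divide_distrib add_divide_distrib)
  also have "q * l + 1 / (q * q * l) - l / q - 1 / l = d * (l - 1 / (q * l))"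
   using q0 assms by (simp add: d_def field_simps)
  finally show ?thesis using d by simp
 qed
 finally show ?thesis by (simp add: d_def)
qed

text \<open>The difference of the two values contains the factor
  \<open>(l - m) * (l * m * q ^ 3 - 1)\<close>: a value of \<open>th\<close> determines the weight
  up to the reflection \<open>l \<mapsto> 1 / (q ^ 3 * l)\<close>.\<close>

lemma th_eq_iff:
 assumes "l \<noteq> 0" "m \<noteq> 0"
 shows "th l = th m \<longleftrightarrow> l = m \<or> l * m = 1 / q ^ 3"
proof -
 have "th l = th m \<longleftrightarrow> q * l + 1 / (q ^ 2 * l) = q * m + 1 / (q ^ 2 * m)"
  using qd by (simp add: th_def)
 also have "\<dots> \<longleftrightarrow> (l - m) * (l * m * q ^ 3 - 1) = 0"
 proof -
  have "(q * l + 1 / (q ^ 2 * l)) - (q * m + 1 / (q ^ 2 * m))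
    = (l - m) * (l * m * q ^ 3 - 1) / (q ^ 2 * l * m)"
   using assms q0 by (simp add: field_simps power2_eq_square power3_eq_cube)
  then show ?thesis using assms q0 by (simp only: eq_iff_diff_eq_0[of "q * l + _"]) simp
 qed
 also have "\<dots> \<longleftrightarrow> l = m \<or> l * m = 1 / q ^ 3"
  using q0 by (simp add: eq_divide_eq)
 finally show ?thesis .
qed

end

text \<open>The operators are linear on the whole type, but satisfy the relations only on
  \<open>S\<close>. Thus a submodule is an instance with the same operators and a smaller
  \<open>S\<close>, see \<open>stable_qs\<close>. The central generator is absent, being the scalar
  \<open>z\<close>.\<close>

locale qs = qparam q z for q z +
 fixes S :: "'a::cvec set" and E F K Ki X Y :: "'a \<Rightarrow> 'a"
 assumes subS: "cv.subspace S"
  and lin: "clinear E" "clinear F" "clinear K" "clinear Ki" "clinear X" "clinear Y"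
  and clo: "\<And>m. m \<in> S \<Longrightarrow> E m \<in> S" "\<And>m. m \<in> S \<Longrightarrow> F m \<in> S" "\<And>m. m \<in> S \<Longrightarrow> K m \<in> S"
   "\<And>m. m \<in> S \<Longrightarrow> Ki m \<in> S" "\<And>m. m \<in> S \<Longrightarrow> X m \<in> S" "\<And>m. m \<in> S \<Longrightarrow> Y m \<in> S"
  and KKi: "\<And>m. m \<in> S \<Longrightarrow> K (Ki m) = m" and KiK: "\<And>m. m \<in> S \<Longrightarrow> Ki (K m) = m"
  and EF: "\<And>m. m \<in> S \<Longrightarrow> E (F m) = F (E m) + (1 / (q - 1 / q)) *s (K m - Ki m)"
  and KE: "\<And>m. m \<in> S \<Longrightarrow> K (E m) = (q ^ 2) *s E (K m)"
  and KF: "\<And>m. m \<in> S \<Longrightarrow> K (F m) = (1 / q ^ 2) *s F (K m)"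
  and KX: "\<And>m. m \<in> S \<Longrightarrow> K (X m) = q *s X (K m)"
  and KY: "\<And>m. m \<in> S \<Longrightarrow> K (Y m) = (1 / q) *s Y (K m)"
  and XY: "\<And>m. m \<in> S \<Longrightarrow> X (Y m) = q *s Y (X m) - z *s m"
  and EX: "\<And>m. m \<in> S \<Longrightarrow> E (X m) = q *s X (E m)"
  and EY: "\<And>m. m \<in> S \<Longrightarrow> E (Y m) = X m + (1 / q) *s Y (E m)"
  and FX: "\<And>m. m \<in> S \<Longrightarrow> F (X m) = Y (Ki m) + X (F m)"
  and FY: "\<And>m. m \<in> S \<Longrightarrow> F (Y m) = Y (F m)"
begin

lemmas lins = lin[THEN clinear_add] lin[THEN clinear_scale] lin[THEN clinear_0]
 lin[THEN clinear_diff] lin[THEN clinear_neg]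

declare clo [simp] KKi [simp] KiK [simp]

lemma Sclo [simp]: "0 \<in> S" "x \<in> S \<Longrightarrow> y \<in> S \<Longrightarrow> x + y \<in> S" "x \<in> S \<Longrightarrow> y \<in> S \<Longrightarrow> x - y \<in> S"
 "x \<in> S \<Longrightarrow> c *s x \<in> S"
 using subS by (auto simp: cv.subspace_0 cv.subspace_add cv.subspace_diff cv.subspace_scale)

lemma KiY: assumes "m \<in> S" shows "Ki (Y m) = q *s Y (Ki m)"
proof -
 have "K (Y (Ki m)) = (1 / q) *s Y m" using assms KY[of "Ki m"] by simp
 then have "Ki (K (Y (Ki m))) = (1 / q) *s Ki (Y m)" by (simp only: lins)
 then show ?thesis using assms q0 by simp
qed

lemma KiE: assumes "m \<in> S" shows "Ki (E m) = (1 / q ^ 2) *s E (Ki m)"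
proof -
 have "K (E (Ki m)) = (q ^ 2) *s E m" using assms KE[of "Ki m"] by simp
 then have "Ki (K (E (Ki m))) = (q ^ 2) *s Ki (E m)" by (simp only: lins)
 then show ?thesis using assms q0 by simp
qed

lemma KiX: assumes "m \<in> S" shows "Ki (X m) = (1 / q) *s X (Ki m)"
proof -
 have "K (X (Ki m)) = q *s X m" using assms KX[of "Ki m"] by simp
 then have "Ki (K (X (Ki m))) = q *s Ki (X m)" by (simp only: lins)
 then show ?thesis using assms q0 by simp
qed

text \<open>Singular vectors with respect to \<open>X\<close> only; \<open>E\<close> need not kill
  them.\<close>

definition ww :: "complex \<Rightarrow> 'a set" where "ww l = {w \<in> S. X w = 0 \<and> K w = l *s w}"

definition F' :: "'a \<Rightarrow> 'a" where "F' m = F m - kap *s Y (Y (Ki m))"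

definition fam :: "'a set \<Rightarrow> 'a set" where
 "fam B = {(Y ^^ k) ((F' ^^ i) b) | k i b. b \<in> B}"

text \<open>These are the submodules: closure under the central generator is automatic for a
  scalar.\<close>

definition stable :: "'a set \<Rightarrow> bool" where
 "stable P \<longleftrightarrow> cv.subspace P \<and> P \<subseteq> S \<and>
   (\<forall>x\<in>P. E x \<in> P \<and> F x \<in> P \<and> K x \<in> P \<and> Ki x \<in> P \<and> X x \<in> P \<and> Y x \<in> P)"

definition Ct :: "'a \<Rightarrow> 'a" where
 "Ct m = z *s ((1 + 1 / q) *s (F (E m) + (1 / (q - 1 / q) ^ 2) *s (q *s K m + (1 / q) *s Ki m))
   + (1 / (q ^ 2 - 1)) *s Ki m)
  + X (X (F m)) - Y (Y (E (Ki m))) + X (Y ((1 / q) *s F (E m) - q *s E (F m)))"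

lemma linF': "clinear F'"
 by (rule clinearI) (simp_all add: F'_def lins vs mult.commute)

lemma linCt: "clinear Ct"
 by (rule clinearI) (simp_all add: Ct_def lins vs algebra_simps)

lemma F'_S [simp]: "m \<in> S \<Longrightarrow> F' m \<in> S" by (simp add: F'_def)
lemma Ct_S [simp]: "m \<in> S \<Longrightarrow> Ct m \<in> S" by (simp add: Ct_def)
lemma pow_S [simp]: "m \<in> S \<Longrightarrow> (Y ^^ k) m \<in> S" "m \<in> S \<Longrightarrow> (F' ^^ k) m \<in> S"
 "m \<in> S \<Longrightarrow> (E ^^ k) m \<in> S" "m \<in> S \<Longrightarrow> (X ^^ k) m \<in> S"
 by (induct k) auto

lemma linY: "clinear (Y ^^ k)" and linF'k: "clinear (F' ^^ k)" and linEk: "clinear (E ^^ k)"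
 and linXk: "clinear (X ^^ k)"
 using lin linF' by (auto intro: clinear_pow)

lemmas lins' = lins clin[OF linF'] clin[OF linY] clin[OF linF'k] clin[OF linEk] clin[OF linXk] clin[OF linCt]

text \<open>Each passage of \<open>X\<close> through a \<open>Y\<close> multiplies by
  \<open>q\<close> and subtracts \<open>z\<close>, which builds up the q-integer. At
  \<open>k = 0\<close> the truncated exponent is harmless because \<open>qi 0 = 0\<close>.\<close>

lemma X_Yk:
 assumes "w \<in> S" "X w = 0"
 shows "X ((Y ^^ k) w) = (- z * qi k) *s (Y ^^ (k - 1)) w"
proof (induct k)
 case (Suc k)
 show ?case
 proof (cases k)
  case 0
  then show ?thesis using assms by (simp add: XY lins qi_Suc)
 next
  case (Suc j)
  have "X ((Y ^^ Suc k) w) = q *s Y ((- z * qi k) *s (Y ^^ (k - 1)) w) - z *s (Y ^^ k) w"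
   using assms Suc.hyps by (simp add: XY)
  also have "\<dots> = (q * (- z * qi k)) *s (Y ^^ k) w - z *s (Y ^^ k) w"
   using Suc by (simp only: lins cv.scale_scale diff_Suc_1 funpow.simps comp_def)
  also have "\<dots> = (- z * qi (Suc k)) *s (Y ^^ k) w"
   by (simp only: qi_Suc flip: cv.scale_left_diff_distrib) (simp add: algebra_simps)
  finally show ?thesis by simp
 qed
qed (use assms in simp)

text \<open>For \<open>k < 2\<close> the truncated exponent \<open>k - 2\<close> is harmless because
  \<open>eps\<close> vanishes at \<open>0\<close> and \<open>1\<close>.\<close>

lemma E_Yk:
 assumes "w \<in> S" "X w = 0"
 shows "E ((Y ^^ k) w) = (1 / q ^ k) *s (Y ^^ k) (E w) + eps k *s (Y ^^ (k - 2)) w"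
proof (induct k)
 case (Suc k)
 have 1: "eps k *s Y ((Y ^^ (k - 2)) w) = eps k *s (Y ^^ (k - 1)) w"
 proof (cases "k < 2")
  case True
  then have "k = 0 \<or> k = Suc 0" by auto
  then show ?thesis by auto
 next
  case False
  then obtain j where "k = 2 + j" using le_Suc_ex[of 2 k] by auto
  then show ?thesis by simp
 qed
 have "E ((Y ^^ Suc k) w) = X ((Y ^^ k) w) + (1 / q) *s Y (E ((Y ^^ k) w))"
  using assms by (simp add: EY)
 also have "\<dots> = (- z * qi k) *s (Y ^^ (k - 1)) w
   + (1 / q) *s ((1 / q ^ k) *s (Y ^^ Suc k) (E w) + eps k *s (Y ^^ (k - 1)) w)"
  using assms Suc 1 by (simp add: X_Yk lins)
 also have "\<dots> = (1 / q ^ Suc k) *s (Y ^^ Suc k) (E w) + eps (Suc k) *s (Y ^^ (Suc k - 2)) w"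
  by (simp add: vs)
 finally show ?case .
qed simp

lemma F_Yk: "m \<in> S \<Longrightarrow> F ((Y ^^ k) m) = (Y ^^ k) (F m)"
 by (induct k) (auto simp: FY)

lemma K_Yk: "m \<in> S \<Longrightarrow> K ((Y ^^ k) m) = (1 / q ^ k) *s (Y ^^ k) (K m)"
 by (induct k) (auto simp: KY lins)

lemma Ki_Yk: "m \<in> S \<Longrightarrow> Ki ((Y ^^ k) m) = (q ^ k) *s (Y ^^ k) (Ki m)"
 by (induct k) (auto simp: KiY lins mult.commute)

lemma F_F': "F m = F' m + kap *s Y (Y (Ki m))" by (simp add: F'_def)

lemma wwD: assumes "w \<in> ww l" shows "w \<in> S" "X w = 0" "K w = l *s w"
 using assms by (auto simp: ww_def)

lemma ww_Ki': assumes "w \<in> ww l" shows "w = l *s Ki w"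
proof -
 have "w = Ki (K w)" using assms wwD(1) KiK by metis
 also have "\<dots> = l *s Ki w" using wwD(3)[OF assms] by (simp only: lins)
 finally show ?thesis .
qed

lemma ww_Ki: assumes "w \<in> ww l" "l \<noteq> 0" shows "Ki w = (1 / l) *s w"
proof -
 have "(1 / l) *s w = (1 / l) *s (l *s Ki w)" using ww_Ki'[OF assms(1)] by (rule arg_cong)
 then show ?thesis using assms by simp
qed

lemma sub_ww: "cv.subspace (ww l)"
 by (auto simp: ww_def cv.subspace_def lins vs mult.commute)

lemma ww_E: assumes "w \<in> ww l" shows "E w \<in> ww (l * q ^ 2)"
proof -
 note w = wwD[OF assms]
 have "q *s X (E w) = 0" using w EX[of w] by (simp add: lins)
 then show ?thesis using w q0 by (simp add: ww_def KE lins mult.commute)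
qed

text \<open>\<open>X (F w)\<close> is \<open>- Y (Ki w)\<close>, and \<open>X\<close> maps
  \<open>Y (Y (Ki w))\<close> to \<open>- z (1 + q) Y (Ki w)\<close>; with the factor
  \<open>kap\<close> the two contributions cancel. For the weight, \<open>F\<close> and
  \<open>Y Y Ki\<close> both divide by \<open>q ^ 2\<close>.\<close>

lemma ww_F': assumes "w \<in> ww l" shows "F' w \<in> ww (l / q ^ 2)"
proof -
 have w: "w \<in> S" "X w = 0" "K w = l *s w" using wwD assms by auto
 have XKi: "X (Ki w) = 0" using KiX[of w] w q0 by (simp add: lins)
 have "X (F w) = - Y (Ki w)" using FX[of w] w by (simp add: lins add_eq_0_iff)
 moreover have "X (Y (Y (Ki w))) = (- z * qi 2) *s Y (Ki w)"
  using X_Yk[of "Ki w" 2] w XKi by (simp add: numeral_2_eq_2)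
 moreover have "qi 2 = 1 + q" by (simp add: numeral_2_eq_2 qi_Suc)
 ultimately have "X (F' w) = - Y (Ki w) - (kap * (- z * (1 + q))) *s Y (Ki w)"
  by (simp add: F'_def lins)
 also have "kap * (- z * (1 + q)) = - 1" using z0 q1p by (simp add: kap_def)
 finally have "X (F' w) = 0" by simp
 moreover have "K (F' w) = (l / q ^ 2) *s F' w"
 proof -
  have "K (Y (Y (Ki w))) = (1 / q ^ 2) *s Y (Y w)"
   using w q0 by (simp add: KY lins power2_eq_square)
  moreover have "Y (Y w) = l *s Y (Y (Ki w))"
   using arg_cong[OF ww_Ki'[OF assms], of "\<lambda>x. Y (Y x)"] by (simp only: lins)
  ultimately have "K (Y (Y (Ki w))) = (l / q ^ 2) *s Y (Y (Ki w))" by simp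
  moreover have "K (F w) = (l / q ^ 2) *s F w"
   using KF[OF w(1)] wwD(3)[OF assms] by (simp add: lins)
  ultimately show ?thesis by (simp add: F'_def lins vs mult.commute)
 qed
 ultimately show ?thesis using w by (simp add: ww_def)
qed

lemma ww_F'k: "w \<in> ww l \<Longrightarrow> (F' ^^ i) w \<in> ww (l / q ^ (2 * i))"
proof (induct i)
 case (Suc i)
 then have "F' ((F' ^^ i) w) \<in> ww (l / q ^ (2 * i) / q ^ 2)" using ww_F' by blast
 then show ?case by (simp add: mult.commute power2_eq_square mult.assoc)
qed simp

lemma ww_Ek: "w \<in> ww l \<Longrightarrow> (E ^^ i) w \<in> ww (l * q ^ (2 * i))"
proof (induct i)
 case (Suc i)
 then have "E ((E ^^ i) w) \<in> ww (l * q ^ (2 * i) * q ^ 2)" using ww_E by blast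
 then show ?case by (simp add: mult.commute power2_eq_square mult.assoc mult.left_commute)
qed simp

text \<open>\<open>E (F w)\<close> contributes the usual commutator. Moving \<open>E\<close> past
  \<open>Y Y\<close> contributes \<open>eps 2 = - z\<close>, hence \<open>kap * z / l\<close> after
  the factor \<open>- kap\<close> and \<open>Ki w = (1 / l) *s w\<close>. The sum of the two scalars
  is the one evaluated in \<open>th_step\<close>.\<close>

lemma E_F':
 assumes "w \<in> ww l" "l \<noteq> 0"
 shows "E (F' w) = F' (E w) + (th l - th (l / q ^ 2)) *s w"
proof -
 have w: "w \<in> S" "X w = 0" "K w = l *s w" using wwD assms by auto
 have "E (Y (Y (Ki w))) = (1 / q ^ 2) *s Y (Y (E (Ki w))) + (- z / l) *s w"
  using E_Yk[of w 2] w assms by (simp add: ww_Ki lins qi_1 vs numeral_2_eq_2 mult_ac)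
 moreover have "F' (E w) = F (E w) - (kap / q ^ 2) *s Y (Y (E (Ki w)))"
  using w by (simp add: F'_def KiE lins)
 ultimately have "E (F' w) = F' (E w) + (1 / (q - 1 / q)) *s (K w - Ki w) - (kap * (- z / l)) *s w"
  using w by (simp add: F'_def EF lins vs)
 also have "(1 / (q - 1 / q)) *s (K w - Ki w) = ((l - 1 / l) / (q - 1 / q)) *s w"
  using assms w(3) by (simp add: ww_Ki vs diff_divide_distrib mult_ac)
 finally have "E (F' w) = F' (E w) + ((l - 1 / l) / (q - 1 / q) + kap * z / l) *s w"
  by (simp add: vs)
 then show ?thesis using th_step[OF assms(2)] by simp
qed

text \<open>The differences of \<open>th\<close> along \<open>l, l / q ^ 2, ...\<close> telescope.
  At \<open>i = 0\<close> the coefficient vanishes, so the truncated exponent \<open>i - 1\<close>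
  does not matter.\<close>

lemma E_F'k:
 assumes "w \<in> ww l" "l \<noteq> 0"
 shows "E ((F' ^^ i) w) = (F' ^^ i) (E w) + (th l - th (l / q ^ (2 * i))) *s (F' ^^ (i - 1)) w"
proof (induct i)
 case (Suc i)
 let ?m = "l / q ^ (2 * i)"
 have m: "?m \<noteq> 0" using assms q0 by simp
 have d: "(th l - th ?m) *s F' ((F' ^^ (i - 1)) w) = (th l - th ?m) *s (F' ^^ i) w"
  by (cases i) auto
 have "E ((F' ^^ Suc i) w) = F' (E ((F' ^^ i) w)) + (th ?m - th (?m / q ^ 2)) *s (F' ^^ i) w"
  using E_F'[OF ww_F'k[OF assms(1)] m] by simp
 also have "F' (E ((F' ^^ i) w)) = (F' ^^ Suc i) (E w) + (th l - th ?m) *s (F' ^^ i) w"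
  using Suc d by (simp add: lins')
 also have "?m / q ^ 2 = l / q ^ (2 * Suc i)"
  by (simp add: power2_eq_square mult.commute mult.left_commute)
 finally show ?case by (simp add: vs)
qed simp

text \<open>Of the centrality of \<open>Ct\<close> only this commutation is required:
  \<open>Ct\<close> is evaluated on singular vectors and the result is carried along by powers of
  \<open>Y\<close>. The inverses occurring are abbreviated, and only their relations
  \<open>p * q = 1\<close>, \<open>d * (q - p) = 1\<close>, \<open>d2 = d * d\<close> and
  \<open>e * q = d\<close> enter the main computation.\<close>

lemma Ct_Y:
 assumes m: "m \<in> S"
 shows "Ct (Y m) = Y (Ct m)"
proof -
 define p d d2 e where "p = 1 / q" and "d = 1 / (q - 1 / q)" and "d2 = 1 / (q - 1 / q) ^ 2"
  and "e = 1 / (q ^ 2 - 1)"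
 have pq: "p * q = 1" using q0 by (simp add: p_def)
 have dq: "d * (q - p) = 1" using qd by (simp add: d_def p_def)
 have d2: "d2 = d * d" by (simp add: d_def d2_def power2_eq_square)
 have e: "e * (q * q - 1) = 1" using q2 by (simp add: e_def power2_eq_square)
 have ed: "e * q = d"
 proof -
  have "d * (q * q - p * q) = q * (d * (q - p))" by (simp add: algebra_simps)
  then have "d * (q * q - 1) = q" using pq dq by simp
  moreover have "(e * q) * (q * q - 1) = (e * (q * q - 1)) * q" by (simp only: ac_simps)
  ultimately have "(e * q) * (q * q - 1) = d * (q * q - 1)" using e by simp
  then show ?thesis using qq1 by simp
 qed
 have ef: "E (F m) = F (E m) + (d *s K m - d *s Ki m)"
  using EF[OF m] by (simp add: d_def vs)
 have f1: "F (E (Y m)) = Y (Ki m) + X (F m) + p *s Y (F (E m))"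
  using m by (simp add: EY FX FY lins p_def)
 have f2: "E (F (Y m)) = X (F m) + p *s Y (F (E m)) + (p * d) *s Y (K m) - (p * d) *s Y (Ki m)"
  using m ef by (simp add: EY FY lins vs p_def)
 have f3: "X (Y (Y u)) = (q * q) *s Y (Y (X u)) - (q * z) *s Y u - z *s Y u" if "u \<in> S" for u
  using that by (simp add: XY lins vs)
 have f4: "X (X (Y u)) = (q * q) *s Y (X (X u)) - (q * z) *s X u - z *s X u" if "u \<in> S" for u
  using that by (simp add: XY lins vs)
 have f5: "X (Y (X u)) = q *s Y (X (X u)) - z *s X u" if "u \<in> S" for u
  using that by (simp add: XY)
 have f6: "Y (X (Y u)) = q *s Y (Y (X u)) - z *s Y u" if "u \<in> S" for u
  using that by (simp add: XY lins)
 have f7: "Y (Y (E (Ki (Y m)))) = q *s Y (Y (X (Ki m))) + Y (Y (Y (E (Ki m))))"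
  using m q0 by (simp add: EY KiY lins vs)
 have k1: "K (Y m) = p *s Y (K m)" and k2: "Ki (Y m) = q *s Y (Ki m)"
  using m KY KiY by (simp_all add: p_def)
 have ct: "Ct u = z *s ((1 + p) *s (F (E u) + d2 *s (q *s K u + p *s Ki u)) + e *s Ki u)
  + X (X (F u)) - Y (Y (E (Ki u))) + X (Y (p *s F (E u) - q *s E (F u)))" for u
  by (simp only: Ct_def p_def d2_def e_def)
 have L: "Ct (Y m) = z *s ((1 + p) *s (Y (Ki m) + X (F m) + p *s Y (F (E m))
    + d2 *s ((q * p) *s Y (K m) + (p * q) *s Y (Ki m))) + (e * q) *s Y (Ki m))
   + ((q * q) *s Y (X (X (F m))) - (q * z) *s X (F m) - z *s X (F m))
   - (q *s Y (Y (X (Ki m))) + Y (Y (Y (E (Ki m)))))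
   + X (Y (p *s F (E (Y m)) - q *s E (F (Y m))))"
 proof -
  have fx: "X (X (F (Y m))) = (q * q) *s Y (X (X (F m))) - (q * z) *s X (F m) - z *s X (F m)"
   using m by (simp only: FY f4 clo)
  show ?thesis unfolding ct unfolding f7 fx unfolding k1 k2 f1 cv.scale_scale ..
 qed
 have L2: "X (Y (p *s F (E (Y m)) - q *s E (F (Y m)))) =
   (p + q * p * d) *s X (Y (Y (Ki m))) + (p - q) *s X (Y (X (F m)))
   + (p * p - q * p) *s X (Y (Y (F (E m)))) - (q * p * d) *s X (Y (Y (K m)))"
  unfolding f1 f2 by (simp add: lins vs algebra_simps)
 have R: "Y (Ct m) = z *s ((1 + p) *s (Y (F (E m)) + d2 *s (q *s Y (K m) + p *s Y (Ki m))) + e *s Y (Ki m))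
   + Y (X (X (F m))) - Y (Y (Y (E (Ki m))))
   + ((p - q) *s Y (X (Y (F (E m)))) - (q * d) *s Y (X (Y (K m))) + (q * d) *s Y (X (Y (Ki m))))"
  unfolding ct ef by (simp add: lins vs algebra_simps)
 \<comment> \<open>With every \<open>Y\<close> moved to the left of every \<open>X\<close>, the
   terms in \<open>Y Y Y E Ki\<close> cancel and eight monomials remain. Each of their coefficients
   is shown to vanish below.\<close>
 have "Ct (Y m) - Y (Ct m) =
   (z * (1 + p) * (1 + d2 * (p * q)) + z * (e * q) - (q * z + z) * (p + q * p * d)
     - (z * (1 + p) * (d2 * p) + z * e - z * (q * d))) *s Y (Ki m)
   + (z * (1 + p) - (q * z + z) - z * (p - q)) *s X (F m)
   + (z * (1 + p) * p - (q * z + z) * (p * p - q * p) - (z * (1 + p) - z * (p - q))) *s Y (F (E m))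
   + (z * (1 + p) * (d2 * (q * p)) + (q * z + z) * (q * p * d) - (z * (1 + p) * (d2 * q) + z * (q * d))) *s Y (K m)
   + (- q + q * q * (p + q * p * d) - q * (q * d)) *s Y (Y (X (Ki m)))
   + (q * q * (p * p - q * p) - q * (p - q)) *s Y (Y (X (F (E m))))
   + (q * (q * d) - q * q * (q * p * d)) *s Y (Y (X (K m)))
   + (q * q + q * (p - q) - 1) *s Y (X (X (F m)))"
  unfolding L L2 R using m by (simp add: f3 f5 f6 vs algebra_simps)
 moreover have "z * (1 + p) * (1 + d2 * (p * q)) + z * (e * q) - (q * z + z) * (p + q * p * d)
     - (z * (1 + p) * (d2 * p) + z * e - z * (q * d)) = 0"
 proof -
  have "e * (q * p) = d * p" using ed by (simp add: mult.assoc[symmetric])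
  then have e': "e = d * p" using pq by (simp add: mult.commute)
  have "d * d * (p * q - p * p) = d * p * (d * (q - p))" by (simp add: algebra_simps)
  then have k: "d * d * (1 - p * p) - d * p = 0" using pq dq by simp
  have qp: "q * p = 1" using pq by (simp add: mult.commute)
  have "z * (1 + p) * (1 + d2 * (p * q)) + z * (e * q) - (q * z + z) * (p + q * p * d)
     - (z * (1 + p) * (d2 * p) + z * e - z * (q * d))
    = z * (1 + p) * (1 + d * d) + z * d - (q * z + z) * (p + d)
     - (z * (1 + p) * (d * d * p) + z * (d * p) - z * (q * d))"
   unfolding ed unfolding e' d2 pq qp by simp
  also have "\<dots> = z * (d * d * (1 - p * p) - d * p) + z * (1 - p * q)"
   by (simp add: algebra_simps)
  finally show ?thesis using k pq by simp
 qed
 moreover have "z * (1 + p) - (q * z + z) - z * (p - q) = 0"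
  by (simp add: algebra_simps)
 moreover have "z * (1 + p) * p - (q * z + z) * (p * p - q * p) - (z * (1 + p) - z * (p - q)) = 0"
  using q0 by (simp add: p_def field_simps)
 moreover have "z * (1 + p) * (d2 * (q * p)) + (q * z + z) * (q * p * d) - (z * (1 + p) * (d2 * q) + z * (q * d)) = 0"
 proof -
  have qp: "q * p = 1" using pq by (simp add: mult.commute)
  have "z * (1 + p) * (d2 * (q * p)) + (q * z + z) * (q * p * d) - (z * (1 + p) * (d2 * q) + z * (q * d))
    = z * d * (1 - d * (q - p)) + z * d * d * (1 - p * q)"
   unfolding d2 qp by (simp add: algebra_simps)
  then show ?thesis using dq pq by simp
 qed
 moreover have "- q + q * q * (p + q * p * d) - q * (q * d) = 0" using q0 by (simp add: p_def field_simps)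
 moreover have "q * q * (p * p - q * p) - q * (p - q) = 0" using q0 by (simp add: p_def field_simps)
 moreover have "q * (q * d) - q * q * (q * p * d) = 0" using q0 by (simp add: p_def field_simps)
 moreover have "q * q + q * (p - q) - 1 = 0" using q0 by (simp add: p_def field_simps)
 ultimately show ?thesis by simp
qed

lemma Ct_Yk: "m \<in> S \<Longrightarrow> Ct ((Y ^^ k) m) = (Y ^^ k) (Ct m)"
 by (induct k) (auto simp: Ct_Y)

text \<open>In terms of \<open>g = F' (E w)\<close> and \<open>y = Y (Y (E w))\<close> all parts of
  \<open>Ct w\<close> are combinations of \<open>g\<close>, \<open>y\<close> and \<open>w\<close>.
  The choice of \<open>kap\<close> makes the coefficient of \<open>y\<close> vanish, and what is
  left at \<open>w\<close> is a multiple of \<open>th l\<close>.\<close>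

lemma Ct_ww:
 assumes w: "w \<in> ww l" "l \<noteq> 0"
 shows "Ct w = (z * (1 + q)) *s (F' (E w) + th l *s w)"
proof -
 note wS = wwD[OF w(1)]
 define g y where "g = F' (E w)" and "y = Y (Y (E w))"
 define D where "D = q - 1 / q"
 have D: "D \<noteq> 0" "q * D = q * q - 1" using qd q0 by (auto simp: D_def field_simps)
 have kz: "kap * z * (1 + q) = 1" using z0 q1p by (simp add: kap_def)
 have gw: "X g = 0" "g \<in> S"
  using wwD[OF ww_F'[OF ww_E[OF w(1)]]] by (auto simp: g_def)
 have Ki: "Ki w = (1 / l) *s w" using w by (rule ww_Ki)
 have fe: "F (E w) = g + (kap / (q ^ 2 * l)) *s y"
  using wS by (simp add: F_F'[of "E w"] g_def y_def KiE Ki lins)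
 have ef: "E (F w) = F (E w) + ((l - 1 / l) / D) *s w"
  using wS by (simp add: EF Ki vs D_def diff_divide_distrib)
 have qi2: "qi 2 = 1 + q" by (simp add: numeral_2_eq_2 qi_Suc)
 have XY1: "X (Y w) = (- z) *s w" using wS by (simp add: XY lins)
 have XYY: "X (Y (Y u)) = (- z * (1 + q)) *s Y u" if "u \<in> S" "X u = 0" for u
  using X_Yk[OF that, of 2] qi2 by (simp add: numeral_2_eq_2)
 have xxf: "X (X (F w)) = (z / l) *s w"
 proof -
  have "X (F' w) = 0" using wwD[OF ww_F'[OF w(1)]] by simp
  then have "X (X (F w)) = (kap / l) *s X (X (Y (Y w)))"
   by (simp add: F_F' Ki lins)
  also have "\<dots> = (kap / l * (- z * (1 + q)) * (- z)) *s w"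
   using wS by (simp add: XYY XY1 lins)
  also have "kap / l * (- z * (1 + q)) * (- z) = kap * z * (1 + q) * (z / l)" by simp
  finally show ?thesis using kz by simp
 qed
 have yye: "Y (Y (E (Ki w))) = (1 / l) *s y" by (simp add: Ki lins y_def)
 have Ew: "E w \<in> S" "X (E w) = 0" using wwD[OF ww_E[OF w(1)]] by auto
 have xy: "X (Y ((1 / q) *s F (E w) - q *s E (F w)))
   = (- z * (1 / q - q)) *s g + (- ((1 / q - q) / (q * l)) - z * (1 / q - q) * kap / (q ^ 2 * l)) *s y
    + (z * q * (l - 1 / l) / D) *s w"
 proof -
  define c where "c = 1 / q - q"
  define r where "r = kap / (q ^ 2 * l)"
  have yS: "y \<in> S" using Ew by (simp add: y_def)
  have Xy: "X y = (- z * (1 + q)) *s Y (E w)" using XYY[OF Ew] by (simp add: y_def)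
  have u: "(1 / q) *s F (E w) - q *s E (F w) = c *s g + (c * r) *s y - (q * ((l - 1 / l) / D)) *s w"
   unfolding ef fe c_def r_def[symmetric] by (simp add: vs left_diff_distrib)
  have "X (Y ((1 / q) *s F (E w) - q *s E (F w)))
    = q *s Y (X (c *s g + (c * r) *s y - (q * ((l - 1 / l) / D)) *s w))
     - z *s (c *s g + (c * r) *s y - (q * ((l - 1 / l) / D)) *s w)"
   unfolding u by (rule XY) (use gw yS wS in simp)
  also have "\<dots> = (q * (c * r * (- z * (1 + q)))) *s y
    - z *s (c *s g + (c * r) *s y - (q * ((l - 1 / l) / D)) *s w)"
   using gw wS by (simp add: lins Xy y_def[symmetric])
  also have "q * (c * r * (- z * (1 + q))) = - (c / (q * l)) * (kap * z * (1 + q))"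
   using q0 by (simp add: r_def power2_eq_square)
  finally show ?thesis
   unfolding kz c_def[symmetric] by (simp add: r_def vs algebra_simps)
 qed
 \<comment> \<open>The three coefficients are collected here and evaluated in \<open>h2\<close>,
   \<open>h3\<close> and \<open>h4\<close>; in \<open>h3\<close> the numerator is
   \<open>kap * z * (1 + q) - 1 = 0\<close>.\<close>
 have h1: "Ct w = (z * (1 + 1 / q) - z * (1 / q - q)) *s g
   + (z * (1 + 1 / q) * (kap / (q ^ 2 * l)) - 1 / l
     + (- ((1 / q - q) / (q * l)) - z * (1 / q - q) * kap / (q ^ 2 * l))) *s y
   + (z * (1 + 1 / q) * (1 / D ^ 2) * (q * l + 1 / q * (1 / l)) + z * (1 / (q ^ 2 - 1)) * (1 / l)
     + z / l + z * q * (l - 1 / l) / D) *s w"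
 proof -
  define p r li A d2 e where "p = 1 / q" and "r = kap / (q ^ 2 * l)" and "li = 1 / l" and "A = 1 + 1 / q"
   and "d2 = 1 / D ^ 2" and "e = 1 / (q ^ 2 - 1)"
  define cg cy cw where "cg = - z * (1 / q - q)"
   and "cy = - ((1 / q - q) / (q * l)) - z * (1 / q - q) * kap / (q ^ 2 * l)"
   and "cw = z * q * (l - 1 / l) / D"
  have "Ct w = z *s (A *s ((g + r *s y) + d2 *s (q *s (l *s w) + p *s (li *s w)))
    + e *s (li *s w)) + (z / l) *s w - li *s y + (cg *s g + cy *s y + cw *s w)"
   unfolding Ct_def D_def[symmetric] unfolding xy xxf yye unfolding fe Ki wS(3)
    A_def d2_def e_def p_def r_def li_def cg_def cy_def cw_def by (rule refl)
  also have "\<dots> = (z * A + cg) *s g + (z * A * r - li + cy) *s y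
    + (z * A * d2 * (q * l + p * li) + z * e * li + z / l + cw) *s w"
   by (simp add: vs algebra_simps)
  finally show ?thesis
   unfolding A_def d2_def e_def p_def r_def li_def cg_def cy_def cw_def by simp
 qed
 have h2: "z * (1 + 1 / q) - z * (1 / q - q) = z * (1 + q)" by (simp add: algebra_simps)
 have h3: "z * (1 + 1 / q) * (kap / (q ^ 2 * l)) - 1 / l
     + (- ((1 / q - q) / (q * l)) - z * (1 / q - q) * kap / (q ^ 2 * l)) = 0"
 proof -
  have "z * (1 + 1 / q) * (kap / (q ^ 2 * l)) - 1 / l
     + (- ((1 / q - q) / (q * l)) - z * (1 / q - q) * kap / (q ^ 2 * l))
    = (kap * z * (1 + q) - 1) / (q ^ 2 * l)"
   using q0 w by (simp add: field_simps power2_eq_square)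
  then show ?thesis using kz by simp
 qed
 have h4: "z * (1 + 1 / q) * (1 / D ^ 2) * (q * l + 1 / q * (1 / l)) + z * (1 / (q ^ 2 - 1)) * (1 / l)
     + z / l + z * q * (l - 1 / l) / D = z * (1 + q) * th l"
 proof -
  have e: "1 / (q ^ 2 - 1) = 1 / (q * D)" using D by (simp add: power2_eq_square)
  have "z * (1 + 1 / q) * (1 / D ^ 2) * (q * l + 1 / q * (1 / l)) + z * (1 / (q ^ 2 - 1)) * (1 / l)
     + z / l + z * q * (l - 1 / l) / D
    = z * ((1 + 1 / q) * (q * l + 1 / q * (1 / l)) + D / (q * l) + D * D / l + q * D * (l - 1 / l)) / D ^ 2"
   unfolding e using D q0 w by (simp add: field_simps power2_eq_square)
  also have "(1 + 1 / q) * (q * l + 1 / q * (1 / l)) + D / (q * l) + D * D / l + q * D * (l - 1 / l)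
    = (1 + q) * (q * l + 1 / (q ^ 2 * l))"
   using q0 w by (simp add: D_def field_simps power2_eq_square)
  finally show ?thesis by (simp add: th_def D_def)
 qed
 show ?thesis using h1 unfolding h2 h3 h4 by (simp add: g_def cv.scale_right_distrib)
qed

end

section \<open>Submodules spanned by the translates of singular vectors under Y and F'\<close>

context qs
begin

definition chain :: "'a set \<Rightarrow> 'a set" where "chain B = {(F' ^^ i) b | i b. b \<in> B}"

lemma famI: "b \<in> B \<Longrightarrow> (Y ^^ k) ((F' ^^ i) b) \<in> fam B" by (auto simp: fam_def)
lemma chainI: "b \<in> B \<Longrightarrow> (F' ^^ i) b \<in> chain B" by (auto simp: chain_def)

lemma fam_mono: "A \<subseteq> B \<Longrightarrow> fam A \<subseteq> fam B" by (auto simp: fam_def)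

lemma subset_fam: "B \<subseteq> fam B"
 using famI[where k = 0 and i = 0] by auto

lemma fam_S: "B \<subseteq> S \<Longrightarrow> cv.span (fam B) \<subseteq> S"
 by (rule span_subset_subspace[OF _ subS]) (auto simp: fam_def)

lemma Yk_chain: "x \<in> cv.span (chain B) \<Longrightarrow> (Y ^^ k) x \<in> cv.span (fam B)"
 by (rule span_image_subset[OF linY cv.subspace_span]) (auto simp: chain_def intro!: cv.span_base famI)

lemma F'k_chain: "x \<in> cv.span (chain B) \<Longrightarrow> (F' ^^ k) x \<in> cv.span (chain B)"
proof (rule span_image_subset[OF linF'k cv.subspace_span])
 fix b assume "b \<in> chain B"
 then obtain i b' where "b = (F' ^^ i) b'" "b' \<in> B" by (auto simp: chain_def)
 then have "(F' ^^ k) b = (F' ^^ (k + i)) b'" "b' \<in> B" by (simp_all add: funpow_add)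
 then show "(F' ^^ k) b \<in> cv.span (chain B)" by (auto intro!: cv.span_base chainI)
qed

lemma fam_span: "x \<in> cv.span (fam B) \<Longrightarrow> B \<subseteq> cv.span (chain C) \<Longrightarrow> x \<in> cv.span (fam C)"
proof (erule span_image_subset[OF clinear_id cv.subspace_span, rotated])
 fix b assume "b \<in> fam B" and B: "B \<subseteq> cv.span (chain C)"
 then obtain k i b' where "b = (Y ^^ k) ((F' ^^ i) b')" "b' \<in> B" by (auto simp: fam_def)
 then show "b \<in> cv.span (fam C)" using B Yk_chain F'k_chain by blast
qed

lemma stableD:
 assumes "stable P"
 shows "cv.subspace P" "P \<subseteq> S" "x \<in> P \<Longrightarrow> E x \<in> P" "x \<in> P \<Longrightarrow> F x \<in> P" "x \<in> P \<Longrightarrow> K x \<in> P"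
  "x \<in> P \<Longrightarrow> Ki x \<in> P" "x \<in> P \<Longrightarrow> X x \<in> P" "x \<in> P \<Longrightarrow> Y x \<in> P"
 using assms by (auto simp: stable_def)

lemma stable_S: "stable S" by (auto simp: stable_def subS)

lemma stable_F': assumes "stable P" "x \<in> P" shows "F' x \<in> P"
 using assms stableD[OF assms(1)] by (simp add: F'_def cv.subspace_diff cv.subspace_scale)

lemma stable_pow: assumes "stable P" "x \<in> P" shows "(Y ^^ k) x \<in> P" "(F' ^^ k) x \<in> P" "(E ^^ k) x \<in> P"
 by (induct k) (use assms stableD(3,8)[OF assms(1)] stable_F'[OF assms(1)] in auto)

lemma stable_fam: assumes "stable P" "B \<subseteq> P" shows "cv.span (fam B) \<subseteq> P"
 using assms stable_pow[OF assms(1)] stableD(1)[OF assms(1)]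
 by (intro span_subset_subspace) (auto simp: fam_def)

lemma stable_qs: assumes "stable P" shows "qs q z P E F K Ki X Y"
proof -
 note P = stableD[OF assms]
 have PS: "m \<in> S" if "m \<in> P" for m using P(2) that by auto
 show ?thesis
  by (rule qs.intro[OF qparam_axioms qs_axioms.intro])
   (use P PS in \<open>auto simp: lin EF KE KF KX KY XY EX EY FX FY\<close>)
qed

text \<open>The commutation formulas keep all operators inside the family, with \<open>F\<close>
  rewritten as \<open>F'\<close> plus a multiple of \<open>Y Y Ki\<close>. The only new vectors are
  those that \<open>E\<close> produces from \<open>E b\<close>, so these alone have to be
  controlled.\<close>

lemma fam_stable:
 assumes B: "\<And>b. b \<in> B \<Longrightarrow> \<exists>l. l \<noteq> 0 \<and> b \<in> ww l" and E: "\<And>b. b \<in> B \<Longrightarrow> E b \<in> cv.span (chain B)"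
 shows "stable (cv.span (fam B))"
proof -
 let ?P = "cv.span (fam B)"
 have sub: "cv.subspace ?P" by simp
 have BS: "B \<subseteq> S" using B wwD by blast
 have gen: "E g \<in> ?P \<and> F g \<in> ?P \<and> K g \<in> ?P \<and> Ki g \<in> ?P \<and> X g \<in> ?P \<and> Y g \<in> ?P" if gB: "g \<in> fam B" for g
 proof -
  obtain k i b where g: "g = (Y ^^ k) ((F' ^^ i) b)" and b: "b \<in> B" using gB by (auto simp: fam_def)
  obtain l where l: "l \<noteq> 0" "b \<in> ww l" using B b by auto
  define w m where "w = (F' ^^ i) b" and "m = l / q ^ (2 * i)"
  have w: "w \<in> ww m" and m: "m \<noteq> 0" using ww_F'k[OF l(2)] l q0 by (auto simp: w_def m_def)
  note wS = wwD[OF w]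
  have base: "(Y ^^ j) ((F' ^^ n) b) \<in> ?P" for j n using b by (auto intro: cv.span_base famI)
  have Yw: "(Y ^^ j) w \<in> ?P" for j using base by (simp add: w_def)
  have "E w \<in> cv.span (chain B)"
   unfolding w_def E_F'k[OF l(2,1)] using E[OF b] b
   by (intro cv.span_add F'k_chain cv.span_scale cv.span_base[OF chainI])
  then have "E g \<in> ?P"
   unfolding g w_def[symmetric] E_Yk[OF wS(1,2)] using Yw Yk_chain[OF \<open>E w \<in> _\<close>] by (meson cv.span_add cv.span_scale)
  moreover have "F g \<in> ?P"
  proof -
   have "F g = (Y ^^ k) (F' w) + (kap / m) *s (Y ^^ k) (Y (Y w))"
    unfolding g w_def[symmetric] F_Yk[OF wS(1)] F_F'[of w] ww_Ki[OF w m] by (simp add: lins')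
   also have "(Y ^^ k) (Y (Y w)) = (Y ^^ Suc (Suc k)) w" by (simp add: funpow_swap1)
   also have "(Y ^^ k) (F' w) = (Y ^^ k) ((F' ^^ Suc i) b)" by (simp add: w_def)
   finally have "F g = (Y ^^ k) ((F' ^^ Suc i) b) + (kap / m) *s (Y ^^ Suc (Suc k)) w" .
   then show ?thesis using cv.span_add[OF base[of k "Suc i"] cv.span_scale[OF Yw[of "Suc (Suc k)"]]]
    by (simp only:)
  qed
  moreover have "K g \<in> ?P"
   unfolding g w_def[symmetric] K_Yk[OF wS(1)] wS(3) using Yw by (simp add: lins' cv.span_scale)
  moreover have "Ki g \<in> ?P"
   unfolding g w_def[symmetric] Ki_Yk[OF wS(1)] ww_Ki[OF w m] using Yw by (simp add: lins' cv.span_scale)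
  moreover have "X g \<in> ?P"
   unfolding g w_def[symmetric] X_Yk[OF wS(1,2)] using Yw by (simp only: cv.span_scale)
  moreover have "Y g \<in> ?P" using base[of "Suc k" i] by (simp add: g)
  ultimately show ?thesis by blast
 qed
 show ?thesis
  unfolding stable_def
  using fam_S[OF BS] gen lin span_image_subset[OF _ sub, of _ "fam B"] by blast
qed

text \<open>\<open>Y X\<close> acts on \<open>(Y ^^ k) w\<close> with eigenvalue
  \<open>- z * qi k\<close>, which is zero only for \<open>k = 0\<close>. So a vector killed by
  \<open>X\<close> uses only members without \<open>Y\<close>, and comparison of
  \<open>K\<close>-eigenvalues selects those of weight \<open>l\<close>. The clause
  \<open>b \<noteq> 0\<close> makes the weight \<open>m\<close> of \<open>b\<close> unique.\<close>

lemma fam_component: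
 assumes B: "\<And>b. b \<in> B \<Longrightarrow> \<exists>l. l \<noteq> 0 \<and> b \<in> ww l" and x: "x \<in> cv.span (fam B)" "x \<in> ww l"
 shows "x \<in> cv.span {(F' ^^ i) b | i b m. b \<in> B \<and> b \<noteq> 0 \<and> b \<in> ww m \<and> m / q ^ (2 * i) = l}"
  (is "x \<in> cv.span ?T")
proof -
 have lYX: "clinear (\<lambda>x. Y (X x))" using lin by (auto intro: clinear_comp)
 have YX: "Y (X ((Y ^^ k) ((F' ^^ i) b))) = (- z * qi k) *s (Y ^^ k) ((F' ^^ i) b)" if "b \<in> B" for k i b
 proof -
  obtain l where "b \<in> ww l" using B \<open>b \<in> B\<close> by auto
  then have w: "(F' ^^ i) b \<in> ww (l / q ^ (2 * i))" by (rule ww_F'k)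
  show ?thesis
   unfolding X_Yk[OF wwD(1,2)[OF w]] by (cases k) (simp_all add: lins)
 qed
 have "x \<in> cv.span {g \<in> fam B. Y (X g) = 0 *s g}"
 proof (rule eig_component[OF lYX _ x(1)])
  show "\<exists>l. Y (X b) = l *s b" if "b \<in> fam B" for b
   using that YX unfolding fam_def by blast
  show "Y (X x) = 0 *s x" using wwD[OF x(2)] by (simp add: lins)
 qed
 moreover have "{g \<in> fam B. Y (X g) = 0 *s g} \<subseteq> cv.span (chain B)"
 proof
  fix g assume g: "g \<in> {g \<in> fam B. Y (X g) = 0 *s g}"
  then obtain k i b where gb: "g = (Y ^^ k) ((F' ^^ i) b)" "b \<in> B" by (auto simp: fam_def)
  have "(- z * qi k) *s g = 0" using g YX[OF gb(2), of k i] gb(1) by simp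
  then have "k = 0 \<or> g = 0" using z0 qi_nz[of k] by (simp add: cv.scale_eq_0_iff) auto
  then show "g \<in> cv.span (chain B)" using gb chainI[OF gb(2), of i] cv.span_base[of g "chain B"] by (auto simp: cv.span_zero)
 qed
 ultimately have "x \<in> cv.span (chain B)" using span_subset_subspace[OF _ cv.subspace_span] by blast
 then have "x \<in> cv.span {g \<in> chain B. K g = l *s g}"
 proof (rule eig_component[OF lin(3), rotated])
  show "\<exists>l. K b = l *s b" if "b \<in> chain B" for b
   using that B ww_F'k wwD(3) unfolding chain_def by blast
  show "K x = l *s x" using wwD[OF x(2)] by simp
 qed
 moreover have "{g \<in> chain B. K g = l *s g} \<subseteq> cv.span ?T"
 proof
  fix g assume g: "g \<in> {g \<in> chain B. K g = l *s g}"
  then obtain i b where gb: "g = (F' ^^ i) b" "b \<in> B" by (auto simp: chain_def)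
  obtain m where m: "b \<in> ww m" using B gb by auto
  show "g \<in> cv.span ?T"
  proof (cases "g = 0")
   case False
   have "l *s g = (m / q ^ (2 * i)) *s g" using wwD(3)[OF ww_F'k[OF m]] g gb by auto
   then have "m / q ^ (2 * i) = l" using False by simp
   moreover have "b \<noteq> 0" using False gb by (auto simp: lins')
   ultimately show ?thesis using gb m by (intro cv.span_base) blast
  qed (simp add: cv.span_zero)
 qed
 ultimately show ?thesis using span_subset_subspace[OF _ cv.subspace_span] by blast
qed

end

subsection \<open>The two weights of a block\<close>

text \<open>\<open>s\<close> gives meaning to half-integral powers of \<open>q\<close>;
  \<open>N\<close> is the number of steps of \<open>F'\<close>, each dividing the weight by
  \<open>q ^ 2\<close>, that lead from \<open>l0\<close> to \<open>l1\<close>.\<close>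

locale qsp = qparam q z for q z +
 fixes s :: complex and N :: nat
 assumes s2: "s ^ 2 = q"
begin

definition l0 :: complex where "l0 = s powi (2 * int N - 3)"
definition l1 :: complex where "l1 = s powi (- 2 * int N - 3)"

lemma s0: "s \<noteq> 0" using s2 q0 by auto

lemma q_powi: "q powi m = s powi (2 * m)"
 using s2 by (simp add: power_int_mult)

lemma l0_nz: "l0 \<noteq> 0" and l1_nz: "l1 \<noteq> 0" using s0 by (auto simp: l0_def l1_def)

lemma l1_l0: "l1 = l0 / q ^ (2 * N)"
proof -
 have "q ^ (2 * N) = s powi (4 * int N)" using q_powi[of "2 * int N"] by (simp add: power_int_def nat_mult_distrib)
 then have "l1 * q ^ (2 * N) = s powi (- 2 * int N - 3 + 4 * int N)"
  using s0 by (simp add: l1_def flip: power_int_add)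
 also have "\<dots> = l0" by (simp add: l0_def)
 finally show ?thesis using q0 by (simp add: field_simps)
qed

text \<open>The two weights are exchanged by the reflection under which \<open>th\<close> is
  invariant.\<close>

lemma l0_l1: "l0 * l1 = 1 / q ^ 3"
proof -
 have "l0 * l1 = s powi (2 * int N - 3 + (- 2 * int N - 3))"
  using s0 unfolding l0_def l1_def by (subst power_int_add) auto
 also have "\<dots> = q powi (- 3)" by (simp add: q_powi)
 finally show ?thesis by (simp add: power_int_minus field_simps)
qed

lemma th_l0: assumes "l \<noteq> 0" shows "th l = th l0 \<longleftrightarrow> l = l0 \<or> l = l1"
proof -
 have "l * l0 = 1 / q ^ 3 \<longleftrightarrow> l * l0 = l1 * l0" using l0_l1 by (simp add: mult.commute)
 then show ?thesis using th_eq_iff[OF assms l0_nz] l0_nz by auto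
qed

lemma half_coset_alt: "half_coset q s = {l0 * q powi j | j. True}"
proof -
 have l: "l0 = s * q powi (int N - 2)"
  using s0 unfolding q_powi l0_def by (simp flip: power_int_add_1')
 have "l0 * q powi j = s * q powi (int N - 2 + j)" for j
  using q0 by (simp add: l power_int_add)
 moreover have "s * q powi m = l0 * q powi (m - (int N - 2))" for m
  using q0 by (simp add: l flip: power_int_add)
 ultimately show ?thesis unfolding half_coset_def by blast
qed

lemma hc_nz: "l \<in> half_coset q s \<Longrightarrow> l \<noteq> 0" using l0_nz q0 by (auto simp: half_coset_alt)

lemma hc_mult: assumes "l \<in> half_coset q s" shows "l * q ^ k \<in> half_coset q s"
proof -
 obtain j where "l = l0 * q powi j" using assms by (auto simp: half_coset_alt)
 then have "l * q ^ k = l0 * q powi (j + int k)" using q0 by (simp add: power_int_add)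
 then show ?thesis by (auto simp: half_coset_alt)
qed

lemma hc_div: assumes "l \<in> half_coset q s" shows "l / q ^ k \<in> half_coset q s"
proof -
 obtain j where "l = l0 * q powi j" using assms by (auto simp: half_coset_alt)
 then have "l / q ^ k = l0 * q powi (j - int k)" using q0 by (simp add: power_int_diff)
 then show ?thesis by (auto simp: half_coset_alt)
qed

lemma hc_l0: "l0 \<in> half_coset q s"
 unfolding half_coset_alt by (auto intro!: exI[of _ 0])

lemma hc_l1: "l1 \<in> half_coset q s" using hc_div[OF hc_l0] by (simp add: l1_l0)

lemma l0_div: "l0 / q ^ i = l0 / q ^ j \<longleftrightarrow> i = j"
 using l0_nz q0 qpow_inj[of i j] by (auto simp: field_simps)

lemma l0_step: assumes "i > 0" "i \<noteq> N" shows "th (l0 / q ^ (2 * i)) \<noteq> th l0"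
proof -
 have "l0 / q ^ (2 * i) \<noteq> l0 / q ^ 0" "l0 / q ^ (2 * i) \<noteq> l0 / q ^ (2 * N)"
  unfolding l0_div using assms by auto
 then show ?thesis using th_l0[of "l0 / q ^ (2 * i)"] l0_nz q0 by (simp add: l1_l0)
qed

text \<open>The scalar by which \<open>E ^^ (N - 1)\<close> after \<open>F' ^^ (N - 1)\<close> acts
  on \<open>ww l0\<close>. It is nonzero since along the chain the value \<open>th l0\<close> recurs
  only after \<open>N\<close> steps.\<close>

definition gam :: complex where "gam = (\<Prod>j = 1..<N. th l0 - th (l0 / q ^ (2 * j)))"

lemma gam_nz: "gam \<noteq> 0"
proof -
 have "th l0 - th (l0 / q ^ (2 * j)) \<noteq> 0" if "j \<in> {1..<N}" for j
  using l0_step[of j] that by simp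
 then show ?thesis by (simp add: gam_def)
qed

end

text \<open>Membership in the block, in the form in which it is used. Local finiteness enters only
  as nilpotency of \<open>X\<close> and \<open>E\<close> on weight vectors, annihilation by a power
  of the ideal only as nilpotency of \<open>Ct\<close> minus its scalar, with one exponent for all
  of \<open>S\<close>.\<close>

locale qsb = qs q z S E F K Ki X Y + qsp q z s N for q z :: complex and S :: "'a::cvec set" and E F K Ki X Y s N +
 assumes wts: "S \<subseteq> cv.span (\<Union>l\<in>half_coset q s. {m \<in> S. K m = l *s m})"
  and nil: "\<And>l m. l \<in> half_coset q s \<Longrightarrow> m \<in> S \<Longrightarrow> K m = l *s m \<Longrightarrow> (\<exists>r. (X ^^ r) m = 0) \<and> (\<exists>r. (E ^^ r) m = 0)"
  and cas: "\<exists>k. \<forall>m\<in>S. ((\<lambda>m. Ct m - ctilde q z l0 *s m) ^^ k) m = 0"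
begin

lemma stable_qsb: assumes "stable P" shows "qsb q z P E F K Ki X Y s N"
proof -
 interpret P: qs q z P E F K Ki X Y by (rule stable_qs[OF assms])
 note P = stableD[OF assms]
 show ?thesis
 proof (intro qsb.intro qsb_axioms.intro P.qs_axioms qsp_axioms)
  show "P \<subseteq> cv.span (\<Union>l\<in>half_coset q s. {m \<in> P. K m = l *s m})"
   by (rule eig_subspace[OF lin(3) P(1) P(5) subS P(2) wts])
  show "(\<exists>r. (X ^^ r) m = 0) \<and> (\<exists>r. (E ^^ r) m = 0)"
   if "l \<in> half_coset q s" "m \<in> P" "K m = l *s m" for l m
   using nil that P(2) by blast
  show "\<exists>k. \<forall>m\<in>P. ((\<lambda>m. Ct m - ctilde q z l0 *s m) ^^ k) m = 0"
   using cas P(2) by blast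
 qed
qed

definition YW :: "'a set" where "YW = {(Y ^^ k) w | k w. w \<in> S \<and> X w = 0}"

lemma YWI: "w \<in> S \<Longrightarrow> X w = 0 \<Longrightarrow> (Y ^^ k) w \<in> YW" by (auto simp: YW_def)

text \<open>\<open>X\<close> sends \<open>(Y ^^ Suc k) w\<close> to \<open>- z * qi (Suc k)\<close>
  times \<open>(Y ^^ k) w\<close>, and this scalar is invertible.\<close>

lemma X_surj: "u \<in> cv.span YW \<Longrightarrow> \<exists>m\<in>cv.span YW. X m = u"
proof (induct rule: cv.span_induct_alt)
 case base
 show ?case by (rule bexI[of _ 0]) (auto simp: lins cv.span_zero)
next
 case (step c x y)
 then obtain m where m: "m \<in> cv.span YW" "X m = y" by blast
 obtain k w where x: "x = (Y ^^ k) w" "w \<in> S" "X w = 0" using step by (auto simp: YW_def)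
 have nz: "z * qi (Suc k) \<noteq> 0" using z0 qi_nz by simp
 define m' where "m' = (- c / (z * qi (Suc k))) *s (Y ^^ Suc k) w + m"
 have "m' \<in> cv.span YW" unfolding m'_def
  by (intro cv.span_add[OF cv.span_scale[OF cv.span_base] m(1)] YWI x)
 moreover have "X m' = c *s x + y"
  using X_Yk[OF x(2,3), of "Suc k"] m nz by (simp add: m'_def lins x(1) del: funpow.simps)
 ultimately show ?case by blast
qed

text \<open>As for modules over a Weyl algebra with a locally nilpotent derivation:
  \<open>X m\<close> has by induction a preimage \<open>m'\<close> in the span of \<open>YW\<close>,
  and \<open>m - m'\<close> lies in the kernel of \<open>X\<close>.\<close>

lemma X_nil_YW: "m \<in> S \<Longrightarrow> (X ^^ r) m = 0 \<Longrightarrow> m \<in> cv.span YW"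
proof (induct r arbitrary: m)
 case 0
 then show ?case by (simp add: cv.span_zero)
next
 case (Suc r)
 then have "X m \<in> cv.span YW" by (simp add: funpow_swap1)
 then obtain m' where m': "m' \<in> cv.span YW" "X m' = X m" using X_surj by blast
 have "cv.span YW \<subseteq> S" by (rule span_subset_subspace[OF _ subS]) (auto simp: YW_def)
 then have "m' \<in> S" using m' by auto
 then have "m - m' \<in> S" "X (m - m') = 0" using m' Suc by (simp_all add: lins)
 then have "m - m' \<in> YW" using YWI[of "m - m'" 0] by simp
 then have "(m - m') + m' \<in> cv.span YW" using m' cv.span_add[OF cv.span_base] by blast
 then show ?case by simp
qed

lemma S_YW: "S \<subseteq> cv.span YW"
proof -
 have "(\<Union>l\<in>half_coset q s. {m \<in> S. K m = l *s m}) \<subseteq> cv.span YW"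
  using nil X_nil_YW by blast
 then show ?thesis using wts span_subset_subspace[OF _ cv.subspace_span] by blast
qed

lemma kerX_weights: "{w \<in> S. X w = 0} \<subseteq> cv.span (\<Union>l\<in>half_coset q s. ww l)"
proof -
 have "{w \<in> S. X w = 0} \<subseteq> cv.span (\<Union>l\<in>half_coset q s. {w \<in> {w \<in> S. X w = 0}. K w = l *s w})"
 proof (rule eig_subspace[OF lin(3) _ _ subS _ wts])
  show "cv.subspace {w \<in> S. X w = 0}" by (auto simp: cv.subspace_def lins)
  show "K x \<in> {w \<in> S. X w = 0}" if "x \<in> {w \<in> S. X w = 0}" for x
  proof -
   have "q *s X (K x) = 0" using that KX[of x] by (simp add: lins)
   then show ?thesis using that q0 by simp
  qed
 qed auto
 then show ?thesis by (simp add: ww_def conj_assoc)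
qed

definition Nn :: "'a \<Rightarrow> 'a" where "Nn m = Ct m - ctilde q z l0 *s m"

lemma linNn: "clinear Nn" unfolding Nn_def by (intro clinear_combine linCt clinear_id)

lemma zq: "z * (1 + q) \<noteq> 0" using z0 q1p by simp

lemma Nn_ww: assumes "w \<in> ww l" "l \<noteq> 0"
 shows "Nn w = (z * (1 + q)) *s (F' (E w) + (th l - th l0) *s w)"
 using Ct_ww[OF assms] ctilde_th[OF l0_nz] by (simp add: Nn_def vs algebra_simps)

lemma FE_ww: "w \<in> ww l \<Longrightarrow> F' (E w) \<in> ww l"
 using ww_F'[OF ww_E] q0 by fastforce

lemma Nn_in_ww: assumes "w \<in> ww l" "l \<noteq> 0" shows "Nn w \<in> ww l"
 unfolding Nn_ww[OF assms] using FE_ww[OF assms(1)] assms sub_ww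
 by (intro cv.subspace_scale cv.subspace_add) auto

lemma Nn_nil: "\<exists>k. \<forall>m\<in>S. (Nn ^^ k) m = 0"
proof -
 have "Nn = (\<lambda>m. Ct m - ctilde q z l0 *s m)" by (rule ext) (simp add: Nn_def)
 then show ?thesis using cas by simp
qed

text \<open>If \<open>E w = 0\<close>, then \<open>w\<close> is an eigenvector of the nilpotent
  operator \<open>Nn\<close> with nonzero eigenvalue.\<close>

lemma E_inj: assumes "w \<in> ww l" "l \<noteq> 0" "th l \<noteq> th l0" "E w = 0" shows "w = 0"
proof -
 let ?d = "z * (1 + q) * (th l - th l0)"
 have "Nn w = ?d *s w" using Nn_ww[OF assms(1,2)] assms by (simp add: clin[OF linF'])
 then have "(Nn ^^ k) w = (?d ^ k) *s w" for k
  by (induct k) (simp_all add: clin[OF linNn] mult.commute)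
 then show ?thesis using Nn_nil wwD(1)[OF assms(1)] assms(3) zq by fastforce
qed

text \<open>Up to the factor \<open>z * (1 + q)\<close>, the operator \<open>F' E\<close> is the
  nilpotent \<open>Nn\<close> minus a nonzero scalar, hence onto. The induction on the exponent of
  nilpotency is the geometric series.\<close>

lemma FE_surj_aux:
 assumes "l \<noteq> 0" "th l \<noteq> th l0"
 shows "w \<in> ww l \<Longrightarrow> (Nn ^^ k) w = 0 \<Longrightarrow> \<exists>u\<in>ww l. F' (E u) = w"
proof (induct k arbitrary: w)
 case 0
 then show ?case using sub_ww[of l] by (intro bexI[of _ 0]) (auto simp: lins' cv.subspace_0)
next
 case (Suc k)
 then have "Nn w \<in> ww l" "(Nn ^^ k) (Nn w) = 0" using Nn_in_ww assms by (simp_all add: funpow_swap1)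
 then obtain u where u: "u \<in> ww l" "F' (E u) = Nn w" using Suc by blast
 let ?t = "z * (1 + q)" and ?d = "th l - th l0"
 have d: "?d \<noteq> 0" using assms by simp
 \<comment> \<open>\<open>F' (E u)\<close> is \<open>Nn w\<close>, and \<open>Nn w\<close> minus
   \<open>?t\<close> times \<open>F' (E w)\<close> leaves only the scalar part of
   \<open>Nn w\<close>.\<close>
 have "F' (E (u - ?t *s w)) = (?t * ?d) *s w"
  using u Nn_ww[OF Suc(2) assms(1)] by (simp add: lins' vs right_diff_distrib)
 then have "F' (E ((1 / (?t * ?d)) *s (u - ?t *s w))) = w"
  using zq d by (simp add: lins clin[OF linF'])
 moreover have "(1 / (?t * ?d)) *s (u - ?t *s w) \<in> ww l"
  using u Suc sub_ww by (auto intro!: cv.subspace_scale cv.subspace_diff)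
 ultimately show ?case by blast
qed

lemma FE_surj: assumes "w \<in> ww l" "l \<noteq> 0" "th l \<noteq> th l0" shows "\<exists>u\<in>ww l. F' (E u) = w"
 using FE_surj_aux[OF assms(2,3,1)] Nn_nil wwD(1)[OF assms(1)] by blast

text \<open>Climbing from \<open>w\<close> by \<open>E\<close>, injectivity can fail only at the
  weights \<open>l0\<close> and \<open>l1\<close>, both of which lie on the chain below
  \<open>l0\<close>. Starting off the chain they are never met, so no power of \<open>E\<close>
  kills \<open>w\<close>, against nilpotency.\<close>

lemma ww_chain:
 assumes "w \<in> ww l" "w \<noteq> 0" "l \<in> half_coset q s"
 shows "\<exists>i. l = l0 / q ^ (2 * i)"
proof (rule ccontr)
 assume no: "\<nexists>i. l = l0 / q ^ (2 * i)"
 have "(E ^^ r) w \<noteq> 0" for r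
 proof (induct r)
  case (Suc r)
  let ?l = "l * q ^ (2 * r)"
  have l: "?l \<noteq> 0" using hc_nz[OF assms(3)] q0 by simp
  have "?l \<noteq> l0" using no q0 by (auto simp: field_simps)
  moreover have "?l \<noteq> l1"
  proof
   assume "?l = l1"
   then have "l = l0 / q ^ (2 * (N + r))" using q0 by (simp add: l1_l0 field_simps power_add)
   then show False using no by blast
  qed
  ultimately have "th ?l \<noteq> th l0" using th_l0[OF l] by simp
  then show ?case using E_inj[OF ww_Ek[OF assms(1)] l] Suc by auto
 qed (use assms in simp)
 then show False using nil[OF assms(3)] wwD[OF assms(1)] by blast
qed

lemma E_l0: assumes "w \<in> ww l0" shows "E w = 0"
proof (rule ccontr)
 assume "E w \<noteq> 0"
 then obtain i where "l0 * q ^ 2 = l0 / q ^ (2 * i)"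
  using ww_chain[OF ww_E[OF assms]] hc_mult[OF hc_l0] by blast
 then have "q ^ 2 * q ^ (2 * i) = 1" using l0_nz q0 by (simp add: field_simps)
 then have "q ^ (2 + 2 * i) = 1" by (simp only: power_add)
 then show False using qn[of "2 + 2 * i"] by simp
qed

text \<open>At a weight other than \<open>l0\<close> and \<open>l1\<close> the map
  \<open>F' E\<close> is onto, so every vector there comes by \<open>F'\<close> from one step
  higher.\<close>

lemma ww_down:
 assumes "w \<in> ww (l0 / q ^ (2 * Suc i))" "Suc i \<noteq> N"
 shows "\<exists>u\<in>ww (l0 / q ^ (2 * i)). w = F' u"
proof -
 have "l0 / q ^ (2 * Suc i) \<noteq> 0" using l0_nz q0 by simp
 then obtain u where u: "u \<in> ww (l0 / q ^ (2 * Suc i))" "F' (E u) = w"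
  using FE_surj[OF assms(1)] l0_step[of "Suc i"] assms by blast
 have "E u \<in> ww (l0 / q ^ (2 * Suc i) * q ^ 2)" using u by (rule_tac ww_E)
 also have "l0 / q ^ (2 * Suc i) * q ^ 2 = l0 / q ^ (2 * i)"
  using q0 by (simp add: power2_eq_square)
 finally show ?thesis using u by blast
qed

lemma ww_upper: "w \<in> ww (l0 / q ^ (2 * i)) \<Longrightarrow> i < N \<Longrightarrow> \<exists>v\<in>ww l0. w = (F' ^^ i) v"
proof (induct i arbitrary: w)
 case (Suc i)
 then obtain u where u: "u \<in> ww (l0 / q ^ (2 * i))" "w = F' u" using ww_down by (metis less_irrefl)
 then show ?case using Suc by fastforce
qed simp

definition VV :: "'a set" where "VV = ww l0 \<union> ww l1"

lemma ww_span_chain: "w \<in> ww (l0 / q ^ (2 * i)) \<Longrightarrow> w \<in> cv.span (chain VV)"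
proof (induct i arbitrary: w)
 case 0
 then show ?case using chainI[of w VV 0] by (auto simp: VV_def intro: cv.span_base)
next
 case (Suc i)
 show ?case
 proof (cases "Suc i = N")
  case True
  then have "w \<in> ww l1" using Suc by (simp add: l1_l0)
  then show ?thesis using chainI[of w VV 0] by (auto simp: VV_def intro: cv.span_base)
 next
  case False
  then obtain u where u: "u \<in> ww (l0 / q ^ (2 * i))" "w = F' u" using ww_down Suc by blast
  then show ?thesis using F'k_chain[of u VV 1] Suc by auto
 qed
qed

theorem S_fam: "S \<subseteq> cv.span (fam VV)"
proof -
 have "ww l \<subseteq> cv.span (chain VV)" if "l \<in> half_coset q s" for l
  using ww_chain[OF _ _ that] ww_span_chain cv.span_zero by blast
 then have "(\<Union>l\<in>half_coset q s. ww l) \<subseteq> cv.span (chain VV)" by (rule UN_least)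
 then have W: "{w \<in> S. X w = 0} \<subseteq> cv.span (chain VV)"
  by (rule subset_trans[OF kerX_weights span_subset_subspace[OF _ cv.subspace_span]])
 have "YW \<subseteq> cv.span (fam VV)"
 proof
  fix y assume "y \<in> YW"
  then obtain k w where "y = (Y ^^ k) w" "w \<in> S" "X w = 0" by (auto simp: YW_def)
  then show "y \<in> cv.span (fam VV)" using W Yk_chain by auto
 qed
 then show ?thesis by (rule subset_trans[OF S_YW span_subset_subspace[OF _ cv.subspace_span]])
qed

lemma Ek_F'k: assumes "v \<in> ww l0"
 shows "(E ^^ i) ((F' ^^ i) v) = (\<Prod>j = 1..<Suc i. th l0 - th (l0 / q ^ (2 * j))) *s v"
proof (induct i)
 case (Suc i)
 have "E ((F' ^^ Suc i) v) = (th l0 - th (l0 / q ^ (2 * Suc i))) *s (F' ^^ i) v"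
  using E_F'k[OF assms l0_nz, of "Suc i"] E_l0[OF assms] by (simp add: lins' del: funpow.simps)
 then have "(E ^^ Suc i) ((F' ^^ Suc i) v) = (E ^^ i) ((th l0 - th (l0 / q ^ (2 * Suc i))) *s (F' ^^ i) v)"
  by (simp only: funpow_Suc_right comp_def)
 then show ?case using Suc by (simp add: lins' mult.commute del: funpow.simps)
qed simp

text \<open>\<open>E v\<close> lies one step above \<open>l1\<close>, so it is
  \<open>F' ^^ (N - 1)\<close> of some \<open>u\<close> of weight \<open>l0\<close>; applying
  \<open>E ^^ (N - 1)\<close> identifies \<open>u\<close> as \<open>(E ^^ N) v\<close> divided by
  \<open>gam\<close>. Hence \<open>E\<close> on \<open>ww l1\<close> is determined by
  \<open>E ^^ N\<close>.\<close>

lemma E_l1: assumes "v \<in> ww l1" "N > 0"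
 shows "E v = (1 / gam) *s (F' ^^ (N - 1)) ((E ^^ N) v)"
proof -
 have "E v \<in> ww (l1 * q ^ 2)" using ww_E assms by blast
 also have "l1 * q ^ 2 = l0 / q ^ (2 * (N - 1))"
 proof -
  have "2 * N = 2 * (N - 1) + 2" using assms(2) by simp
  then have "q ^ (2 * N) = q ^ (2 * (N - 1)) * q ^ 2" by (metis power_add)
  then show ?thesis using q0 by (simp add: l1_l0)
 qed
 finally obtain u where u: "u \<in> ww l0" "E v = (F' ^^ (N - 1)) u"
  using ww_upper[of "E v" "N - 1"] assms by auto
 have "(E ^^ N) v = (E ^^ (N - 1)) (E v)"
  using assms(2) funpow_swap1[of E "N - 1" v] by (cases N) simp_all
 also have "\<dots> = gam *s u" using Ek_F'k[OF u(1), of "N - 1"] assms(2) u by (simp add: gam_def)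
 finally have 1: "(E ^^ N) v = gam *s u" .
 show ?thesis unfolding 1 u(2) clinear_scale[OF linF'k] using gam_nz by simp
qed

lemma EN_l1: assumes "v \<in> ww l1" shows "(E ^^ N) v \<in> ww l0"
 using ww_Ek[OF assms, of N] q0 by (simp add: l1_l0)

lemma F'N_l0: assumes "v \<in> ww l0" shows "(F' ^^ N) v \<in> ww l1"
 using ww_F'k[OF assms, of N] by (simp add: l1_l0)

lemma EN_F'N: assumes "v \<in> ww l0" "N > 0" shows "(E ^^ N) ((F' ^^ N) v) = 0"
proof -
 have 1: "th l0 - th (l0 / q ^ (2 * N)) = 0" using th_l0[OF l1_nz] by (simp add: l1_l0)
 have "(\<Prod>j = 1..<Suc N. th l0 - th (l0 / q ^ (2 * j))) = 0"
  by (rule prod_zero[OF finite_atLeastLessThan]) (use 1 assms(2) in \<open>auto intro!: bexI[of _ N]\<close>)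
 then show ?thesis unfolding Ek_F'k[OF assms(1)] by simp
qed

end

section \<open>Nilpotency of X and E from finite dimension\<close>

lemma eig_indep_family:
 assumes A: "clinear A" and I: "finite I" "inj_on e I" "\<And>i. i \<in> I \<Longrightarrow> A (y i) = e i *s y i"
  and "(\<Sum>i\<in>I. y i) = 0" "i \<in> I"
 shows "y i = 0"
proof -
 let ?g = "inv_into I e"
 have "(\<Sum>l\<in>e ` I. y (?g l)) = (\<Sum>i\<in>I. y i)"
  using I(2) by (simp add: sum.reindex)
 moreover have "A (y (?g l)) = l *s y (?g l)" if "l \<in> e ` I" for l
  using I that by auto
 ultimately have "y (?g (e i)) = 0"
  using eig_indep[OF A, of "e ` I" "\<lambda>l. y (?g l)" "e i"] assms by simp
 then show ?thesis using assms by simp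
qed

text \<open>The iterates lie in finitely many dimensions, but have distinct eigenvalues.\<close>

lemma nilpotent_if_finite:
 assumes K: "clinear K" and G: "finite G" "\<And>r. (A ^^ r) m \<in> cv.span G"
  and ev: "\<And>r. K ((A ^^ r) m) = e r *s (A ^^ r) m" and e: "inj e"
 shows "\<exists>r. (A ^^ r) m = 0"
proof (rule ccontr)
 assume no: "\<nexists>r. (A ^^ r) m = 0"
 let ?y = "\<lambda>r. (A ^^ r) m"
 let ?I = "{..card G}"
 have inj: "inj_on ?y ?I"
 proof (rule inj_onI)
  fix r t assume eq: "?y r = ?y t"
  have "e r *s ?y r = e t *s ?y r" using ev[of r, symmetric] ev[of t] unfolding eq by (rule trans)
  moreover have "?y r \<noteq> 0" using no by blast
  ultimately have "e r = e t" by (simp only: cv.scale_cancel_right) simp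
  then show "r = t" using e by (rule injD[rotated])
 qed
 have "cv.independent (?y ` ?I)"
 proof (rule cv.independent_if_scalars_zero)
  fix f x assume 0: "(\<Sum>x\<in>?y ` ?I. f x *s x) = 0" and x: "x \<in> ?y ` ?I"
  then obtain i where i: "i \<in> ?I" "x = ?y i" by blast
  have "(\<Sum>r\<in>?I. f (?y r) *s ?y r) = 0" using 0 inj by (simp add: sum.reindex)
  then have "f (?y i) *s ?y i = 0"
   using eig_indep_family[OF K, of ?I e "\<lambda>r. f (?y r) *s ?y r" i] e i ev
   by (auto simp: clin[OF K] mult.commute inj_on_subset)
  then show "f x = 0" using no i by (auto simp: cv.scale_eq_0_iff)
 qed simp
 then have "card (?y ` ?I) \<le> card G"
  using cv.independent_span_bound[OF G(1)] G(2) by blast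
 then show False using card_image[OF inj] by simp
qed

context qparam
begin

lemma inj_qpow: "l \<noteq> 0 \<Longrightarrow> n > 0 \<Longrightarrow> inj (\<lambda>r::nat. l * q ^ (n * r))"
 by (rule injI) (simp add: qpow_inj)

end

context qs
begin

lemma K_Xr: "m \<in> S \<Longrightarrow> K m = l *s m \<Longrightarrow> K ((X ^^ r) m) = (l * q ^ (1 * r)) *s (X ^^ r) m"
 by (induct r) (auto simp: KX lins mult_ac)

lemma K_Er: "m \<in> S \<Longrightarrow> K m = l *s m \<Longrightarrow> K ((E ^^ r) m) = (l * q ^ (2 * r)) *s (E ^^ r) m"
 by (induct r) (auto simp: KE lins mult_ac power2_eq_square)

lemma nil_if_finite:
 assumes "l \<noteq> 0" "m \<in> S" "K m = l *s m" "finite G"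
  "\<And>r. (X ^^ r) m \<in> cv.span G" "\<And>r. (E ^^ r) m \<in> cv.span G"
 shows "(\<exists>r. (X ^^ r) m = 0) \<and> (\<exists>r. (E ^^ r) m = 0)"
 using nilpotent_if_finite[OF lin(3) assms(4,5) K_Xr[OF assms(2,3)] inj_qpow]
  nilpotent_if_finite[OF lin(3) assms(4,6) K_Er[OF assms(2,3)] inj_qpow] assms(1) by simp

end

text \<open>The converse of \<open>qsb\<close>: conditions on finitely many generators that can be
  verified in a concrete module. A generator of weight \<open>l1\<close> not killed by
  \<open>E\<close> must have the form that \<open>E_l1\<close> imposes in a block.\<close>

locale qsh = qs q z S E F K Ki X Y + qsp q z s N for q z :: complex and S :: "'a::cvec set" and E F K Ki X Y s N +
 fixes B :: "'a set"
 assumes finB: "finite B"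
  and B: "\<And>b. b \<in> B \<Longrightarrow> b \<in> ww l0 \<and> E b = 0 \<or>
    b \<in> ww l1 \<and> (E b = 0 \<or> (\<exists>u\<in>cv.span {b \<in> B. b \<in> ww l0 \<and> E b = 0}. N > 0 \<and> E b = (F' ^^ (N - 1)) u))"
  and gen: "S \<subseteq> cv.span (fam B)"
begin

definition B0 :: "'a set" where "B0 = {b \<in> B. b \<in> ww l0 \<and> E b = 0}"

text \<open>Finite pieces of the family stable under \<open>E\<close> and \<open>X\<close>, where
  \<open>Y ^^ k\<close> and \<open>F' ^^ i\<close> count for degree \<open>k + 2 * i\<close>. For a
  generator of weight \<open>l1\<close> the operator \<open>E\<close> brings in
  \<open>F' ^^ (N - 1)\<close> of generators in \<open>B0\<close>; these therefore get
  \<open>2 * N\<close> additional degrees, and being killed by \<open>E\<close> they cause no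
  further growth.\<close>

definition GG :: "nat \<Rightarrow> 'a set" where
 "GG D = {(Y ^^ k) ((F' ^^ i) b) | k i b. b \<in> B0 \<and> k + 2 * i \<le> D + 2 * N} \<union>
     {(Y ^^ k) ((F' ^^ i) b) | k i b. b \<in> B \<and> k + 2 * i \<le> D}"

lemma B_cases:
 assumes "b \<in> B"
 obtains l where "b \<in> ww l" "l \<noteq> 0" "l \<in> {l0, l1}" "E b = 0"
  | u where "b \<in> ww l1" "u \<in> cv.span B0" "N > 0" "E b = (F' ^^ (N - 1)) u"
 using B[OF assms] l0_nz l1_nz unfolding B0_def by blast

lemma B_ww: "b \<in> B \<Longrightarrow> \<exists>l. l \<noteq> 0 \<and> l \<in> half_coset q s \<and> b \<in> ww l"
 using B l0_nz l1_nz hc_l0 hc_l1 by blast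

lemma BS: "B \<subseteq> S" using B_ww wwD(1) by blast

lemma finite_GG: "finite (GG D)"
proof -
 let ?f = "\<lambda>(k, i, b). (Y ^^ k) ((F' ^^ i) b)"
 have "GG D \<subseteq> ?f ` ({..D + 2 * N} \<times> {..D + 2 * N} \<times> B)"
 proof
  fix x assume "x \<in> GG D"
  then obtain k i b where x: "x = (Y ^^ k) ((F' ^^ i) b)" "b \<in> B" "k + 2 * i \<le> D + 2 * N"
   by (auto simp: GG_def B0_def)
  then have "(k, i, b) \<in> {..D + 2 * N} \<times> {..D + 2 * N} \<times> B" by auto
  then show "x \<in> ?f ` ({..D + 2 * N} \<times> {..D + 2 * N} \<times> B)"
   by (rule rev_image_eqI) (simp add: x)
 qed
 then show ?thesis using finB finite_subset by blast
qed

lemma GG_mono: "D \<le> D' \<Longrightarrow> GG D \<subseteq> GG D'"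
 unfolding GG_def by fastforce

lemma GG_S: "GG D \<subseteq> S" using BS by (auto simp: GG_def B0_def)

lemma S_GG: "x \<in> cv.span (fam B) \<Longrightarrow> \<exists>D. x \<in> cv.span (GG D)"
proof (induct rule: cv.span_induct_alt)
 case base
 then show ?case by (auto simp: cv.span_zero)
next
 case (step c x y)
 then obtain D where D: "y \<in> cv.span (GG D)" by blast
 obtain k i b where x: "x = (Y ^^ k) ((F' ^^ i) b)" "b \<in> B" using step by (auto simp: fam_def)
 have "x \<in> GG (k + 2 * i)" unfolding GG_def using x order_refl by blast
 then have "x \<in> cv.span (GG (k + 2 * i + D))"
  using GG_mono[of "k + 2 * i" "k + 2 * i + D"] by (auto intro: cv.span_base)
 moreover have "y \<in> cv.span (GG (k + 2 * i + D))"
  using D cv.span_mono[OF GG_mono[of D "k + 2 * i + D"]] by auto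
 ultimately show ?case by (blast intro: cv.span_add cv.span_scale)
qed

lemma GG_stable_gen:
 assumes "b \<in> B" and mem: "\<And>k' i'. k' + 2 * i' \<le> k + 2 * i \<Longrightarrow> (Y ^^ k') ((F' ^^ i') b) \<in> GG D"
  and Eb: "(Y ^^ k) ((F' ^^ i) (E b)) \<in> cv.span (GG D)"
 shows "E ((Y ^^ k) ((F' ^^ i) b)) \<in> cv.span (GG D) \<and> X ((Y ^^ k) ((F' ^^ i) b)) \<in> cv.span (GG D)"
proof -
 obtain l where l: "b \<in> ww l" "l \<noteq> 0" using B_ww[OF assms(1)] by blast
 note w = wwD[OF ww_F'k[OF l(1), of i]]
 have "(Y ^^ (k - 1)) ((F' ^^ i) b) \<in> cv.span (GG D)" "(Y ^^ (k - 2)) ((F' ^^ i) b) \<in> cv.span (GG D)"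
  "(Y ^^ k) ((F' ^^ (i - 1)) b) \<in> cv.span (GG D)"
  by (rule cv.span_base[OF mem], simp)+
 then show ?thesis
  unfolding X_Yk[OF w(1,2)] E_Yk[OF w(1,2)] E_F'k[OF l] clin(1,2)[OF linY]
  using Eb by (meson cv.span_add cv.span_scale)
qed

lemma GG_stable: "x \<in> cv.span (GG D) \<Longrightarrow> E x \<in> cv.span (GG D) \<and> X x \<in> cv.span (GG D)"
proof -
 have gen: "E g \<in> cv.span (GG D) \<and> X g \<in> cv.span (GG D)" if g: "g \<in> GG D" for g
 proof -
  obtain k i b where gb: "g = (Y ^^ k) ((F' ^^ i) b)"
   and b: "b \<in> B0 \<and> k + 2 * i \<le> D + 2 * N \<or> b \<in> B \<and> k + 2 * i \<le> D"
   using g by (auto simp: GG_def)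
  have bB: "b \<in> B" using b by (auto simp: B0_def)
  have mem: "(Y ^^ k') ((F' ^^ i') b) \<in> GG D" if "k' + 2 * i' \<le> k + 2 * i" for k' i'
   using b that unfolding GG_def by fastforce
  have "(Y ^^ k) ((F' ^^ i) (E b)) \<in> cv.span (GG D)"
  proof (cases "E b = 0")
   case True
   then show ?thesis by (simp add: lins' cv.span_zero)
  next
   case False
   then have kD: "k + 2 * i \<le> D" using b by (auto simp: B0_def)
   from bB False obtain u where u: "u \<in> cv.span B0" "N > 0" "E b = (F' ^^ (N - 1)) u"
    by (cases rule: B_cases) auto
   \<comment> \<open>The degree grows by \<open>2 * (N - 1)\<close>, which the allowance for
     \<open>B0\<close> absorbs.\<close>
   have "(Y ^^ k) ((F' ^^ (i + (N - 1))) u) \<in> cv.span (GG D)"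
   proof (rule span_image_subset[OF clinear_comp[OF linF'k linY] cv.subspace_span _ u(1)])
    fix b assume "b \<in> B0"
    then have "(Y ^^ k) ((F' ^^ (i + (N - 1))) b) \<in> GG D"
     using kD u(2) unfolding GG_def by force
    then show "(Y ^^ k) ((F' ^^ (i + (N - 1))) b) \<in> cv.span (GG D)" by (rule cv.span_base)
   qed
   then show ?thesis by (simp add: u(3) funpow_add)
  qed
  then show ?thesis unfolding gb using GG_stable_gen[OF bB mem] by blast
 qed
 assume x: "x \<in> cv.span (GG D)"
 show ?thesis
  using span_image_subset[OF lin(1) cv.subspace_span _ x] span_image_subset[OF lin(5) cv.subspace_span _ x] gen
  by blast
qed

lemma loc_fin:
 assumes "m \<in> S"
 shows "\<exists>G. finite G \<and> G \<subseteq> S \<and> m \<in> cv.span G \<and> (\<forall>x\<in>cv.span G. E x \<in> cv.span G \<and> X x \<in> cv.span G)"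
 using S_GG[of m] gen assms finite_GG GG_S GG_stable by (meson subsetD)

definition Nq :: "'a \<Rightarrow> 'a" where "Nq m = Ct m - ctilde q z l0 *s m"

lemma linNq: "clinear Nq" unfolding Nq_def by (intro clinear_combine linCt clinear_id)

lemma Nq_ww: assumes "w \<in> ww l" "l \<noteq> 0"
 shows "Nq w = (z * (1 + q)) *s (F' (E w) + (th l - th l0) *s w)"
 using Ct_ww[OF assms] ctilde_th[OF l0_nz] by (simp add: Nq_def vs algebra_simps)

lemma Nq_Yk: "m \<in> S \<Longrightarrow> Nq ((Y ^^ k) m) = (Y ^^ k) (Nq m)"
 by (simp add: Nq_def Ct_Yk lins')

text \<open>Because \<open>th l = th l0\<close>, the scalar from moving \<open>E\<close> past
  \<open>F' ^^ i\<close> cancels the scalar part of \<open>Nq\<close>.\<close>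

lemma Nq_F'k:
 assumes "b \<in> ww l" "l = l0 \<or> l = l1"
 shows "Nq ((F' ^^ i) b) = (z * (1 + q)) *s F' ((F' ^^ i) (E b))"
proof -
 let ?m = "l / q ^ (2 * i)"
 have l: "l \<noteq> 0" "?m \<noteq> 0" using assms l0_nz l1_nz q0 by auto
 have th: "th l = th l0" using assms th_l0 l by auto
 have "F' (E ((F' ^^ i) b)) = F' ((F' ^^ i) (E b)) + (th l - th ?m) *s (F' ^^ i) b"
  unfolding E_F'k[OF assms(1) l(1)] by (cases i) (simp_all add: lins')
 then show ?thesis
  using Nq_ww[OF ww_F'k[OF assms(1)] l(2)] by (simp add: th vs)
qed

lemma Nq_B0: assumes "u \<in> cv.span B0" shows "Nq ((F' ^^ i) u) = 0"
proof -
 have "Nq ((F' ^^ i) u) \<in> {0}"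
 proof (rule span_image_subset[OF clinear_comp[OF linF'k linNq] _ _ assms])
  fix b assume "b \<in> B0"
  then show "Nq ((F' ^^ i) b) \<in> {0}" using Nq_F'k[of b l0 i] by (simp add: B0_def lins')
 qed (simp add: cv.subspace_def)
 then show ?thesis by simp
qed

text \<open>\<open>Nq\<close> commutes with \<open>Y\<close>, maps the chain of every generator into
  translates of \<open>B0\<close>, and kills those; so two applications give zero.\<close>

lemma Nq_Nq: assumes "m \<in> S" shows "Nq (Nq m) = 0"
proof -
 have "Nq (Nq m) \<in> {0}"
 proof (rule span_image_subset[OF clinear_comp[OF linNq linNq], of _ "fam B"])
  show "m \<in> cv.span (fam B)" using gen assms by blast
  fix g assume "g \<in> fam B"
  then obtain k i b where g: "g = (Y ^^ k) ((F' ^^ i) b)" "b \<in> B" by (auto simp: fam_def)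
  have bS: "b \<in> S" using g BS by auto
  have "Nq (Nq ((F' ^^ i) b)) = 0"
   using g(2)
  proof (cases rule: B_cases)
   case (1 l)
   then show ?thesis using Nq_F'k[of b l i] by (simp add: lins' clin[OF linNq])
  next
   case (2 u)
   have "Nq ((F' ^^ i) b) = (z * (1 + q)) *s (F' ^^ (Suc i + (N - 1))) u"
    using Nq_F'k[OF 2(1), of i] 2(4) by (simp add: funpow_add)
   then show ?thesis using Nq_B0[OF 2(2), of "Suc i + (N - 1)"] by (simp only: clin[OF linNq] cv.scale_zero_right)
  qed
  moreover have "Nq ((F' ^^ i) b) \<in> S" using bS by (simp add: Nq_def)
  ultimately show "Nq (Nq g) \<in> {0}" using bS by (simp add: g Nq_Yk lins')
 qed (simp add: cv.subspace_def)
 then show ?thesis by simp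
qed

lemma fam_weight:
 assumes "g \<in> fam B" shows "g \<in> S \<and> (\<exists>l\<in>half_coset q s. K g = l *s g)"
proof -
 obtain k i b where g: "g = (Y ^^ k) ((F' ^^ i) b)" "b \<in> B" using assms by (auto simp: fam_def)
 obtain l where l: "l \<in> half_coset q s" "b \<in> ww l" using B_ww[OF g(2)] by blast
 note w = wwD[OF ww_F'k[OF l(2), of i]]
 have "K g = (l / q ^ (2 * i) / q ^ k) *s g"
  unfolding g K_Yk[OF w(1)] w(3) by (simp add: lins' mult.commute)
 moreover have "l / q ^ (2 * i) / q ^ k \<in> half_coset q s" using l by (intro hc_div)
 ultimately show ?thesis using w(1) g by auto
qed

lemma weights: "S \<subseteq> cv.span (\<Union>l\<in>half_coset q s. {m \<in> S. K m = l *s m})"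
 by (rule subset_trans[OF gen cv.span_mono]) (use fam_weight in blast)

lemma to_qsb: "qsb q z S E F K Ki X Y s N"
proof (intro qsb.intro qsb_axioms.intro qs_axioms qsp_axioms weights)
 fix l m assume l: "l \<in> half_coset q s" and m: "m \<in> S" "K m = l *s m"
 obtain G where G: "finite G" "m \<in> cv.span G" "\<forall>x\<in>cv.span G. E x \<in> cv.span G \<and> X x \<in> cv.span G"
  using loc_fin[OF m(1)] by blast
 have "(X ^^ r) m \<in> cv.span G" "(E ^^ r) m \<in> cv.span G" for r
  by (induct r) (use G in auto)
 then show "(\<exists>r. (X ^^ r) m = 0) \<and> (\<exists>r. (E ^^ r) m = 0)"
  using nil_if_finite[OF hc_nz[OF l] m G(1)] by blast
next
 have "((\<lambda>m. Ct m - ctilde q z l0 *s m) ^^ 2) m = 0" if "m \<in> S" for m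
  using Nq_Nq[OF that] by (simp add: numeral_2_eq_2 Nq_def)
 then show "\<exists>k. \<forall>m\<in>S. ((\<lambda>m. Ct m - ctilde q z l0 *s m) ^^ k) m = 0" by blast
qed

end

section \<open>The module of a representation of the quiver\<close>

context qparam
begin

lemma qi_SS: "qi (Suc (Suc k)) = qi k + (1 + q) * q ^ k"
proof -
 have "(q - 1) * qi k + 1 = q ^ k" using q1 by (simp add: qi_def)
 then have "(1 + q) * q ^ k = (1 + q) * ((q - 1) * qi k + 1)" by simp
 then show ?thesis by (simp add: qi_Suc algebra_simps)
qed

text \<open>The quotient of \<open>qi (Suc k) * qi k\<close> by \<open>1 + q\<close> is the
  q-binomial coefficient of \<open>Suc k\<close> over \<open>2\<close>.\<close>

lemma eps_closed: "eps (Suc k) = - z * qi (Suc k) * qi k * q / ((1 + q) * q ^ k)"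
proof (induct k)
 case (Suc k)
 have 1: "(1 + q) * q ^ k + qi k = qi (Suc (Suc k))"
  by (simp add: qi_SS)
 have "eps (Suc (Suc k)) = - z * qi (Suc k) * (((1 + q) * q ^ k + qi k) / ((1 + q) * q ^ k))"
 proof -
  define c where "c = 1 + q"
  have "c \<noteq> 0" using q1p by (simp add: c_def)
  then show ?thesis unfolding eps.simps(2)[of "Suc k"] Suc c_def[symmetric] using q0 by (simp add: field_simps)
 qed
 then show ?case unfolding 1 using q0 by simp
qed simp

text \<open>The coefficient identity behind the relation \<open>E X = q X E\<close> in the
  model.\<close>

lemma eps_ratio: "eps (Suc (Suc k)) * qi (Suc (Suc (Suc k))) = q * qi (Suc k) * eps (Suc (Suc (Suc k)))"
proof -
 define c where "c = 1 + q"
 have "c \<noteq> 0" using q1p by (simp add: c_def)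
 then show ?thesis unfolding eps_closed c_def[symmetric] using q0 by (simp add: field_simps)
qed

text \<open>The coefficient identity behind the commutator of \<open>E\<close> and \<open>F\<close>
  in the model: the \<open>Y Y\<close> part of \<open>F\<close> shifts the index of
  \<open>eps\<close> by two.\<close>

lemma eps_diff: "kap * (eps (Suc (Suc k)) - eps k) = (1 / q ^ k - q ^ k) / (q - 1 / q) - kap * z / q ^ k"
proof (induct k)
 case 0
 then show ?case by (simp add: qi_1)
next
 case (Suc k)
 have kz: "kap * z * (1 + q) = 1" using z0 q1p by (simp add: kap_def)
 have qq: "qi (Suc (Suc k)) - qi k = (1 + q) * q ^ k" by (simp add: qi_SS)
 have "kap * (eps (Suc (Suc (Suc k))) - eps (Suc k))
   = - (kap * z) * (qi (Suc (Suc k)) - qi k) + kap * (eps (Suc (Suc k)) - eps k) / q"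
  unfolding eps.simps(2)[of "Suc (Suc k)"] eps.simps(2)[of k]
  by (simp add: algebra_simps diff_divide_distrib del: eps.simps)
 also have "\<dots> = - (kap * z * (1 + q)) * q ^ k + ((1 / q ^ k - q ^ k) / (q - 1 / q) - kap * z / q ^ k) / q"
  unfolding qq Suc by simp
 also have "\<dots> = (1 / q ^ Suc k - q ^ Suc k) / (q - 1 / q) - kap * z / q ^ Suc k"
 proof -
  have "- (q ^ k) + (1 / q ^ k - q ^ k) / (q - 1 / q) / q = (1 / q ^ Suc k - q ^ Suc k) / (q - 1 / q)"
  proof -
   have "- (q ^ k) = (q ^ k / q - q * q ^ k) / (q - 1 / q)" using qd by (simp add: field_simps)
   then show ?thesis using q0 by (simp add: diff_divide_distrib add_divide_distrib mult.commute)
  qed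
  moreover have "- 1 * x + (w - kap * z / q ^ k) / q = (- x + w / q) - kap * z / q ^ Suc k" for x w
   by (simp add: diff_divide_distrib mult.commute)
  ultimately show ?thesis unfolding kz by metis
 qed
 finally show ?case .
qed

end

text \<open>What the kernel of \<open>X\<close> retains of the module structure: \<open>e\<close>,
  \<open>h\<close>, \<open>hi\<close> are the restrictions of \<open>E\<close>, \<open>K\<close>,
  \<open>Ki\<close>, and \<open>f\<close> plays the role of \<open>F'\<close>. Hence the additional
  term with \<open>kap * z\<close> in the commutator, as in \<open>E_F'\<close>.\<close>

locale wm = qparam q z for q z +
 fixes S0 :: "'c::cvec set" and e f h hi :: "'c \<Rightarrow> 'c"
 assumes sub0: "cv.subspace S0"
  and lin0: "clinear e" "clinear f" "clinear h" "clinear hi"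
  and clo0: "\<And>m. m \<in> S0 \<Longrightarrow> e m \<in> S0" "\<And>m. m \<in> S0 \<Longrightarrow> f m \<in> S0" "\<And>m. m \<in> S0 \<Longrightarrow> h m \<in> S0"
   "\<And>m. m \<in> S0 \<Longrightarrow> hi m \<in> S0"
  and hhi: "\<And>m. h (hi m) = m" "\<And>m. hi (h m) = m"
  and he: "\<And>m. h (e m) = (q ^ 2) *s e (h m)"
  and hf: "\<And>m. h (f m) = (1 / q ^ 2) *s f (h m)"
  and ef: "\<And>m. m \<in> S0 \<Longrightarrow> e (f m) = f (e m) + (1 / (q - 1 / q)) *s (h m - hi m) + (kap * z) *s hi m"
begin

text \<open>A sequence \<open>m\<close> stands for the sum of all \<open>(Y ^^ k) (m k)\<close>. The
  operators below are then forced by \<open>X_Yk\<close>, \<open>K_Yk\<close>, \<open>Ki_Yk\<close>,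
  \<open>E_Yk\<close> and \<open>F = F' + kap Y Y Ki\<close>, the last two connecting degrees two
  apart.\<close>

definition SS :: "(nat \<Rightarrow> 'c) set" where "SS = {m. finite {k. m k \<noteq> 0} \<and> (\<forall>k. m k \<in> S0)}"
definition YY :: "(nat \<Rightarrow> 'c) \<Rightarrow> nat \<Rightarrow> 'c" where "YY m k = (case k of 0 \<Rightarrow> 0 | Suc j \<Rightarrow> m j)"
definition XX :: "(nat \<Rightarrow> 'c) \<Rightarrow> nat \<Rightarrow> 'c" where "XX m k = (- z * qi (Suc k)) *s m (Suc k)"
definition KK :: "(nat \<Rightarrow> 'c) \<Rightarrow> nat \<Rightarrow> 'c" where "KK m k = (1 / q ^ k) *s h (m k)"
definition KKi :: "(nat \<Rightarrow> 'c) \<Rightarrow> nat \<Rightarrow> 'c" where "KKi m k = (q ^ k) *s hi (m k)"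
definition EE :: "(nat \<Rightarrow> 'c) \<Rightarrow> nat \<Rightarrow> 'c" where
 "EE m k = (1 / q ^ k) *s e (m k) + eps (Suc (Suc k)) *s m (Suc (Suc k))"
definition FF :: "(nat \<Rightarrow> 'c) \<Rightarrow> nat \<Rightarrow> 'c" where
 "FF m k = f (m k) + (case k of 0 \<Rightarrow> 0 | Suc j \<Rightarrow> (case j of 0 \<Rightarrow> 0 | Suc i \<Rightarrow> kap *s hi (m i)))"

lemmas lins0 = lin0[THEN clinear_add] lin0[THEN clinear_scale] lin0[THEN clinear_0]
 lin0[THEN clinear_diff] lin0[THEN clinear_neg]

lemma hie: "hi (e m) = (1 / q ^ 2) *s e (hi m)"
proof -
 have "hi (h (e (hi m))) = (q ^ 2) *s hi (e m)" by (simp only: he hhi lins0)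
 then show ?thesis using q0 by (simp add: hhi)
qed

lemma S0clo: "0 \<in> S0" "x \<in> S0 \<Longrightarrow> y \<in> S0 \<Longrightarrow> x + y \<in> S0" "x \<in> S0 \<Longrightarrow> c *s x \<in> S0"
 "x \<in> S0 \<Longrightarrow> - x \<in> S0"
 using sub0 by (auto simp: cv.subspace_0 cv.subspace_add cv.subspace_scale cv.subspace_neg)

lemma shift_finite:
 fixes m :: "nat \<Rightarrow> 'c" assumes "finite {k. m k \<noteq> 0}" shows "finite {k. m (k + n) \<noteq> 0}" and "finite {k. k \<ge> n \<and> m (k - n) \<noteq> 0}"
proof -
 have "{k. m (k + n) \<noteq> 0} \<subseteq> (\<lambda>k. k - n) ` {k. m k \<noteq> 0}"
 proof
  fix k assume "k \<in> {k. m (k + n) \<noteq> 0}"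
  then show "k \<in> (\<lambda>k. k - n) ` {k. m k \<noteq> 0}" by (intro image_eqI[of _ _ "k + n"]) auto
 qed
 then show "finite {k. m (k + n) \<noteq> 0}" using assms finite_subset by blast
 have "{k. k \<ge> n \<and> m (k - n) \<noteq> 0} \<subseteq> (\<lambda>k. k + n) ` {k. m k \<noteq> 0}"
 proof
  fix k assume "k \<in> {k. k \<ge> n \<and> m (k - n) \<noteq> 0}"
  then show "k \<in> (\<lambda>k. k + n) ` {k. m k \<noteq> 0}" by (intro image_eqI[of _ _ "k - n"]) auto
 qed
 then show "finite {k. k \<ge> n \<and> m (k - n) \<noteq> 0}" using assms finite_subset by blast
qed

lemma sub_SS: "cv.subspace SS"
 unfolding cv.subspace_def
proof (intro conjI ballI allI)
 show "0 \<in> SS" by (auto simp: SS_def S0clo zero_fun_def)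
 fix x y assume xy: "x \<in> SS" "y \<in> SS"
 have "{k. (x + y) k \<noteq> 0} \<subseteq> {k. x k \<noteq> 0} \<union> {k. y k \<noteq> 0}" by auto
 then show "x + y \<in> SS" using xy by (auto simp: SS_def intro: S0clo finite_subset)
next
 fix c x assume x: "x \<in> SS"
 have "{k. (c *s x) k \<noteq> 0} \<subseteq> {k. x k \<noteq> 0}" by (auto simp: cscale_fun_apply)
 then show "c *s x \<in> SS" using x by (auto simp: SS_def cscale_fun_apply intro: S0clo finite_subset)
qed

lemma SS_clo:
 assumes "m \<in> SS"
 shows "YY m \<in> SS" "XX m \<in> SS" "KK m \<in> SS" "KKi m \<in> SS" "EE m \<in> SS" "FF m \<in> SS"
proof -
 have fin: "finite {k. m k \<noteq> 0}" and mS: "\<And>k. m k \<in> S0" using assms by (auto simp: SS_def)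
 note fins = fin shift_finite(1)[OF fin] shift_finite(2)[OF fin]
 have memb: "u \<in> SS" if "{k. u k \<noteq> 0} \<subseteq> A" "finite A" "\<And>k. u k \<in> S0" for u A
  using that finite_subset by (auto simp: SS_def)
 show "YY m \<in> SS"
  by (rule memb[OF _ shift_finite(2)[OF fin, of 1]]) (auto simp: YY_def mS S0clo split: nat.splits)
 show "XX m \<in> SS"
  by (rule memb[OF _ shift_finite(1)[OF fin, of 1]]) (auto simp: XX_def intro: S0clo mS)
 show "KK m \<in> SS" by (rule memb[OF _ fin]) (auto simp: KK_def lins0 intro: S0clo clo0 mS)
 show "KKi m \<in> SS" by (rule memb[OF _ fin]) (auto simp: KKi_def lins0 intro: S0clo clo0 mS)
 show "EE m \<in> SS"
  by (rule memb[of _ "{k. m k \<noteq> 0} \<union> {k. m (k + 2) \<noteq> 0}"])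
   (use fin shift_finite(1)[OF fin, of 2] in \<open>auto simp: EE_def lins0 numeral_2_eq_2 simp del: eps.simps intro!: S0clo clo0 mS\<close>)
 show "FF m \<in> SS"
 proof (rule memb[of _ "{k. m k \<noteq> 0} \<union> {k. k \<ge> 2 \<and> m (k - 2) \<noteq> 0}"])
  show "{k. FF m k \<noteq> 0} \<subseteq> {k. m k \<noteq> 0} \<union> {k. k \<ge> 2 \<and> m (k - 2) \<noteq> 0}"
  proof
   fix k assume k: "k \<in> {k. FF m k \<noteq> 0}"
   consider "k = 0" | "k = Suc 0" | i where "k = Suc (Suc i)" by (metis not0_implies_Suc)
   then show "k \<in> {k. m k \<noteq> 0} \<union> {k. k \<ge> 2 \<and> m (k - 2) \<noteq> 0}"
    by cases (use k in \<open>auto simp: FF_def lins0\<close>)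
  qed
  show "FF m k \<in> S0" for k
   by (auto simp: FF_def split: nat.splits intro!: S0clo clo0 mS)
 qed (use fin shift_finite(2)[OF fin, of 2] in simp)
qed

lemma to_qs: "qs q z SS EE FF KK KKi XX YY"
proof (intro qs.intro qs_axioms.intro qparam_axioms sub_SS SS_clo)
 show "clinear EE" "clinear FF" "clinear KK" "clinear KKi" "clinear XX" "clinear YY"
  by (rule clinearI; auto simp: fun_eq_iff EE_def FF_def KK_def KKi_def XX_def YY_def cscale_fun_apply lins0 vs
    algebra_simps split: nat.split)+
 fix m assume "m \<in> SS"
 then have mS: "\<And>k. m k \<in> S0" by (auto simp: SS_def)
 show "KK (KKi m) = m" "KKi (KK m) = m"
  using q0 by (simp_all add: fun_eq_iff KK_def KKi_def lins0 hhi)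
 show "EE (FF m) = FF (EE m) + (1 / (q - 1 / q)) *s (KK m - KKi m)"
 proof
  fix k
  \<comment> \<open>Total coefficient of \<open>hi (m k)\<close>: contributions from
    \<open>ef\<close> and from the shift of \<open>eps\<close> combine to the coefficient that
    \<open>KKi\<close> requires.\<close>
  have c: "1 / q ^ k * (kap * z) - 1 / q ^ k * (1 / (q - 1 / q)) + kap * (eps (Suc (Suc k)) - eps k)
    = - (q ^ k) / (q - 1 / q)"
   unfolding eps_diff by (simp add: diff_divide_distrib)
  have 1: "(1 / q ^ k) *s e (f (m k)) + (kap * (eps (Suc (Suc k)) - eps k)) *s hi (m k)
    = (1 / q ^ k) *s f (e (m k)) + (1 / (q - 1 / q)) *s (KK m k - KKi m k)"
  proof -
   have "(1 / q ^ k) *s e (f (m k)) + (kap * (eps (Suc (Suc k)) - eps k)) *s hi (m k)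
     = (1 / q ^ k) *s f (e (m k)) + (1 / q ^ k * (1 / (q - 1 / q))) *s h (m k)
     + (1 / q ^ k * (kap * z) - 1 / q ^ k * (1 / (q - 1 / q)) + kap * (eps (Suc (Suc k)) - eps k)) *s hi (m k)"
    unfolding ef[OF mS] by (simp only: cv.scale_right_distrib cv.scale_right_diff_distrib
      cv.scale_left_distrib cv.scale_left_diff_distrib cv.scale_scale) simp
   then show ?thesis unfolding c by (simp add: KK_def KKi_def vs mult.commute)
  qed
  \<comment> \<open>The term in which the \<open>Y Y\<close> part of \<open>F\<close> and the
    degree-preserving part of \<open>E\<close> meet. It occurs in both products, as
    \<open>hi\<close> and \<open>e\<close> commute up to \<open>q ^ 2\<close>, and cancels.\<close>
  define A where "A = (case k of 0 \<Rightarrow> 0 | Suc j \<Rightarrow> (case j of 0 \<Rightarrow> 0 | Suc i \<Rightarrow> (1 / q ^ k * kap) *s e (hi (m i))))"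
  have "EE (FF m) k = (1 / q ^ k) *s e (f (m k)) + A
    + (eps (Suc (Suc k)) *s f (m (Suc (Suc k))) + (eps (Suc (Suc k)) * kap) *s hi (m k))"
   by (simp add: EE_def FF_def A_def lins0 vs del: eps.simps split: nat.split)
  moreover have "FF (EE m) k = (1 / q ^ k) *s f (e (m k)) + A
    + (eps (Suc (Suc k)) *s f (m (Suc (Suc k))) + (eps k * kap) *s hi (m k))"
  proof (cases k)
   case (Suc j)
   show ?thesis
   proof (cases j)
    case (Suc i)
    have "kap *s (1 / q ^ i) *s hi (e (m i)) = (1 / q ^ Suc (Suc i) * kap) *s e (hi (m i))"
     using q0 by (simp add: hie power2_eq_square)
    then show ?thesis using \<open>k = Suc j\<close> Suc
     by (simp add: EE_def FF_def A_def lins0 cv.scale_right_distrib mult.commute del: eps.simps cv.scale_scale)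
      (simp del: eps.simps add: mult.commute)
   qed (simp add: \<open>k = Suc j\<close> EE_def FF_def A_def lins0 vs)
  qed (simp add: EE_def FF_def A_def lins0 vs)
  ultimately have "EE (FF m) k - FF (EE m) k
   = ((1 / q ^ k) *s e (f (m k)) + (kap * (eps (Suc (Suc k)) - eps k)) *s hi (m k))
     - (1 / q ^ k) *s f (e (m k))"
   by (simp add: vs right_diff_distrib mult.commute del: eps.simps)
  then show "EE (FF m) k = (FF (EE m) + (1 / (q - 1 / q)) *s (KK m - KKi m)) k"
   unfolding 1 by (simp add: cscale_fun_apply algebra_simps)
 qed
 show "KK (EE m) = (q ^ 2) *s EE (KK m)"
  using q0 by (simp add: fun_eq_iff KK_def EE_def cscale_fun_apply lins0 vs he power2_eq_square field_simps del: eps.simps)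
 show "KK (FF m) = (1 / q ^ 2) *s FF (KK m)"
  using q0 by (simp add: fun_eq_iff KK_def FF_def cscale_fun_apply lins0 vs hf hhi power2_eq_square field_simps split: nat.split)
 show "KK (XX m) = q *s XX (KK m)"
  using q0 by (simp add: fun_eq_iff KK_def XX_def cscale_fun_apply lins0 vs field_simps)
 show "KK (YY m) = (1 / q) *s YY (KK m)"
  using q0 by (simp add: fun_eq_iff KK_def YY_def cscale_fun_apply lins0 field_simps split: nat.split)
 show "XX (YY m) = q *s YY (XX m) - z *s m"
  by (simp add: fun_eq_iff XX_def YY_def cscale_fun_apply qi_Suc vs algebra_simps split: nat.split)
 show "EE (XX m) = q *s XX (EE m)"
 proof
  fix k
  have "eps (Suc (Suc k)) * (- z * qi (Suc (Suc (Suc k)))) = q * (- z * qi (Suc k)) * eps (Suc (Suc (Suc k)))"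
   using arg_cong[OF eps_ratio[of k], of "\<lambda>x. - z * x"] by (simp del: eps.simps add: mult_ac)
  then show "EE (XX m) k = (q *s XX (EE m)) k"
   using q0 by (simp add: EE_def XX_def cscale_fun_apply lins0 vs mult_ac del: eps.simps)
 qed
 show "EE (YY m) = XX m + (1 / q) *s YY (EE m)"
  using q0 by (simp add: fun_eq_iff EE_def YY_def XX_def cscale_fun_apply lins0 vs qi_1 diff_divide_distrib split: nat.split)
 show "FF (XX m) = YY (KKi m) + XX (FF m)"
 proof
  fix k
  have kz: "kap * z * (1 + q) = 1" using z0 q1p by (simp add: kap_def)
  have 1: "kap * (- z * qi k) = q ^ k + (- z * qi (Suc (Suc k))) * kap" for k
  proof -
   have "(- z * qi (Suc (Suc k))) * kap = kap * (- z * qi k) - (kap * z * (1 + q)) * q ^ k"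
    by (simp add: qi_SS algebra_simps)
   then show ?thesis unfolding kz by simp
  qed
  show "FF (XX m) k = (YY (KKi m) + XX (FF m)) k"
  proof (cases k)
   case (Suc j)
   have "(kap * (- z * qi j)) *s hi (m j) = (q ^ j) *s hi (m j) + ((- z * qi (Suc (Suc j))) * kap) *s hi (m j)"
    unfolding 1[of j] by (rule cv.scale_left_distrib)
   then show ?thesis using Suc
    by (cases j) (simp_all add: FF_def XX_def YY_def KKi_def lins0 cv.scale_right_distrib algebra_simps)
  qed (simp add: FF_def XX_def YY_def lins0)
 qed
 show "FF (YY m) = YY (FF m)"
  by (simp add: fun_eq_iff FF_def YY_def lins0 split: nat.split)
qed

end

text \<open>A representation of the quiver, \<open>C1\<close> to be placed at weight
  \<open>l1\<close> and \<open>C2\<close> at weight \<open>l0\<close>. For \<open>N = 0\<close>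
  these weights coincide and only \<open>C1\<close> is kept.\<close>

locale quiv = qsp q z s N for q z s :: complex and N +
 fixes C1 C2 :: "'b::cvec set" and a b :: "'b \<Rightarrow> 'b" and B1 B2 :: "'b set"
 assumes C: "cv.subspace C1" "cv.subspace C2"
  and linab: "clinear a" "clinear b"
  and aC: "\<And>v. v \<in> C1 \<Longrightarrow> a v \<in> C2" and bC: "\<And>v. v \<in> C2 \<Longrightarrow> b v \<in> C1"
  and ab: "\<And>v. v \<in> C2 \<Longrightarrow> a (b v) = 0" and N0: "N = 0 \<Longrightarrow> C2 = {0}"
  and B1: "finite B1" "B1 \<subseteq> C1" "C1 \<subseteq> cv.span B1"
  and B2: "finite B2" "B2 \<subseteq> C2" "C2 \<subseteq> cv.span B2"
begin

text \<open>Position \<open>i\<close> of the chain has weight \<open>l0 / q ^ (2 * i)\<close>. From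
  \<open>l0\<close> down to just above \<open>l1\<close> it carries a copy of \<open>C2\<close>,
  from \<open>l1\<close> on a copy of \<open>C1\<close>.\<close>

definition CC :: "nat \<Rightarrow> 'b set" where "CC i = (if i < N then C2 else C1)"
definition S0 :: "(nat \<Rightarrow> 'b) set" where "S0 = {u. finite {i. u i \<noteq> 0} \<and> (\<forall>i. u i \<in> CC i)}"
definition gm :: "nat \<Rightarrow> complex" where "gm j = th l0 - th (l0 / q ^ (2 * j))"
definition a' :: "'b \<Rightarrow> 'b" where "a' v = (1 / gam) *s a v"
definition st :: "nat \<Rightarrow> 'b \<Rightarrow> 'b" where "st j v = (if Suc j = N then b v else v)"
text \<open>\<open>E\<close> from position \<open>Suc i\<close> to \<open>i\<close>, where
  \<open>st i\<close> is \<open>F'\<close> in the other direction. The values are forced by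
  \<open>E_F'k\<close> and \<open>E_l1\<close>: on \<open>C1\<close> the operator \<open>E\<close>
  first yields \<open>a' v\<close> just above \<open>l1\<close>, and \<open>F'\<close> carries this
  across \<open>l1\<close> as \<open>b (a' v)\<close>.\<close>

definition et :: "nat \<Rightarrow> 'b \<Rightarrow> 'b" where
 "et i v = (if Suc i < N then gm (Suc i) *s v else if Suc i = N then a' v
   else gm (Suc i) *s v + b (a' v))"
definition f0 :: "(nat \<Rightarrow> 'b) \<Rightarrow> nat \<Rightarrow> 'b" where
 "f0 u i = (case i of 0 \<Rightarrow> 0 | Suc j \<Rightarrow> st j (u j))"
definition e0 :: "(nat \<Rightarrow> 'b) \<Rightarrow> nat \<Rightarrow> 'b" where "e0 u i = et i (u (Suc i))"
definition h0 :: "(nat \<Rightarrow> 'b) \<Rightarrow> nat \<Rightarrow> 'b" where "h0 u i = (l0 / q ^ (2 * i)) *s u i"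
definition hi0 :: "(nat \<Rightarrow> 'b) \<Rightarrow> nat \<Rightarrow> 'b" where "hi0 u i = (q ^ (2 * i) / l0) *s u i"

lemma lina': "clinear a'" unfolding a'_def using linab by (intro clinear_combine)

lemma linst: "clinear (st j)" and linet: "clinear (et j)"
 by (rule clinearI; simp add: st_def et_def vs clin[OF lina'] clin[OF linab(2)] algebra_simps)+

lemmas linsab = clin[OF lina'] clin[OF linab(1)] clin[OF linab(2)] clin[OF linst] clin[OF linet]

lemma sub_CC: "cv.subspace (CC i)" using C by (simp add: CC_def)

lemma CCclo: "0 \<in> CC i" "x \<in> CC i \<Longrightarrow> y \<in> CC i \<Longrightarrow> x + y \<in> CC i" "x \<in> CC i \<Longrightarrow> c *s x \<in> CC i"
 using sub_CC by (auto simp: cv.subspace_0 cv.subspace_add cv.subspace_scale)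

lemma a'C: "v \<in> C1 \<Longrightarrow> a' v \<in> C2" using aC C(2) by (simp add: a'_def cv.subspace_scale)

lemma a'b: "v \<in> C2 \<Longrightarrow> a' (b v) = 0" by (simp add: a'_def ab)

lemma gm_0: "gm 0 = 0" by (simp add: gm_def)
lemma gm_N: "gm N = 0" using th_l0[OF l1_nz] by (simp add: gm_def l1_l0)

lemma S0_memb: "{i. u i \<noteq> 0} \<subseteq> A \<Longrightarrow> finite A \<Longrightarrow> (\<And>i. u i \<in> CC i) \<Longrightarrow> u \<in> S0"
 using finite_subset by (auto simp: S0_def)

lemma sub_S0: "cv.subspace S0"
 unfolding cv.subspace_def
proof (intro conjI ballI allI)
 show "0 \<in> S0" by (auto simp: S0_def CCclo zero_fun_def)
 fix x y assume xy: "x \<in> S0" "y \<in> S0"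
 show "x + y \<in> S0"
  by (rule S0_memb[of _ "{k. x k \<noteq> 0} \<union> {k. y k \<noteq> 0}"]) (use xy in \<open>auto simp: S0_def CCclo\<close>)
next
 fix c x assume x: "x \<in> S0"
 show "c *s x \<in> S0"
  by (rule S0_memb[of _ "{k. x k \<noteq> 0}"]) (use x in \<open>auto simp: S0_def cscale_fun_apply CCclo\<close>)
qed

lemma gm_diff: "gm (Suc i) - gm i = th (l0 / q ^ (2 * i)) - th (l0 / q ^ (2 * i) / q ^ 2)"
 by (simp add: gm_def power2_eq_square mult_ac)

lemma wm0: "wm q z S0 e0 f0 h0 hi0"
proof (intro wm.intro wm_axioms.intro qparam_axioms sub_S0)
 show "clinear e0" "clinear f0" "clinear h0" "clinear hi0"
  by (rule clinearI; auto simp: fun_eq_iff e0_def f0_def h0_def hi0_def cscale_fun_apply linsab vs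
    algebra_simps split: nat.split)+
 show hh: "h0 (hi0 m) = m" "hi0 (h0 m) = m" for m
  using q0 l0_nz by (simp_all add: fun_eq_iff h0_def hi0_def)
 show "h0 (e0 m) = (q ^ 2) *s e0 (h0 m)" for m
  using q0 by (auto simp: fun_eq_iff h0_def e0_def cscale_fun_apply linsab vs power2_eq_square field_simps)
 show "h0 (f0 m) = (1 / q ^ 2) *s f0 (h0 m)" for m
  using q0 by (auto simp: fun_eq_iff h0_def f0_def cscale_fun_apply linsab power2_eq_square field_simps split: nat.split)
 fix m assume "m \<in> S0"
 then have fin: "finite {i. m i \<noteq> 0}" and mC: "\<And>i. m i \<in> CC i" by (auto simp: S0_def)
 have m1: "m i \<in> C1" if "i \<ge> N" for i using mC[of i] that by (simp add: CC_def)
 have m2: "m i \<in> C2" if "i < N" for i using mC[of i] that by (simp add: CC_def)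
 show "h0 m \<in> S0" "hi0 m \<in> S0"
  by (rule S0_memb[OF _ fin]; auto simp: h0_def hi0_def mC CCclo)+
 show "f0 m \<in> S0"
 proof (rule S0_memb[of _ "Suc ` {i. m i \<noteq> 0}"])
  show "{i. f0 m i \<noteq> 0} \<subseteq> Suc ` {i. m i \<noteq> 0}"
  proof
   fix i assume i: "i \<in> {i. f0 m i \<noteq> 0}"
   then obtain j where j: "i = Suc j" "st j (m j) \<noteq> 0" by (cases i) (auto simp: f0_def)
   then have "m j \<noteq> 0" using clinear_0[OF linst, of j] by auto
   with j show "i \<in> Suc ` {i. m i \<noteq> 0}" by simp
  qed
  show "f0 m i \<in> CC i" for i
  proof (cases i)
   case (Suc j)
   then show ?thesis using m1[of j] m2[of j] bC by (simp add: f0_def st_def CC_def)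
  qed (simp add: f0_def CCclo)
 qed (use fin in simp)
 show "e0 m \<in> S0"
 proof (rule S0_memb[of _ "(\<lambda>i. i - 1) ` {i. m i \<noteq> 0}"])
  show "{i. e0 m i \<noteq> 0} \<subseteq> (\<lambda>i. i - 1) ` {i. m i \<noteq> 0}"
  proof
   fix i assume "i \<in> {i. e0 m i \<noteq> 0}"
   then have "m (Suc i) \<noteq> 0" by (auto simp: e0_def linsab)
   then show "i \<in> (\<lambda>i. i - 1) ` {i. m i \<noteq> 0}" by (intro image_eqI[of _ _ "Suc i"]) auto
  qed
  show "e0 m i \<in> CC i" for i
   using m1[of "Suc i"] m2[of "Suc i"] bC a'C C
   by (simp add: e0_def et_def CC_def cv.subspace_add cv.subspace_scale)
 qed (use fin in simp)
 show "e0 (f0 m) = f0 (e0 m) + (1 / (q - 1 / q)) *s (h0 m - hi0 m) + (kap * z) *s hi0 m"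
 proof
  fix i
  let ?l = "l0 / q ^ (2 * i)"
  have l: "?l \<noteq> 0" using l0_nz q0 by simp
  have "(f0 (e0 m) + (1 / (q - 1 / q)) *s (h0 m - hi0 m) + (kap * z) *s hi0 m) i
    = f0 (e0 m) i + ((?l - 1 / ?l) / (q - 1 / q) + kap * z / ?l) *s m i"
   by (simp add: h0_def hi0_def cscale_fun_apply vs diff_divide_distrib mult.commute)
  also have "\<dots> = f0 (e0 m) i + (gm (Suc i) - gm i) *s m i"
   unfolding th_step[OF l] gm_diff ..
  also have "\<dots> = e0 (f0 m) i"
  proof -
   \<comment> \<open>Away from \<open>l1\<close> the relation is the telescoping of
     \<open>gm\<close>. At \<open>Suc i = N\<close> it expresses that \<open>a\<close> after
     \<open>b\<close> is zero and that \<open>gm N = 0\<close>; at \<open>i = N\<close> the term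
     \<open>b (a' v)\<close> arises on both sides, or vanishes because \<open>C2 = {0}\<close> when
     \<open>N = 0\<close>.\<close>
   consider "Suc i < N" | "Suc i = N" | "i = N" | "i > N" by linarith
   then show ?thesis
   proof cases
    case 1
    then show ?thesis by (cases i) (simp_all add: e0_def f0_def st_def et_def gm_0 vs)
   next
    case 2
    then have "a' (b (m i)) = 0" using m2 a'b by simp
    moreover have "f0 m (Suc i) = st i (m i)" by (simp add: f0_def)
    then have "f0 m (Suc i) = b (m i)" using 2 by (simp only: st_def) simp
    ultimately have "e0 (f0 m) i = 0" using 2 by (simp add: e0_def et_def)
    then show ?thesis unfolding \<open>e0 (f0 m) i = 0\<close> using 2 gm_N by (cases i) (simp_all add: e0_def f0_def st_def et_def gm_0 vs)
   next
    case 3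
    show ?thesis
    proof (cases i)
     case 0
     then have "0 \<ge> N" "C2 = {0}" using 3 N0 by auto
     then have "a' (m 0) = 0" using a'C[OF m1[of 0]] by auto
     moreover have "\<not> Suc 0 < N" "Suc 0 \<noteq> N" using \<open>0 \<ge> N\<close> by auto
     ultimately show ?thesis unfolding 0 by (simp add: e0_def f0_def st_def et_def gm_0 clin[OF linab(2)])
    next
     case (Suc j)
     then have n: "Suc j = N" using 3 by simp
     have "st j v = b v" "et j v = a' v" for v by (simp_all add: st_def et_def n)
     moreover have "st (Suc j) v = v" "et (Suc j) v = gm (Suc (Suc j)) *s v + b (a' v)" for v
      using n by (auto simp: st_def et_def)
     moreover have "gm (Suc j) = 0" unfolding n by (rule gm_N)
     ultimately show ?thesis unfolding Suc by (simp add: e0_def f0_def)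
    qed
   next
    case 4
    then show ?thesis by (cases i) (simp_all add: e0_def f0_def st_def et_def gm_0 vs)
   qed
  qed
  finally show "e0 (f0 m) i = (f0 (e0 m) + (1 / (q - 1 / q)) *s (h0 m - hi0 m) + (kap * z) *s hi0 m) i" ..
 qed
qed

sublocale wm q z S0 e0 f0 h0 hi0 by (rule wm0)

sublocale M: qs q z SS EE FF KK KKi XX YY by (rule to_qs)

text \<open>The vector \<open>Y ^^ k\<close> applied to \<open>v\<close> at position
  \<open>i\<close> of the chain.\<close>

definition un :: "nat \<Rightarrow> nat \<Rightarrow> 'b \<Rightarrow> nat \<Rightarrow> nat \<Rightarrow> 'b" where
 "un k i v = (\<lambda>k' i'. if k' = k \<and> i' = i then v else 0)"

lemma lin_un: "clinear (un k i)"
 by (rule clinearI) (auto simp: un_def fun_eq_iff cscale_fun_apply)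

lemma un_SS: assumes "v \<in> CC i" shows "un k i v \<in> SS"
proof -
 have "{k'. un k i v k' \<noteq> 0} \<subseteq> {k}" by (auto simp: un_def fun_eq_iff)
 moreover have "un k i v k' \<in> S0" for k'
  by (rule S0_memb[of _ "{i}"]) (use assms in \<open>auto simp: un_def CCclo\<close>)
 ultimately show ?thesis using finite_subset by (auto simp: SS_def)
qed

lemma SS_D:
 assumes "m \<in> SS" shows "finite {k. m k \<noteq> 0}" "finite {i. m k i \<noteq> 0}" "m k i \<in> CC i"
proof -
 have "m k \<in> S0" and fin: "finite {k. m k \<noteq> 0}" using assms unfolding SS_def by auto
 then show "finite {i. m k i \<noteq> 0}" "m k i \<in> CC i" unfolding S0_def by auto
 show "finite {k. m k \<noteq> 0}" by (rule fin)
qed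

lemma Y_un: "YY (un k i v) = un (Suc k) i v"
 by (auto simp: fun_eq_iff YY_def un_def split: nat.split)

lemma Yk_un: "(YY ^^ k) (un 0 i v) = un k i v"
 by (induct k) (simp_all add: Y_un)

lemma F'_un: "M.F' (un 0 i v) = un 0 (Suc i) (st i v)"
proof -
 have "FF (un 0 i v) = un 0 (Suc i) (st i v) + kap *s YY (YY (KKi (un 0 i v)))"
  by (auto simp: fun_eq_iff FF_def un_def YY_def KKi_def f0_def hi0_def linsab cscale_fun_apply split: nat.split)
 then show ?thesis by (simp add: M.F'_def)
qed

lemma F'k_un2: "i < N \<Longrightarrow> (M.F' ^^ i) (un 0 0 v) = un 0 i v"
 by (induct i) (simp_all add: F'_un st_def)

lemma F'N_un2: assumes "N > 0" shows "(M.F' ^^ N) (un 0 0 v) = un 0 N (b v)"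
proof -
 obtain n where n: "Suc n = N" using assms gr0_implies_Suc by metis
 then have "(M.F' ^^ n) (un 0 0 v) = un 0 n v" by (intro F'k_un2) simp
 then have "(M.F' ^^ Suc n) (un 0 0 v) = un 0 (Suc n) (st n v)"
  by (simp only: funpow.simps comp_apply F'_un)
 then show ?thesis unfolding n by (simp add: st_def n)
qed

lemma F'k_un1: "(M.F' ^^ i) (un 0 N v) = un 0 (N + i) v"
 by (induct i) (simp_all add: F'_un st_def)

lemma un_ww: assumes "v \<in> CC i" shows "un 0 i v \<in> M.ww (l0 / q ^ (2 * i))"
proof -
 have "XX (un 0 i v) = 0" by (simp add: fun_eq_iff XX_def un_def cscale_fun_apply)
 moreover have "KK (un 0 i v) = (l0 / q ^ (2 * i)) *s un 0 i v"
  by (auto simp: fun_eq_iff KK_def un_def h0_def cscale_fun_apply)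
 ultimately show ?thesis using un_SS[OF assms] by (simp add: M.ww_def)
qed

text \<open>\<open>XX\<close> has nonzero coefficients, so its kernel lives in degree zero in
  \<open>Y\<close>; there the positions have distinct weights.\<close>

lemma ww_un: assumes "m \<in> M.ww (l0 / q ^ (2 * i))" shows "\<exists>v\<in>CC i. m = un 0 i v"
proof
 note m = M.wwD[OF assms]
 have mC: "m k j \<in> CC j" for k j using SS_D(3)[OF m(1)] .
 then show "m 0 i \<in> CC i" .
 have 1: "m (Suc k) = 0" for k
 proof -
  have "(- z * qi (Suc k)) *s m (Suc k) = 0" using fun_cong[OF m(2), of k] by (simp add: XX_def)
  then show ?thesis using z0 qi_nz[of "Suc k"] by simp
 qed
 have 2: "m 0 j = 0" if "j \<noteq> i" for j
 proof -
  have "(l0 / q ^ (2 * j)) *s m 0 j = (l0 / q ^ (2 * i)) *s m 0 j"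
   using fun_cong[OF fun_cong[OF m(3), of 0], of j] by (simp add: KK_def h0_def cscale_fun_apply)
  then show ?thesis using l0_div[of "2 * j" "2 * i"] that by simp
 qed
 show "m = un 0 i (m 0 i)"
 proof (intro ext)
  fix k j show "m k j = un 0 i (m 0 i) k j"
   using 1 2 by (cases k) (auto simp: un_def)
 qed
qed

lemma E_un: "EE (un 0 i v) k j = (if k = 0 \<and> Suc j = i then et j v else 0)"
 by (simp add: EE_def un_def e0_def linsab cscale_fun_apply del: eps.simps)

lemma E_un2: "EE (un 0 0 v) = 0"
 by (simp add: fun_eq_iff E_un)

lemma E_un1_0: assumes "N = 0" shows "EE (un 0 N v) = 0"
 using E_un2 unfolding assms .

lemma E_un1: assumes "N > 0" shows "EE (un 0 N v) = (M.F' ^^ (N - 1)) (un 0 0 (a' v))"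
proof -
 have "EE (un 0 N v) = un 0 (N - 1) (a' v)"
 proof (intro ext)
  fix k j
  have "Suc j = N \<longleftrightarrow> j = N - 1" using assms by auto
  then show "EE (un 0 N v) k j = un 0 (N - 1) (a' v) k j"
   unfolding E_un using assms by (simp add: un_def et_def)
 qed
 then show ?thesis using F'k_un2[of "N - 1"] assms by simp
qed

definition BB :: "(nat \<Rightarrow> nat \<Rightarrow> 'b) set" where
 "BB = un 0 N ` B1 \<union> (if N = 0 then {} else un 0 0 ` B2)"

lemma un_fam: assumes "v \<in> CC i" shows "un k i v \<in> cv.span (M.fam BB)"
proof (cases "i < N")
 case True
 then have v: "v \<in> cv.span B2" using assms B2 by (auto simp: CC_def)
 show ?thesis
 proof (rule span_image_subset[OF lin_un cv.subspace_span _ v])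
  fix v assume "v \<in> B2"
  then have "un 0 0 v \<in> BB" using True by (simp add: BB_def)
  then have "(YY ^^ k) ((M.F' ^^ i) (un 0 0 v)) \<in> M.fam BB" by (rule M.famI)
  then show "un k i v \<in> cv.span (M.fam BB)" using True by (simp add: F'k_un2 Yk_un cv.span_base)
 qed
next
 case False
 then have v: "v \<in> cv.span B1" using assms B1 by (auto simp: CC_def)
 show ?thesis
 proof (rule span_image_subset[OF lin_un cv.subspace_span _ v])
  fix v assume "v \<in> B1"
  then have "un 0 N v \<in> BB" by (simp add: BB_def)
  then have "(YY ^^ k) ((M.F' ^^ (i - N)) (un 0 N v)) \<in> M.fam BB" by (rule M.famI)
  then show "un k i v \<in> cv.span (M.fam BB)" using False by (simp add: F'k_un1 Yk_un cv.span_base)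
 qed
qed

lemma SS_fam: "SS \<subseteq> cv.span (M.fam BB)"
proof
 fix m assume m: "m \<in> SS"
 note fin = SS_D(1,2)[OF m] and mC = SS_D(3)[OF m]
 have "m = (\<Sum>k\<in>{k. m k \<noteq> 0}. \<Sum>i\<in>{i. m k i \<noteq> 0}. un k i (m k i))"
 proof (intro ext)
  fix k' i'
  have ap: "(sum g A) x = (\<Sum>k\<in>A. g k x)" for g :: "nat \<Rightarrow> 'x \<Rightarrow> 'y::comm_monoid_add" and A x
   by (induct A rule: infinite_finite_induct) auto
  have "(\<Sum>k\<in>{k. m k \<noteq> 0}. \<Sum>i\<in>{i. m k i \<noteq> 0}. un k i (m k i)) k' i'
    = (\<Sum>k\<in>{k. m k \<noteq> 0}. \<Sum>i\<in>{i. m k i \<noteq> 0}. un k i (m k i) k' i')"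
   by (simp add: ap)
  also have "\<dots> = (\<Sum>k\<in>{k. m k \<noteq> 0}. if k = k' then (\<Sum>i\<in>{i. m k i \<noteq> 0}. if i = i' then m k i else 0) else 0)"
   by (intro sum.cong refl) (auto simp: un_def intro!: sum.cong sum.neutral)
  also have "\<dots> = m k' i'"
   using fin by (simp add: sum.delta)
  finally show "m k' i' = (\<Sum>k\<in>{k. m k \<noteq> 0}. \<Sum>i\<in>{i. m k i \<noteq> 0}. un k i (m k i)) k' i'" ..
 qed
 also have "\<dots> \<in> cv.span (M.fam BB)"
  by (intro cv.span_sum un_fam mC)
 finally show "m \<in> cv.span (M.fam BB)" .
qed

lemma BB_l0: "N > 0 \<Longrightarrow> v \<in> C2 \<Longrightarrow> un 0 0 v \<in> M.ww l0"
 using un_ww[of v 0] by (simp add: CC_def)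

lemma BB_l1: "v \<in> C1 \<Longrightarrow> un 0 N v \<in> M.ww l1"
 using un_ww[of v N] by (simp add: CC_def l1_l0)

sublocale M: qsh q z SS EE FF KK KKi XX YY s N BB
proof (intro qsh.intro qsh_axioms.intro M.qs_axioms qsp_axioms SS_fam)
 show "finite BB" using B1 B2 by (simp add: BB_def)
 fix x assume x: "x \<in> BB"
 show "x \<in> M.ww l0 \<and> EE x = 0 \<or> x \<in> M.ww l1 \<and> (EE x = 0 \<or>
   (\<exists>u\<in>cv.span {b \<in> BB. b \<in> M.ww l0 \<and> EE b = 0}. N > 0 \<and> EE x = (M.F' ^^ (N - 1)) u))"
 proof (cases "\<exists>v\<in>B1. x = un 0 N v")
  case True
  then obtain v where v: "v \<in> C1" "x = un 0 N v" using B1 by blast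
  have "EE x = 0 \<or> (\<exists>u\<in>cv.span {b \<in> BB. b \<in> M.ww l0 \<and> EE b = 0}. N > 0 \<and> EE x = (M.F' ^^ (N - 1)) u)"
  proof (cases "N = 0")
   case False
   have "a' v \<in> cv.span B2" using a'C v B2 by blast
   then have "un 0 0 (a' v) \<in> cv.span {b \<in> BB. b \<in> M.ww l0 \<and> EE b = 0}"
   proof (rule span_image_subset[OF lin_un cv.subspace_span, rotated])
    fix v assume "v \<in> B2"
    then show "un 0 0 v \<in> cv.span {b \<in> BB. b \<in> M.ww l0 \<and> EE b = 0}"
     using False B2 BB_l0 by (intro cv.span_base) (auto simp: BB_def E_un2)
   qed
   then show ?thesis using E_un1 v False by blast
  qed (use v E_un1_0 in simp)
  then show ?thesis using v BB_l1 by blast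
 next
  case False
  then have N: "N > 0" and "x \<in> un 0 0 ` B2" using x by (auto simp: BB_def split: if_splits)
  then obtain v where "v \<in> C2" "x = un 0 0 v" using B2 by blast
  then show ?thesis using E_un2 BB_l0 N by auto
 qed
qed

sublocale M: qsb q z SS EE FF KK KKi XX YY s N by (rule M.to_qsb)

text \<open>The factor \<open>gam\<close> from climbing \<open>N - 1\<close> steps cancels the
  factor \<open>1 / gam\<close> in \<open>a'\<close>: this is the reason for that
  normalization.\<close>

lemma EN_un1: assumes "N > 0" "v \<in> C1" shows "(EE ^^ N) (un 0 N v) = un 0 0 (a v)"
proof -
 have "a' v \<in> C2" using a'C assms by simp
 then have u: "un 0 0 (a' v) \<in> M.ww l0" using BB_l0 assms by simp
 have "(EE ^^ N) (un 0 N v) = (EE ^^ (N - 1)) (EE (un 0 N v))"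
  using assms funpow_swap1[of EE "N - 1"] by (cases N) simp_all
 also have "\<dots> = gam *s un 0 0 (a' v)"
  unfolding E_un1[OF assms(1)] using M.Ek_F'k[OF u, of "N - 1"] assms(1) by (simp add: gam_def)
 also have "\<dots> = un 0 0 (a v)"
  using gam_nz by (simp add: a'_def clin[OF lin_un])
 finally show ?thesis .
qed

lemma ww_l0_un: "N > 0 \<Longrightarrow> M.ww l0 = un 0 0 ` C2"
 using ww_un[of _ 0] BB_l0 by (auto simp: CC_def)

lemma ww_l1_un: "M.ww l1 = un 0 N ` C1"
 using ww_un[of _ N] BB_l1 by (auto simp: CC_def l1_l0)

lemma un_inj: "un k i v = un k i w \<Longrightarrow> v = w"
proof -
 assume "un k i v = un k i w"
 then have "un k i v k i = un k i w k i" by simp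
 then show ?thesis by (simp add: un_def)
qed

end

section \<open>The algebra and its modules\<close>

lemma univ_ring_simps [simp]:
 "carrier univ_ring = UNIV" "x \<otimes>\<^bsub>univ_ring\<^esub> y = x * y" "\<one>\<^bsub>univ_ring\<^esub> = 1" "\<zero>\<^bsub>univ_ring\<^esub> = 0"
 "x \<oplus>\<^bsub>univ_ring\<^esub> y = x + y"
 by (simp_all add: univ_ring_def)

lemma univ_ring: "ring (univ_ring :: 'a::ring_1 ring)"
proof (rule ringI)
 show "abelian_group (univ_ring :: 'a ring)"
 proof (rule abelian_groupI)
  show "\<exists>y\<in>carrier univ_ring. y \<oplus>\<^bsub>univ_ring\<^esub> x = \<zero>\<^bsub>univ_ring\<^esub>" for x :: 'a
   by (rule bexI[of _ "- x"]) auto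
 qed (auto simp: algebra_simps)
 show "monoid (univ_ring :: 'a ring)" by unfold_locales (auto simp: algebra_simps)
qed (auto simp: algebra_simps)

lemma complex_field_cring: "cring complex_field"
proof (rule cringI)
 show "abelian_group complex_field" by (rule ring.is_abelian_group[OF univ_ring])
 show "comm_monoid complex_field" by unfold_locales (auto simp: mult_ac)
qed (auto simp: algebra_simps)

lemma univ_ring_a_inv [simp]: "\<ominus>\<^bsub>univ_ring\<^esub> x = - (x::'a::ring_1)"
proof -
 interpret ring "univ_ring :: 'a ring" by (rule univ_ring)
 show ?thesis by (rule minus_equality) auto
qed

lemma relation_ideal: "ideal (relation_ideal q) univ_ring"
 unfolding relation_ideal_def by (rule ring.genideal_ideal[OF univ_ring]) simp

lemma U_ring: "ring (U q)"
 unfolding U_def by (rule ideal.quotient_is_ring[OF relation_ideal])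

lemma cls_hom: "cls q \<in> ring_hom univ_ring (U q)"
proof -
 have "(+>\<^bsub>univ_ring\<^esub>) (relation_ideal q) = cls q" by (rule ext) (simp add: cls_def)
 then show ?thesis using ideal.rcos_ring_hom[OF relation_ideal, of q] by (simp add: U_def)
qed

lemma cls_simps:
 "cls q a \<in> carrier (U q)" "cls q (a + b) = cls q a \<oplus>\<^bsub>U q\<^esub> cls q b"
 "cls q (a * b) = cls q a \<otimes>\<^bsub>U q\<^esub> cls q b" "cls q 1 = \<one>\<^bsub>U q\<^esub>"
 using ring_hom_closed[OF cls_hom, of a q] ring_hom_add[OF cls_hom, of a b q]
  ring_hom_mult[OF cls_hom, of a b q] ring_hom_one[OF cls_hom, of q] by simp_all

lemma cls_zero: "cls q 0 = \<zero>\<^bsub>U q\<^esub>"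
 using ring_hom_zero[OF cls_hom univ_ring U_ring, of q] by simp

lemma carrier_U: "carrier (U q) = range (cls q)"
 by (auto simp: U_def FactRing_def A_RCOSETS_def' cls_def)

lemma cls_eqD: assumes "cls q a = cls q b" shows "a - b \<in> relation_ideal q"
proof -
 interpret ideal "relation_ideal q" univ_ring by (rule relation_ideal)
 have "a \<in> cls q b" using a_rcos_self[of a] assms by (simp add: cls_def)
 then obtain h where "h \<in> relation_ideal q" "a = h + b" by (auto simp: cls_def a_r_coset_def')
 then show ?thesis by simp
qed

lemma cls_eqI: assumes "a - b \<in> relation_ideal q" shows "cls q a = cls q b"
proof -
 interpret ideal "relation_ideal q" univ_ring by (rule relation_ideal)
 have "a = (a - b) + b" by simp
 then have "a \<in> relation_ideal q +>\<^bsub>univ_ring\<^esub> b"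
  using assms unfolding a_r_coset_def' by (auto intro!: bexI[of _ "a - b"])
 then show ?thesis unfolding cls_def using a_repr_independence'[of a b] by simp
qed

lemma cls_relator: assumes "r \<in> relators q" shows "cls q r = \<zero>\<^bsub>U q\<^esub>"
proof -
 have "r \<in> relation_ideal q"
  unfolding relation_ideal_def using ring.genideal_self[OF univ_ring, of "relators q"] assms by auto
 then have "cls q r = cls q 0" by (intro cls_eqI) simp
 then show ?thesis by (simp add: cls_zero)
qed

subsection \<open>Operators\<close>

text \<open>With \<open>foldr\<close> the last letter of a word acts first, so that concatenation of
  words becomes composition of operators.\<close>

definition wact :: "(gen \<Rightarrow> 'a \<Rightarrow> 'a) \<Rightarrow> word \<Rightarrow> 'a \<Rightarrow> 'a" where
 "wact op w = foldr op (letters w)"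

definition act :: "(gen \<Rightarrow> 'a \<Rightarrow> 'a) \<Rightarrow> free_alg \<Rightarrow> 'a \<Rightarrow> 'a::cvec" where
 "act op a m = (\<Sum>w\<in>Poly_Mapping.keys a. poly_mapping.lookup a w *s wact op w m)"

lemma act_superset:
 "finite A \<Longrightarrow> Poly_Mapping.keys a \<subseteq> A \<Longrightarrow> act op a m = (\<Sum>w\<in>A. poly_mapping.lookup a w *s wact op w m)"
 unfolding act_def by (rule sum.mono_neutral_left) (auto simp: in_keys_iff)

lemma act_add: "act op (a + b) m = act op a m + act op b m"
proof -
 let ?A = "Poly_Mapping.keys a \<union> Poly_Mapping.keys b"
 have "Poly_Mapping.keys (a + b) \<subseteq> ?A" by (rule Poly_Mapping.keys_add)
 then show ?thesis
  by (simp add: act_superset[of ?A] lookup_add cv.scale_left_distrib sum.distrib)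
qed

lemma act_0 [simp]: "act op 0 m = 0" by (simp add: act_def)

lemma act_uminus: "act op (- a) m = - act op a m"
 using act_add[of op a "- a" m] by (simp add: eq_neg_iff_add_eq_0 add.commute)

lemma act_diff: "act op (a - b) m = act op a m - act op b m"
 using act_add[of op a "- b" m] by (simp add: act_uminus)

lemma act_single: "act op (Poly_Mapping.single w c) m = c *s wact op w m"
 by (cases "c = 0") (simp_all add: act_def)

lemma act_scalar: "act op (scalar c) m = c *s m"
 by (simp add: scalar_def act_single wact_def zero_word_def)

lemma act_letter: "act op (letter g) m = op g m"
 by (simp add: letter_def act_single wact_def)

lemma free_alg_induct [case_names zero add]:
 fixes a :: free_alg
 assumes "P 0" "\<And>w c a. P a \<Longrightarrow> P (Poly_Mapping.single w c + a)"
 shows "P a"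
proof (induct a rule: Poly_Mapping.update_induct)
 case const
 show ?case by (rule assms(1))
next
 case (update f w c)
 have "Poly_Mapping.update w c f = Poly_Mapping.single w c + f"
  using update(1) by (intro poly_mapping_eqI) (auto simp: Poly_Mapping.lookup_update lookup_add lookup_single in_keys_iff when_def)
 then show ?case using assms(2) update by simp
qed

lemma scalar_mult: "scalar c * scalar d = scalar (c * d)"
 by (simp add: scalar_def mult_single)

lemma scalar_add: "scalar (c + d) = scalar c + scalar d"
 by (simp add: scalar_def single_add)

lemma scalar_1: "scalar 1 = 1" by (simp add: scalar_def)

lemma single_word: "Poly_Mapping.single (Word gs) c = scalar c * foldr (\<lambda>g a. letter g * a) gs 1"
proof -
 have "Poly_Mapping.single (Word gs) 1 = foldr (\<lambda>g a. letter g * a) gs (1 :: free_alg)"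
 proof (induct gs)
  case Nil
  show ?case by (simp add: zero_word_def[symmetric])
 next
  case (Cons g gs)
  have "letter g * Poly_Mapping.single (Word gs) 1 = Poly_Mapping.single (Word (g # gs)) 1"
   by (simp add: letter_def mult_single plus_word_def)
  then show ?case using Cons by simp
 qed
 moreover have "Poly_Mapping.single (Word gs) c = scalar c * Poly_Mapping.single (Word gs) 1"
  by (simp add: scalar_def mult_single)
 ultimately show ?thesis by simp
qed

context
 fixes op :: "gen \<Rightarrow> 'a::cvec \<Rightarrow> 'a"
 assumes lop: "\<And>g. clinear (op g)"
begin

lemma lin_wact: "clinear (wact op w)"
 unfolding wact_def
proof (induct "letters w" arbitrary: w)
 case Nil
 then show ?case by (simp add: clinear_id id_def flip: Nil)
next
 case (Cons g gs)
 have "clinear (foldr op gs)" using Cons(1)[of "Word gs"] by simp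
 then have "clinear (\<lambda>m. op g (foldr op gs m))" by (rule clinear_comp[OF _ lop])
 then show ?case by (simp add: comp_def flip: Cons(2))
qed

lemma lin_act: "clinear (act op a)"
proof (induct a rule: free_alg_induct)
 case zero
 show ?case by (rule clinearI) simp_all
next
 case (add w c a)
 have "act op (Poly_Mapping.single w c + a) = (\<lambda>m. c *s wact op w m + act op a m)"
  by (rule ext) (simp add: act_add act_single)
 then show ?case using add lin_wact by (simp add: clinear_combine)
qed

lemma act_mult: "act op (a * b) m = act op a (act op b m)"
proof (induct a rule: free_alg_induct)
 case (add w c a)
 have "act op (Poly_Mapping.single w c * b) m = c *s wact op w (act op b m)"
 proof (induct b rule: free_alg_induct)
  case zero
  show ?case using clin[OF lin_wact, of w] by simp
 next
  case (add v d b)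
  have "wact op (w + v) m = wact op w (wact op v m)"
   by (simp add: wact_def plus_word_def)
  then show ?case using add clin[OF lin_wact, of w]
   by (simp add: distrib_left act_add mult_single act_single cv.scale_right_distrib)
 qed
 then show ?case using add by (simp add: distrib_right act_add act_single)
qed simp

lemma act_one: "act op 1 m = m"
 using act_scalar[of op 1 m] by (simp add: scalar_1)

lemma act_closed:
 assumes "cv.subspace P" "\<And>g x. x \<in> P \<Longrightarrow> op g x \<in> P" "m \<in> P"
 shows "act op a m \<in> P"
proof (induct a rule: free_alg_induct)
 case zero
 show ?case using assms by (simp add: cv.subspace_0)
next
 case (add w c a)
 have "wact op w m \<in> P"
 proof -
  have "foldr op gs m \<in> P" for gs by (induct gs) (use assms in auto)
  then show ?thesis by (simp add: wact_def)
 qed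
 then show ?case using add assms by (simp add: act_add act_single cv.subspace_add cv.subspace_scale)
qed

end

lemmas act_simps = act_add act_diff act_uminus act_scalar act_letter

text \<open>The carrier of a module is a set in an arbitrary type.  Computations take place in a copy
 of the module inside a vector space type, where \<open>op g\<close> stands for the generator \<open>g\<close>.\<close>

definition presents ::
  "complex \<Rightarrow> (ualg, 'v) module \<Rightarrow> 'a::cvec set \<Rightarrow> (gen \<Rightarrow> 'a \<Rightarrow> 'a) \<Rightarrow> ('a \<Rightarrow> 'v) \<Rightarrow> bool" where
 "presents q M S op ev \<longleftrightarrow> left_module (U q) M \<and> cv.subspace S \<and> (\<forall>g. clinear (op g)) \<and>
   (\<forall>g. \<forall>x\<in>S. op g x \<in> S) \<and> bij_betw ev S (carrier M) \<and>
   (\<forall>x\<in>S. \<forall>y\<in>S. ev (x + y) = ev x \<oplus>\<^bsub>M\<^esub> ev y) \<and>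
   (\<forall>c. \<forall>x\<in>S. ev (c *s x) = cls q (scalar c) \<odot>\<^bsub>M\<^esub> ev x) \<and>
   (\<forall>g. \<forall>x\<in>S. ev (op g x) = cls q (letter g) \<odot>\<^bsub>M\<^esub> ev x)"

locale pres =
 fixes q :: complex and M :: "(ualg, 'v) module" and S :: "'a::cvec set"
  and op :: "gen \<Rightarrow> 'a \<Rightarrow> 'a" and ev :: "'a \<Rightarrow> 'v"
 assumes presents: "presents q M S op ev"
begin

lemma lmod: "left_module (U q) M" and subS: "cv.subspace S" and lop: "clinear (op g)"
 and op_S: "x \<in> S \<Longrightarrow> op g x \<in> S" and ev_bij: "bij_betw ev S (carrier M)"
 and ev_add: "x \<in> S \<Longrightarrow> y \<in> S \<Longrightarrow> ev (x + y) = ev x \<oplus>\<^bsub>M\<^esub> ev y"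
 and ev_scale: "x \<in> S \<Longrightarrow> ev (c *s x) = cls q (scalar c) \<odot>\<^bsub>M\<^esub> ev x"
 and ev_op: "x \<in> S \<Longrightarrow> ev (op g x) = cls q (letter g) \<odot>\<^bsub>M\<^esub> ev x"
 using presents by (auto simp: presents_def)

sublocale left_module "U q" M by (rule lmod)

lemma ev_carrier [simp]: "x \<in> S \<Longrightarrow> ev x \<in> carrier M"
 using ev_bij by (auto simp: bij_betw_def)

lemma ev_inj: "x \<in> S \<Longrightarrow> y \<in> S \<Longrightarrow> ev x = ev y \<longleftrightarrow> x = y"
 using ev_bij by (auto simp: bij_betw_def inj_on_def)

lemma ev_surj: "v \<in> carrier M \<Longrightarrow> \<exists>x\<in>S. v = ev x"
 using ev_bij by (auto simp: bij_betw_def)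

lemma S_simps [simp]: "0 \<in> S" "x \<in> S \<Longrightarrow> y \<in> S \<Longrightarrow> x + y \<in> S" "x \<in> S \<Longrightarrow> y \<in> S \<Longrightarrow> x - y \<in> S"
 "x \<in> S \<Longrightarrow> c *s x \<in> S" "x \<in> S \<Longrightarrow> - x \<in> S"
 using subS by (auto simp: cv.subspace_0 cv.subspace_add cv.subspace_diff cv.subspace_scale cv.subspace_neg)

lemma ev_0: "ev 0 = \<zero>\<^bsub>M\<^esub>"
proof -
 have "ev 0 \<oplus>\<^bsub>M\<^esub> ev 0 = ev 0" using ev_add[of 0 0] by simp
 then show ?thesis by (simp add: M.add.l_cancel_one)
qed

lemma ev_eq_0: "x \<in> S \<Longrightarrow> ev x = \<zero>\<^bsub>M\<^esub> \<longleftrightarrow> x = 0"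
 using ev_inj[of x 0] by (simp add: ev_0)

lemma ev_minus: assumes "x \<in> S" shows "ev (- x) = \<ominus>\<^bsub>M\<^esub> ev x"
proof -
 have "ev (- x) \<oplus>\<^bsub>M\<^esub> ev x = \<zero>\<^bsub>M\<^esub>" using ev_add[of "- x" x] assms by (simp add: ev_0)
 then show ?thesis using assms M.minus_equality by (metis S_simps(5) ev_carrier)
qed

lemma smult_zero: assumes "v \<in> carrier M" shows "\<zero>\<^bsub>U q\<^esub> \<odot>\<^bsub>M\<^esub> v = \<zero>\<^bsub>M\<^esub>"
proof -
 have "\<zero>\<^bsub>U q\<^esub> \<odot>\<^bsub>M\<^esub> v \<oplus>\<^bsub>M\<^esub> \<zero>\<^bsub>U q\<^esub> \<odot>\<^bsub>M\<^esub> v = \<zero>\<^bsub>U q\<^esub> \<odot>\<^bsub>M\<^esub> v"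
  using smult_l_distr[of "\<zero>\<^bsub>U q\<^esub>" "\<zero>\<^bsub>U q\<^esub>" v] assms by simp
 then show ?thesis using assms by (simp add: M.add.l_cancel_one)
qed

lemma act_S [simp]: "x \<in> S \<Longrightarrow> act op a x \<in> S"
 by (rule act_closed[OF lop subS op_S])

lemma ev_act: assumes "x \<in> S" shows "ev (act op a x) = cls q a \<odot>\<^bsub>M\<^esub> ev x"
proof -
 have w: "foldr op gs x \<in> S \<and> ev (foldr op gs x) = cls q (foldr (\<lambda>g a. letter g * a) gs 1) \<odot>\<^bsub>M\<^esub> ev x" for gs
  by (induct gs) (use assms in \<open>auto simp: cls_simps op_S ev_op smult_assoc1\<close>)
 show ?thesis
 proof (induct a rule: free_alg_induct)
  case zero
  show ?case using assms by (simp add: cls_zero ev_0 smult_zero)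
 next
  case (add w c a)
  have 1: "act op (Poly_Mapping.single w c) x = c *s foldr op (letters w) x"
   by (simp add: act_single wact_def)
  have 2: "cls q (Poly_Mapping.single w c)
    = cls q (scalar c) \<otimes>\<^bsub>U q\<^esub> cls q (foldr (\<lambda>g a. letter g * a) (letters w) 1)"
   using single_word[of "letters w" c] by (simp only: cls_simps word.collapse)
  have "ev (act op (Poly_Mapping.single w c) x) = cls q (Poly_Mapping.single w c) \<odot>\<^bsub>M\<^esub> ev x"
   unfolding 1 2 using w[of "letters w"] assms by (simp add: ev_scale cls_simps smult_assoc1)
  then show ?case using add assms
   by (simp add: act_add ev_add cls_simps smult_l_distr)
 qed
qed

lemma act_relator: "r \<in> relators q \<Longrightarrow> x \<in> S \<Longrightarrow> act op r x = 0"
 using ev_act[of x r] ev_eq_0[of "act op r x"] by (simp add: cls_relator smult_zero)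

text \<open>Under \<open>ev\<close> these subspaces correspond to the submodules. All generators are
  required, since nothing is yet assumed about the action of \<open>Z\<close>.\<close>

definition opstable :: "'a set \<Rightarrow> bool" where
 "opstable P \<longleftrightarrow> cv.subspace P \<and> P \<subseteq> S \<and> (\<forall>g. \<forall>x\<in>P. op g x \<in> P)"

lemma opstable_submodule: assumes "opstable P" shows "submodule (ev ` P) (U q) M"
proof -
 have P: "cv.subspace P" "P \<subseteq> S" "\<And>g x. x \<in> P \<Longrightarrow> op g x \<in> P" using assms by (auto simp: opstable_def)
 have PS: "x \<in> S" if "x \<in> P" for x using P that by auto
 have inv: "inv\<^bsub>add_monoid M\<^esub> ev x = ev (- x)" if "x \<in> P" for x
  using ev_minus[OF PS[OF that]] by (simp add: a_inv_def)
 show ?thesis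
 proof (intro submodule.intro subgroup.intro submodule_axioms.intro)
  show "ev ` P \<subseteq> carrier (add_monoid M)" using PS by auto
  show "x \<otimes>\<^bsub>add_monoid M\<^esub> y \<in> ev ` P" if "x \<in> ev ` P" "y \<in> ev ` P" for x y
   using that P(1) PS by (auto simp: cv.subspace_add simp flip: ev_add)
  show "\<one>\<^bsub>add_monoid M\<^esub> \<in> ev ` P" using P(1) cv.subspace_0 ev_0 by (metis image_eqI monoid.simps(2))
  show "inv\<^bsub>add_monoid M\<^esub> x \<in> ev ` P" if "x \<in> ev ` P" for x
   using that P(1) inv by (auto simp: cv.subspace_neg)
  show "a \<odot>\<^bsub>M\<^esub> x \<in> ev ` P" if "a \<in> carrier (U q)" "x \<in> ev ` P" for a x
   using that PS act_closed[OF lop P(1) P(3)] by (auto simp: carrier_U simp flip: ev_act)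
 qed
qed

lemma submodule_opstable:
 assumes "submodule N (U q) M" shows "opstable {x \<in> S. ev x \<in> N}" "N = ev ` {x \<in> S. ev x \<in> N}"
proof -
 interpret N: submodule N "U q" M by (rule assms)
 have add: "x \<oplus>\<^bsub>M\<^esub> y \<in> N" if "x \<in> N" "y \<in> N" for x y using N.m_closed[OF that] by simp
 show "opstable {x \<in> S. ev x \<in> N}"
  unfolding opstable_def cv.subspace_def
  using N.one_closed by (auto simp: ev_0 ev_add ev_scale ev_op op_S add cls_simps)
 show "N = ev ` {x \<in> S. ev x \<in> N}" using N.subset ev_surj by auto
qed

end

subsection \<open>Every module has a presentation\<close>

text \<open>A basis of \<open>R\<close> is extended to one of the whole space; \<open>p\<close>
  kills the former vectors and fixes the added ones.\<close>

lemma projection_exists: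
 assumes R: "cv.subspace (R :: 'a::cvec set)"
 shows "\<exists>p. clinear p \<and> (\<forall>r\<in>R. p r = (0::'a)) \<and> (\<forall>f. f - p f \<in> R)"
proof -
 obtain B where B: "B \<subseteq> R" "cv.independent B" "R \<subseteq> cv.span B"
  using cv.maximal_independent_subset[of R] by blast
 obtain B' where B': "B \<subseteq> B'" "B' \<subseteq> UNIV" "cv.independent B'" "UNIV \<subseteq> cv.span B'"
  by (rule cv.maximal_independent_subset_extend[OF subset_UNIV B(2)])
 obtain p where p: "clinear p" "\<And>x. x \<in> B' \<Longrightarrow> p x = (if x \<in> B then 0 else x)"
  using cvp.linear_independent_extend[OF B'(3), of "\<lambda>x. if x \<in> B then 0 else x"] by metis
 have "p r \<in> {0}" if "r \<in> R" for r
 proof (rule span_image_subset[OF p(1)])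
  show "r \<in> cv.span B" using that B(3) by blast
  show "p b \<in> {0}" if "b \<in> B" for b using p(2)[of b] that B'(1) by auto
 qed simp
 moreover have "f - p f \<in> R" for f
 proof (rule span_image_subset[of "\<lambda>f. f - p f" R B' f])
  show "clinear (\<lambda>f. f - p f)" by (intro clinear_combine clinear_id p)
  show "f \<in> cv.span B'" using B'(4) by blast
  show "b - p b \<in> R" if "b \<in> B'" for b
   using p(2)[OF that] B(1) cv.subspace_0[OF R] by auto
 qed (rule R)
 ultimately show ?thesis using p(1) by auto
qed

text \<open>Formal combinations of carrier elements map onto \<open>V\<close> by evaluation. A
  projection along the kernel of evaluation singles out a complement \<open>S\<close>, on which
  evaluation is bijective with inverse \<open>sect\<close>.\<close>

lemma typed_space:
 assumes "Module.module complex_field (V :: (complex, 'v) module)"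
 shows "\<exists>(S :: ('v \<Rightarrow>\<^sub>0 complex) set) ev sect. cv.subspace S \<and> (\<forall>f. ev f \<in> carrier V) \<and>
  (\<forall>f g. ev (f + g) = ev f \<oplus>\<^bsub>V\<^esub> ev g) \<and> (\<forall>c f. ev (c *s f) = c \<odot>\<^bsub>V\<^esub> ev f) \<and>
  (\<forall>x\<in>carrier V. sect x \<in> S \<and> ev (sect x) = x) \<and> (\<forall>f\<in>S. sect (ev f) = f) \<and>
  (\<forall>x\<in>carrier V. \<forall>y\<in>carrier V. sect (x \<oplus>\<^bsub>V\<^esub> y) = sect x + sect y) \<and>
  (\<forall>c. \<forall>x\<in>carrier V. sect (c \<odot>\<^bsub>V\<^esub> x) = c *s sect x)"
proof -
 interpret V: Module.module complex_field V by (rule assms)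
 \<comment> \<open>Elements outside the carrier are ignored; this makes the evaluation total and
   linear on the whole type.\<close>
 define ev where "ev f = finsum V (\<lambda>x. poly_mapping.lookup f x \<odot>\<^bsub>V\<^esub> x) (Poly_Mapping.keys f \<inter> carrier V)"
  for f :: "'v \<Rightarrow>\<^sub>0 complex"
 have sup: "ev f = finsum V (\<lambda>x. poly_mapping.lookup f x \<odot>\<^bsub>V\<^esub> x) A"
  if "finite A" "Poly_Mapping.keys f \<inter> carrier V \<subseteq> A" "A \<subseteq> carrier V" for f A
  unfolding ev_def
  by (rule V.add.finprod_mono_neutral_cong_left[OF that(1,2)]) (use that V.smult_l_null[unfolded univ_ring_simps] in \<open>auto simp: in_keys_iff\<close>)
 have ev_C: "ev f \<in> carrier V" for f unfolding ev_def by (rule V.finsum_closed) auto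
 have ev_add: "ev (f + g) = ev f \<oplus>\<^bsub>V\<^esub> ev g" for f g
 proof -
  let ?A = "(Poly_Mapping.keys f \<union> Poly_Mapping.keys g) \<inter> carrier V"
  have k: "Poly_Mapping.keys (f + g) \<inter> carrier V \<subseteq> ?A" using Poly_Mapping.keys_add[of f g] by auto
  have "ev (f + g) = finsum V (\<lambda>x. poly_mapping.lookup f x \<odot>\<^bsub>V\<^esub> x \<oplus>\<^bsub>V\<^esub> poly_mapping.lookup g x \<odot>\<^bsub>V\<^esub> x) ?A"
   unfolding sup[OF _ k, simplified]
   by (rule V.finsum_cong') (auto simp: lookup_add V.smult_l_distr[unfolded univ_ring_simps, OF UNIV_I UNIV_I])
  also have "\<dots> = finsum V (\<lambda>x. poly_mapping.lookup f x \<odot>\<^bsub>V\<^esub> x) ?A \<oplus>\<^bsub>V\<^esub> finsum V (\<lambda>x. poly_mapping.lookup g x \<odot>\<^bsub>V\<^esub> x) ?A"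
   by (rule V.finsum_addf) auto
  also have "finsum V (\<lambda>x. poly_mapping.lookup f x \<odot>\<^bsub>V\<^esub> x) ?A = ev f" by (rule sup[symmetric]) auto
  also have "finsum V (\<lambda>x. poly_mapping.lookup g x \<odot>\<^bsub>V\<^esub> x) ?A = ev g" by (rule sup[symmetric]) auto
  finally show ?thesis .
 qed
 have ev_scale: "ev (c *s f) = c \<odot>\<^bsub>V\<^esub> ev f" for c f
 proof -
  let ?A = "Poly_Mapping.keys f \<inter> carrier V"
  have k: "Poly_Mapping.keys (c *s f) \<inter> carrier V \<subseteq> ?A"
   by (auto simp: in_keys_iff lookup_cscale cscale_complex_def)
  have "ev (c *s f) = finsum V (\<lambda>x. c \<odot>\<^bsub>V\<^esub> (poly_mapping.lookup f x \<odot>\<^bsub>V\<^esub> x)) ?A"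
   unfolding sup[OF _ k, simplified]
   by (rule V.finsum_cong')
    (auto simp: lookup_cscale cscale_complex_def V.smult_assoc1[unfolded univ_ring_simps, OF UNIV_I UNIV_I])
  also have "\<dots> = c \<odot>\<^bsub>V\<^esub> ev f"
   unfolding ev_def by (rule V.finsum_smult_ldistr[symmetric]) auto
  finally show ?thesis .
 qed
 have ev_single: "ev (Poly_Mapping.single x 1) = x" if "x \<in> carrier V" for x
  using that V.smult_one[OF that] by (simp add: ev_def V.finsum_insert V.finsum_empty)
 have ev_0: "ev 0 = \<zero>\<^bsub>V\<^esub>" by (simp add: ev_def)
 define R where "R = {f. ev f = \<zero>\<^bsub>V\<^esub>}"
 have R: "cv.subspace R"
  unfolding cv.subspace_def R_def using V.smult_r_null by (auto simp: ev_0 ev_add ev_scale)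
 obtain p where p: "clinear p" "\<And>r. r \<in> R \<Longrightarrow> p r = 0" "\<And>f. f - p f \<in> R"
  using projection_exists[OF R] by blast
 have ev_p: "ev (p f) = ev f" for f
 proof -
  have "f = (f - p f) + p f" by simp
  then have "ev f = ev (f - p f) \<oplus>\<^bsub>V\<^esub> ev (p f)" using ev_add by metis
  then show ?thesis using p(3)[of f] ev_C by (simp add: R_def)
 qed
 have p_eq: "p f = p g" if "ev f = ev g" for f g
 proof -
  have "ev g = ev (g - f) \<oplus>\<^bsub>V\<^esub> ev f" using ev_add[of "g - f" f] by simp
  then have "ev g = ev (g - f) \<oplus>\<^bsub>V\<^esub> ev g" unfolding that .
  then have "ev (g - f) = \<zero>\<^bsub>V\<^esub>"
   using V.add.r_cancel_one'[of "ev g" "ev (g - f)"] ev_C by auto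
  then have "p (g - f) = 0" using p(2) by (simp add: R_def)
  then show ?thesis using clin[OF p(1)] by simp
 qed
 define sect where "sect x = p (SOME f. ev f = x)" for x
 have sect: "sect (ev f) = p f" for f
  unfolding sect_def by (rule p_eq) (rule someI[of _ f], rule refl)
 have surj: "\<exists>f. x = ev f" if "x \<in> carrier V" for x using ev_single[OF that] by metis
 have pp: "p (p f) = p f" for f by (rule p_eq) (rule ev_p)
 show ?thesis
 proof (intro exI conjI ballI allI)
  show "cv.subspace (range p)"
   using cvp.linear_subspace_image[OF p(1) cv.subspace_UNIV] .
  show "sect x \<in> range p" if "x \<in> carrier V" for x by (simp add: sect_def)
  show "ev (sect x) = x" if "x \<in> carrier V" for x using surj[OF that] sect ev_p by auto
  show "sect (ev f) = f" if "f \<in> range p" for f using that sect pp by auto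
  show "sect (x \<oplus>\<^bsub>V\<^esub> y) = sect x + sect y" if "x \<in> carrier V" "y \<in> carrier V" for x y
   using surj[OF that(1)] surj[OF that(2)] sect clin[OF p(1)] by (auto simp flip: ev_add)
  show "sect (c \<odot>\<^bsub>V\<^esub> x) = c *s sect x" if "x \<in> carrier V" for c x
   using surj[OF that] sect clin[OF p(1)] by (auto simp flip: ev_scale)
 qed (simp_all add: ev_C ev_add ev_scale)
qed

lemma cls_scalar_simps:
 "cls q (scalar (c + d)) = cls q (scalar c) \<oplus>\<^bsub>U q\<^esub> cls q (scalar d)"
 "cls q (scalar (c * d)) = cls q (scalar c) \<otimes>\<^bsub>U q\<^esub> cls q (scalar d)"
 "cls q (scalar 1) = \<one>\<^bsub>U q\<^esub>"
 by (simp_all add: scalar_add scalar_1 cls_simps flip: scalar_mult)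

lemma vector_space_of_module:
 assumes "left_module (U q) M" shows "Module.module complex_field (vector_space_of q M)"
proof -
 interpret left_module "U q" M by (rule assms)
 have ag: "abelian_group (vector_space_of q M)"
  by (rule abelian_groupI)
   (auto simp: vector_space_of_def M.a_ac intro: M.l_neg bexI[of _ "\<ominus>\<^bsub>M\<^esub> _"])
 show ?thesis
  by (rule module.intro[OF complex_field_cring ag], unfold_locales)
   (auto simp: vector_space_of_def cls_scalar_simps cls_simps smult_l_distr smult_r_distr smult_assoc1)
qed

lemma scalar_comm: "scalar c * a = a * scalar c"
proof (induct a rule: free_alg_induct)
 case (add w d a)
 have "scalar c * Poly_Mapping.single w d = Poly_Mapping.single w d * scalar c"
  by (simp add: scalar_def mult_single mult.commute)
 then show ?case using add by (simp add: distrib_left distrib_right)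
qed simp

text \<open>The action is transported to the copy as \<open>sect\<close> after a generator after
  \<open>ev\<close>. It is linear on the whole type because \<open>ev\<close> is.\<close>

lemma pres_exists:
 assumes "left_module (U q) (M :: (ualg, 'v) module)"
 shows "\<exists>(S :: ('v \<Rightarrow>\<^sub>0 complex) set) op ev. presents q M S op ev"
proof -
 interpret left_module "U q" M by (rule assms)
 let ?V = "vector_space_of q M"
 obtain S :: "('v \<Rightarrow>\<^sub>0 complex) set" and ev sect where S: "cv.subspace S"
  and H: "\<forall>f. ev f \<in> carrier ?V" "\<forall>f g. ev (f + g) = ev f \<oplus>\<^bsub>?V\<^esub> ev g"
   "\<forall>c f. ev (c *s f) = c \<odot>\<^bsub>?V\<^esub> ev f"
   "\<forall>x\<in>carrier ?V. sect x \<in> S \<and> ev (sect x) = x" "\<forall>f\<in>S. sect (ev f) = f"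
   "\<forall>x\<in>carrier ?V. \<forall>y\<in>carrier ?V. sect (x \<oplus>\<^bsub>?V\<^esub> y) = sect x + sect y"
   "\<forall>c. \<forall>x\<in>carrier ?V. sect (c \<odot>\<^bsub>?V\<^esub> x) = c *s sect x"
  using typed_space[OF vector_space_of_module[OF assms]] by (elim exE conjE) (rule that)
 have V: "carrier ?V = carrier M" "x \<oplus>\<^bsub>?V\<^esub> y = x \<oplus>\<^bsub>M\<^esub> y" "c \<odot>\<^bsub>?V\<^esub> x = cls q (scalar c) \<odot>\<^bsub>M\<^esub> x" for x y c
  by (simp_all add: vector_space_of_def)
 have ev: "ev f \<in> carrier M" "ev (f + g) = ev f \<oplus>\<^bsub>M\<^esub> ev g"
   "ev (c *s f) = cls q (scalar c) \<odot>\<^bsub>M\<^esub> ev f" for f g c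
  using H(1-3) unfolding V by auto
 have sect: "x \<in> carrier M \<Longrightarrow> sect x \<in> S" "x \<in> carrier M \<Longrightarrow> ev (sect x) = x"
   "f \<in> S \<Longrightarrow> sect (ev f) = f"
   "x \<in> carrier M \<Longrightarrow> y \<in> carrier M \<Longrightarrow> sect (x \<oplus>\<^bsub>M\<^esub> y) = sect x + sect y"
   "x \<in> carrier M \<Longrightarrow> sect (cls q (scalar c) \<odot>\<^bsub>M\<^esub> x) = c *s sect x" for x y c f
  using H(4-) unfolding V by auto
 define op where "op g f = sect (cls q (letter g) \<odot>\<^bsub>M\<^esub> ev f)" for g f
 have "clinear (op g)" for g
 proof (rule clinearI)
  fix x y show "op g (x + y) = op g x + op g y"
   by (simp add: op_def ev sect smult_r_distr cls_simps)
  fix c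
  have "cls q (letter g) \<odot>\<^bsub>M\<^esub> (cls q (scalar c) \<odot>\<^bsub>M\<^esub> ev x) = cls q (scalar c) \<odot>\<^bsub>M\<^esub> (cls q (letter g) \<odot>\<^bsub>M\<^esub> ev x)"
   using scalar_comm[of c "letter g"] ev(1) by (simp add: cls_simps flip: smult_assoc1 cls_simps(3))
  then show "op g (c *s x) = c *s op g x"
   by (simp add: op_def ev sect cls_simps)
 qed
 moreover have "bij_betw ev S (carrier M)"
  by (rule bij_betwI[of ev S "carrier M" sect]) (auto simp: ev sect)
 ultimately have "presents q M S op ev"
  unfolding presents_def using assms S ev sect by (auto simp: op_def cls_simps)
 then show ?thesis by blast
qed

definition rec_mod ::
  "complex \<Rightarrow> 'a::cvec set \<Rightarrow> (gen \<Rightarrow> 'a \<Rightarrow> 'a) \<Rightarrow> ('a \<Rightarrow> 'v) \<Rightarrow> (ualg, 'v) module" where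
 "rec_mod q S op j =
   \<lparr>carrier = j ` S, mult = undefined, one = undefined, zero = j 0,
   add = (\<lambda>u v. j (the_inv_into S j u + the_inv_into S j v)),
   smult = (\<lambda>u v. j (act op (SOME a. cls q a = u) (the_inv_into S j v)))\<rparr>"

text \<open>The elements of the free algebra that kill \<open>S\<close> form a two-sided ideal; it
  contains the relators and hence the whole relation ideal, so representatives of one class act
  equally.\<close>

lemma presents_rec_mod:
 assumes S: "cv.subspace S" and op: "\<And>g. clinear (op g)" "\<And>g x. x \<in> S \<Longrightarrow> op g x \<in> S"
  and rel: "\<And>r x. r \<in> relators q \<Longrightarrow> x \<in> S \<Longrightarrow> act op r x = 0" and j: "inj_on j S"
 shows "presents q (rec_mod q S op j) S op j"
proof -
 let ?M = "rec_mod q S op j" and ?i = "the_inv_into S j"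
 have i: "?i (j x) = x" if "x \<in> S" for x using the_inv_into_f_f[OF j that] .
 have act_S: "act op a x \<in> S" if "x \<in> S" for a x by (rule act_closed[OF op(1) S op(2) that])
 have kill: "act op a x = 0" if "a \<in> relation_ideal q" "x \<in> S" for a x
 proof -
  have "ideal {a. \<forall>x\<in>S. act op a x = 0} (univ_ring :: free_alg ring)"
  proof (rule idealI[OF univ_ring])
   show "subgroup {a. \<forall>x\<in>S. act op a x = 0} (add_monoid univ_ring)"
   proof (rule subgroup.intro)
    fix x :: free_alg assume x: "x \<in> {a. \<forall>x\<in>S. act op a x = 0}"
    have "inv\<^bsub>add_monoid univ_ring\<^esub> x = - x" using univ_ring_a_inv[of x] by (simp only: a_inv_def)
    then show "inv\<^bsub>add_monoid univ_ring\<^esub> x \<in> {a. \<forall>x\<in>S. act op a x = 0}"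
     using x by (simp add: act_uminus)
   qed (auto simp: act_add)
  qed (auto simp: act_mult[OF op(1)] act_S clin[OF lin_act[OF op(1)]])
  then have "relation_ideal q \<subseteq> {a. \<forall>x\<in>S. act op a x = 0}"
   unfolding relation_ideal_def using rel by (intro ring.genideal_minimal[OF univ_ring]) auto
  then show ?thesis using that by auto
 qed
 have sm: "cls q a \<odot>\<^bsub>?M\<^esub> j x = j (act op a x)" if "x \<in> S" for a x
 proof -
  define a' where "a' = (SOME a'. cls q a' = cls q a)"
  have "cls q a' = cls q a" unfolding a'_def by (rule someI[of _ a]) simp
  then have "act op (a' - a) x = 0" using kill[OF cls_eqD that] by blast
  then show ?thesis using i[OF that] by (simp add: rec_mod_def act_diff a'_def)
 qed
 have ad: "j x \<oplus>\<^bsub>?M\<^esub> j y = j (x + y)" if "x \<in> S" "y \<in> S" for x y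
  using i that by (simp add: rec_mod_def)
 have car: "carrier ?M = j ` S" "\<zero>\<^bsub>?M\<^esub> = j 0" by (simp_all add: rec_mod_def)
 note Ss = cv.subspace_0[OF S] cv.subspace_add[OF S] cv.subspace_neg[OF S] cv.subspace_scale[OF S]
 have ag: "abelian_group ?M"
 proof (rule abelian_groupI)
  fix x assume "x \<in> carrier ?M"
  then obtain y where "y \<in> S" "x = j y" by (auto simp: car)
  then show "\<exists>y\<in>carrier ?M. y \<oplus>\<^bsub>?M\<^esub> x = \<zero>\<^bsub>?M\<^esub>"
   by (intro bexI[of _ "j (- y)"]) (auto simp: car ad Ss)
 qed (auto simp: car ad Ss add_ac)
 have "left_module (U q) ?M"
  by (intro left_module.intro left_module_axioms.intro U_ring ag)
   (auto simp: carrier_U car sm ad act_S Ss act_add act_mult[OF op(1)] act_one[OF op(1)]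
    clin[OF lin_act[OF op(1)]] simp flip: cls_simps)
 then show ?thesis
  unfolding presents_def using S op j
  by (auto simp: car sm ad Ss act_scalar act_letter bij_betw_def)
qed

subsection \<open>Central charge\<close>

definition ops :: "('a \<Rightarrow> 'a) \<Rightarrow> ('a \<Rightarrow> 'a) \<Rightarrow> ('a \<Rightarrow> 'a) \<Rightarrow> ('a \<Rightarrow> 'a) \<Rightarrow> ('a \<Rightarrow> 'a) \<Rightarrow> ('a \<Rightarrow> 'a) \<Rightarrow> ('a \<Rightarrow> 'a) \<Rightarrow> gen \<Rightarrow> 'a \<Rightarrow> 'a" where
 "ops E F K Ki X Y Z g = (case g of gE \<Rightarrow> E | gF \<Rightarrow> F | gK \<Rightarrow> K | gKi \<Rightarrow> Ki | gX \<Rightarrow> X | gY \<Rightarrow> Y | gZ \<Rightarrow> Z)"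

lemma ops_simps [simp]:
 "ops E F K Ki X Y Z gE = E" "ops E F K Ki X Y Z gF = F" "ops E F K Ki X Y Z gK = K"
 "ops E F K Ki X Y Z gKi = Ki" "ops E F K Ki X Y Z gX = X" "ops E F K Ki X Y Z gY = Y"
 "ops E F K Ki X Y Z gZ = Z"
 by (simp_all add: ops_def)

context qs
begin

abbreviation opf :: "gen \<Rightarrow> 'a \<Rightarrow> 'a" where "opf \<equiv> ops E F K Ki X Y (\<lambda>m. z *s m)"

lemma lopf: "clinear (opf g)"
 by (cases g) (simp_all add: lin clinear_cscale)

lemma opf_S: "x \<in> S \<Longrightarrow> opf g x \<in> S"
 by (cases g) simp_all

lemma opf_relators: assumes r: "r \<in> relators q" and x: "x \<in> S" shows "act opf r x = 0"
proof -
 have c: "act opf (eZ * letter g - letter g * eZ) x = 0" for g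
  by (simp add: act_simps act_mult[OF lopf] act_one[OF lopf] clin[OF lopf])
 have KE': "K (E (Ki x)) = (q ^ 2) *s E x" using KE[of "Ki x"] x by simp
 have KF': "K (F (Ki x)) = (1 / q ^ 2) *s F x" using KF[of "Ki x"] x by simp
 have KX': "K (X (Ki x)) = q *s X x" using KX[of "Ki x"] x by simp
 have KY': "K (Y (Ki x)) = (1 / q) *s Y x" using KY[of "Ki x"] x by simp
 show ?thesis
  using r x c unfolding relators_def
  by (auto simp: act_simps act_mult[OF lopf] act_one[OF lopf] KE' KF' KX' KY' EF XY EX EY FX FY lins)
qed

end

locale cpres = pres q M S op ev + qparam q z for q z and M :: "(ualg, 'v) module" and S :: "'a::cvec set" and op ev +
 assumes charge: "\<And>v. v \<in> carrier M \<Longrightarrow> cls q eZ \<odot>\<^bsub>M\<^esub> v = cls q (scalar z) \<odot>\<^bsub>M\<^esub> v"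
begin

lemma opZ: "x \<in> S \<Longrightarrow> op gZ x = z *s x"
 using charge[of "ev x"] ev_inj[of "op gZ x" "z *s x"] by (simp add: ev_op ev_scale op_S)

lemma to_qs: "qs q z S (op gE) (op gF) (op gK) (op gKi) (op gX) (op gY)"
proof (intro qs.intro qs_axioms.intro qparam_axioms subS lop op_S)
 fix m assume m: "m \<in> S"
 note rel = act_relator[OF _ m] and sm = act_simps act_mult[OF lop] act_one[OF lop]
 note oc = op_S[OF m]
 have ki: "op gKi (op gK m) = m" if "m \<in> S" for m
  using act_relator[OF _ that, of "eKi * eK - 1"] by (simp add: relators_def sm)
 show "op gK (op gKi m) = m" using rel[of "eK * eKi - 1"] by (simp add: relators_def sm)
 show "op gKi (op gK m) = m" by (rule ki[OF m])
 show "op gE (op gF m) = op gF (op gE m) + (1 / (q - 1 / q)) *s (op gK m - op gKi m)"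
  using rel[of "(eE * eF - eF * eE) - scalar (1 / (q - 1 / q)) * (eK - eKi)"]
  by (simp add: relators_def sm algebra_simps)
 \<comment> \<open>The weight relators end in \<open>Ki\<close>; evaluated at \<open>K m\<close>
   instead of \<open>m\<close> they give the relations in the form without
   \<open>Ki\<close>.\<close>
 have kr: "act op r (op gK m) = 0" if "r \<in> relators q" for r
  using act_relator[OF that] op_S[OF m] by blast
 show "op gK (op gE m) = (q ^ 2) *s op gE (op gK m)"
  using kr[of "eK * eE * eKi - scalar (q ^ 2) * eE"] by (simp add: relators_def sm ki[OF m])
 show "op gK (op gF m) = (1 / q ^ 2) *s op gF (op gK m)"
  using kr[of "eK * eF * eKi - scalar (1 / q ^ 2) * eF"] by (simp add: relators_def sm ki[OF m])
 show "op gK (op gX m) = q *s op gX (op gK m)"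
  using kr[of "eK * eX * eKi - scalar q * eX"] by (simp add: relators_def sm ki[OF m])
 show "op gK (op gY m) = (1 / q) *s op gY (op gK m)"
  using kr[of "eK * eY * eKi - scalar (1 / q) * eY"] by (simp add: relators_def sm ki[OF m])
 show "op gX (op gY m) = q *s op gY (op gX m) - z *s m"
  using rel[of "(scalar q * eY * eX - eX * eY) - eZ"] by (simp add: relators_def sm opZ[OF m] algebra_simps)
 show "op gE (op gX m) = q *s op gX (op gE m)"
  using rel[of "eE * eX - scalar q * eX * eE"] by (simp add: relators_def sm)
 show "op gE (op gY m) = op gX m + (1 / q) *s op gY (op gE m)"
  using rel[of "eE * eY - (eX + scalar (1 / q) * eY * eE)"] by (simp add: relators_def sm)
 show "op gF (op gX m) = op gY (op gKi m) + op gX (op gF m)"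
  using rel[of "eF * eX - (eY * eKi + eX * eF)"] by (simp add: relators_def sm)
 show "op gF (op gY m) = op gY (op gF m)"
  using rel[of "eF * eY - eY * eF"] by (simp add: relators_def sm)
qed

sublocale qs q z S "op gE" "op gF" "op gK" "op gKi" "op gX" "op gY" by (rule to_qs)

lemma opstable_iff: "opstable P \<longleftrightarrow> stable P"
proof
 assume P: "opstable P"
 then have "cv.subspace P" "P \<subseteq> S" "\<And>g x. x \<in> P \<Longrightarrow> op g x \<in> P" unfolding opstable_def by blast+
 then show "stable P" unfolding stable_def by simp
next
 assume P: "stable P"
 note P' = stableD[OF P]
 have "op g x \<in> P" if x: "x \<in> P" for g x
 proof (cases g)
  case gZ
  have "op gZ x = z *s x" using opZ P'(2) x by blast
  then show ?thesis using gZ cv.subspace_scale[OF P'(1) x] by simp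
 qed (use P'(3-8) x in simp_all)
 then show "opstable P" using P'(1,2) unfolding opstable_def by blast
qed

lemma act_Ct: assumes "x \<in> S" shows "act op (elemCtilde q) x = Ct x"
proof -
 let ?y = "act op (scalar (1 + 1 / q) * elemC q + scalar (1 / (q ^ 2 - 1)) * eKi) x"
 have "?y \<in> S" using assms by simp
 then have "act op (elemCtilde q) x = z *s ?y + act op (eX ^ 2 * eF) x - act op (eY ^ 2 * eE * eKi) x
   + act op (eX * eY * (scalar (1 / q) * eF * eE - scalar q * eE * eF)) x"
  unfolding elemCtilde_def act_simps act_mult[OF lop] by (simp only: opZ)
 then show ?thesis
  unfolding Ct_def elemC_def act_simps act_mult[OF lop] power2_eq_square[of "letter _"] .
qed

end

section \<open>The category O in terms of operators\<close>

lemma eig_decomp_space: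
 assumes A: "clinear A" and S: "cv.subspace S" and m: "m \<in> cv.span (\<Union>l\<in>\<Lambda>. {x \<in> S. A x = l *s x})"
 shows "\<exists>L y. finite L \<and> L \<subseteq> \<Lambda> \<and> (\<forall>l\<in>L. y l \<in> S \<and> A (y l) = l *s y l) \<and> m = (\<Sum>l\<in>L. y l)"
proof -
 let ?B = "\<Union>l\<in>\<Lambda>. {x \<in> S. A x = l *s x}"
 have "\<exists>L y. finite L \<and> L \<subseteq> \<Lambda> \<and> (\<forall>l\<in>L. y l \<in> cv.span {b \<in> ?B. A b = l *s b}) \<and> m = (\<Sum>l\<in>L. y l)"
  by (rule eig_decomp[OF m]) blast
 then obtain L y where L: "finite L" "L \<subseteq> \<Lambda>"
  "\<forall>l\<in>L. y l \<in> cv.span {b \<in> ?B. A b = l *s b}" "m = (\<Sum>l\<in>L. y l)"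
  by (elim exE conjE) (rule that)
 have "y l \<in> S \<and> A (y l) = l *s y l" if l: "l \<in> L" for l
 proof
  have y: "y l \<in> cv.span {b \<in> ?B. A b = l *s b}" using L(3) l by (rule bspec)
  then show "A (y l) = l *s y l" by (rule eig_in_span[OF A])
  have "{b \<in> ?B. A b = l *s b} \<subseteq> S" by blast
  then show "y l \<in> S" using y span_subset_subspace[OF _ S] by (rule_tac subsetD)
 qed
 then show ?thesis using L(1,2,4) by (intro exI[of _ L] exI[of _ y]) simp
qed

context pres
begin

lemma ev_sum: "finite A \<Longrightarrow> (\<And>i. i \<in> A \<Longrightarrow> y i \<in> S) \<Longrightarrow> ev (\<Sum>i\<in>A. y i) = finsum M (\<lambda>i. ev (y i)) A"
proof (induct A rule: finite_induct)
 case (insert i A)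
 have "(\<Sum>i\<in>A. y i) \<in> S" using insert by (intro cv.subspace_sum[OF subS]) auto
 then show ?case using insert by (subst M.finsum_insert) (auto simp: ev_add)
qed (simp add: ev_0)

text \<open>A direct sum decomposition checked inside the copy. Existence of the family of
  components is \<open>span\<close>; its uniqueness is \<open>indep\<close> for the difference of
  two families.\<close>

lemma ids_intro:
 assumes P: "\<And>i. i \<in> I \<Longrightarrow> cv.subspace (P i) \<and> P i \<subseteq> S \<and> Nf i = ev ` P i"
  and span: "\<And>m. m \<in> S \<Longrightarrow> \<exists>J y. finite J \<and> J \<subseteq> I \<and> (\<forall>i\<in>J. y i \<in> P i) \<and> m = (\<Sum>i\<in>J. y i)"
  and indep: "\<And>J y i. finite J \<Longrightarrow> J \<subseteq> I \<Longrightarrow> (\<forall>i\<in>J. y i \<in> P i) \<Longrightarrow> (\<Sum>i\<in>J. y i) = 0 \<Longrightarrow> i \<in> J \<Longrightarrow> y i = 0"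
 shows "internal_direct_sum M I Nf"
 unfolding internal_direct_sum_def
proof (intro conjI ballI)
 fix i assume i: "i \<in> I"
 note Pi = P[OF i]
 show "subgroup (Nf i) (add_monoid M)"
 proof (rule subgroup.intro)
  show "Nf i \<subseteq> carrier (add_monoid M)" using Pi by auto
  show "x \<otimes>\<^bsub>add_monoid M\<^esub> y \<in> Nf i" if "x \<in> Nf i" "y \<in> Nf i" for x y
   using that Pi by (auto simp: subset_iff cv.subspace_add simp flip: ev_add)
  show "\<one>\<^bsub>add_monoid M\<^esub> \<in> Nf i" using Pi cv.subspace_0 ev_0 by (metis image_eqI monoid.simps(2))
  show "inv\<^bsub>add_monoid M\<^esub> x \<in> Nf i" if "x \<in> Nf i" for x
   using that Pi ev_minus by (auto simp: subset_iff cv.subspace_neg a_inv_def[symmetric] simp flip: ev_minus)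
 qed
next
 fix x assume "x \<in> carrier M"
 then obtain m where m: "m \<in> S" "x = ev m" using ev_surj by blast
 obtain J y where J: "finite J" "J \<subseteq> I" "\<forall>i\<in>J. y i \<in> P i" "m = (\<Sum>i\<in>J. y i)" using span[OF m(1)] by blast
 have PS: "u \<in> S" if "u \<in> P i" "i \<in> I" for u i using P that by blast
 have P0: "0 \<in> P i" if "i \<in> I" for i using P[OF that] cv.subspace_0 by blast
 let ?f = "\<lambda>i\<in>I. if i \<in> J then ev (y i) else \<zero>\<^bsub>M\<^esub>"
 have sum: "ev (\<Sum>i\<in>L. w i) = finsum M g L"
  if "finite L" "L \<subseteq> I" "\<And>i. i \<in> L \<Longrightarrow> w i \<in> P i \<and> g i = ev (w i)" for L g and w :: "_ \<Rightarrow> 'a"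
 proof -
  have wS: "w i \<in> S" if "i \<in> L" for i using PS \<open>L \<subseteq> I\<close> that that(1) \<open>\<And>i. i \<in> L \<Longrightarrow> w i \<in> P i \<and> g i = ev (w i)\<close> by blast
  have "finsum M g L = finsum M (\<lambda>i. ev (w i)) L"
   by (rule M.finsum_cong') (use that wS in auto)
  then show ?thesis using ev_sum[OF that(1), of w] wS by auto
 qed
 show "\<exists>!f. f \<in> (\<Pi>\<^sub>E i\<in>I. Nf i) \<and> finite {i \<in> I. f i \<noteq> \<zero>\<^bsub>M\<^esub>} \<and> x = finsum M f {i \<in> I. f i \<noteq> \<zero>\<^bsub>M\<^esub>}"
 proof (rule ex1I[of _ ?f])
  have eq: "{i \<in> I. ?f i \<noteq> \<zero>\<^bsub>M\<^esub>} = {i \<in> J. y i \<noteq> 0}"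
   using J PS by (auto simp: ev_eq_0 subset_iff)
  have "finsum M ?f {i \<in> J. y i \<noteq> 0} = ev (\<Sum>i\<in>{i \<in> J. y i \<noteq> 0}. y i)"
   by (rule sum[symmetric]) (use J in auto)
  also have "(\<Sum>i\<in>{i \<in> J. y i \<noteq> 0}. y i) = m"
   unfolding J(4) by (rule sum.mono_neutral_left) (use J in auto)
  finally have 1: "x = finsum M ?f {i \<in> I. ?f i \<noteq> \<zero>\<^bsub>M\<^esub>}" unfolding eq m(2) by (rule sym)
  have 2: "?f \<in> (\<Pi>\<^sub>E i\<in>I. Nf i)"
  proof (rule PiE_I)
   fix i assume i: "i \<in> I"
   show "?f i \<in> Nf i" using J(3) P[OF i] P0[OF i] i by (auto simp flip: ev_0)
  qed auto
  have 3: "finite {i \<in> I. ?f i \<noteq> \<zero>\<^bsub>M\<^esub>}" unfolding eq using J(1) by simp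
  show "?f \<in> (\<Pi>\<^sub>E i\<in>I. Nf i) \<and> finite {i \<in> I. ?f i \<noteq> \<zero>\<^bsub>M\<^esub>} \<and> x = finsum M ?f {i \<in> I. ?f i \<noteq> \<zero>\<^bsub>M\<^esub>}"
   using 1 2 3 by blast
 next
  fix g assume g: "g \<in> (\<Pi>\<^sub>E i\<in>I. Nf i) \<and> finite {i \<in> I. g i \<noteq> \<zero>\<^bsub>M\<^esub>} \<and> x = finsum M g {i \<in> I. g i \<noteq> \<zero>\<^bsub>M\<^esub>}"
  let ?L = "{i \<in> I. g i \<noteq> \<zero>\<^bsub>M\<^esub>}"
  have "\<exists>w. \<forall>i\<in>I. w i \<in> P i \<and> g i = ev (w i)"
  proof (rule bchoice, rule ballI)
   fix i assume "i \<in> I"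
   then have "g i \<in> ev ` P i" using g P[of i] by (auto simp: PiE_iff)
   then show "\<exists>u. u \<in> P i \<and> g i = ev u" by blast
  qed
  then obtain w where w: "\<And>i. i \<in> I \<Longrightarrow> w i \<in> P i" "\<And>i. i \<in> I \<Longrightarrow> g i = ev (w i)" by blast
  have wS: "w i \<in> S" if "i \<in> I" for i using PS w that by blast
  have "ev (\<Sum>i\<in>?L. w i) = finsum M g ?L"
  proof (rule sum)
   show "finite ?L" using g by blast
   show "w i \<in> P i \<and> g i = ev (w i)" if "i \<in> ?L" for i using w that by blast
  qed blast
  also have "finsum M g ?L = x" using g by (elim conjE) (rule sym)
  finally have "ev (\<Sum>i\<in>?L. w i) = x" .
  moreover have "(\<Sum>i\<in>?L. w i) \<in> S" by (rule cv.subspace_sum[OF subS]) (use wS in auto)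
  ultimately have "(\<Sum>i\<in>?L. w i) = m" unfolding m(2) using m(1) ev_inj by blast
  \<comment> \<open>The difference of the components prescribed by \<open>g\<close> and by
    \<open>y\<close>; it sums to zero over the union of their supports.\<close>
  define u where "u i = (if i \<in> ?L then w i else 0) - (if i \<in> J then y i else 0)" for i
  have fin: "finite (?L \<union> J)" using g J(1) by blast
  have "(\<Sum>i\<in>?L \<union> J. u i) = (\<Sum>i\<in>?L \<union> J. if i \<in> ?L then w i else 0) - (\<Sum>i\<in>?L \<union> J. if i \<in> J then y i else 0)"
   unfolding u_def by (rule sum_subtractf)
  also have "(\<Sum>i\<in>?L \<union> J. if i \<in> ?L then w i else 0) = (\<Sum>i\<in>?L. w i)"
   by (rule sum.mono_neutral_cong_right) (use fin in auto)
  also have "(\<Sum>i\<in>?L \<union> J. if i \<in> J then y i else 0) = (\<Sum>i\<in>J. y i)"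
   by (rule sum.mono_neutral_cong_right) (use fin in auto)
  finally have u0: "(\<Sum>i\<in>?L \<union> J. u i) = 0" using \<open>(\<Sum>i\<in>?L. w i) = m\<close> J(4) by simp
  have uP: "\<forall>i\<in>?L \<union> J. u i \<in> P i"
  proof
   fix i assume i: "i \<in> ?L \<union> J"
   then have iI: "i \<in> I" using J(2) by auto
   show "u i \<in> P i" unfolding u_def
   proof (rule cv.subspace_diff)
    show "cv.subspace (P i)" using P[OF iI] by blast
    show "(if i \<in> ?L then w i else 0) \<in> P i" using w(1)[OF iI] P0[OF iI] by simp
    show "(if i \<in> J then y i else 0) \<in> P i" using J(3) P0[OF iI] by simp
   qed
  qed
  have eqw: "(if i \<in> ?L then w i else 0) = (if i \<in> J then y i else 0)" if "i \<in> I" for i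
  proof (cases "i \<in> ?L \<union> J")
   case True
   then have "u i = 0" using indep[OF fin _ uP u0] J(2) by blast
   then show ?thesis by (simp add: u_def)
  qed auto
  show "g = ?f"
  proof (rule extensionalityI[of _ I])
   show "g \<in> extensional I" using g by (auto simp: PiE_iff)
   show "?f \<in> extensional I" by auto
   fix i assume i: "i \<in> I"
   show "g i = ?f i"
   proof (cases "g i = \<zero>\<^bsub>M\<^esub>")
    case True
    then have "(if i \<in> J then y i else 0) = 0" using eqw[OF i] by simp
    then show ?thesis using i True by (auto simp: ev_0 split: if_splits)
   next
    case False
    then have "w i = (if i \<in> J then y i else 0)" using eqw[OF i] i by simp
    then show ?thesis using i w(2)[OF i] by (auto simp: ev_0)
   qed
  qed
 qed
qed

lemma weight_space_ev: "weight_space q M l = ev ` {x \<in> S. op gK x = l *s x}"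
proof -
 have "cls q eK \<odot>\<^bsub>M\<^esub> ev x = cls q (scalar l) \<odot>\<^bsub>M\<^esub> ev x \<longleftrightarrow> op gK x = l *s x" if "x \<in> S" for x
  using ev_inj[of "op gK x" "l *s x"] that by (simp add: ev_op ev_scale op_S)
 then have eq: "v \<in> weight_space q M l \<longleftrightarrow> v \<in> ev ` {x \<in> S. op gK x = l *s x}" if "v \<in> carrier M" for v
  using ev_surj[OF that] ev_inj unfolding weight_space_def by fastforce
 have "weight_space q M l \<subseteq> carrier M" by (auto simp: weight_space_def)
 then show ?thesis using eq by auto
qed

lemma wt_sub: "cv.subspace {x \<in> S. op gK x = l *s x}"
 by (auto simp: cv.subspace_def clin[OF lop] cv.scale_right_distrib mult.commute)

lemma weight_module_dest:
 assumes "weight_module q M" "supp q M \<subseteq> \<xi>"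
 shows "S \<subseteq> cv.span (\<Union>l\<in>\<xi>. {x \<in> S. op gK x = l *s x})"
proof
 fix m assume m: "m \<in> S"
 let ?T = "cv.span (\<Union>l\<in>\<xi>. {x \<in> S. op gK x = l *s x})"
 obtain f where f: "f \<in> (\<Pi>\<^sub>E i\<in>UNIV - {0}. weight_space q M i)" "finite {i \<in> UNIV - {0}. f i \<noteq> \<zero>\<^bsub>M\<^esub>}"
  "ev m = finsum M f {i \<in> UNIV - {0}. f i \<noteq> \<zero>\<^bsub>M\<^esub>}"
  using bspec[OF conjunct2[OF assms(1)[unfolded weight_module_def internal_direct_sum_def]] ev_carrier[OF m]]
  by (elim ex1E conjE) (rule that)
 let ?L = "{i \<in> UNIV - {0}. f i \<noteq> \<zero>\<^bsub>M\<^esub>}"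
 have "\<exists>w. \<forall>i\<in>?L. w i \<in> S \<and> op gK (w i) = i *s w i \<and> f i = ev (w i)"
 proof (rule bchoice, rule ballI)
  fix i assume "i \<in> ?L"
  then have "f i \<in> ev ` {x \<in> S. op gK x = i *s x}" using f(1) by (auto simp: PiE_iff weight_space_ev)
  then show "\<exists>x. x \<in> S \<and> op gK x = i *s x \<and> f i = ev x" by blast
 qed
 then obtain w where w: "\<And>i. i \<in> ?L \<Longrightarrow> w i \<in> S \<and> op gK (w i) = i *s w i \<and> f i = ev (w i)" by blast
 have "ev m = finsum M (\<lambda>i. ev (w i)) ?L"
  unfolding f(3)
 proof (rule M.finsum_cong'[OF refl])
  show "(\<lambda>i. ev (w i)) \<in> ?L \<rightarrow> carrier M" using w by (blast intro: ev_carrier)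
  show "f i = ev (w i)" if "i \<in> ?L" for i using w that by blast
 qed
 also have "\<dots> = ev (\<Sum>i\<in>?L. w i)"
  by (rule ev_sum[OF f(2), symmetric]) (use w in blast)
 finally have "ev m = ev (\<Sum>i\<in>?L. w i)" .
 moreover have "(\<Sum>i\<in>?L. w i) \<in> S" by (rule cv.subspace_sum[OF subS]) (use w in blast)
 ultimately have "m = (\<Sum>i\<in>?L. w i)" using ev_inj[OF m] by blast
 also have "\<dots> \<in> ?T"
 proof (rule cv.span_sum)
  fix i assume i: "i \<in> ?L"
  then have "f i \<in> weight_space q M i" "f i \<noteq> \<zero>\<^bsub>M\<^esub>" "i \<noteq> 0" using f(1) by (auto simp: PiE_iff)
  then have "i \<in> supp q M" unfolding supp_def by blast
  then have "i \<in> \<xi>" using assms(2) by blast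
  then show "w i \<in> ?T" using w[OF i] by (blast intro: cv.span_base)
 qed
 finally show "m \<in> ?T" .
qed

text \<open>The support is bounded since a vector of weight outside \<xi> lies, by
  \<open>eig_component\<close>, in a span of zero vectors. The hypothesis on \<open>0\<close>
  matches the nonzero weights in \<open>weight_module\<close>.\<close>

lemma weight_module_intro:
 assumes "S \<subseteq> cv.span (\<Union>l\<in>\<xi>. {x \<in> S. op gK x = l *s x})" "0 \<notin> \<xi>"
 shows "weight_module q M" "supp q M \<subseteq> \<xi>"
proof -
 have dec: "\<exists>L y. finite L \<and> L \<subseteq> \<xi> \<and> (\<forall>l\<in>L. y l \<in> S \<and> op gK (y l) = l *s y l) \<and> m = (\<Sum>l\<in>L. y l)"
  if "m \<in> S" for m
  by (rule eig_decomp_space[OF lop subS subsetD[OF assms(1) that]])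
 show "weight_module q M"
  unfolding weight_module_def
 proof (rule ids_intro[of _ "\<lambda>l. {x \<in> S. op gK x = l *s x}"])
  show "cv.subspace {x \<in> S. op gK x = i *s x} \<and> {x \<in> S. op gK x = i *s x} \<subseteq> S \<and>
   weight_space q M i = ev ` {x \<in> S. op gK x = i *s x}" for i
   using wt_sub weight_space_ev by blast
 next
  fix m assume "m \<in> S"
  from dec[OF this] obtain L y where L: "finite L" "L \<subseteq> \<xi>" "\<forall>l\<in>L. y l \<in> S \<and> op gK (y l) = l *s y l"
   "m = (\<Sum>l\<in>L. y l)" by (elim exE conjE) (rule that)
  have "L \<subseteq> UNIV - {0}" using L(2) assms(2) by blast
  with L show "\<exists>J y. finite J \<and> J \<subseteq> UNIV - {0} \<and> (\<forall>i\<in>J. y i \<in> {x \<in> S. op gK x = i *s x}) \<and> m = sum y J"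
   by (intro exI[of _ L] exI[of _ y]) simp
 next
  fix J y i assume "finite J" "\<forall>i\<in>J. y i \<in> {x \<in> S. op gK x = i *s x}" "sum y J = 0" "i \<in> J"
  then show "y i = 0" by (intro eig_indep[of "op gK" J y i, OF lop]) auto
 qed
 show "supp q M \<subseteq> \<xi>"
 proof
  fix l assume l: "l \<in> supp q M"
  have "{x \<in> S. op gK x = l *s x} \<noteq> {0}"
  proof
   assume "{x \<in> S. op gK x = l *s x} = {0}"
   then have "weight_space q M l = {\<zero>\<^bsub>M\<^esub>}" unfolding weight_space_ev by (simp add: ev_0)
   then show False using l by (simp add: supp_def)
  qed
  then obtain x where x: "x \<in> S" "op gK x = l *s x" "x \<noteq> 0"
   using cv.subspace_0[OF wt_sub[of l]] by blast
  let ?B = "\<Union>l\<in>\<xi>. {x \<in> S. op gK x = l *s x}"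
  have xs: "x \<in> cv.span {b \<in> ?B. op gK b = l *s b}"
  proof (rule eig_component[OF lop _ _ x(2)])
   show "x \<in> cv.span ?B" by (rule subsetD[OF assms(1) x(1)])
  qed blast
  have z: "{b \<in> ?B. op gK b = l *s b} \<subseteq> {0}" if "l \<notin> \<xi>"
  proof
   fix b assume "b \<in> {b \<in> ?B. op gK b = l *s b}"
   then obtain l' where "l' \<in> \<xi>" "l' *s b = l *s b" by auto
   then show "b \<in> {0}" using that by auto
  qed
  show "l \<in> \<xi>"
  proof (rule ccontr)
   assume "l \<notin> \<xi>"
   then have "cv.span {b \<in> ?B. op gK b = l *s b} \<subseteq> {0}" by (intro span_subset_subspace z) simp_all
   then show False using xs x(3) by blast
  qed
 qed
qed

lemma fg_dest:
 assumes "finitely_generated (U q) M"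
 shows "\<exists>G. finite G \<and> G \<subseteq> S \<and> (\<forall>P. opstable P \<longrightarrow> G \<subseteq> P \<longrightarrow> S \<subseteq> P)"
proof -
 obtain T where T: "finite T" "T \<subseteq> carrier M" "generated_submodule (U q) M T = carrier M"
  using assms by (auto simp: finitely_generated_def)
 let ?G = "ev -` T \<inter> S"
 have "finite ?G" using T(1) ev_bij by (intro finite_vimage_IntI) (auto simp: bij_betw_def)
 moreover have "S \<subseteq> P" if P: "opstable P" "?G \<subseteq> P" for P
 proof
  fix x assume x: "x \<in> S"
  have "T \<subseteq> ev ` P"
  proof
   fix t assume t: "t \<in> T"
   then obtain y where "y \<in> S" "t = ev y" using T(2) ev_surj by (meson subsetD)
   then show "t \<in> ev ` P" using t P(2) by auto
  qed
  then have "generated_submodule (U q) M T \<subseteq> ev ` P"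
   unfolding generated_submodule_def using opstable_submodule[OF P(1)] by (intro Inter_lower) simp
  then have "ev x \<in> ev ` P" using ev_carrier[OF x] T(3) by blast
  then obtain y where "y \<in> P" "ev x = ev y" by blast
  moreover have "P \<subseteq> S" using P(1) by (simp add: opstable_def)
  ultimately show "x \<in> P" using ev_inj[OF x] by blast
 qed
 ultimately show ?thesis by (intro exI[of _ ?G]) blast
qed

lemma carrier_submodule: "submodule (carrier M) (U q) M"
proof -
 have "opstable S" using subS op_S by (auto simp: opstable_def)
 then have "submodule (ev ` S) (U q) M" by (rule opstable_submodule)
 then show ?thesis using ev_bij by (simp add: bij_betw_def)
qed

lemma fg_intro:
 assumes "finite G" "G \<subseteq> S" "\<And>P. opstable P \<Longrightarrow> G \<subseteq> P \<Longrightarrow> S \<subseteq> P"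
 shows "finitely_generated (U q) M"
 unfolding finitely_generated_def
proof (intro exI[of _ "ev ` G"] conjI)
 show "finite (ev ` G)" "ev ` G \<subseteq> carrier M" using assms by auto
 show "generated_submodule (U q) M (ev ` G) = carrier M"
 proof
  show "generated_submodule (U q) M (ev ` G) \<subseteq> carrier M"
   unfolding generated_submodule_def using carrier_submodule assms(2) by (intro Inter_lower) auto
  show "carrier M \<subseteq> generated_submodule (U q) M (ev ` G)"
   unfolding generated_submodule_def
  proof (rule Inter_greatest)
   fix N assume N: "N \<in> {N. submodule N (U q) M \<and> ev ` G \<subseteq> N}"
   then have "opstable {x \<in> S. ev x \<in> N}" "G \<subseteq> {x \<in> S. ev x \<in> N}"
    using submodule_opstable(1) assms(2) by auto
   then have "S \<subseteq> {x \<in> S. ev x \<in> N}" by (rule assms(3))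
   then show "carrier M \<subseteq> N" using ev_surj by auto
  qed
 qed
qed

lemma restricted_submodule:
 assumes Q: "cv.subspace Q" "Q \<subseteq> S" and P: "cv.subspace P" "P \<subseteq> Q"
 shows "submodule (ev ` P) complex_field ((vector_space_of q M)\<lparr>carrier := ev ` Q\<rparr>)" (is "submodule _ _ ?W")
proof -
 have PS: "x \<in> S" if "x \<in> P" for x using P Q that by auto
 have inv: "inv\<^bsub>add_monoid ?W\<^esub> (ev x) = ev (- x)" if x: "x \<in> P" for x
  unfolding m_inv_def
 proof (rule the_equality)
  have "- x \<in> Q" using x P Q by (auto simp: cv.subspace_neg)
  then show "ev (- x) \<in> carrier (add_monoid ?W) \<and> ev x \<otimes>\<^bsub>add_monoid ?W\<^esub> ev (- x) = \<one>\<^bsub>add_monoid ?W\<^esub> \<and>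
    ev (- x) \<otimes>\<^bsub>add_monoid ?W\<^esub> ev x = \<one>\<^bsub>add_monoid ?W\<^esub>"
   using PS[OF x] ev_add[of x "- x"] ev_add[of "- x" x] by (simp add: vector_space_of_def ev_0)
  fix y assume y: "y \<in> carrier (add_monoid ?W) \<and> ev x \<otimes>\<^bsub>add_monoid ?W\<^esub> y = \<one>\<^bsub>add_monoid ?W\<^esub> \<and>
    y \<otimes>\<^bsub>add_monoid ?W\<^esub> ev x = \<one>\<^bsub>add_monoid ?W\<^esub>"
  then obtain u where u: "u \<in> Q" "y = ev u" by (auto simp: vector_space_of_def)
  then have uS: "u \<in> S" using Q by auto
  have "ev (u + x) = ev 0" using y u uS PS[OF x] by (simp add: vector_space_of_def ev_add ev_0)
  then have "u + x = 0" using ev_inj uS PS[OF x] by simp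
  then have "u = - x" by (simp add: eq_neg_iff_add_eq_0)
  then show "y = ev (- x)" using u by simp
 qed
 show ?thesis
 proof (intro submodule.intro subgroup.intro submodule_axioms.intro)
  show "ev ` P \<subseteq> carrier (add_monoid ?W)" using P(2) by auto
  show "x \<otimes>\<^bsub>add_monoid ?W\<^esub> y \<in> ev ` P" if "x \<in> ev ` P" "y \<in> ev ` P" for x y
   using that PS P(1) by (auto simp: vector_space_of_def cv.subspace_add simp flip: ev_add)
  show "\<one>\<^bsub>add_monoid ?W\<^esub> \<in> ev ` P"
   using cv.subspace_0[OF P(1)] by (auto simp: vector_space_of_def ev_0[symmetric])
  show "inv\<^bsub>add_monoid ?W\<^esub> x \<in> ev ` P" if "x \<in> ev ` P" for x
   using that inv P(1) by (auto simp: cv.subspace_neg)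
  show "a \<odot>\<^bsub>?W\<^esub> x \<in> ev ` P" if "a \<in> carrier complex_field" "x \<in> ev ` P" for a x
   using that PS P(1) by (auto simp: vector_space_of_def cv.subspace_scale simp flip: ev_scale)
 qed
qed

lemma restricted_submodule_sub:
 assumes Q: "cv.subspace Q" "Q \<subseteq> S"
  and N: "submodule H complex_field ((vector_space_of q M)\<lparr>carrier := ev ` Q\<rparr>)"
 shows "cv.subspace {x \<in> Q. ev x \<in> H}"
proof -
 interpret N: submodule H complex_field "(vector_space_of q M)\<lparr>carrier := ev ` Q\<rparr>" by (rule N)
 have QS: "x \<in> S" if "x \<in> Q" for x using Q that by auto
 have "\<zero>\<^bsub>M\<^esub> \<in> H" using N.one_closed by (simp add: vector_space_of_def)
 moreover have "x \<oplus>\<^bsub>M\<^esub> y \<in> H" if "x \<in> H" "y \<in> H" for x y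
  using N.m_closed[OF that] by (simp add: vector_space_of_def)
 moreover have "cls q (scalar c) \<odot>\<^bsub>M\<^esub> x \<in> H" if "x \<in> H" for c x
  using N.smult_closed[of c x] that by (simp add: vector_space_of_def)
 ultimately show ?thesis
  using Q(1) QS unfolding cv.subspace_def by (auto simp: ev_0 ev_add ev_scale)
qed

text \<open>Finite generation over the field is finite dimension. The finite set \<open>G\<close>
  need not lie in \<open>Q\<close>, but it bounds the size of a maximal independent subset of
  \<open>Q\<close>, which does.\<close>

lemma restricted_fg_iff:
 assumes Q: "cv.subspace Q" "Q \<subseteq> S"
 shows "finitely_generated complex_field ((vector_space_of q M)\<lparr>carrier := ev ` Q\<rparr>) \<longleftrightarrow>
  (\<exists>G. finite G \<and> Q \<subseteq> cv.span G)" (is "finitely_generated _ ?W \<longleftrightarrow> _")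
proof
 assume "finitely_generated complex_field ?W"
 then obtain T where T: "finite T" "T \<subseteq> ev ` Q" "generated_submodule complex_field ?W T = ev ` Q"
  by (auto simp: finitely_generated_def vector_space_of_def)
 let ?G = "ev -` T \<inter> S"
 have "finite ?G" using T(1) ev_bij by (intro finite_vimage_IntI) (auto simp: bij_betw_def)
 moreover have "Q \<subseteq> cv.span ?G"
 proof
  fix x assume x: "x \<in> Q"
  have "submodule (ev ` (Q \<inter> cv.span ?G)) complex_field ?W"
   by (rule restricted_submodule[OF Q]) (use Q in \<open>auto intro: cv.subspace_inter\<close>)
  moreover have "T \<subseteq> ev ` (Q \<inter> cv.span ?G)"
  proof
   fix t assume t: "t \<in> T"
   then obtain y where "y \<in> Q" "t = ev y" using T(2) by blast
   then show "t \<in> ev ` (Q \<inter> cv.span ?G)" using t Q(2) by (intro image_eqI[of _ _ y]) (auto intro: cv.span_base)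
  qed
  ultimately have "ev ` Q \<subseteq> ev ` (Q \<inter> cv.span ?G)" using T(3) unfolding generated_submodule_def by blast
  then have "ev x \<in> ev ` (Q \<inter> cv.span ?G)" using x by blast
  then show "x \<in> cv.span ?G" using x Q(2) ev_inj by (auto simp: subset_iff)
 qed
 ultimately show "\<exists>G. finite G \<and> Q \<subseteq> cv.span G" by blast
next
 assume "\<exists>G. finite G \<and> Q \<subseteq> cv.span G"
 then obtain G where G: "finite G" "Q \<subseteq> cv.span G" by blast
 obtain B where B: "B \<subseteq> Q" "cv.independent B" "Q \<subseteq> cv.span B"
  by (rule cv.maximal_independent_subset)
 have "finite B" using cv.independent_span_bound[OF G(1) B(2)] B(1) G(2) by auto
 show "finitely_generated complex_field ?W"
  unfolding finitely_generated_def
 proof (intro exI[of _ "ev ` B"] conjI)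
  show "finite (ev ` B)" "ev ` B \<subseteq> carrier ?W" using \<open>finite B\<close> B by auto
  have "generated_submodule complex_field ?W (ev ` B) = ev ` Q"
  proof
   show "generated_submodule complex_field ?W (ev ` B) \<subseteq> ev ` Q"
    unfolding generated_submodule_def using restricted_submodule[OF Q Q(1) order_refl] B(1) by blast
   show "ev ` Q \<subseteq> generated_submodule complex_field ?W (ev ` B)"
    unfolding generated_submodule_def
   proof (rule Inter_greatest)
    fix H assume H: "H \<in> {N. submodule N complex_field ?W \<and> ev ` B \<subseteq> N}"
    then have "cv.span B \<subseteq> {x \<in> Q. ev x \<in> H}"
     using B(1) by (intro span_subset_subspace restricted_submodule_sub[OF Q]) auto
    then show "ev ` Q \<subseteq> H" using B(3) by auto
   qed
  qed
  then show "generated_submodule complex_field ?W (ev ` B) = carrier ?W" by simp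
 qed
qed

lemma gen_ring_orbit:
 assumes P: "cv.subspace P" "P \<subseteq> S" and H: "\<And>h x. h \<in> H \<Longrightarrow> x \<in> P \<Longrightarrow> h \<odot>\<^bsub>M\<^esub> ev x \<in> ev ` P"
  and HU: "H \<subseteq> carrier (U q)" and a: "a \<in> generate_ring (U q) H" and x: "x \<in> P"
 shows "a \<odot>\<^bsub>M\<^esub> ev x \<in> ev ` P"
proof -
 note car = R.generate_ring_in_carrier[OF HU]
 have PS: "x \<in> S" if "x \<in> P" for x using P that by auto
 show ?thesis
  using a x
 proof (induct arbitrary: x rule: generate_ring.induct)
  case one
  then show ?case using PS by auto
 next
  case (incl h)
  then show ?case using H by blast
 next
  case (a_inv h)
  obtain y where y: "y \<in> P" "h \<odot>\<^bsub>M\<^esub> ev x = ev y" using a_inv by blast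
  obtain h' where h': "h = cls q h'" using car[OF a_inv(1)] carrier_U by blast
  have "\<ominus>\<^bsub>U q\<^esub> h = cls q (- h')"
   by (rule R.minus_equality) (use cls_simps(2)[of q "- h'" h'] in \<open>auto simp: h' cls_simps(1) cls_zero\<close>)
  then have "\<ominus>\<^bsub>U q\<^esub> h \<odot>\<^bsub>M\<^esub> ev x = ev (act op (- h') x)" using ev_act PS[OF a_inv(3)] by simp
  also have "act op (- h') x = - y"
  proof -
   have "ev (act op h' x) = ev y" using y h' ev_act PS[OF a_inv(3)] by simp
   then show ?thesis using ev_inj[of "act op h' x" y] PS y a_inv(3) by (simp add: act_uminus)
  qed
  finally show ?case using y P(1) by (auto simp: cv.subspace_neg)
 next
  case (eng_add h1 h2)
  obtain y1 y2 where "y1 \<in> P" "h1 \<odot>\<^bsub>M\<^esub> ev x = ev y1" "y2 \<in> P" "h2 \<odot>\<^bsub>M\<^esub> ev x = ev y2"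
   using eng_add(2)[OF eng_add(5)] eng_add(4)[OF eng_add(5)] by blast
  then show ?case using car[OF eng_add(1)] car[OF eng_add(3)] PS eng_add(5) P(1)
   by (auto simp: smult_l_distr cv.subspace_add simp flip: ev_add)
 next
  case (eng_mult h1 h2)
  obtain y2 where y2: "y2 \<in> P" "h2 \<odot>\<^bsub>M\<^esub> ev x = ev y2" using eng_mult(4)[OF eng_mult(5)] by blast
  have "(h1 \<otimes>\<^bsub>U q\<^esub> h2) \<odot>\<^bsub>M\<^esub> ev x = h1 \<odot>\<^bsub>M\<^esub> ev y2"
   using car[OF eng_mult(1)] car[OF eng_mult(3)] PS eng_mult(5) y2 by (simp add: smult_assoc1)
  then show ?case using eng_mult(2)[OF y2(1)] by simp
 qed
qed

definition orb :: "ualg set \<Rightarrow> 'a \<Rightarrow> 'a set" where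
 "orb A x = {y \<in> S. \<exists>a\<in>A. ev y = a \<odot>\<^bsub>M\<^esub> ev x}"

lemma subalg_carrier: "T \<subseteq> carrier (U q) \<Longrightarrow> subalgebra_generated q T \<subseteq> carrier (U q)"
 unfolding subalgebra_generated_def using cls_simps(1) by (intro R.generate_ring_incl) auto

lemma orb_props:
 assumes T: "T \<subseteq> carrier (U q)" and x: "x \<in> S" defines "A \<equiv> subalgebra_generated q T"
 shows "cv.subspace (orb A x)" "orb A x \<subseteq> S" "ev ` orb A x = (\<lambda>a. a \<odot>\<^bsub>M\<^esub> ev x) ` A"
proof -
 note AU = subalg_carrier[OF T, folded A_def]
 have cl: "\<zero>\<^bsub>U q\<^esub> \<in> A" "a \<in> A \<Longrightarrow> b \<in> A \<Longrightarrow> a \<oplus>\<^bsub>U q\<^esub> b \<in> A" "a \<in> A \<Longrightarrow> cls q (scalar c) \<otimes>\<^bsub>U q\<^esub> a \<in> A" for a b c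
  unfolding A_def subalgebra_generated_def
  by (auto intro: R.zero_in_generate generate_ring.eng_add generate_ring.eng_mult generate_ring.incl)
 show "orb A x \<subseteq> S" by (auto simp: orb_def)
 show "cv.subspace (orb A x)"
  unfolding cv.subspace_def
 proof (intro conjI ballI allI)
  show "0 \<in> orb A x" using cl(1) x by (auto simp: orb_def ev_0 smult_zero intro!: bexI[of _ "\<zero>\<^bsub>U q\<^esub>"])
  fix y y' assume "y \<in> orb A x" "y' \<in> orb A x"
  then obtain a a' where "y \<in> S" "a \<in> A" "ev y = a \<odot>\<^bsub>M\<^esub> ev x" "y' \<in> S" "a' \<in> A" "ev y' = a' \<odot>\<^bsub>M\<^esub> ev x"
   by (auto simp: orb_def)
  then show "y + y' \<in> orb A x" using x AU cl(2)
   by (auto simp: orb_def ev_add smult_l_distr subset_iff intro!: bexI[of _ "a \<oplus>\<^bsub>U q\<^esub> a'"])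
 next
  fix c y assume "y \<in> orb A x"
  then obtain a where "y \<in> S" "a \<in> A" "ev y = a \<odot>\<^bsub>M\<^esub> ev x" by (auto simp: orb_def)
  then show "c *s y \<in> orb A x" using x AU cl(3)
   by (auto simp: orb_def ev_scale smult_assoc1 subset_iff cls_simps intro!: bexI[of _ "cls q (scalar c) \<otimes>\<^bsub>U q\<^esub> a"])
 qed
 show "ev ` orb A x = (\<lambda>a. a \<odot>\<^bsub>M\<^esub> ev x) ` A"
 proof
  show "(\<lambda>a. a \<odot>\<^bsub>M\<^esub> ev x) ` A \<subseteq> ev ` orb A x"
  proof
   fix v assume "v \<in> (\<lambda>a. a \<odot>\<^bsub>M\<^esub> ev x) ` A"
   then obtain a where a: "a \<in> A" "v = a \<odot>\<^bsub>M\<^esub> ev x" by blast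
   then have "v \<in> carrier M" using AU x by auto
   then obtain y where y: "y \<in> S" "v = ev y" using ev_surj by blast
   have "ev y = a \<odot>\<^bsub>M\<^esub> ev x" unfolding y(2)[symmetric] by (rule a(2))
   then have "y \<in> orb A x" using y(1) a(1) unfolding orb_def by blast
   then show "v \<in> ev ` orb A x" unfolding y(2) by (rule imageI)
  qed
 qed (auto simp: orb_def)
qed

lemma EX_U: "{cls q eE, cls q eX} \<subseteq> carrier (U q)" by (simp add: cls_simps)

text \<open>All powers of \<open>E\<close> and of \<open>X\<close> applied to \<open>x\<close> lie
  in the orbit of \<open>x\<close> under the subalgebra, which is finite-dimensional.\<close>

lemma locally_finite_dest:
 assumes "locally_finite q (subalgebra_generated q {cls q eE, cls q eX}) M" "x \<in> S"
 shows "\<exists>G. finite G \<and> (\<forall>r. (op gX ^^ r) x \<in> cv.span G \<and> (op gE ^^ r) x \<in> cv.span G)"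
proof -
 let ?A = "subalgebra_generated q {cls q eE, cls q eX}"
 note Q = orb_props[OF EX_U assms(2)]
 have "finitely_generated complex_field ((vector_space_of q M)\<lparr>carrier := ev ` orb ?A x\<rparr>)"
  using assms unfolding locally_finite_def Q(3) by simp
 then obtain G where G: "finite G" "orb ?A x \<subseteq> cv.span G" using restricted_fg_iff[OF Q(1,2)] by blast
 have pow: "(op g ^^ r) x \<in> orb ?A x" if g: "g = gE \<or> g = gX" for g r
 proof -
  have mem: "cls q (letter g ^ r) \<in> ?A"
  proof (induct r)
   case 0
   show ?case by (simp add: cls_simps subalgebra_generated_def generate_ring.one)
  next
   case (Suc r)
   have "cls q (letter g) \<in> ?A"
    unfolding subalgebra_generated_def using g by (auto intro: generate_ring.incl)
   then show ?case using Suc unfolding subalgebra_generated_def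
    by (simp add: cls_simps generate_ring.eng_mult)
  qed
  have "act op (letter g ^ r) x = (op g ^^ r) x"
   by (induct r) (simp_all add: act_simps act_mult[OF lop] act_one[OF lop])
  then have "ev ((op g ^^ r) x) = cls q (letter g ^ r) \<odot>\<^bsub>M\<^esub> ev x" "(op g ^^ r) x \<in> S"
   using ev_act[OF assms(2), of "letter g ^ r"] act_S[OF assms(2), of "letter g ^ r"] by simp_all
  then show ?thesis using mem by (auto simp: orb_def)
 qed
 show ?thesis using G pow by blast
qed

text \<open>A finite-dimensional subspace that contains \<open>x\<close> and is closed under
  \<open>E\<close> and \<open>X\<close> contains the orbit of \<open>x\<close> under the generated
  subalgebra.\<close>

lemma locally_finite_intro:
 assumes "\<And>x. x \<in> S \<Longrightarrow> \<exists>G. finite G \<and> G \<subseteq> S \<and> x \<in> cv.span G \<and>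
  (\<forall>x\<in>cv.span G. op gE x \<in> cv.span G \<and> op gX x \<in> cv.span G)"
 shows "locally_finite q (subalgebra_generated q {cls q eE, cls q eX}) M"
 unfolding locally_finite_def
proof
 let ?A = "subalgebra_generated q {cls q eE, cls q eX}"
 fix v assume "v \<in> carrier M"
 then obtain x where x: "x \<in> S" "v = ev x" using ev_surj by blast
 obtain G where G: "finite G" "G \<subseteq> S" "x \<in> cv.span G"
  "\<forall>x\<in>cv.span G. op gE x \<in> cv.span G \<and> op gX x \<in> cv.span G" using assms[OF x(1)] by blast
 have GS: "cv.span G \<subseteq> S" by (rule span_subset_subspace[OF G(2) subS])
 note Q = orb_props[OF EX_U x(1)]
 have "orb ?A x \<subseteq> cv.span G"
 proof
  fix y assume "y \<in> orb ?A x"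
  then obtain a where a: "y \<in> S" "a \<in> ?A" "ev y = a \<odot>\<^bsub>M\<^esub> ev x" by (auto simp: orb_def)
  have "a \<odot>\<^bsub>M\<^esub> ev x \<in> ev ` cv.span G"
  proof (rule gen_ring_orbit[OF cv.subspace_span GS _ _ a(2)[unfolded subalgebra_generated_def] G(3)])
   fix h y assume h: "h \<in> range (\<lambda>c. cls q (scalar c)) \<union> {cls q eE, cls q eX}" and y: "y \<in> cv.span G"
   have yS: "y \<in> S" using GS y by blast
   consider c where "h = cls q (scalar c)" | "h = cls q eE" | "h = cls q eX" using h by blast
   then show "h \<odot>\<^bsub>M\<^esub> ev y \<in> ev ` cv.span G"
    by cases (use y G(4) yS in \<open>auto intro: cv.span_scale simp flip: ev_scale ev_op\<close>)
  qed (auto simp: cls_simps)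
  then show "y \<in> cv.span G" using a GS ev_inj by (auto simp: subset_iff)
 qed
 then show "finitely_generated complex_field ((vector_space_of q M)\<lparr>carrier := (\<lambda>a. a \<odot>\<^bsub>M\<^esub> v) ` ?A\<rparr>)"
  using restricted_fg_iff[OF Q(1,2)] G(1) unfolding x(2) Q(3)[symmetric] by blast
qed

lemma act_pow: "act op (a ^ k) x = (act op a ^^ k) x"
 by (induct k) (simp_all add: act_mult[OF lop] act_one[OF lop])

end

lemma central_gens: "range (\<lambda>c. cls q (scalar c)) \<union> {cls q eZ, cls q (elemCtilde q)} \<subseteq> carrier (U q)"
 by (auto simp: cls_simps)

lemma central_carrier: "carrier (central_subalgebra q) =
  generate_ring (U q) (range (\<lambda>c. cls q (scalar c)) \<union> {cls q eZ, cls q (elemCtilde q)})"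
 by (simp add: central_subalgebra_def subalgebra_generated_def)

lemma central_ring: "ring (central_subalgebra q)"
 unfolding central_subalgebra_def subalgebra_generated_def
 by (rule ring.generate_ring_is_ring[OF U_ring central_gens])

lemma central_simps: "x \<otimes>\<^bsub>central_subalgebra q\<^esub> y = x \<otimes>\<^bsub>U q\<^esub> y" "x \<oplus>\<^bsub>central_subalgebra q\<^esub> y = x \<oplus>\<^bsub>U q\<^esub> y"
 "\<zero>\<^bsub>central_subalgebra q\<^esub> = \<zero>\<^bsub>U q\<^esub>" "\<one>\<^bsub>central_subalgebra q\<^esub> = \<one>\<^bsub>U q\<^esub>"
 by (simp_all add: central_subalgebra_def)

lemma central_diff: assumes "a = eZ \<or> a = elemCtilde q" shows "cls q (a - scalar c) \<in> carrier (central_subalgebra q)"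
proof -
 have "a - scalar c = a + scalar (- c)" by (simp add: scalar_def single_uminus)
 then have "cls q (a - scalar c) = cls q a \<oplus>\<^bsub>U q\<^esub> cls q (scalar (- c))" by (simp only: cls_simps)
 then show ?thesis unfolding central_carrier using assms
  by (auto intro!: generate_ring.eng_add intro: generate_ring.incl)
qed

lemma ideals_pow: "I [^]\<^bsub>ideals_set R\<^esub> (0::nat) = carrier R"
 "I [^]\<^bsub>ideals_set R\<^esub> (Suc k) = ideal_prod R (I [^]\<^bsub>ideals_set R\<^esub> k) I"
 by (simp_all add: ideals_set_def nat_pow_def)

text \<open>The \<open>k\<close>-th power of an ideal contains the \<open>k\<close>-th powers of its
  elements, in particular those of the two generators.\<close>

lemma (in pres) block_pow:
 assumes "M \<in> block q \<xi> c z"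
 shows "\<exists>k. \<forall>x\<in>S. (act op (elemCtilde q - scalar c) ^^ k) x = 0 \<and> (act op (eZ - scalar z) ^^ k) x = 0"
proof -
 let ?I = "central_ideal q c z" and ?R = "central_subalgebra q"
 obtain k :: nat where k: "\<And>a v. a \<in> ?I [^]\<^bsub>ideals_set ?R\<^esub> k \<Longrightarrow> v \<in> carrier M \<Longrightarrow> a \<odot>\<^bsub>M\<^esub> v = \<zero>\<^bsub>M\<^esub>"
  using assms by (auto simp: block_def)
 have mem: "cls q (a ^ k) \<in> ?I [^]\<^bsub>ideals_set ?R\<^esub> k" if a: "cls q a \<in> ?I" for a k
 proof (induct k)
  case 0
  show ?case unfolding ideals_pow by (simp add: central_carrier cls_simps generate_ring.one)
 next
  case (Suc k)
  have "cls q (a ^ Suc k) = cls q (a ^ k) \<otimes>\<^bsub>?R\<^esub> cls q a"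
   by (simp only: power_Suc2 cls_simps central_simps)
  then show ?case unfolding ideals_pow using Suc a by (auto intro: ideal_prod.prod)
 qed
 have gen: "cls q (elemCtilde q - scalar c) \<in> ?I" "cls q (eZ - scalar z) \<in> ?I"
  unfolding central_ideal_def genideal_def by auto
 have "(act op a ^^ k) x = 0" if "cls q a \<in> ?I" "x \<in> S" for a x
  using k[OF mem[OF that(1)], of "ev x"] that(2) ev_eq_0[of "act op (a ^ k) x"]
  by (simp add: ev_act act_pow[symmetric])
 then show ?thesis using gen by blast
qed

locale cps = cpres q z M S op ev + qsp q z s N for q z and M :: "(ualg, 'v) module" and S :: "'a::cvec set" and op ev s N
begin

lemma act_N: "x \<in> S \<Longrightarrow> act op (elemCtilde q - scalar c) x = Ct x - c *s x"
 by (simp add: act_simps act_Ct)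

lemma act_N_pow: "x \<in> S \<Longrightarrow> ((\<lambda>x. Ct x - c *s x) ^^ k) x = (act op (elemCtilde q - scalar c) ^^ k) x"
proof -
 assume x: "x \<in> S"
 have "(act op (elemCtilde q - scalar c) ^^ k) x \<in> S \<and>
   ((\<lambda>x. Ct x - c *s x) ^^ k) x = (act op (elemCtilde q - scalar c) ^^ k) x"
 proof (induct k)
  case (Suc k)
  then show ?case using act_N[of "(act op (elemCtilde q - scalar c) ^^ k) x" c] by simp
 qed (use x in simp)
 then show ?thesis by blast
qed

lemma block_dest:
 assumes "M \<in> block q (half_coset q s) (ctilde q z l0) z"
 shows "qsb q z S (op gE) (op gF) (op gK) (op gKi) (op gX) (op gY) s N"
proof (intro qsb.intro qsb_axioms.intro qs_axioms qsp_axioms)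
 have M: "weight_module q M" "supp q M \<subseteq> half_coset q s"
  "locally_finite q (subalgebra_generated q {cls q eE, cls q eX}) M"
  using assms by (auto simp: block_def category_O_def)
 show "S \<subseteq> cv.span (\<Union>l\<in>half_coset q s. {m \<in> S. op gK m = l *s m})"
  by (rule weight_module_dest[OF M(1,2)])
 show "(\<exists>r. (op gX ^^ r) m = 0) \<and> (\<exists>r. (op gE ^^ r) m = 0)"
  if lm: "l \<in> half_coset q s" "m \<in> S" "op gK m = l *s m" for l m
 proof -
  obtain G where "finite G" "\<forall>r. (op gX ^^ r) m \<in> cv.span G \<and> (op gE ^^ r) m \<in> cv.span G"
   using locally_finite_dest[OF M(3) lm(2)] by blast
  then show ?thesis using nil_if_finite[OF hc_nz[OF lm(1)] lm(2,3), of G] by blast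
 qed
 obtain k where k: "\<forall>x\<in>S. (act op (elemCtilde q - scalar (ctilde q z l0)) ^^ k) x = 0"
  using block_pow[OF assms] by blast
 show "\<exists>k. \<forall>m\<in>S. ((\<lambda>m. Ct m - ctilde q z l0 *s m) ^^ k) m = 0"
  using k act_N_pow by (intro exI[of _ k]) simp
qed

text \<open>The annihilator of the filtration \<open>0 \<subseteq> T \<subseteq> S\<close> with \<open>T\<close> the kernel of
 \<open>Ct - c\<close> is an ideal containing the generators, hence the square of the ideal acts by zero.\<close>

lemma central_square:
 fixes c :: complex
 assumes N2: "\<And>x. x \<in> S \<Longrightarrow> Ct (Ct x - c *s x) = c *s (Ct x - c *s x)"
  and a: "a \<in> central_ideal q c z [^]\<^bsub>ideals_set (central_subalgebra q)\<^esub> (2::nat)" and v: "v \<in> carrier M"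
 shows "a \<odot>\<^bsub>M\<^esub> v = \<zero>\<^bsub>M\<^esub>"
proof -
 let ?R = "central_subalgebra q" and ?I = "central_ideal q c z"
 define T where "T = {x \<in> S. Ct x = c *s x}"
 have T: "cv.subspace T" "T \<subseteq> S"
  by (auto simp: T_def cv.subspace_def clin[OF linCt] cv.scale_right_distrib mult.commute)
 note Tc = cv.subspace_0[OF T(1)] cv.subspace_add[OF T(1)] cv.subspace_neg[OF T(1)]
 note mult = act_mult[OF lop]
 interpret C: ring ?R by (rule central_ring)
 have rep: "\<exists>b. a = cls q b" if "a \<in> carrier ?R" for a
  using that R.generate_ring_in_carrier[OF central_gens] carrier_U unfolding central_carrier by blast
 have pres: "act op b x \<in> T" if b: "cls q b \<in> carrier ?R" and x: "x \<in> T" for b x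
 proof -
  have "cls q b \<odot>\<^bsub>M\<^esub> ev x \<in> ev ` T"
  proof (rule gen_ring_orbit[OF T _ central_gens b[unfolded central_carrier] x])
   fix h y assume h: "h \<in> range (\<lambda>c. cls q (scalar c)) \<union> {cls q eZ, cls q (elemCtilde q)}" and y: "y \<in> T"
   have yS: "y \<in> S" and Cy: "Ct y = c *s y" using y by (auto simp: T_def)
   obtain b where b: "h = cls q b" "b \<in> range scalar \<union> {eZ, elemCtilde q}" using h by blast
   have "\<exists>d. act op b y = d *s y"
    using b(2) opZ[OF yS] act_Ct[OF yS] Cy by (auto simp: act_simps)
   then have "act op b y \<in> T" using cv.subspace_scale[OF T(1) y] by auto
   then show "h \<odot>\<^bsub>M\<^esub> ev y \<in> ev ` T" unfolding b(1) ev_act[OF yS, symmetric] by (rule imageI)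
  qed
  then obtain y where y: "y \<in> T" "ev (act op b x) = ev y" using ev_act T(2) x by (metis imageE subsetD)
  have "act op b x \<in> S" "y \<in> S" using T(2) x y(1) by auto
  then have "act op b x = y" using ev_inj y(2) by blast
  then show ?thesis using y(1) by simp
 qed
 define P where "P b \<longleftrightarrow> (\<forall>x\<in>S. act op b x \<in> T) \<and> (\<forall>x\<in>T. act op b x = 0)" for b
 define D where "D = carrier ?R \<inter> cls q ` Collect P"
 have DI: "cls q b \<in> D" if "cls q b \<in> carrier ?R" "P b" for b using that by (simp add: D_def)
 have PS: "P b \<Longrightarrow> x \<in> S \<Longrightarrow> act op b x \<in> T" "P b \<Longrightarrow> x \<in> T \<Longrightarrow> act op b x = 0" for b x by (simp_all add: P_def)
 have P: "P 0" "\<And>b b'. P b \<Longrightarrow> P b' \<Longrightarrow> P (b + b')" "\<And>b. P b \<Longrightarrow> P (- b)"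
  by (auto simp: P_def act_add act_uminus Tc)
 have P': "P (r * b)" "P (b * r)" if "P b" "cls q r \<in> carrier ?R" for b r
  using that T(2) pres by (auto simp: P_def mult clin[OF lin_act[OF lop]])
 have D: "ideal D ?R"
 proof (rule idealI[OF central_ring])
  show "subgroup D (add_monoid ?R)"
  proof (rule subgroup.intro)
   show "D \<subseteq> carrier (add_monoid ?R)" by (auto simp: D_def)
   show "\<one>\<^bsub>add_monoid ?R\<^esub> \<in> D"
    using DI[OF _ P(1)] C.zero_closed by (simp add: central_simps cls_zero)
   show "a \<otimes>\<^bsub>add_monoid ?R\<^esub> b \<in> D" if ab: "a \<in> D" "b \<in> D" for a b
   proof -
    obtain a' b' where a': "a = cls q a'" "P a'" "b = cls q b'" "P b'" using ab unfolding D_def by blast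
    have "cls q a' \<oplus>\<^bsub>?R\<^esub> cls q b' \<in> carrier ?R" using ab a' C.add.m_closed by (simp add: D_def)
    then show ?thesis using DI[OF _ P(2)[OF a'(2,4)]] by (simp add: a' central_simps cls_simps)
   qed
   show "inv\<^bsub>add_monoid ?R\<^esub> a \<in> D" if a: "a \<in> D" for a
   proof -
    obtain a' where a': "a = cls q a'" "P a'" using a unfolding D_def by blast
    have aR: "a \<in> carrier ?R" using a by (simp add: D_def)
    obtain b where b: "\<ominus>\<^bsub>?R\<^esub> a = cls q b" using rep[OF C.a_inv_closed[OF aR]] by blast
    have 1: "cls q b \<oplus>\<^bsub>U q\<^esub> cls q a' = \<zero>\<^bsub>U q\<^esub>" using C.l_neg[OF aR] unfolding b unfolding a'(1) central_simps .
    have 2: "cls q (- a') \<oplus>\<^bsub>U q\<^esub> cls q a' = \<zero>\<^bsub>U q\<^esub>" by (simp add: cls_zero flip: cls_simps)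
    have "cls q b = cls q (- a')"
     using R.minus_equality[OF 1 cls_simps(1) cls_simps(1)] R.minus_equality[OF 2 cls_simps(1) cls_simps(1)] by simp
    then show ?thesis using DI[OF _ P(3)[OF a'(2)]] C.a_inv_closed[OF aR] b by (simp add: a_inv_def)
   qed
  qed
  fix d r assume d: "d \<in> D" and r: "r \<in> carrier ?R"
  obtain d' r' where e: "d = cls q d'" "P d'" "r = cls q r'" using d rep[OF r] unfolding D_def by blast
  have "r \<otimes>\<^bsub>?R\<^esub> d \<in> carrier ?R" "d \<otimes>\<^bsub>?R\<^esub> r \<in> carrier ?R" using d r C.m_closed by (simp_all add: D_def)
  then show "r \<otimes>\<^bsub>?R\<^esub> d \<in> D" "d \<otimes>\<^bsub>?R\<^esub> r \<in> D"
   using DI[OF _ P'(1)[OF e(2)]] DI[OF _ P'(2)[OF e(2)]] r by (simp_all add: e central_simps flip: cls_simps(3))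
 qed
 have "cls q (elemCtilde q - scalar c) \<in> D" "cls q (eZ - scalar z) \<in> D"
  by (rule DI; use central_diff N2 T(2) Tc(1) in \<open>auto simp: P_def T_def act_N subset_iff\<close>)
   (rule DI; use central_diff opZ T(2) Tc(1) in \<open>auto simp: P_def act_simps subset_iff\<close>)
 then have ID: "?I \<subseteq> D"
  unfolding central_ideal_def by (intro C.genideal_minimal[OF D]) auto
 \<comment> \<open>The square of the ideal unfolds to \<open>(R * I) * I\<close>, the zeroth power
   being the whole ring \<open>R\<close>; so \<open>R * I\<close> has to be placed in
   \<open>D\<close> as well.\<close>
 have 1: "b \<in> D" if "b \<in> ideal_prod ?R (carrier ?R) ?I" for b
  using that
 proof (induct rule: ideal_prod.induct)
  case (prod i j)
  then show ?case using ID D by (auto intro: ideal.I_l_closed)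
 next
  case (sum s1 s2)
  then show ?case using D by (auto intro: additive_subgroup.a_closed ideal.axioms(1))
 qed
 have "a \<in> ideal_prod ?R (ideal_prod ?R (carrier ?R) ?I) ?I"
  using a unfolding numeral_2_eq_2 ideals_pow .
 then have "\<exists>b. a = cls q b \<and> (\<forall>x\<in>S. act op b x = 0)"
 proof (induct rule: ideal_prod.induct)
  case (prod i j)
  then obtain i' j' where e: "i = cls q i'" "P i'" "j = cls q j'" "P j'" using 1 ID unfolding D_def by blast
  then show ?case using PS by (intro exI[of _ "i' * j'"]) (simp add: central_simps cls_simps mult)
 next
  case (sum s1 s2)
  then obtain b1 b2 where "s1 = cls q b1" "\<forall>x\<in>S. act op b1 x = 0" "s2 = cls q b2" "\<forall>x\<in>S. act op b2 x = 0" by blast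
  then show ?case by (intro exI[of _ "b1 + b2"]) (simp add: central_simps cls_simps act_add)
 qed
 then obtain b where b: "a = cls q b" "\<And>x. x \<in> S \<Longrightarrow> act op b x = 0" by blast
 obtain x where x: "x \<in> S" "v = ev x" using ev_surj[OF v] by blast
 show ?thesis unfolding b(1) x(2) ev_act[OF x(1), symmetric] b(2)[OF x(1)] by (rule ev_0)
qed

text \<open>The exponent \<open>2\<close> comes from \<open>Nq_Nq\<close>: the central element minus
  its scalar squares to zero on such a module.\<close>

lemma block_intro:
 assumes "qsh q z S (op gE) (op gF) (op gK) (op gKi) (op gX) (op gY) s N B"
 shows "M \<in> block q (half_coset q s) (ctilde q z l0) z"
proof -
 interpret H: qsh q z S "op gE" "op gF" "op gK" "op gKi" "op gX" "op gY" s N B by (rule assms)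
 have z0: "0 \<notin> half_coset q s" using hc_nz by blast
 have "finitely_generated (U q) M"
 proof (rule fg_intro[OF H.finB H.BS])
  fix P assume P: "opstable P" "B \<subseteq> P"
  then have "cv.span (fam B) \<subseteq> P" using opstable_iff stable_fam by blast
  then show "S \<subseteq> P" using H.gen by blast
 qed
 moreover have "locally_finite q (subalgebra_generated q {cls q eE, cls q eX}) M"
  by (rule locally_finite_intro, rule H.loc_fin)
 moreover have "\<exists>k::nat. \<forall>a \<in> central_ideal q (ctilde q z l0) z [^]\<^bsub>ideals_set (central_subalgebra q)\<^esub> k.
      \<forall>v\<in>carrier M. a \<odot>\<^bsub>M\<^esub> v = \<zero>\<^bsub>M\<^esub>"
 proof (intro exI[of _ 2] ballI)
  fix a v assume a: "a \<in> central_ideal q (ctilde q z l0) z [^]\<^bsub>ideals_set (central_subalgebra q)\<^esub> (2::nat)"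
   and v: "v \<in> carrier M"
  show "a \<odot>\<^bsub>M\<^esub> v = \<zero>\<^bsub>M\<^esub>"
  proof (rule central_square[OF _ a v])
   fix x assume "x \<in> S"
   then show "Ct (Ct x - ctilde q z l0 *s x) = ctilde q z l0 *s (Ct x - ctilde q z l0 *s x)"
    using H.Nq_Nq[of x] by (simp add: H.Nq_def)
  qed
 qed
 ultimately show ?thesis
  unfolding block_def category_O_def
  using lmod weight_module_intro[OF H.weights z0] by simp
qed

end

section \<open>Quotients and Verma modules\<close>

lemma linear_mapsD:
 assumes "f \<in> linear_maps R M M'"
 shows "x \<in> carrier M \<Longrightarrow> f x \<in> carrier M'"
  "x \<in> carrier M \<Longrightarrow> y \<in> carrier M \<Longrightarrow> f (x \<oplus>\<^bsub>M\<^esub> y) = f x \<oplus>\<^bsub>M'\<^esub> f y"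
  "a \<in> carrier R \<Longrightarrow> x \<in> carrier M \<Longrightarrow> f (a \<odot>\<^bsub>M\<^esub> x) = a \<odot>\<^bsub>M'\<^esub> f x"
 using assms by (auto simp: linear_maps_def)

lemma linear_map_zero_neg:
 assumes f: "f \<in> linear_maps R M M'" and M: "abelian_group M" and M': "abelian_group M'"
 shows "f \<zero>\<^bsub>M\<^esub> = \<zero>\<^bsub>M'\<^esub>" "x \<in> carrier M \<Longrightarrow> f (\<ominus>\<^bsub>M\<^esub> x) = \<ominus>\<^bsub>M'\<^esub> f x"
proof -
 interpret M: abelian_group M by (rule M)
 interpret M': abelian_group M' by (rule M')
 note f' = linear_mapsD[OF f]
 have "f \<zero>\<^bsub>M\<^esub> \<oplus>\<^bsub>M'\<^esub> f \<zero>\<^bsub>M\<^esub> = f \<zero>\<^bsub>M\<^esub>" using f'(2)[of "\<zero>\<^bsub>M\<^esub>" "\<zero>\<^bsub>M\<^esub>"] by simp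
 then show 0: "f \<zero>\<^bsub>M\<^esub> = \<zero>\<^bsub>M'\<^esub>" using f'(1)[of "\<zero>\<^bsub>M\<^esub>"] by (simp add: M'.add.l_cancel_one)
 assume x: "x \<in> carrier M"
 have "f (\<ominus>\<^bsub>M\<^esub> x) \<oplus>\<^bsub>M'\<^esub> f x = \<zero>\<^bsub>M'\<^esub>" using f'(2)[of "\<ominus>\<^bsub>M\<^esub> x" x] x 0 by (simp add: M.l_neg)
 then have "\<ominus>\<^bsub>M'\<^esub> f x = f (\<ominus>\<^bsub>M\<^esub> x)" by (rule M'.minus_equality) (use x f' in auto)
 then show "f (\<ominus>\<^bsub>M\<^esub> x) = \<ominus>\<^bsub>M'\<^esub> f x" ..
qed

lemma submodule_by_closure:
 assumes "left_module R M" "H \<subseteq> carrier M" "\<zero>\<^bsub>M\<^esub> \<in> H" "\<And>x. x \<in> H \<Longrightarrow> \<ominus>\<^bsub>M\<^esub> x \<in> H"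
  "\<And>x y. x \<in> H \<Longrightarrow> y \<in> H \<Longrightarrow> x \<oplus>\<^bsub>M\<^esub> y \<in> H" "\<And>a x. a \<in> carrier R \<Longrightarrow> x \<in> H \<Longrightarrow> a \<odot>\<^bsub>M\<^esub> x \<in> H"
 shows "submodule H R M"
 using assms by (intro submodule.intro subgroup.intro submodule_axioms.intro) (auto simp: a_inv_def)

lemma submoduleD:
 assumes "submodule H R M"
 shows "H \<subseteq> carrier M" "\<zero>\<^bsub>M\<^esub> \<in> H" "x \<in> H \<Longrightarrow> y \<in> H \<Longrightarrow> x \<oplus>\<^bsub>M\<^esub> y \<in> H"
  "x \<in> H \<Longrightarrow> \<ominus>\<^bsub>M\<^esub> x \<in> H" "a \<in> carrier R \<Longrightarrow> x \<in> H \<Longrightarrow> a \<odot>\<^bsub>M\<^esub> x \<in> H"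
proof -
 interpret submodule H R M by (rule assms)
 show "H \<subseteq> carrier M" using subset by simp
 show "\<zero>\<^bsub>M\<^esub> \<in> H" using one_closed by simp
 show "x \<in> H \<Longrightarrow> y \<in> H \<Longrightarrow> x \<oplus>\<^bsub>M\<^esub> y \<in> H" using m_closed by simp
 show "x \<in> H \<Longrightarrow> \<ominus>\<^bsub>M\<^esub> x \<in> H" using m_inv_closed by (simp add: a_inv_def)
 show "a \<in> carrier R \<Longrightarrow> x \<in> H \<Longrightarrow> a \<odot>\<^bsub>M\<^esub> x \<in> H" by simp
qed

lemma equalizer_submodule:
 assumes "left_module R M" "left_module R M'" and f: "f \<in> linear_maps R M M'" and g: "g \<in> linear_maps R M M'"
 shows "submodule {x \<in> carrier M. f x = g x} R M"
proof -
 interpret M: left_module R M by (rule assms)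
 interpret M': left_module R M' by (rule assms)
 note z = linear_map_zero_neg[OF f M.M.abelian_group_axioms M'.M.abelian_group_axioms]
  linear_map_zero_neg[OF g M.M.abelian_group_axioms M'.M.abelian_group_axioms]
 show ?thesis
  by (rule submodule_by_closure[OF assms(1)])
   (use linear_mapsD[OF f] linear_mapsD[OF g] z in auto)
qed

lemma vimage_submodule:
 assumes "left_module R M" "left_module R M'" and f: "f \<in> linear_maps R M M'" and H: "submodule H R M'"
 shows "submodule {x \<in> carrier M. f x \<in> H} R M"
proof -
 interpret M: left_module R M by (rule assms)
 interpret M': left_module R M' by (rule assms)
 note z = linear_map_zero_neg[OF f M.M.abelian_group_axioms M'.M.abelian_group_axioms]
 show ?thesis
  by (rule submodule_by_closure[OF assms(1)])
   (use linear_mapsD[OF f] z submoduleD[OF H] in auto)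
qed

lemma image_submodule:
 assumes "left_module R M" "left_module R M'" and f: "f \<in> linear_maps R M M'" and H: "submodule H R M"
 shows "submodule (f ` H) R M'"
proof -
 interpret M: left_module R M by (rule assms)
 interpret M': left_module R M' by (rule assms)
 note z = linear_map_zero_neg[OF f M.M.abelian_group_axioms M'.M.abelian_group_axioms]
 note D = submoduleD[OF H] linear_mapsD[OF f]
 have HC: "x \<in> carrier M" if "x \<in> H" for x using D(1) that by blast
 show ?thesis
 proof (rule submodule_by_closure[OF assms(2)])
  show "f ` H \<subseteq> carrier M'" using HC D(6) by auto
  show "\<zero>\<^bsub>M'\<^esub> \<in> f ` H" using imageI[OF D(2), of f] unfolding z(1) .
  show "\<ominus>\<^bsub>M'\<^esub> x \<in> f ` H" if x: "x \<in> f ` H" for x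
  proof -
   obtain y where y: "y \<in> H" "x = f y" using x by blast
   show ?thesis unfolding y(2) z(2)[OF HC[OF y(1)], symmetric] by (rule imageI[OF D(4)[OF y(1)]])
  qed
  show "x \<oplus>\<^bsub>M'\<^esub> y \<in> f ` H" if xy: "x \<in> f ` H" "y \<in> f ` H" for x y
  proof -
   obtain u v where u: "u \<in> H" "x = f u" "v \<in> H" "y = f v" using xy by blast
   show ?thesis unfolding u(2,4) D(7)[OF HC[OF u(1)] HC[OF u(3)], symmetric]
    by (rule imageI[OF D(3)[OF u(1,3)]])
  qed
  show "a \<odot>\<^bsub>M'\<^esub> x \<in> f ` H" if a: "a \<in> carrier R" and x: "x \<in> f ` H" for a x
  proof -
   obtain y where y: "y \<in> H" "x = f y" using x by blast
   show ?thesis unfolding y(2) D(8)[OF a HC[OF y(1)], symmetric] by (rule imageI[OF D(5)[OF a y(1)]])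
  qed
 qed
qed

lemma zero_submodule:
 assumes "left_module R M" shows "submodule {\<zero>\<^bsub>M\<^esub>} R M"
proof -
 interpret left_module R M by (rule assms)
 have "a \<odot>\<^bsub>M\<^esub> \<zero>\<^bsub>M\<^esub> = \<zero>\<^bsub>M\<^esub>" if "a \<in> carrier R" for a
 proof -
  have "a \<odot>\<^bsub>M\<^esub> \<zero>\<^bsub>M\<^esub> \<oplus>\<^bsub>M\<^esub> a \<odot>\<^bsub>M\<^esub> \<zero>\<^bsub>M\<^esub> = a \<odot>\<^bsub>M\<^esub> \<zero>\<^bsub>M\<^esub>"
   using that smult_r_distr[of a "\<zero>\<^bsub>M\<^esub>" "\<zero>\<^bsub>M\<^esub>"] by simp
  then show ?thesis using that by (simp add: M.add.l_cancel_one)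
 qed
 then show ?thesis by (intro submodule_by_closure[OF assms]) auto
qed

lemma generated_submodule_submodule:
 assumes "left_module R M" "S \<subseteq> carrier M"
 shows "submodule (generated_submodule R M S) R M" "S \<subseteq> generated_submodule R M S"
  "\<And>N. submodule N R M \<Longrightarrow> S \<subseteq> N \<Longrightarrow> generated_submodule R M S \<subseteq> N"
proof -
 interpret left_module R M by (rule assms)
 have c: "submodule (carrier M) R M"
  by (rule submodule_by_closure[OF assms(1)]) auto
 then have "generated_submodule R M S \<subseteq> carrier M"
  using assms(2) unfolding generated_submodule_def by (intro Inter_lower) simp
 then show "submodule (generated_submodule R M S) R M"
  by (intro submodule_by_closure[OF assms(1)]) (auto simp: generated_submodule_def submoduleD)
qed (auto simp: generated_submodule_def)

locale quotient = left_module R M for R :: "('a, 'c) ring_scheme" and M :: "('a, 'b) module" +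
 fixes H assumes H: "submodule H R M"
begin

abbreviation "Q \<equiv> quotient_module M H"
abbreviation "pr x \<equiv> H +>\<^bsub>M\<^esub> x"

sublocale H: abelian_subgroup H M
 by (rule abelian_subgroupI3[OF additive_subgroup.intro[OF submodule.axioms(1)[OF H]] M.abelian_group_axioms])

lemma HC: "x \<in> H \<Longrightarrow> x \<in> carrier M" using submoduleD(1)[OF H] by blast

lemma carrier_Q: "carrier Q = pr ` carrier M"
 by (auto simp: quotient_module_def A_RCOSETS_def')

lemma pr_mem: "y \<in> pr x \<longleftrightarrow> (\<exists>h\<in>H. y = h \<oplus>\<^bsub>M\<^esub> x)" by (auto simp: a_r_coset_def')

lemma pr_self: "x \<in> carrier M \<Longrightarrow> x \<in> pr x" by (rule H.a_rcos_self)

lemma pr_eqI: "y \<in> pr x \<Longrightarrow> x \<in> carrier M \<Longrightarrow> pr y = pr x"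
 using M.a_repr_independence[OF _ _ H.a_subgroup] by (metis)

lemma pr_eq_zero: "x \<in> carrier M \<Longrightarrow> pr x = H \<longleftrightarrow> x \<in> H"
 using H.a_rcos_const pr_self by auto

lemma Q_zero: "\<zero>\<^bsub>Q\<^esub> = H" by (simp add: quotient_module_def)

lemma pr_zero: "pr \<zero>\<^bsub>M\<^esub> = H" using pr_eq_zero[of "\<zero>\<^bsub>M\<^esub>"] H.zero_closed by simp

lemma Q_add: "x \<in> carrier M \<Longrightarrow> y \<in> carrier M \<Longrightarrow> pr x \<oplus>\<^bsub>Q\<^esub> pr y = pr (x \<oplus>\<^bsub>M\<^esub> y)"
 using H.a_rcos_sum by (simp add: quotient_module_def)

lemma Q_smult: assumes "a \<in> carrier R" "x \<in> carrier M" shows "a \<odot>\<^bsub>Q\<^esub> pr x = pr (a \<odot>\<^bsub>M\<^esub> x)"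
proof -
 have "pr (a \<odot>\<^bsub>M\<^esub> y) = pr (a \<odot>\<^bsub>M\<^esub> x)" if y: "y \<in> pr x" for y
 proof -
  obtain h where h: "h \<in> H" "y = h \<oplus>\<^bsub>M\<^esub> x" using y unfolding pr_mem by blast
  have "a \<odot>\<^bsub>M\<^esub> y = a \<odot>\<^bsub>M\<^esub> h \<oplus>\<^bsub>M\<^esub> a \<odot>\<^bsub>M\<^esub> x"
   unfolding h(2) by (rule smult_r_distr[OF assms(1) HC[OF h(1)] assms(2)])
  then have "a \<odot>\<^bsub>M\<^esub> y \<in> pr (a \<odot>\<^bsub>M\<^esub> x)"
   unfolding pr_mem by (intro bexI[of _ "a \<odot>\<^bsub>M\<^esub> h"] submoduleD(5)[OF H assms(1) h(1)])
  then show ?thesis by (rule pr_eqI) (simp add: assms)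
 qed
 then have "(\<Union>y\<in>pr x. pr (a \<odot>\<^bsub>M\<^esub> y)) = (\<Union>y\<in>pr x. pr (a \<odot>\<^bsub>M\<^esub> x))" by (intro SUP_cong refl)
 also have "\<dots> = pr (a \<odot>\<^bsub>M\<^esub> x)" using pr_self[OF assms(2)] by auto
 finally show ?thesis by (simp add: quotient_module_def)
qed

lemma left_module_Q: "left_module R Q"
proof (intro left_module.intro left_module_axioms.intro R.ring_axioms)
 show "abelian_group Q"
 proof (rule abelian_groupI)
  fix x assume "x \<in> carrier Q"
  then obtain y where "y \<in> carrier M" "x = pr y" by (auto simp: carrier_Q)
  then show "\<exists>y\<in>carrier Q. y \<oplus>\<^bsub>Q\<^esub> x = \<zero>\<^bsub>Q\<^esub>"
   by (intro bexI[of _ "pr (\<ominus>\<^bsub>M\<^esub> y)"]) (auto simp: carrier_Q Q_add M.l_neg pr_zero Q_zero)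
 next
  show "\<zero>\<^bsub>Q\<^esub> \<in> carrier Q" using pr_zero by (auto simp: carrier_Q Q_zero intro!: image_eqI[of _ _ "\<zero>\<^bsub>M\<^esub>"])
  show "\<zero>\<^bsub>Q\<^esub> \<oplus>\<^bsub>Q\<^esub> x = x" if "x \<in> carrier Q" for x
   using that Q_add[of "\<zero>\<^bsub>M\<^esub>"] by (auto simp: carrier_Q Q_zero pr_zero)
 qed (auto simp: carrier_Q Q_add M.a_ac)
qed (auto simp: carrier_Q Q_add Q_smult smult_l_distr smult_r_distr smult_assoc1)

lemma pr_linear: "pr \<in> linear_maps R M Q"
 by (auto simp: linear_maps_def carrier_Q Q_add Q_smult)

text \<open>The induced map evaluates \<open>f\<close> at an element picked from the coset; the
  choice is immaterial as \<open>f\<close> kills \<open>H\<close>.\<close>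

lemma factor:
 assumes M': "left_module R M'" and f: "f \<in> linear_maps R M M'" and k: "\<And>x. x \<in> H \<Longrightarrow> f x = \<zero>\<^bsub>M'\<^esub>"
 shows "\<exists>g\<in>linear_maps R Q M'. \<forall>x\<in>carrier M. g (pr x) = f x"
proof -
 interpret M': left_module R M' by (rule M')
 define g where "g C = f (SOME x. x \<in> C)" for C
 have g: "g (pr x) = f x" if x: "x \<in> carrier M" for x
 proof -
  have "(SOME y. y \<in> pr x) \<in> pr x" using pr_self[OF x] by (rule someI)
  then obtain h where h: "h \<in> H" "(SOME y. y \<in> pr x) = h \<oplus>\<^bsub>M\<^esub> x" unfolding pr_mem by blast
  then show ?thesis using k[OF h(1)] HC[OF h(1)] x linear_mapsD[OF f] by (simp add: g_def)
 qed
 then have "g \<in> linear_maps R Q M'"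
  using linear_mapsD[OF f] by (auto simp: linear_maps_def carrier_Q Q_add Q_smult)
 then show ?thesis using g by blast
qed

lemma simple_Q_iff:
 "simple_module R Q \<longleftrightarrow> H \<noteq> carrier M \<and> (\<forall>N. submodule N R M \<longrightarrow> H \<subseteq> N \<longrightarrow> N = H \<or> N = carrier M)"
proof
 assume S: "simple_module R Q"
 have "H \<noteq> carrier M"
 proof
  assume HM: "H = carrier M"
  have 1: "pr x = H" if "x \<in> carrier M" for x
   unfolding pr_eq_zero[OF that] unfolding HM by (rule that)
  have "pr ` carrier M = {H}"
  proof
   show "pr ` carrier M \<subseteq> {H}" using 1 by blast
   show "{H} \<subseteq> pr ` carrier M" using 1[OF M.zero_closed] M.zero_closed by blast
  qed
  then have "carrier Q = {H}" unfolding carrier_Q .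
  then show False using S by (simp add: simple_module_def Q_zero)
 qed
 moreover have "N = H \<or> N = carrier M" if N: "submodule N R M" "H \<subseteq> N" for N
 proof -
  note ND = submoduleD[OF N(1)]
  have "submodule (pr ` N) R Q"
   by (rule image_submodule[OF left_module_axioms left_module_Q pr_linear N(1)])
  then consider "pr ` N = {H}" | "pr ` N = carrier Q" using S by (auto simp: simple_module_def Q_zero)
  then show ?thesis
  proof cases
   case 1
   have "x \<in> H" if x: "x \<in> N" for x
   proof -
    have "pr x = H" using imageI[OF x, of "\<lambda>x. pr x"] unfolding 1 by (rule singletonD)
    then show ?thesis unfolding pr_eq_zero[OF subsetD[OF ND(1) x]] .
   qed
   then show ?thesis using N(2) by blast
  next
   case 2
   have "x \<in> N" if x: "x \<in> carrier M" for x
   proof -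
    obtain y where y: "y \<in> N" "pr x = pr y" using imageI[OF x, of "\<lambda>x. pr x"] unfolding carrier_Q[symmetric] 2[symmetric] by blast
    then have "x \<in> pr y" using pr_self[OF x] by simp
    then obtain h where h: "h \<in> H" "x = h \<oplus>\<^bsub>M\<^esub> y" unfolding pr_mem by blast
    then show ?thesis using ND(3)[OF subsetD[OF N(2) h(1)] y(1)] by simp
   qed
   then show ?thesis using ND(1) by blast
  qed
 qed
 ultimately show "H \<noteq> carrier M \<and> (\<forall>N. submodule N R M \<longrightarrow> H \<subseteq> N \<longrightarrow> N = H \<or> N = carrier M)" by blast
next
 assume A: "H \<noteq> carrier M \<and> (\<forall>N. submodule N R M \<longrightarrow> H \<subseteq> N \<longrightarrow> N = H \<or> N = carrier M)"
 show "simple_module R Q"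
  unfolding simple_module_def
 proof (intro conjI allI impI)
  show "carrier Q \<noteq> {\<zero>\<^bsub>Q\<^esub>}"
  proof
   assume "carrier Q = {\<zero>\<^bsub>Q\<^esub>}"
   then have "pr x \<in> {H}" if "x \<in> carrier M" for x
    using imageI[OF that, of "\<lambda>x. pr x"] unfolding carrier_Q Q_zero by simp
   then have "x \<in> H" if "x \<in> carrier M" for x using that pr_eq_zero[OF that] by simp
   then show False using A submoduleD(1)[OF H] by blast
  qed
  fix N assume N: "submodule N R Q"
  let ?N = "{x \<in> carrier M. pr x \<in> N}"
  have "submodule ?N R M"
   by (rule vimage_submodule[OF left_module_axioms left_module_Q pr_linear N])
  moreover have "H \<subseteq> ?N"
  proof
   fix x assume x: "x \<in> H"
   have "pr x = H" using pr_eq_zero[OF HC[OF x]] x by blast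
   then show "x \<in> ?N" using HC[OF x] submoduleD(2)[OF N] unfolding Q_zero by simp
  qed
  ultimately consider "?N = H" | "?N = carrier M" using A by blast
  then show "N = {\<zero>\<^bsub>Q\<^esub>} \<or> N = carrier Q"
  proof cases
   case 1
   have "N \<subseteq> {H}"
   proof
    fix C assume C: "C \<in> N"
    then obtain x where x: "x \<in> carrier M" "C = pr x"
     using submoduleD(1)[OF N] unfolding carrier_Q by blast
    have "x \<in> ?N" using x(1) C unfolding x(2) by simp
    then have "x \<in> H" unfolding 1 .
    then have "pr x = H" using pr_eq_zero[OF x(1)] by blast
    then show "C \<in> {H}" unfolding x(2) by blast
   qed
   moreover have "H \<in> N" using submoduleD(2)[OF N] unfolding Q_zero .
   ultimately have "N = {H}" by (intro equalityI) simp_all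
   then show ?thesis unfolding Q_zero by (rule disjI1)
  next
   case 2
   have "pr x \<in> N" if x: "x \<in> carrier M" for x
   proof -
    have "x \<in> ?N" unfolding 2 by (rule x)
    then show ?thesis by simp
   qed
   then have "carrier Q \<subseteq> N" unfolding carrier_Q by (rule image_subsetI)
   then have "N = carrier Q" using submoduleD(1)[OF N] by (intro equalityI)
   then show ?thesis by (rule disjI2)
  qed
 qed
qed

end

lemma bij_linear_inverse:
 assumes "left_module R M" "left_module R M'" and f: "f \<in> linear_maps R M M'" and b: "bij_betw f (carrier M) (carrier M')"
 shows "module_iso R M' M" "module_iso R M M'"
proof -
 interpret M: left_module R M by (rule assms)
 interpret M': left_module R M' by (rule assms)
 let ?g = "the_inv_into (carrier M) f"
 have inj: "inj_on f (carrier M)" and im: "f ` carrier M = carrier M'" using b by (auto simp: bij_betw_def)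
 have gf: "?g (f x) = x" if "x \<in> carrier M" for x using the_inv_into_f_f[OF inj that] .
 have "?g \<in> linear_maps R M' M"
  unfolding linear_maps_def
  using linear_mapsD[OF f] gf by (auto simp flip: im linear_mapsD(2,3)[OF f])
 moreover have "bij_betw ?g (carrier M') (carrier M)" by (rule bij_betw_the_inv_into[OF b])
 ultimately show "module_iso R M' M" by (auto simp: module_iso_def)
 show "module_iso R M M'" using f b by (auto simp: module_iso_def)
qed

lemma regular_left_module: "ring R \<Longrightarrow> left_module R (regular_module R)"
proof -
 assume "ring R"
 then interpret ring R .
 have "abelian_group (regular_module R)"
  by (rule abelian_groupI) (auto simp: regular_module_def a_ac intro: l_neg bexI[of _ "\<ominus>\<^bsub>R\<^esub> _"])
 then show ?thesis
  by (intro left_module.intro left_module_axioms.intro ring_axioms)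
   (auto simp: regular_module_def l_distr r_distr m_assoc)
qed

definition prim :: "complex \<Rightarrow> complex \<Rightarrow> complex \<Rightarrow> (ualg, 'v) module \<Rightarrow> 'v \<Rightarrow> bool" where
 "prim q l z M v \<longleftrightarrow> v \<in> carrier M \<and> cls q eE \<odot>\<^bsub>M\<^esub> v = \<zero>\<^bsub>M\<^esub> \<and> cls q eX \<odot>\<^bsub>M\<^esub> v = \<zero>\<^bsub>M\<^esub> \<and>
   cls q eK \<odot>\<^bsub>M\<^esub> v = cls q (scalar l) \<odot>\<^bsub>M\<^esub> v \<and> cls q eZ \<odot>\<^bsub>M\<^esub> v = cls q (scalar z) \<odot>\<^bsub>M\<^esub> v"

definition hwm :: "complex \<Rightarrow> complex \<Rightarrow> complex \<Rightarrow> (ualg, 'v) module \<Rightarrow> 'v \<Rightarrow> bool" where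
 "hwm q l z M v \<longleftrightarrow> left_module (U q) M \<and> prim q l z M v \<and>
   (\<forall>N. submodule N (U q) M \<longrightarrow> v \<in> N \<longrightarrow> N = carrier M)"

lemma cls_diff_smult:
 assumes "left_module (U q) M" "v \<in> carrier M"
 shows "cls q (a - b) \<odot>\<^bsub>M\<^esub> v = \<zero>\<^bsub>M\<^esub> \<longleftrightarrow> cls q a \<odot>\<^bsub>M\<^esub> v = cls q b \<odot>\<^bsub>M\<^esub> v"
proof -
 interpret left_module "U q" M by (rule assms)
 have c: "cls q x \<odot>\<^bsub>M\<^esub> v \<in> carrier M" for x using assms cls_simps(1) by auto
 have "cls q a \<odot>\<^bsub>M\<^esub> v = cls q (a - b) \<odot>\<^bsub>M\<^esub> v \<oplus>\<^bsub>M\<^esub> cls q b \<odot>\<^bsub>M\<^esub> v"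
  using cls_simps(2)[of q "a - b" b] smult_l_distr[of "cls q (a - b)" "cls q b" v] assms by (simp add: cls_simps(1))
 then show ?thesis using M.add.r_cancel_one'[OF c[of b] c[of "a - b"]] c by auto
qed

definition vgens :: "complex \<Rightarrow> complex \<Rightarrow> complex \<Rightarrow> ualg set" where
 "vgens q l z = {cls q eE, cls q eX, cls q (eK - scalar l), cls q (eZ - scalar z)}"

lemma verma_alt: "verma q l z = quotient_module (regular_module (U q))
  (generated_submodule (U q) (regular_module (U q)) (vgens q l z))"
 by (simp add: verma_def vgens_def)

definition vhw :: "complex \<Rightarrow> complex \<Rightarrow> complex \<Rightarrow> ualg set" where
 "vhw q l z = generated_submodule (U q) (regular_module (U q)) (vgens q l z) +>\<^bsub>regular_module (U q)\<^esub> \<one>\<^bsub>U q\<^esub>"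

text \<open>The generator is the class of one. For a highest weight vector \<open>w\<close> the map
  \<open>u \<mapsto> u w\<close> on the algebra kills the generators of the left ideal and therefore
  factors through the quotient.\<close>

lemma verma_hwm: "hwm q l z (verma q l z) (vhw q l z)"
 and verma_universal: "left_module (U q) M \<Longrightarrow> prim q l z M w \<Longrightarrow>
  \<exists>f\<in>linear_maps (U q) (verma q l z) M. f (vhw q l z) = w"
proof -
 let ?R = "regular_module (U q)"
 let ?I = "generated_submodule (U q) ?R (vgens q l z)"
 interpret U: ring "U q" by (rule U_ring)
 have R: "left_module (U q) ?R" by (rule regular_left_module[OF U_ring])
 have car: "carrier ?R = carrier (U q)" "a \<odot>\<^bsub>?R\<^esub> b = a \<otimes>\<^bsub>U q\<^esub> b" "\<zero>\<^bsub>?R\<^esub> = \<zero>\<^bsub>U q\<^esub>"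
  "a \<oplus>\<^bsub>?R\<^esub> b = a \<oplus>\<^bsub>U q\<^esub> b" for a b by (simp_all add: regular_module_def)
 have gC: "vgens q l z \<subseteq> carrier ?R" by (auto simp: vgens_def cls_simps car)
 note I = generated_submodule_submodule[OF R gC]
 interpret Q: quotient "U q" ?R ?I by (intro quotient.intro quotient_axioms.intro R I(1))
 note V = verma_alt[of q l z]
 have one: "\<one>\<^bsub>U q\<^esub> \<in> carrier ?R" by (simp add: car)
 have act1: "u \<odot>\<^bsub>verma q l z\<^esub> vhw q l z = Q.pr u" if "u \<in> carrier (U q)" for u
  using Q.Q_smult[OF that one] that by (simp add: V vhw_def car)
 have kill: "u \<odot>\<^bsub>verma q l z\<^esub> vhw q l z = \<zero>\<^bsub>verma q l z\<^esub>" if "u \<in> vgens q l z" for u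
 proof -
  have "u \<in> carrier ?R" "u \<in> ?I" using that gC I(2) by auto
  then show ?thesis using act1[of u] Q.pr_eq_zero[of u] by (simp add: V Q.Q_zero car)
 qed
 have LV: "left_module (U q) (verma q l z)" using Q.left_module_Q by (simp add: V)
 have hwC: "vhw q l z \<in> carrier (verma q l z)" using one by (simp add: V vhw_def Q.carrier_Q)
 have "prim q l z (verma q l z) (vhw q l z)"
  unfolding prim_def
  using hwC kill[of "cls q eE"] kill[of "cls q eX"] kill[of "cls q (eK - scalar l)"] kill[of "cls q (eZ - scalar z)"]
   cls_diff_smult[OF LV hwC] by (simp add: vgens_def)
 moreover have "N = carrier (verma q l z)" if N: "submodule N (U q) (verma q l z)" "vhw q l z \<in> N" for N
 proof
  show "carrier (verma q l z) \<subseteq> N"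
  proof
   fix C assume "C \<in> carrier (verma q l z)"
   then obtain u where "u \<in> carrier (U q)" "C = Q.pr u" by (auto simp: V Q.carrier_Q car)
   then show "C \<in> N" using act1 submoduleD(5)[OF N(1) _ N(2)] by metis
  qed
 qed (rule submoduleD(1)[OF N(1)])
 ultimately show "hwm q l z (verma q l z) (vhw q l z)" using LV by (simp add: hwm_def)
 show "\<exists>f\<in>linear_maps (U q) (verma q l z) M. f (vhw q l z) = w"
  if M: "left_module (U q) M" and w: "prim q l z M w"
 proof -
  interpret M: left_module "U q" M by (rule M)
  have wC: "w \<in> carrier M" using w by (simp add: prim_def)
  define f where "f u = u \<odot>\<^bsub>M\<^esub> w" for u
  have f: "f \<in> linear_maps (U q) ?R M"
   using wC by (auto simp: linear_maps_def f_def car M.smult_l_distr M.smult_assoc1)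
  have "?I \<subseteq> {u \<in> carrier ?R. f u \<in> {\<zero>\<^bsub>M\<^esub>}}"
  proof (rule I(3)[OF vimage_submodule[OF R M f zero_submodule[OF M]]])
   show "vgens q l z \<subseteq> {u \<in> carrier ?R. f u \<in> {\<zero>\<^bsub>M\<^esub>}}"
    using gC w cls_diff_smult[OF M wC] by (auto simp: vgens_def f_def prim_def)
  qed
  then obtain g where "g \<in> linear_maps (U q) Q.Q M" "\<forall>x\<in>carrier ?R. g (Q.pr x) = f x"
   using Q.factor[OF M f] by blast
  then show ?thesis using one wC by (intro bexI[of _ g]) (auto simp: V vhw_def f_def)
 qed
qed

section \<open>Highest weight modules and simple modules\<close>

text \<open>A submodule satisfies the block conditions itself, so it is spanned by translates of its
  own vectors of weights \<open>l0\<close> and \<open>l1\<close>; if these are all zero, so is the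
  submodule.\<close>

lemma (in qsb) stable_has_vec:
 assumes P: "stable P" and x: "x \<in> P" "x \<noteq> 0"
 shows "\<exists>w\<in>P. w \<noteq> 0 \<and> (w \<in> ww l0 \<or> w \<in> ww l1)"
proof (rule ccontr)
 interpret P: qsb q z P E F K Ki X Y s N by (rule stable_qsb[OF P])
 assume n: "\<not> (\<exists>w\<in>P. w \<noteq> 0 \<and> (w \<in> ww l0 \<or> w \<in> ww l1))"
 have 1: "P.ww l \<subseteq> ww l" "P.ww l \<subseteq> P" for l using stableD(2)[OF P] by (auto simp: P.ww_def ww_def)
 have 2: "b = 0" if "b \<in> P.VV" for b
 proof -
  have "b \<in> P" "b \<in> ww l0 \<or> b \<in> ww l1" using that 1 unfolding P.VV_def by blast+
  then show ?thesis using n by blast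
 qed
 have "P.fam P.VV \<subseteq> {0}"
 proof
  fix g assume "g \<in> P.fam P.VV"
  then obtain k i b where g: "g = (Y ^^ k) ((F' ^^ i) b)" "b \<in> P.VV" unfolding P.fam_def by blast
  show "g \<in> {0}" unfolding g(1) 2[OF g(2)] by (simp add: clin[OF linY] clin[OF linF'k])
 qed
 then have "cv.span (P.fam P.VV) \<subseteq> {0}" by (rule span_subset_subspace) (rule cv.subspace_single_0)
 then show False using P.S_fam x by blast
qed

lemma (in qsp) l1_eq_l0: "l1 = l0 \<longleftrightarrow> N = 0"
 using l0_div[of "2 * N" 0] by (simp flip: l1_l0)

text \<open>A version of \<open>fam_component\<close> for generators of one common weight: a nonzero
  generator has no other weight.\<close>

lemma (in qs) fam_component1:
 assumes B: "B \<subseteq> ww m" "m \<noteq> 0" and x: "x \<in> cv.span (fam B)" "x \<in> ww l"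
  and T: "\<And>b i. b \<in> B \<Longrightarrow> m / q ^ (2 * i) = l \<Longrightarrow> (F' ^^ i) b \<in> T"
 shows "x \<in> cv.span T"
proof -
 have "x \<in> cv.span {(F' ^^ i) b | i b n. b \<in> B \<and> b \<noteq> 0 \<and> b \<in> ww n \<and> n / q ^ (2 * i) = l}" (is "_ \<in> cv.span ?A")
  by (rule fam_component[OF _ x]) (use B in blast)
 moreover have "?A \<subseteq> T"
 proof
  fix y assume "y \<in> ?A"
  then obtain i b n where y: "y = (F' ^^ i) b" "b \<in> B" "b \<noteq> 0" "b \<in> ww n" "n / q ^ (2 * i) = l" by blast
  have "n *s b = m *s b" by (rule trans[OF wwD(3)[OF y(4), symmetric] wwD(3)[OF subsetD[OF B(1) y(2)]]])
  then have "n = m" unfolding cv.scale_cancel_right using y(3) by blast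
  then show "y \<in> T" using T[OF y(2)] y(1,5) by blast
 qed
 ultimately show ?thesis using cv.span_mono by blast
qed

text \<open>A highest weight module in terms of operators. Since \<open>v\<close> is killed by
  \<open>E\<close>, its translates already span a submodule, and \<open>{v}\<close> meets the
  conditions of \<open>qsh\<close>.\<close>

locale hwv = qs q z S E F K Ki X Y + qsp q z s N for q z :: complex and S :: "'a::cvec set" and E F K Ki X Y s N +
 fixes v l
 assumes v: "v \<in> ww l" "E v = 0" and l: "l = l0 \<or> l = l1" and vgen: "\<And>P. stable P \<Longrightarrow> v \<in> P \<Longrightarrow> S \<subseteq> P"
begin

lemma lnz: "l \<noteq> 0" using l l0_nz l1_nz by auto

lemma fam_v_stable: assumes "w \<in> ww m" "E w = 0" "m \<noteq> 0" shows "stable (cv.span (fam {w}))"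
 by (rule fam_stable) (use assms in \<open>auto simp: cv.span_zero\<close>)

lemma v_gen: "S \<subseteq> cv.span (fam {v})"
 by (rule vgen[OF fam_v_stable[OF v lnz]]) (use subset_fam[of "{v}"] in \<open>auto intro: cv.span_base\<close>)

sublocale qsh q z S E F K Ki X Y s N "{v}"
 by unfold_locales (use v l v_gen in auto)

sublocale qsb q z S E F K Ki X Y s N by (rule to_qsb)

lemma component: assumes "w \<in> S" "w \<in> ww m" "\<And>i. l / q ^ (2 * i) = m \<Longrightarrow> (F' ^^ i) v \<in> cv.span T"
 shows "w \<in> cv.span T"
proof -
 have "w \<in> cv.span (cv.span T)"
  by (rule fam_component1[of "{v}" l]) (use v lnz assms v_gen in auto)
 then show ?thesis by (simp add: cv.span_span)
qed

lemma ww_l: assumes "w \<in> ww l" shows "\<exists>c. w = c *s v"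
proof -
 have "w \<in> cv.span {v}"
 proof (rule component[OF wwD(1)[OF assms] assms])
  fix i :: nat assume "l / q ^ (2 * i) = l"
  then have "q ^ (2 * i) = q ^ 0" using lnz q0 by (simp add: field_simps)
  then have "i = 0" unfolding qpow_inj by simp
  then show "(F' ^^ i) v \<in> cv.span {v}" by (simp add: cv.span_base)
 qed
 then show ?thesis by (auto simp: cv.span_singleton)
qed

lemma ww_l0_l1: assumes "l = l1" "N > 0" "w \<in> ww l0" shows "w = 0"
proof -
 have "w \<in> cv.span {}"
 proof (rule component[OF wwD(1)[OF assms(3)] assms(3)])
  fix i :: nat assume "l / q ^ (2 * i) = l0"
  then have "l0 / q ^ (2 * (N + i)) = l0 / q ^ 0" using assms(1) by (simp add: l1_l0 power_add algebra_simps)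
  then show "(F' ^^ i) v \<in> cv.span {}" using assms(2) unfolding l0_div by simp
 qed
 then show ?thesis by simp
qed

text \<open>A nonzero submodule contains a nonzero vector of weight \<open>l0\<close> or
  \<open>l1\<close> killed by \<open>X\<close>. Those of weight \<open>l1\<close> are the multiples
  of \<open>v\<close>, and there are none of weight \<open>l0\<close> unless \<open>N = 0\<close>,
  when the two weights are equal.\<close>

lemma simple_l1: assumes "l = l1" "stable P" "x \<in> P" "x \<noteq> 0" shows "S \<subseteq> P"
proof -
 obtain w where w: "w \<in> P" "w \<noteq> 0" "w \<in> ww l0 \<or> w \<in> ww l1"
  using stable_has_vec[OF assms(2-4)] by blast
 have "w \<in> ww l"
 proof (cases "N = 0")
  case True then have "l1 = l0" using l1_eq_l0 by blast
  then show ?thesis using w(3) unfolding assms(1) by simp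
 next
  case False then show ?thesis using w(2,3) ww_l0_l1 assms(1) by blast
 qed
 then obtain c where c: "w = c *s v" using ww_l by blast
 then have "v = (1 / c) *s w" using w(2) by auto
 then have "v \<in> P" using cv.subspace_scale[OF stableD(1)[OF assms(2)] w(1)] by simp
 then show ?thesis by (rule vgen[OF assms(2)])
qed

text \<open>Generated by the vector \<open>(F' ^^ N) v\<close> of weight \<open>l1\<close>, which
  \<open>E\<close> kills because \<open>th l0 = th l1\<close>. A submodule without \<open>v\<close>
  has no nonzero vector in \<open>ww l0\<close>, and in \<open>ww l1\<close> only multiples of this
  one, so it lies in \<open>maxsub\<close>.\<close>

definition maxsub :: "'a set" where "maxsub = cv.span (fam {(F' ^^ N) v})"

lemma maxsub:
 assumes "l = l0" "N > 0" "v \<noteq> 0"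
 shows "stable maxsub" "v \<notin> maxsub" "\<And>P. stable P \<Longrightarrow> v \<notin> P \<Longrightarrow> P \<subseteq> maxsub"
proof -
 let ?u = "(F' ^^ N) v"
 have u: "?u \<in> ww l1" using F'N_l0 v(1) assms(1) by simp
 have "E ?u = 0"
  using E_F'k[OF v(1) lnz, of N] v(2) th_l0[OF l1_nz] assms(1) by (simp add: clin[OF linF'k] flip: l1_l0)
 then show st: "stable maxsub" unfolding maxsub_def by (rule fam_v_stable[OF u _ l1_nz])
 show "v \<notin> maxsub"
 proof
  assume "v \<in> maxsub"
  then have "v \<in> cv.span {}"
   unfolding maxsub_def
  proof (rule fam_component1[rotated 2])
   show "v \<in> ww l0" using v(1) assms(1) by simp
   fix i :: nat and b assume "l1 / q ^ (2 * i) = l0"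
   then have "l0 / q ^ (2 * (N + i)) = l0 / q ^ 0" by (simp add: l1_l0 power_add algebra_simps)
   then show "(F' ^^ i) b \<in> {}" using assms(2) unfolding l0_div by simp
  qed (use u l1_nz in auto)
  then show False using assms(3) by simp
 qed
 fix P assume P: "stable P" "v \<notin> P"
 interpret P: qsb q z P E F K Ki X Y s N by (rule stable_qsb[OF P(1)])
 have 1: "P.ww m \<subseteq> ww m" "P.ww m \<subseteq> P" for m using stableD(2)[OF P(1)] by (auto simp: P.ww_def ww_def)
 have "b \<in> maxsub" if b: "b \<in> P.VV" for b
 proof -
  have bP: "b \<in> P" and "b \<in> ww l0 \<or> b \<in> ww l1" using b 1 unfolding P.VV_def by blast+
  then consider "b \<in> ww l0" | "b \<in> ww l1" by blast
  then show ?thesis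
  proof cases
   case 1
   then obtain c where c: "b = c *s v" using ww_l assms(1) by blast
   have "c = 0"
   proof (rule ccontr)
    assume "c \<noteq> 0"
    then have "v = (1 / c) *s b" using c by simp
    then show False using P(2) cv.subspace_scale[OF stableD(1)[OF P(1)] bP] by simp
   qed
   then show ?thesis using c cv.subspace_0[OF stableD(1)[OF st]] by simp
  next
   case 2
   have "b \<in> cv.span {?u}"
   proof (rule component[OF wwD(1)[OF 2] 2])
    fix i :: nat assume "l / q ^ (2 * i) = l1"
    then have "l0 / q ^ (2 * i) = l0 / q ^ (2 * N)" using assms(1) by (simp add: l1_l0)
    then have "i = N" unfolding l0_div by simp
    then show "(F' ^^ i) v \<in> cv.span {?u}" by (simp add: cv.span_base)
   qed
   moreover have "cv.span {?u} \<subseteq> maxsub"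
    unfolding maxsub_def by (rule cv.span_mono) (rule subset_fam)
   ultimately show ?thesis by blast
  qed
 qed
 then have "cv.span (fam P.VV) \<subseteq> maxsub" by (intro stable_fam[OF st]) blast
 then show "P \<subseteq> maxsub" using P.S_fam by blast
qed

end

section \<open>Simple modules and highest weight vectors in a presentation\<close>

context pres
begin

lemma Z_central: assumes "x \<in> S" shows "op gZ (op g x) = op g (op gZ x)"
proof -
 have "eZ * letter g - letter g * eZ \<in> relators q" unfolding relators_def by blast
 from act_relator[OF this assms] show ?thesis by (simp add: act_simps act_mult[OF lop])
qed

text \<open>\<open>Z\<close> commutes with all generators, so its eigenspaces are
  submodules.\<close>

lemma charge_opstable: "opstable {x \<in> S. op gZ x = c *s x}"
 unfolding opstable_def
proof (intro conjI allI ballI)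
 show "cv.subspace {x \<in> S. op gZ x = c *s x}"
  by (rule cv.subspaceI) (auto simp: clin[OF lop] vs mult.commute)
 show "op g x \<in> {x \<in> S. op gZ x = c *s x}" if "x \<in> {x \<in> S. op gZ x = c *s x}" for g x
  using that Z_central[of x g] by (auto simp: op_S clin[OF lop])
qed auto

lemma cpres_intro:
 assumes "qparam q z" "\<And>x. x \<in> S \<Longrightarrow> op gZ x = z *s x" shows "cpres q z M S op ev"
proof (intro cpres.intro cpres_axioms.intro pres_axioms assms(1))
 fix v assume "v \<in> carrier M"
 then obtain x where x: "x \<in> S" "v = ev x" using ev_surj by blast
 show "cls q eZ \<odot>\<^bsub>M\<^esub> v = cls q (scalar z) \<odot>\<^bsub>M\<^esub> v"
  unfolding x(2) ev_op[OF x(1), symmetric] assms(2)[OF x(1)] ev_scale[OF x(1)] ..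
qed

lemma simple_opstable:
 assumes "simple_module (U q) M" "opstable P" shows "P = {0} \<or> P = S"
proof -
 have P: "P \<subseteq> S" "0 \<in> P" using assms(2) cv.subspace_0 by (auto simp: opstable_def)
 consider "ev ` P = {\<zero>\<^bsub>M\<^esub>}" | "ev ` P = carrier M"
  using assms(1) opstable_submodule[OF assms(2)] by (auto simp: simple_module_def)
 then show ?thesis
 proof cases
  case 1
  have "x = 0" if "x \<in> P" for x using imageI[OF that, of ev] ev_eq_0[of x] that P(1) unfolding 1 by blast
  then show ?thesis using P(2) by blast
 next
  case 2
  have "x \<in> P" if x: "x \<in> S" for x
  proof -
   have "ev x \<in> ev ` P" unfolding 2 by (rule ev_carrier[OF x])
   then obtain y where y: "y \<in> P" "ev x = ev y" by blast
   then have "x = y" using ev_inj[OF x, of y] P(1) by blast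
   then show ?thesis using y(1) by simp
  qed
  then show ?thesis using P(1) by blast
 qed
qed

lemma simple_intro:
 assumes "x \<in> S" "x \<noteq> 0" "\<And>P y. opstable P \<Longrightarrow> y \<in> P \<Longrightarrow> y \<noteq> 0 \<Longrightarrow> S \<subseteq> P"
 shows "simple_module (U q) M"
 unfolding simple_module_def
proof (intro conjI allI impI)
 show "carrier M \<noteq> {\<zero>\<^bsub>M\<^esub>}"
  using ev_carrier[OF assms(1)] ev_eq_0[OF assms(1)] assms(2) by blast
 fix N assume N: "submodule N (U q) M"
 let ?P = "{x \<in> S. ev x \<in> N}"
 note o = submodule_opstable[OF N]
 show "N = {\<zero>\<^bsub>M\<^esub>} \<or> N = carrier M"
 proof (cases "?P \<subseteq> {0}")
  case True
  have "N \<subseteq> {\<zero>\<^bsub>M\<^esub>}"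
  proof
   fix v assume "v \<in> N"
   then obtain x where "x \<in> ?P" "v = ev x" using o(2) by blast
   then show "v \<in> {\<zero>\<^bsub>M\<^esub>}" using True ev_0 by blast
  qed
  then show ?thesis using submoduleD(2)[OF N] by blast
 next
  case False
  then obtain y where "y \<in> ?P" "y \<noteq> 0" by blast
  from assms(3)[OF o(1) this] have "S \<subseteq> ?P" .
  then have "carrier M \<subseteq> N" using ev_surj by blast
  then show ?thesis using submoduleD(1)[OF N] by blast
 qed
qed

lemma prim_ev:
 assumes "x \<in> S"
 shows "prim q l z M (ev x) \<longleftrightarrow> op gE x = 0 \<and> op gX x = 0 \<and> op gK x = l *s x \<and> op gZ x = z *s x"
 unfolding prim_def ev_op[OF assms, symmetric] ev_scale[OF assms, symmetric]
 using assms by (simp add: ev_eq_0 ev_inj op_S)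

end

lemma (in cps) prim_ww: "x \<in> S \<Longrightarrow> prim q l z M (ev x) \<longleftrightarrow> op gE x = 0 \<and> x \<in> ww l"
 by (auto simp: prim_ev ww_def opZ)

lemma prim_linear:
 assumes "left_module (U q) M" "left_module (U q) M'" and f: "f \<in> linear_maps (U q) M M'" and v: "prim q l z M v"
 shows "prim q l z M' (f v)"
proof -
 interpret M: left_module "U q" M by (rule assms)
 interpret M': left_module "U q" M' by (rule assms)
 note D = linear_mapsD[OF f] and z = linear_map_zero_neg(1)[OF f M.M.abelian_group_axioms M'.M.abelian_group_axioms]
 show ?thesis using v unfolding prim_def by (metis D(1,3) cls_simps(1) z)
qed

text \<open>The isomorphism is stated from \<open>M'\<close> to \<open>M\<close>, the direction in
  which an unknown simple module is compared with a known one.\<close>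

lemma schur:
 assumes "left_module R M" "left_module R M'" and f: "f \<in> linear_maps R M M'" and M: "simple_module R M"
  and M': "simple_module R M'" and v: "v \<in> carrier M" "f v \<noteq> \<zero>\<^bsub>M'\<^esub>"
 shows "module_iso R M' M"
proof -
 interpret M: left_module R M by (rule assms)
 interpret M': left_module R M' by (rule assms)
 note D = linear_mapsD[OF f] and z = linear_map_zero_neg[OF f M.M.abelian_group_axioms M'.M.abelian_group_axioms]
 have c: "submodule (carrier M) R M" by (rule submodule_by_closure[OF assms(1)]) auto
 have "f ` carrier M = {\<zero>\<^bsub>M'\<^esub>} \<or> f ` carrier M = carrier M'"
  using image_submodule[OF assms(1,2) f c] M' by (simp add: simple_module_def)
 then have sur: "f ` carrier M = carrier M'" using v by blast
 let ?k = "{x \<in> carrier M. f x \<in> {\<zero>\<^bsub>M'\<^esub>}}"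
 have "?k = {\<zero>\<^bsub>M\<^esub>} \<or> ?k = carrier M"
  using vimage_submodule[OF assms(1,2) f zero_submodule[OF assms(2)]] M by (simp add: simple_module_def)
 then have k: "?k = {\<zero>\<^bsub>M\<^esub>}" using v by blast
 have "inj_on f (carrier M)"
 proof (rule inj_onI)
  fix x y assume xy: "x \<in> carrier M" "y \<in> carrier M" "f x = f y"
  have "f (x \<oplus>\<^bsub>M\<^esub> (\<ominus>\<^bsub>M\<^esub> y)) = \<zero>\<^bsub>M'\<^esub>"
   using xy D z by (simp add: M'.M.r_neg)
  then have "x \<oplus>\<^bsub>M\<^esub> (\<ominus>\<^bsub>M\<^esub> y) \<in> ?k" using xy by simp
  then have "x \<oplus>\<^bsub>M\<^esub> (\<ominus>\<^bsub>M\<^esub> y) = \<zero>\<^bsub>M\<^esub>" unfolding k by simp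
  then show "x = y" using xy by (metis M.M.minus_equality M.M.minus_minus M.M.a_inv_closed)
 qed
 then show ?thesis using sur bij_linear_inverse(1)[OF assms(1,2) f] by (simp add: bij_betw_def)
qed

section \<open>Verma modules, their simple quotients and the classification of simple
  objects\<close>

context qsp
begin

lemma qparam: "qparam q z" by unfold_locales

text \<open>That \<open>Z\<close> acts by \<open>z\<close> on the whole module follows from its
  action on the generator: the eigenspace for \<open>z\<close> is a submodule containing the
  generator.\<close>

lemma hwm_bridge:
 assumes h: "hwm q l z (M :: (ualg, 'v) module) v" and l: "l = l0 \<or> l = l1"
 shows "\<exists>(S :: ('v \<Rightarrow>\<^sub>0 complex) set) op ev x. cps q z M S op ev s \<and>
  hwv q z S (op gE) (op gF) (op gK) (op gKi) (op gX) (op gY) s N x l \<and> x \<in> S \<and> v = ev x"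
proof -
 have L: "left_module (U q) M" and p: "prim q l z M v"
  and g: "\<And>N. submodule N (U q) M \<Longrightarrow> v \<in> N \<Longrightarrow> N = carrier M" using h by (auto simp: hwm_def)
 obtain S :: "('v \<Rightarrow>\<^sub>0 complex) set" and op ev where pr: "presents q M S op ev" using pres_exists[OF L] by blast
 interpret pres q M S op ev by (rule pres.intro[OF pr])
 obtain x where x: "x \<in> S" "v = ev x" using p ev_surj by (auto simp: prim_def)
 have gen: "S \<subseteq> P" if P: "opstable P" "x \<in> P" for P
 proof
  fix y assume y: "y \<in> S"
  have "ev ` P = carrier M" by (rule g[OF opstable_submodule[OF P(1)]]) (use x P(2) in simp)
  then have "ev y \<in> ev ` P" using ev_carrier[OF y] by simp
  then obtain y' where y': "y' \<in> P" "ev y = ev y'" by blast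
  have "P \<subseteq> S" using P(1) by (simp add: opstable_def)
  then have "y = y'" using ev_inj[OF y, of y'] y' by blast
  then show "y \<in> P" using y' by simp
 qed
 have Z: "op gZ y = z *s y" if "y \<in> S" for y
 proof -
  have "op gZ x = z *s x" using p prim_ev[OF x(1)] x(2) by simp
  then have "S \<subseteq> {x \<in> S. op gZ x = z *s x}" using x(1) by (intro gen[OF charge_opstable]) simp
  then show ?thesis using that by blast
 qed
 interpret cpres q z M S op ev by (rule cpres_intro[OF qparam Z])
 interpret cps q z M S op ev s N by (intro cps.intro cpres_axioms qsp_axioms)
 have "hwv q z S (op gE) (op gF) (op gK) (op gKi) (op gX) (op gY) s N x l"
  using p prim_ww[OF x(1)] x(2) l gen[unfolded opstable_iff]
  by (intro hwv.intro hwv_axioms.intro qs_axioms qsp_axioms) simp_all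
 then show ?thesis using cps_axioms x by blast
qed

lemma hwm_block:
 assumes "hwm q l z (M :: (ualg, 'v) module) v" "l = l0 \<or> l = l1"
 shows "M \<in> block q (half_coset q s) (ctilde q z l0) z"
proof -
 obtain S :: "('v \<Rightarrow>\<^sub>0 complex) set" and op ev x where c: "cps q z M S op ev s"
  and h: "hwv q z S (op gE) (op gF) (op gK) (op gKi) (op gX) (op gY) s N x l"
  using hwm_bridge[OF assms] by blast
 interpret hwv q z S "op gE" "op gF" "op gK" "op gKi" "op gX" "op gY" s N x l by (rule h)
 show ?thesis by (rule cps.block_intro[OF c qsh_axioms])
qed

lemma hwm_simple:
 assumes "hwm q l1 z (M :: (ualg, 'v) module) v" "v \<noteq> \<zero>\<^bsub>M\<^esub>"
 shows "simple_module (U q) M"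
proof -
 obtain S :: "('v \<Rightarrow>\<^sub>0 complex) set" and op ev x where c: "cps q z M S op ev s" and x: "x \<in> S" "v = ev x"
  and h: "hwv q z S (op gE) (op gF) (op gK) (op gKi) (op gX) (op gY) s N x l1"
  using hwm_bridge[OF assms(1)] by blast
 interpret cps q z M S op ev s N by (rule c)
 interpret hwv q z S "op gE" "op gF" "op gK" "op gKi" "op gX" "op gY" s N x l1 by (rule h)
 show ?thesis
  by (rule simple_intro[OF x(1)]) (use assms(2) x ev_0 simple_l1[OF refl] in \<open>auto simp: opstable_iff\<close>)
qed

lemma hwm_no_l0:
 assumes "hwm q l1 z (M :: (ualg, 'v) module) v" "N > 0" "prim q l0 z M w"
 shows "w = \<zero>\<^bsub>M\<^esub>"
proof -
 obtain S :: "('v \<Rightarrow>\<^sub>0 complex) set" and op ev x where c: "cps q z M S op ev s"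
  and h: "hwv q z S (op gE) (op gF) (op gK) (op gKi) (op gX) (op gY) s N x l1"
  using hwm_bridge[OF assms(1)] by blast
 interpret cps q z M S op ev s N by (rule c)
 interpret hwv q z S "op gE" "op gF" "op gK" "op gKi" "op gX" "op gY" s N x l1 by (rule h)
 obtain y where y: "y \<in> S" "w = ev y" using assms(3) ev_surj by (auto simp: prim_def)
 then have "y \<in> ww l0" using assms(3) prim_ww by simp
 then have "y = 0" by (rule ww_l0_l1[OF refl assms(2)])
 then show ?thesis unfolding y(2) using ev_0 by blast
qed

lemma hwm_max:
 assumes "hwm q l0 z (M :: (ualg, 'v) module) v" "N > 0" "v \<noteq> \<zero>\<^bsub>M\<^esub>"
 shows "\<exists>H. submodule H (U q) M \<and> v \<notin> H \<and> (\<forall>N. submodule N (U q) M \<longrightarrow> v \<notin> N \<longrightarrow> N \<subseteq> H)"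
proof -
 obtain S :: "('v \<Rightarrow>\<^sub>0 complex) set" and op ev x where c: "cps q z M S op ev s" and x: "x \<in> S" "v = ev x"
  and h: "hwv q z S (op gE) (op gF) (op gK) (op gKi) (op gX) (op gY) s N x l0"
  using hwm_bridge[OF assms(1)] by blast
 interpret cps q z M S op ev s N by (rule c)
 interpret hwv q z S "op gE" "op gF" "op gK" "op gKi" "op gX" "op gY" s N x l0 by (rule h)
 have "x \<noteq> 0" using assms(3) x ev_0 by auto
 note m = maxsub[OF refl assms(2) this]
 have mS: "maxsub \<subseteq> S" using stableD(2)[OF m(1)] .
 show ?thesis
 proof (intro exI[of _ "ev ` maxsub"] conjI allI impI)
  show "submodule (ev ` maxsub) (U q) M" using m(1) by (simp add: opstable_submodule opstable_iff)
  show "v \<notin> ev ` maxsub"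
  proof
   assume "v \<in> ev ` maxsub"
   then obtain y where y: "y \<in> maxsub" "ev x = ev y" unfolding x(2) by (rule imageE)
   then have "x = y" using ev_inj[OF x(1), of y] mS by blast
   then show False using y m(2) by simp
  qed
  fix H assume H: "submodule H (U q) M" "v \<notin> H"
  note o = submodule_opstable[OF H(1)]
  have "{x \<in> S. ev x \<in> H} \<subseteq> maxsub"
   by (rule m(3)) (use o(1) H(2) x in \<open>auto simp: opstable_iff\<close>)
  then show "H \<subseteq> ev ` maxsub" using o(2) by blast
 qed
qed

text \<open>By the universal property it is enough to have some module with a nonzero highest weight
  vector of weight \<open>l\<close>. The model of the quiver representation with a one-dimensional
  space at the vertex of \<open>l\<close> and zero arrows is such a module.\<close>

lemma vhw_nz:
 assumes "l = l0 \<or> l = l1" shows "vhw q l z \<noteq> \<zero>\<^bsub>verma q l z\<^esub>"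
proof -
 have "\<exists>(M :: (ualg, nat \<Rightarrow> nat \<Rightarrow> complex) module) w. left_module (U q) M \<and> prim q l z M w \<and> w \<noteq> \<zero>\<^bsub>M\<^esub>"
 proof (cases "l = l1")
  case True
  interpret Q: quiv q z s N "UNIV :: complex set" "{0}" "\<lambda>_. 0" "\<lambda>_. 0" "{1}" "{}"
   by unfold_locales (auto simp: cv.subspace_UNIV cv.span_singleton cscale_complex_def intro: clinearI)
  let ?M = "rec_mod q Q.SS Q.M.opf (\<lambda>x. x)"
  have pr: "presents q ?M Q.SS Q.M.opf (\<lambda>x. x)"
   by (rule presents_rec_mod) (use Q.M.subS Q.M.lopf Q.M.opf_S Q.M.opf_relators in auto)
  interpret p: pres q ?M Q.SS Q.M.opf "\<lambda>x. x" by (rule pres.intro[OF pr])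
  have w: "Q.un 0 N 1 \<in> Q.M.ww l1" using Q.BB_l1 by simp
  have E: "Q.EE (Q.un 0 N 1) = 0"
  proof (cases "N = 0")
   case True then show ?thesis using Q.E_un1_0 by blast
  next
   case False
   then show ?thesis using Q.E_un1[of 1] by (simp add: Q.a'_def clin[OF Q.lin_un] clin[OF Q.M.linF'k])
  qed
  have "prim q l1 z ?M (Q.un 0 N 1)"
   using p.prim_ev[of "Q.un 0 N 1" l1 z] Q.M.wwD[OF w] E by simp
  moreover have "Q.un 0 N 1 \<noteq> 0"
   using Q.un_inj[of 0 N 1 0] by (auto simp: clin[OF Q.lin_un])
  ultimately show ?thesis using p.lmod p.ev_0 True by metis
 next
  case False
  then have l: "l = l0" "N > 0" using assms l1_eq_l0 by auto
  interpret Q: quiv q z s N "{0}" "UNIV :: complex set" "\<lambda>_. 0" "\<lambda>_. 0" "{}" "{1}"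
   by unfold_locales (use l(2) in \<open>auto simp: cv.subspace_UNIV cv.span_singleton cscale_complex_def intro: clinearI\<close>)
  let ?M = "rec_mod q Q.SS Q.M.opf (\<lambda>x. x)"
  have pr: "presents q ?M Q.SS Q.M.opf (\<lambda>x. x)"
   by (rule presents_rec_mod) (use Q.M.subS Q.M.lopf Q.M.opf_S Q.M.opf_relators in auto)
  interpret p: pres q ?M Q.SS Q.M.opf "\<lambda>x. x" by (rule pres.intro[OF pr])
  have w: "Q.un 0 0 1 \<in> Q.M.ww l0" using Q.BB_l0[OF l(2)] by simp
  have "prim q l0 z ?M (Q.un 0 0 1)"
   using p.prim_ev[of "Q.un 0 0 1" l0 z] Q.M.wwD[OF w] Q.E_un2[of 1] by simp
  moreover have "Q.un 0 0 1 \<noteq> 0"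
   using Q.un_inj[of 0 0 1 0] by (auto simp: clin[OF Q.lin_un])
  ultimately show ?thesis using p.lmod p.ev_0 l(1) by metis
 qed
 then obtain M :: "(ualg, nat \<Rightarrow> nat \<Rightarrow> complex) module" and w where
  M: "left_module (U q) M" and w: "prim q l z M w" "w \<noteq> \<zero>\<^bsub>M\<^esub>" by blast
 obtain f where f: "f \<in> linear_maps (U q) (verma q l z) M" "f (vhw q l z) = w"
  using verma_universal[OF M w(1)] by blast
 interpret M: left_module "U q" M by (rule M)
 have "left_module (U q) (verma q l z)" using verma_hwm by (auto simp: hwm_def)
 then interpret V: left_module "U q" "verma q l z" .
 show ?thesis
  using linear_map_zero_neg(1)[OF f(1) V.M.abelian_group_axioms M.M.abelian_group_axioms] f(2) w(2) by auto
qed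

lemma verma_l1_block: "verma q l1 z \<in> block q (half_coset q s) (ctilde q z l0) z"
 by (rule hwm_block[OF verma_hwm]) simp

lemma verma_l1_simple: "simple_module (U q) (verma q l1 z)"
 by (rule hwm_simple[OF verma_hwm vhw_nz]) simp

lemma verma_left: "left_module (U q) (verma q l z)" using verma_hwm by (auto simp: hwm_def)

text \<open>The submodules not containing the generator have a largest element, so there is exactly
  one submodule with simple quotient; this determines the definite description in
  \<open>simple_quotient\<close>.\<close>

lemma verma_maximal:
 assumes N: "N > 0"
 obtains H where "submodule H (U q) (verma q l0 z)" "vhw q l0 z \<notin> H"
  "\<And>P. submodule P (U q) (verma q l0 z) \<Longrightarrow> vhw q l0 z \<notin> P \<Longrightarrow> P \<subseteq> H"
  "simple_quotient q l0 z = quotient_module (verma q l0 z) H"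
  "simple_module (U q) (simple_quotient q l0 z)"
proof -
 let ?V = "verma q l0 z" and ?v = "vhw q l0 z"
 obtain H where H: "submodule H (U q) ?V" "?v \<notin> H" "\<And>P. submodule P (U q) ?V \<Longrightarrow> ?v \<notin> P \<Longrightarrow> P \<subseteq> H"
  using hwm_max[OF verma_hwm N vhw_nz] by blast
 have vC: "?v \<in> carrier ?V" and g: "\<And>P. submodule P (U q) ?V \<Longrightarrow> ?v \<in> P \<Longrightarrow> P = carrier ?V"
  using verma_hwm[of q l0 z] by (auto simp: hwm_def prim_def)
 have iff: "simple_module (U q) (quotient_module ?V P) \<longleftrightarrow>
   P \<noteq> carrier ?V \<and> (\<forall>N. submodule N (U q) ?V \<longrightarrow> P \<subseteq> N \<longrightarrow> N = P \<or> N = carrier ?V)"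
  if "submodule P (U q) ?V" for P
  by (rule quotient.simple_Q_iff[OF quotient.intro[OF verma_left quotient_axioms.intro[OF that]]])
 have sH: "simple_module (U q) (quotient_module ?V H)"
  unfolding iff[OF H(1)]
 proof (intro conjI allI impI)
  show "H \<noteq> carrier ?V" using H(2) vC by blast
  fix P assume P: "submodule P (U q) ?V" "H \<subseteq> P"
  show "P = H \<or> P = carrier ?V"
  proof (cases "?v \<in> P")
   case True then show ?thesis using g[OF P(1)] by blast
  next
   case False then show ?thesis using H(3)[OF P(1)] P(2) by blast
  qed
 qed
 have "(THE P. submodule P (U q) ?V \<and> simple_module (U q) (quotient_module ?V P)) = H"
 proof (rule the_equality)
  fix P assume "submodule P (U q) ?V \<and> simple_module (U q) (quotient_module ?V P)"
  then have P: "submodule P (U q) ?V" "P \<noteq> carrier ?V"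
   "\<And>N. submodule N (U q) ?V \<Longrightarrow> P \<subseteq> N \<Longrightarrow> N = P \<or> N = carrier ?V" using iff by blast+
  have "?v \<notin> P" using g P(1,2) by blast
  then have "P \<subseteq> H" using H(3) P(1) by blast
  then show "P = H" using P(3)[OF H(1)] H(2) vC by blast
 qed (use H sH in blast)
 then have e: "simple_quotient q l0 z = quotient_module ?V H" by (simp add: simple_quotient_def)
 show ?thesis by (rule that[OF H(1,2) _ e sH[folded e]]) (rule H(3))
qed

text \<open>The quotient is again a highest weight module of weight \<open>l0\<close>. An
  isomorphism with the Verma module of weight \<open>l1\<close> would send its nonzero highest
  weight vector to one of weight \<open>l0\<close>, and there only zero has that property.\<close>

lemma simple_quotient_props:
 assumes N: "N > 0"
 shows "left_module (U q) (simple_quotient q l0 z)" "simple_module (U q) (simple_quotient q l0 z)"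
  "simple_quotient q l0 z \<in> block q (half_coset q s) (ctilde q z l0) z"
  "\<not> module_iso (U q) (verma q l1 z) (simple_quotient q l0 z)"
proof -
 let ?V = "verma q l0 z" and ?v = "vhw q l0 z"
 obtain H where H: "submodule H (U q) ?V" "?v \<notin> H"
  "\<And>P. submodule P (U q) ?V \<Longrightarrow> ?v \<notin> P \<Longrightarrow> P \<subseteq> H"
  and L: "simple_quotient q l0 z = quotient_module ?V H" "simple_module (U q) (simple_quotient q l0 z)"
  using verma_maximal[OF N] by blast
 interpret Q: quotient "U q" ?V H by (intro quotient.intro verma_left quotient_axioms.intro H(1))
 have vC: "?v \<in> carrier ?V" and g: "\<And>P. submodule P (U q) ?V \<Longrightarrow> ?v \<in> P \<Longrightarrow> P = carrier ?V"
  and pv: "prim q l0 z ?V ?v"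
  using verma_hwm[of q l0 z] by (auto simp: hwm_def prim_def)
 have p: "prim q l0 z Q.Q (Q.pr ?v)" by (rule prim_linear[OF verma_left Q.left_module_Q Q.pr_linear pv])
 have nz: "Q.pr ?v \<noteq> \<zero>\<^bsub>Q.Q\<^esub>" using Q.pr_eq_zero[OF vC] H(2) unfolding Q.Q_zero by blast
 have "P = carrier Q.Q" if P: "submodule P (U q) Q.Q" "Q.pr ?v \<in> P" for P
 proof -
  have "{x \<in> carrier ?V. Q.pr x \<in> P} = carrier ?V"
   by (rule g[OF vimage_submodule[OF verma_left Q.left_module_Q Q.pr_linear P(1)]]) (use vC P(2) in blast)
  then have "Q.pr ` carrier ?V \<subseteq> P" by blast
  then show ?thesis using submoduleD(1)[OF P(1)] unfolding Q.carrier_Q by blast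
 qed
 then have h: "hwm q l0 z Q.Q (Q.pr ?v)" using p Q.left_module_Q by (simp add: hwm_def)
 show "left_module (U q) (simple_quotient q l0 z)" using Q.left_module_Q L(1) by simp
 show "simple_module (U q) (simple_quotient q l0 z)" by (rule L(2))
 show "simple_quotient q l0 z \<in> block q (half_coset q s) (ctilde q z l0) z"
  unfolding L(1) by (rule hwm_block[OF h]) simp
 show "\<not> module_iso (U q) (verma q l1 z) (simple_quotient q l0 z)"
 proof
  assume "module_iso (U q) (verma q l1 z) (simple_quotient q l0 z)"
  then obtain f where f: "f \<in> linear_maps (U q) (verma q l1 z) Q.Q" "bij_betw f (carrier (verma q l1 z)) (carrier Q.Q)"
   unfolding L(1) module_iso_def by blast
  from bij_linear_inverse(1)[OF verma_left Q.left_module_Q f] obtain g where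
   g: "g \<in> linear_maps (U q) Q.Q (verma q l1 z)" "bij_betw g (carrier Q.Q) (carrier (verma q l1 z))"
   unfolding module_iso_def by blast
  have "prim q l0 z (verma q l1 z) (g (Q.pr ?v))" by (rule prim_linear[OF Q.left_module_Q verma_left g(1) p])
  then have g0: "g (Q.pr ?v) = \<zero>\<^bsub>verma q l1 z\<^esub>" by (rule hwm_no_l0[OF verma_hwm N])
  interpret QM: left_module "U q" Q.Q by (rule Q.left_module_Q)
  interpret V1: left_module "U q" "verma q l1 z" by (rule verma_left)
  have "g \<zero>\<^bsub>Q.Q\<^esub> = \<zero>\<^bsub>verma q l1 z\<^esub>"
   by (rule linear_map_zero_neg(1)[OF g(1) QM.M.abelian_group_axioms V1.M.abelian_group_axioms])
  then have "Q.pr ?v = \<zero>\<^bsub>Q.Q\<^esub>"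
   using inj_onD[OF bij_betw_imp_inj_on[OF g(2)], of "Q.pr ?v" "\<zero>\<^bsub>Q.Q\<^esub>"] g0 p QM.M.zero_closed by (simp add: prim_def)
  then show False using nz by blast
 qed
qed

text \<open>On a simple object \<open>Z\<close> is the scalar \<open>z\<close>: as
  \<open>Z - z\<close> is nilpotent, its kernel is a nonzero submodule. A nonzero vector of
  \<open>ww l0\<close> is killed by \<open>E\<close>. If there is none, then \<open>E ^^ N\<close>
  vanishes on \<open>ww l1\<close>, and by \<open>E_l1\<close> so does \<open>E\<close>.\<close>

lemma simple_has_prim:
 assumes M: "(M :: (ualg, 'v) module) \<in> block q (half_coset q s) (ctilde q z l0) z" and sM: "simple_module (U q) M"
 shows "\<exists>w l. (l = l0 \<or> l = l1) \<and> prim q l z M w \<and> w \<noteq> \<zero>\<^bsub>M\<^esub>"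
proof -
 have L: "left_module (U q) M" using M by (simp add: block_def category_O_def)
 obtain S :: "('v \<Rightarrow>\<^sub>0 complex) set" and op ev where pr: "presents q M S op ev" using pres_exists[OF L] by blast
 interpret pres q M S op ev by (rule pres.intro[OF pr])
 have "\<exists>x\<in>S. x \<noteq> 0"
 proof (rule ccontr)
  assume n: "\<not> (\<exists>x\<in>S. x \<noteq> 0)"
  have "v = \<zero>\<^bsub>M\<^esub>" if v: "v \<in> carrier M" for v
  proof -
   obtain x where x: "x \<in> S" "v = ev x" using ev_surj[OF v] by blast
   have "x = 0" using n x(1) by blast
   then show ?thesis unfolding x(2) using ev_0 by simp
  qed
  then have "carrier M = {\<zero>\<^bsub>M\<^esub>}" using M.zero_closed by (intro equalityI subsetI) simp_all
  then show False using sM unfolding simple_module_def by (elim conjE notE)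
 qed
 then obtain x0 where x0: "x0 \<in> S" "x0 \<noteq> 0" by blast
 let ?A = "act op (eZ - scalar z)"
 have A: "?A x = op gZ x - z *s x" for x by (simp add: act_simps)
 have "{x \<in> S. op gZ x = z *s x} = S"
 proof (rule ccontr)
  assume "{x \<in> S. op gZ x = z *s x} \<noteq> S"
  then have k: "{x \<in> S. op gZ x = z *s x} = {0}" using simple_opstable[OF sM charge_opstable] by blast
  have inj: "x = 0" if "x \<in> S" "?A x = 0" for x
  proof -
   have "x \<in> {x \<in> S. op gZ x = z *s x}" using that A by simp
   then show ?thesis unfolding k by simp
  qed
  have "(?A ^^ k) x = 0 \<Longrightarrow> x \<in> S \<Longrightarrow> x = 0" for k x
  proof (induction k arbitrary: x)
   case (Suc k)
   have "(?A ^^ k) (?A x) = 0" using Suc.prems(1) unfolding funpow_Suc_right o_def .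
   then have "?A x = 0" using Suc.IH Suc.prems(2) by simp
   then show ?case by (rule inj[OF Suc.prems(2)])
  qed simp
  then show False using block_pow[OF M] x0 by blast
 qed
 then have Z: "op gZ x = z *s x" if "x \<in> S" for x using that by blast
 interpret cpres q z M S op ev by (rule cpres_intro[OF qparam Z])
 interpret cps q z M S op ev s N by (intro cps.intro cpres_axioms qsp_axioms)
 interpret Q: qsb q z S "op gE" "op gF" "op gK" "op gKi" "op gX" "op gY" s N by (rule block_dest[OF M])
 have "\<exists>w l. (l = l0 \<or> l = l1) \<and> w \<in> ww l \<and> op gE w = 0 \<and> w \<noteq> 0"
 proof (cases "\<exists>w\<in>ww l0. w \<noteq> 0")
  case True
  then show ?thesis using Q.E_l0 by blast
 next
  case False
  then obtain w where w: "w \<noteq> 0" "w \<in> ww l1" using Q.stable_has_vec[OF stable_S x0] by blast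
  have N: "N > 0" using False w l1_eq_l0 by auto
  have "(op gE ^^ N) w = 0" using Q.EN_l1[OF w(2)] False by blast
  then have "op gE w = 0" using Q.E_l1[OF w(2) N] by (simp add: clin[OF linF'k])
  then show ?thesis using w by blast
 qed
 then obtain w l where w: "l = l0 \<or> l = l1" "w \<in> ww l" "op gE w = 0" "w \<noteq> 0" by blast
 have wS: "w \<in> S" by (rule wwD(1)[OF w(2)])
 show ?thesis
  by (intro exI[of _ "ev w"] exI[of _ l]) (use w wS prim_ww[OF wS] ev_eq_0[OF wS] in simp)
qed

text \<open>The highest weight vector gives a nonzero map from a Verma module. For \<open>l1\<close>
  Schur's lemma applies directly; for \<open>l0\<close> the map first has to be factored through the
  simple quotient.\<close>

theorem simple_classify:
 assumes M: "(M :: (ualg, 'v) module) \<in> block q (half_coset q s) (ctilde q z l0) z" and sM: "simple_module (U q) M"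
 shows "module_iso (U q) M (verma q l1 z) \<or> N > 0 \<and> module_iso (U q) M (simple_quotient q l0 z)"
proof -
 have L: "left_module (U q) M" using M by (simp add: block_def category_O_def)
 interpret M: left_module "U q" M by (rule L)
 obtain w l where w: "l = l0 \<or> l = l1" "prim q l z M w" "w \<noteq> \<zero>\<^bsub>M\<^esub>" using simple_has_prim[OF assms] by blast
 obtain f where f: "f \<in> linear_maps (U q) (verma q l z) M" "f (vhw q l z) = w"
  using verma_universal[OF L w(2)] by blast
 have vC: "vhw q l z \<in> carrier (verma q l z)" using verma_hwm[of q l z] by (simp add: hwm_def prim_def)
 show ?thesis
 proof (cases "l = l1")
  case True
  have "module_iso (U q) M (verma q l z)"
   by (rule schur[OF verma_left L f(1) _ sM vC]) (use verma_l1_simple True f(2) w(3) in simp_all)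
  then show ?thesis using True by simp
 next
  case False
  then have l: "l = l0" "N > 0" using w(1) l1_eq_l0 by auto
  let ?V = "verma q l0 z" and ?v = "vhw q l0 z"
  note f = f[unfolded l(1)] and vC = vC[unfolded l(1)]
  obtain H where H: "submodule H (U q) ?V" "?v \<notin> H"
   "\<And>P. submodule P (U q) ?V \<Longrightarrow> ?v \<notin> P \<Longrightarrow> P \<subseteq> H"
   and Q: "simple_quotient q l0 z = quotient_module ?V H" "simple_module (U q) (simple_quotient q l0 z)"
   using verma_maximal[OF l(2)] by blast
  interpret V: left_module "U q" ?V by (rule verma_left)
  interpret Q: quotient "U q" ?V H by (intro quotient.intro verma_left quotient_axioms.intro H(1))
  note z = linear_map_zero_neg[OF f(1) V.M.abelian_group_axioms M.M.abelian_group_axioms]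
  let ?k = "{x \<in> carrier ?V. f x \<in> {\<zero>\<^bsub>M\<^esub>}}"
  have k: "?k \<subseteq> H"
   by (rule H(3)[OF vimage_submodule[OF verma_left L f(1) zero_submodule[OF L]]]) (use f(2) w(3) in simp)
  \<comment> \<open>Otherwise some \<open>h\<close> in \<open>H\<close> has the same image as the
    generator, which is then the sum of \<open>h\<close> and an element of the kernel; both lie in
    \<open>H\<close>.\<close>
  have "f ` H \<noteq> carrier M"
  proof
   assume "f ` H = carrier M"
   then have "w \<in> f ` H" using w(2) by (simp add: prim_def)
   then obtain h where h: "h \<in> H" "w = f h" by blast
   have hC: "h \<in> carrier ?V" using h(1) Q.HC by blast
   have "f (?v \<oplus>\<^bsub>?V\<^esub> (\<ominus>\<^bsub>?V\<^esub> h)) = w \<oplus>\<^bsub>M\<^esub> (\<ominus>\<^bsub>M\<^esub> w)"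
    using linear_mapsD(2)[OF f(1) vC, of "\<ominus>\<^bsub>?V\<^esub> h"] z(2)[OF hC] f(2) h(2) hC by simp
   also have "\<dots> = \<zero>\<^bsub>M\<^esub>" using w(2) by (simp add: prim_def M.M.r_neg)
   finally have f0: "f (?v \<oplus>\<^bsub>?V\<^esub> (\<ominus>\<^bsub>?V\<^esub> h)) = \<zero>\<^bsub>M\<^esub>" .
   have "?v \<oplus>\<^bsub>?V\<^esub> (\<ominus>\<^bsub>?V\<^esub> h) \<in> H"
    by (rule subsetD[OF k]) (intro CollectI conjI V.M.a_closed V.M.a_inv_closed vC hC, simp add: f0)
   from submoduleD(3)[OF H(1) this h(1)]
   have "?v \<oplus>\<^bsub>?V\<^esub> ((\<ominus>\<^bsub>?V\<^esub> h) \<oplus>\<^bsub>?V\<^esub> h) \<in> H"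
    unfolding V.M.a_assoc[OF vC V.M.a_inv_closed[OF hC] hC] .
   then show False using H(2) unfolding V.M.l_neg[OF hC] V.M.r_zero[OF vC] by (elim notE)
  qed
  then have f0: "f ` H = {\<zero>\<^bsub>M\<^esub>}"
   using image_submodule[OF verma_left L f(1) H(1)] sM unfolding simple_module_def by metis
  have "f h = \<zero>\<^bsub>M\<^esub>" if "h \<in> H" for h
   using imageI[OF that, of f] unfolding f0 by (rule singletonD)
  from Q.factor[OF L f(1) this]
  obtain g where g: "g \<in> linear_maps (U q) Q.Q M" "\<forall>x\<in>carrier ?V. g (Q.pr x) = f x" by blast
  have "module_iso (U q) M Q.Q"
  proof (rule schur[OF Q.left_module_Q L g(1) _ sM])
   show "simple_module (U q) Q.Q" using Q by simp
   show "Q.pr ?v \<in> carrier Q.Q" unfolding Q.carrier_Q by (rule imageI[OF vC])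
   show "g (Q.pr ?v) \<noteq> \<zero>\<^bsub>M\<^esub>" using g(2) vC f(2) w(3) by simp
  qed
  then show ?thesis using l(2) unfolding Q(1) by blast
 qed
qed

end

section \<open>Semisimplicity when the two weights coincide\<close>

lemma subspace_sum_decomp:
 assumes P: "\<And>i. i \<in> I \<Longrightarrow> cv.subspace (P i :: 'a::cvec set)" and m: "m \<in> cv.span (\<Union>i\<in>I. P i)"
 shows "\<exists>J y. finite J \<and> J \<subseteq> I \<and> (\<forall>i\<in>J. y i \<in> P i) \<and> m = (\<Sum>i\<in>J. y i)"
 using m
proof (induction rule: cv.span_induct_alt)
 case base
 show ?case by (intro exI[of _ "{}"]) simp
next
 case (step c x m)
 obtain i where i: "i \<in> I" "x \<in> P i" using step(1) by blast
 obtain J y where J: "finite J" "J \<subseteq> I" "\<forall>i\<in>J. y i \<in> P i" "m = (\<Sum>i\<in>J. y i)" using step(2) by blast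
 let ?J = "insert i J" and ?y = "\<lambda>j. (if j \<in> J then y j else 0) + (if j = i then c *s x else 0)"
 have fJ: "finite ?J" using J(1) by simp
 have "(\<Sum>j\<in>?J. if j \<in> J then y j else 0) = m"
  unfolding J(4) using fJ by (intro sum.mono_neutral_cong_right) auto
 moreover have "(\<Sum>j\<in>?J. if j = i then c *s x else 0) = c *s x" using fJ by (simp add: sum.delta')
 ultimately have "(\<Sum>j\<in>?J. ?y j) = c *s x + m" by (simp only: sum.distrib add.commute)
 moreover have "?y j \<in> P j" if "j \<in> ?J" for j
 proof -
  have jI: "j \<in> I" using that i(1) J(2) by blast
  show ?thesis
   by (rule cv.subspace_add[OF P[OF jI]])
    (use i(2) J(3) cv.subspace_0[OF P[OF jI]] cv.subspace_scale[OF P[OF jI]] in auto)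
 qed
 ultimately show ?case using fJ i(1) J(2) by (intro exI[of _ ?J] exI[of _ ?y]) auto
qed

lemma (in pres) restrict_opstable:
 assumes H: "submodule H (U q) (M\<lparr>carrier := C\<rparr>)" and C: "C \<subseteq> carrier M"
 shows "opstable {x \<in> S. ev x \<in> H}" "H = ev ` {x \<in> S. ev x \<in> H}" "H \<subseteq> C"
proof -
 interpret H: submodule H "U q" "M\<lparr>carrier := C\<rparr>" by (rule H)
 show HC: "H \<subseteq> C" using H.subset by simp
 have 0: "\<zero>\<^bsub>M\<^esub> \<in> H" using H.one_closed by simp
 have a: "x \<oplus>\<^bsub>M\<^esub> y \<in> H" if "x \<in> H" "y \<in> H" for x y using H.m_closed[of x y] that by simp
 have s: "a \<odot>\<^bsub>M\<^esub> x \<in> H" if "a \<in> carrier (U q)" "x \<in> H" for a x using H.smult_closed[of a x] that by simp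
 show "opstable {x \<in> S. ev x \<in> H}"
  unfolding opstable_def
  by (intro conjI cv.subspaceI)
   (use 0 a s cls_simps(1) in \<open>auto simp: ev_0 ev_add ev_scale ev_op op_S\<close>)
 show "H = ev ` {x \<in> S. ev x \<in> H}"
 proof
  show "H \<subseteq> ev ` {x \<in> S. ev x \<in> H}"
  proof
   fix h assume h: "h \<in> H"
   then obtain x where "x \<in> S" "h = ev x" using HC C ev_surj by blast
   then show "h \<in> ev ` {x \<in> S. ev x \<in> H}" using h by blast
  qed
 qed blast
qed

text \<open>With \<open>N = 0\<close> only \<open>ww l0\<close> matters, and \<open>E\<close> kills
  it. Each vector of a basis of \<open>ww l0\<close> generates a submodule whose vectors in
  \<open>ww l0\<close> are its multiples, which makes it simple. The sum is direct because a nonzero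
  intersection would contain a vector of \<open>ww l0\<close> dependent both on \<open>b\<close>
  alone and on the rest of the basis.\<close>

lemma (in qsp) semisimple:
 assumes N: "N = 0" and M: "(M :: (ualg, 'v) module) \<in> charged_block q (half_coset q s) (ctilde q z l0) z"
 shows "semisimple_module (U q) M"
proof -
 have M: "M \<in> block q (half_coset q s) (ctilde q z l0) z"
  and Z: "\<And>v. v \<in> carrier M \<Longrightarrow> cls q eZ \<odot>\<^bsub>M\<^esub> v = cls q (scalar z) \<odot>\<^bsub>M\<^esub> v"
  using M by (auto simp: charged_block_def)
 have L: "left_module (U q) M" using M by (simp add: block_def category_O_def)
 obtain S :: "('v \<Rightarrow>\<^sub>0 complex) set" and op ev where pr: "presents q M S op ev" using pres_exists[OF L] by blast
 interpret pres q M S op ev by (rule pres.intro[OF pr])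
 interpret cpres q z M S op ev by (intro cpres.intro pres_axioms qparam cpres_axioms.intro Z)
 interpret cps q z M S op ev s N by (intro cps.intro cpres_axioms qsp_axioms)
 interpret Q: qsb q z S "op gE" "op gF" "op gK" "op gKi" "op gX" "op gY" s N by (rule block_dest[OF M])
 have l1: "l1 = l0" using N l1_eq_l0 by blast
 have VV: "Q.VV = ww l0" unfolding Q.VV_def l1 by blast
 obtain B where B: "B \<subseteq> ww l0" "cv.independent B" "ww l0 \<subseteq> cv.span B"
  using cv.maximal_independent_subset[of "ww l0"] by blast
 have Bl: "\<exists>l. l \<noteq> 0 \<and> b \<in> ww l" if "b \<in> B" for b using that B(1) l0_nz by blast
 have st: "stable (cv.span (fam A))" if A: "A \<subseteq> B" for A
 proof (rule fam_stable)
  show "\<exists>l. l \<noteq> 0 \<and> b \<in> ww l" if "b \<in> A" for b using that A Bl by blast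
  show "op gE b \<in> cv.span (chain A)" if "b \<in> A" for b
  proof -
   have "op gE b = 0" by (rule Q.E_l0) (use that A B(1) in blast)
   then show ?thesis by (simp add: cv.span_zero)
  qed
 qed
 have comp: "w \<in> cv.span A" if A: "A \<subseteq> B" and w: "w \<in> cv.span (fam A)" "w \<in> ww l0" for A w
 proof (rule fam_component1[OF _ l0_nz w])
  show "A \<subseteq> ww l0" using A B(1) by blast
  fix b i assume "b \<in> A" "l0 / q ^ (2 * i) = l0"
  moreover then have "l0 / q ^ (2 * i) = l0 / q ^ 0" by simp
  then have "i = 0" unfolding l0_div by simp
  ultimately show "(F' ^^ i) b \<in> A" by simp
 qed
 have has: "\<exists>w\<in>P. w \<noteq> 0 \<and> w \<in> ww l0" if "stable P" "x \<in> P" "x \<noteq> 0" for P x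
  using Q.stable_has_vec[OF that] unfolding l1 by blast
 let ?P = "\<lambda>b. cv.span (fam {b})"
 \<comment> \<open>The summands are their own indices, as \<open>semisimple_module\<close> asks;
   \<open>?R\<close> recovers the subspace of \<open>S\<close> from such a submodule.\<close>
 let ?I = "(\<lambda>b. ev ` ?P b) ` B" and ?R = "\<lambda>H. {x \<in> S. ev x \<in> H}"
 have PS: "?P b \<subseteq> S" if "b \<in> B" for b by (rule stableD(2)[OF st]) (use that in blast)
 have R: "?R (ev ` ?P b) = ?P b" if b: "b \<in> B" for b
 proof
  show "?P b \<subseteq> ?R (ev ` ?P b)" using PS[OF b] by blast
  show "?R (ev ` ?P b) \<subseteq> ?P b"
  proof
   fix x assume "x \<in> ?R (ev ` ?P b)"
   then obtain y where y: "x \<in> S" "y \<in> ?P b" "ev x = ev y" by blast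
   then have "x = y" using ev_inj[OF y(1), of y] PS[OF b] by blast
   then show "x \<in> ?P b" using y(2) by simp
  qed
 qed
 have stb: "stable (?P b)" if "b \<in> B" for b by (rule st) (use that in blast)
 have simple: "submodule H (U q) M \<and> simple_module (U q) (M\<lparr>carrier := H\<rparr>)" if H: "H \<in> ?I" for H
 proof
  obtain b where b: "b \<in> B" "H = ev ` ?P b" using H by blast
  show sub: "submodule H (U q) M" unfolding b(2) by (rule opstable_submodule) (simp add: opstable_iff stb[OF b(1)])
  note HM = submoduleD(1)[OF sub]
  have b0: "b \<noteq> 0" using b(1) B(2) cv.dependent_zero by blast
  have bP: "b \<in> ?P b" using subset_fam[of "{b}"] by (blast intro: cv.span_base)
  show "simple_module (U q) (M\<lparr>carrier := H\<rparr>)"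
   unfolding simple_module_def
  proof (intro conjI allI impI)
   have "ev b \<in> H" unfolding b(2) by (rule imageI[OF bP])
   moreover have "ev b \<noteq> \<zero>\<^bsub>M\<^esub>" using ev_eq_0[of b] bP PS[OF b(1)] b0 by blast
   ultimately have "H \<noteq> {\<zero>\<^bsub>M\<^esub>}" by blast
   then show "carrier (M\<lparr>carrier := H\<rparr>) \<noteq> {\<zero>\<^bsub>M\<lparr>carrier := H\<rparr>\<^esub>}" by simp
   fix H' assume H': "submodule H' (U q) (M\<lparr>carrier := H\<rparr>)"
   note r = restrict_opstable[OF H' HM]
   have sP: "stable (?R H')" using r(1) by (simp add: opstable_iff)
   have "H' = {\<zero>\<^bsub>M\<^esub>} \<or> H' = H"
   proof (cases "?R H' \<subseteq> {0}")
    case True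
    then have "?R H' = {0}" using cv.subspace_0[OF stableD(1)[OF sP]] by blast
    then have "H' = ev ` {0}" using r(2) by simp
    then show ?thesis using ev_0 by simp
   next
    case False
    then obtain x where "x \<in> ?R H'" "x \<noteq> 0" by blast
    then obtain w where w: "w \<in> ?R H'" "w \<noteq> 0" "w \<in> ww l0" using has[OF sP] by blast
    have "w \<in> ?R H" using w(1) r(3) by blast
    then have "w \<in> ?P b" unfolding b(2) R[OF b(1)] .
    then have "w \<in> cv.span {b}" using comp[of "{b}" w] w(3) b(1) by blast
    then obtain c where c: "w = c *s b" by (auto simp: cv.span_singleton)
    then have "b = (1 / c) *s w" using w(2) by auto
    then have "b \<in> ?R H'" using cv.subspace_scale[OF stableD(1)[OF sP] w(1)] by simp
    then have "?P b \<subseteq> ?R H'" by (intro stable_fam[OF sP]) simp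
    then have "H \<subseteq> H'" unfolding b(2) by blast
    then show ?thesis using r(3) by blast
   qed
   then show "H' = {\<zero>\<^bsub>M\<lparr>carrier := H\<rparr>\<^esub>} \<or> H' = carrier (M\<lparr>carrier := H\<rparr>)" by simp
  qed
 qed
 have "internal_direct_sum M ?I (\<lambda>H. H)"
 proof (rule ids_intro[where P = ?R])
  fix H assume H: "H \<in> ?I"
  then obtain b where b: "b \<in> B" "H = ev ` ?P b" by blast
  show "cv.subspace (?R H) \<and> ?R H \<subseteq> S \<and> H = ev ` ?R H"
   unfolding b(2) R[OF b(1)] using stableD(1,2)[OF stb[OF b(1)]] by blast
 next
  fix m assume m: "m \<in> S"
  show "\<exists>J y. finite J \<and> J \<subseteq> ?I \<and> (\<forall>i\<in>J. y i \<in> ?R i) \<and> m = (\<Sum>i\<in>J. y i)"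
  proof (rule subspace_sum_decomp)
   show "cv.subspace (?R H)" if H: "H \<in> ?I" for H
   proof -
    obtain b where b: "b \<in> B" "H = ev ` ?P b" using H by blast
    show ?thesis unfolding b(2) R[OF b(1)] by (rule cv.subspace_span)
   qed
   have "m \<in> cv.span (fam B)"
   proof (rule fam_span)
    show "m \<in> cv.span (fam Q.VV)" using m Q.S_fam by blast
    have "B \<subseteq> chain B" using chainI[of _ B 0] by auto
    then have "cv.span B \<subseteq> cv.span (chain B)" by (rule cv.span_mono)
    then show "Q.VV \<subseteq> cv.span (chain B)" unfolding VV using B(3) by blast
   qed
   moreover have "fam B \<subseteq> (\<Union>H\<in>?I. ?R H)"
   proof
    fix g assume "g \<in> fam B"
    then obtain k i b where g: "g = (op gY ^^ k) ((F' ^^ i) b)" "b \<in> B" unfolding fam_def by blast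
    have "g \<in> ?P b" unfolding g(1) by (rule cv.span_base) (rule famI, simp)
    then have "g \<in> ?R (ev ` ?P b)" unfolding R[OF g(2)] .
    then show "g \<in> (\<Union>H\<in>?I. ?R H)" using g(2) by blast
   qed
   ultimately show "m \<in> cv.span (\<Union>H\<in>?I. ?R H)" using cv.span_mono by blast
  qed
 next
  fix J y H assume J: "finite J" "J \<subseteq> ?I" "\<forall>i\<in>J. y i \<in> ?R i" "(\<Sum>i\<in>J. y i) = 0" "H \<in> J"
  obtain b where b: "b \<in> B" "H = ev ` ?P b" using J(2,5) by blast
  let ?C = "cv.span (fam (B - {b}))"
  have 1: "y H \<in> ?P b" using J(3,5) R[OF b(1)] unfolding b(2)[symmetric] by blast
  have o: "y i \<in> ?C" if i: "i \<in> J - {H}" for i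
  proof -
   obtain b' where b': "b' \<in> B" "i = ev ` ?P b'" using J(2) i by blast
   have "b' \<noteq> b" using i b(2) b'(2) by blast
   then have "fam {b'} \<subseteq> fam (B - {b})" using b'(1) by (intro fam_mono) blast
   then have "?P b' \<subseteq> ?C" by (rule cv.span_mono)
   moreover have "y i \<in> ?P b'" using J(3) i R[OF b'(1)] unfolding b'(2)[symmetric] by blast
   ultimately show ?thesis by blast
  qed
  have "y H + (\<Sum>i\<in>J - {H}. y i) = 0" using J(4) sum.remove[OF J(1,5), of y] by simp
  then have "y H = - (\<Sum>i\<in>J - {H}. y i)" by (simp add: eq_neg_iff_add_eq_0)
  then have 2: "y H \<in> ?C" using cv.span_neg[OF cv.span_sum[of "J - {H}" y]] o by metis
  show "y H = 0"
  proof (rule ccontr)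
   assume nz: "y H \<noteq> 0"
   have s1: "stable (?P b)" "stable ?C" by (rule stb[OF b(1)], rule st) blast
   have "stable (?P b \<inter> ?C)"
    using s1 cv.subspace_inter unfolding stable_def by blast
   then obtain w where w: "w \<in> ?P b" "w \<in> ?C" "w \<noteq> 0" "w \<in> ww l0" using has[of _ "y H"] 1 2 nz by blast
   have "w \<in> cv.span {b}" using comp[of "{b}" w] w b(1) by blast
   moreover have w2: "w \<in> cv.span (B - {b})" using comp[of "B - {b}" w] w by blast
   ultimately obtain c where c: "w = c *s b" by (auto simp: cv.span_singleton)
   then have "b = (1 / c) *s w" using w(3) by auto
   then have "b \<in> cv.span (B - {b})" using cv.span_scale[OF w2] by metis
   then show False using B(2) b(1) unfolding cv.dependent_def by blast
  qed
 qed
 then show ?thesis unfolding semisimple_module_def using simple by blast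
qed

section \<open>Equivalences of linear categories\<close>

text \<open>The module axioms hold for a space of maps when they hold after every evaluation and the
  evaluations separate its elements. This covers the morphism spaces of both categories.\<close>

lemma module_by_evaluations:
 fixes H :: "(complex, 'h) module" and W :: "'i \<Rightarrow> (complex, 'w) module"
 assumes W: "\<And>i. i \<in> I \<Longrightarrow> Module.module complex_field (W i)"
  and e: "\<And>i f. i \<in> I \<Longrightarrow> f \<in> carrier H \<Longrightarrow> e i f \<in> carrier (W i)"
  and inj: "\<And>f g. f \<in> carrier H \<Longrightarrow> g \<in> carrier H \<Longrightarrow> (\<And>i. i \<in> I \<Longrightarrow> e i f = e i g) \<Longrightarrow> f = g"
  and zero: "\<zero>\<^bsub>H\<^esub> \<in> carrier H" "\<And>i. i \<in> I \<Longrightarrow> e i \<zero>\<^bsub>H\<^esub> = \<zero>\<^bsub>W i\<^esub>"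
  and add: "\<And>f g. f \<in> carrier H \<Longrightarrow> g \<in> carrier H \<Longrightarrow> f \<oplus>\<^bsub>H\<^esub> g \<in> carrier H"
   "\<And>i f g. i \<in> I \<Longrightarrow> f \<in> carrier H \<Longrightarrow> g \<in> carrier H \<Longrightarrow> e i (f \<oplus>\<^bsub>H\<^esub> g) = e i f \<oplus>\<^bsub>W i\<^esub> e i g"
  and smult: "\<And>c f. f \<in> carrier H \<Longrightarrow> c \<odot>\<^bsub>H\<^esub> f \<in> carrier H"
   "\<And>i c f. i \<in> I \<Longrightarrow> f \<in> carrier H \<Longrightarrow> e i (c \<odot>\<^bsub>H\<^esub> f) = c \<odot>\<^bsub>W i\<^esub> e i f"
 shows "Module.module complex_field H"
proof (rule moduleI[OF complex_field_cring])
 note W' = module.axioms(2)[OF W] and sm = module.axioms(3)[OF W]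
 show "abelian_group H"
 proof (rule abelian_groupI)
  fix f assume f: "f \<in> carrier H"
  show "\<exists>g\<in>carrier H. g \<oplus>\<^bsub>H\<^esub> f = \<zero>\<^bsub>H\<^esub>"
  proof (intro bexI[of _ "(- 1) \<odot>\<^bsub>H\<^esub> f"] inj)
   fix i assume i: "i \<in> I"
   interpret Wi: Module.module complex_field "W i" by (rule W[OF i])
   have "(- 1) \<odot>\<^bsub>W i\<^esub> e i f \<oplus>\<^bsub>W i\<^esub> 1 \<odot>\<^bsub>W i\<^esub> e i f = (- 1 + 1) \<odot>\<^bsub>W i\<^esub> e i f"
    using Wi.smult_l_distr[of "-1" 1 "e i f"] e[OF i f] by simp
   also have "\<dots> = \<zero>\<^bsub>W i\<^esub>" using Wi.smult_l_null[OF e[OF i f]] by simp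
   finally show "e i ((- 1) \<odot>\<^bsub>H\<^esub> f \<oplus>\<^bsub>H\<^esub> f) = e i \<zero>\<^bsub>H\<^esub>"
    using Wi.smult_one[OF e[OF i f]] i f by (simp add: add smult zero)
  qed (use f in \<open>simp_all add: add smult zero\<close>)
 next
  fix f g h assume f: "f \<in> carrier H" "g \<in> carrier H" "h \<in> carrier H"
  show "f \<oplus>\<^bsub>H\<^esub> g \<oplus>\<^bsub>H\<^esub> h = f \<oplus>\<^bsub>H\<^esub> (g \<oplus>\<^bsub>H\<^esub> h)"
   by (rule inj) (use f in \<open>simp_all add: add e abelian_monoid.a_assoc[OF abelian_group.axioms(1)[OF W']]\<close>)
 next
  fix f g assume f: "f \<in> carrier H" "g \<in> carrier H"
  show "f \<oplus>\<^bsub>H\<^esub> g = g \<oplus>\<^bsub>H\<^esub> f"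
   by (rule inj) (use f in \<open>simp_all add: add e abelian_monoid.a_comm[OF abelian_group.axioms(1)[OF W']]\<close>)
 next
  fix f assume f: "f \<in> carrier H"
  show "\<zero>\<^bsub>H\<^esub> \<oplus>\<^bsub>H\<^esub> f = f"
   by (rule inj) (use f in \<open>simp_all add: add zero e abelian_monoid.l_zero[OF abelian_group.axioms(1)[OF W']]\<close>)
 qed (rule add(1), assumption+, rule zero(1))
next
 fix a b x y assume x: "x \<in> carrier H" and y: "y \<in> carrier H"
 note simps = Module.module.smult_l_distr[OF W, simplified] Module.module.smult_r_distr[OF W, simplified]
   Module.module.smult_assoc1[OF W, simplified] Module.module.smult_one[OF W, simplified]
 show "a \<odot>\<^bsub>H\<^esub> x \<in> carrier H" by (rule smult(1)[OF x])
 show "(a \<oplus>\<^bsub>complex_field\<^esub> b) \<odot>\<^bsub>H\<^esub> x = a \<odot>\<^bsub>H\<^esub> x \<oplus>\<^bsub>H\<^esub> b \<odot>\<^bsub>H\<^esub> x"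
  by (rule inj) (use x in \<open>simp_all add: add smult e simps\<close>)
 show "a \<odot>\<^bsub>H\<^esub> (x \<oplus>\<^bsub>H\<^esub> y) = a \<odot>\<^bsub>H\<^esub> x \<oplus>\<^bsub>H\<^esub> a \<odot>\<^bsub>H\<^esub> y"
  by (rule inj) (use x y in \<open>simp_all add: add smult e simps\<close>)
 show "(a \<otimes>\<^bsub>complex_field\<^esub> b) \<odot>\<^bsub>H\<^esub> x = a \<odot>\<^bsub>H\<^esub> (b \<odot>\<^bsub>H\<^esub> x)"
  by (rule inj) (use x in \<open>simp_all add: add smult e simps\<close>)
 show "\<one>\<^bsub>complex_field\<^esub> \<odot>\<^bsub>H\<^esub> x = x"
  by (rule inj) (use x in \<open>simp_all add: add smult e simps\<close>)
qed

lemma left_module_of_module: "Module.module complex_field W \<Longrightarrow> left_module complex_field W"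
proof -
 assume "Module.module complex_field W"
 then interpret Module.module complex_field W .
 show ?thesis
  using smult_l_distr smult_r_distr smult_assoc1 smult_one
  by (intro left_module.intro left_module_axioms.intro univ_ring) (auto intro: abelian_group_axioms)
qed

lemma linear_maps_zero:
 assumes "left_module R M" "left_module R M'"
 shows "(\<lambda>v\<in>carrier M. \<zero>\<^bsub>M'\<^esub>) \<in> linear_maps R M M'"
proof -
 interpret M: left_module R M by (rule assms)
 interpret M': left_module R M' by (rule assms)
 show ?thesis using submoduleD(5)[OF zero_submodule[OF assms(2)]] by (auto simp: linear_maps_def)
qed

lemma linear_maps_add:
 assumes "left_module R M" "left_module R M'" and f: "f \<in> linear_maps R M M'" and g: "g \<in> linear_maps R M M'"
 shows "(\<lambda>v\<in>carrier M. f v \<oplus>\<^bsub>M'\<^esub> g v) \<in> linear_maps R M M'"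
proof -
 interpret M: left_module R M by (rule assms)
 interpret M': left_module R M' by (rule assms)
 show ?thesis
  using linear_mapsD[OF f] linear_mapsD[OF g]
  by (auto simp: linear_maps_def M'.smult_r_distr M'.M.a_ac)
qed

lemma linear_maps_compose:
 assumes "left_module R L" and f: "f \<in> linear_maps R L M" and g: "g \<in> linear_maps R M N"
 shows "(\<lambda>v\<in>carrier L. g (f v)) \<in> linear_maps R L N"
proof -
 interpret L: left_module R L by (rule assms)
 show ?thesis using linear_mapsD[OF f] linear_mapsD[OF g] by (auto simp: linear_maps_def)
qed

lemma cls_scalar_linear:
 assumes "left_module (U q) M" shows "(\<lambda>v. cls q (scalar c) \<odot>\<^bsub>M\<^esub> v) \<in> linear_maps (U q) M M"
proof -
 interpret left_module "U q" M by (rule assms)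
 have "cls q (scalar c) \<odot>\<^bsub>M\<^esub> (u \<odot>\<^bsub>M\<^esub> v) = u \<odot>\<^bsub>M\<^esub> (cls q (scalar c) \<odot>\<^bsub>M\<^esub> v)"
  if uv: "u \<in> carrier (U q)" "v \<in> carrier M" for u v
 proof -
  obtain a where a: "u = cls q a" using uv(1) by (auto simp: carrier_U)
  show ?thesis
   using smult_assoc1[of "cls q (scalar c)" u v] smult_assoc1[of u "cls q (scalar c)" v] uv
   by (simp add: cls_simps(1) a flip: cls_simps(3)) (simp add: scalar_comm)
 qed
 then show ?thesis by (auto simp: linear_maps_def cls_simps(1) smult_r_distr)
qed

lemma complex_scalar_linear:
 assumes "Module.module complex_field W" shows "(\<lambda>v. c \<odot>\<^bsub>W\<^esub> v) \<in> linear_maps complex_field W W"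
proof -
 interpret Module.module complex_field W by (rule assms)
 have "c \<odot>\<^bsub>W\<^esub> (d \<odot>\<^bsub>W\<^esub> v) = d \<odot>\<^bsub>W\<^esub> (c \<odot>\<^bsub>W\<^esub> v)" if "v \<in> carrier W" for d v
  using smult_assoc1[of c d v] smult_assoc1[of d c v] that by (simp add: mult.commute)
 then show ?thesis using smult_r_distr smult_closed by (auto simp: linear_maps_def)
qed

section \<open>The module category and the quiver category as linear categories\<close>

lemma linear_module_category:
 assumes L: "\<And>M. M \<in> \<M> \<Longrightarrow> left_module (U q) M"
 shows "linear_category (full_module_category q \<M>)"
proof -
 have cp: "compose A g f = (\<lambda>v\<in>A. g (f v))" for A and g f :: "'v \<Rightarrow> 'v" by (simp add: compose_def)
 have C: "(f \<in> carrier (ualg_hom_space q M N)) = (f \<in> linear_maps (U q) M N \<and> f \<in> extensional (carrier M))" for f M N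
  by (simp add: ualg_hom_space_def)
 have lc: "(\<lambda>v\<in>carrier M. cls q (scalar c) \<odot>\<^bsub>N\<^esub> f v) \<in> linear_maps (U q) M N"
  if "M \<in> \<M>" "N \<in> \<M>" "f \<in> linear_maps (U q) M N" for M N f c
  by (rule linear_maps_compose[OF L that(3) cls_scalar_linear[OF L]]) (use that in auto)
 have co: "(\<lambda>v\<in>carrier M. g (f v)) \<in> carrier (ualg_hom_space q M P)"
  if "M \<in> \<M>" "f \<in> carrier (ualg_hom_space q M N)" "g \<in> carrier (ualg_hom_space q N P)" for M N P f g
  using linear_maps_compose[OF L[OF that(1)], of f N g P] that by (simp add: C)
 show ?thesis
 proof (rule linear_category.intro, unfold full_module_category_def lin_cat.simps cp)
  fix M N assume M: "M \<in> \<M>" and N: "N \<in> \<M>"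
  interpret N: left_module "U q" N by (rule L[OF N])
  show "Module.module complex_field (ualg_hom_space q M N)"
  proof (rule module_by_evaluations[where I = "carrier M" and e = "\<lambda>v f. f v" and W = "\<lambda>_. vector_space_of q N"])
   show "Module.module complex_field (vector_space_of q N)" by (rule vector_space_of_module[OF L[OF N]])
   show "f v \<in> carrier (vector_space_of q N)" if "v \<in> carrier M" "f \<in> carrier (ualg_hom_space q M N)" for v f
    using that linear_mapsD(1)[of f "U q" M N] by (simp add: C vector_space_of_def)
   show "f = g" if "f \<in> carrier (ualg_hom_space q M N)" "g \<in> carrier (ualg_hom_space q M N)"
    "\<And>v. v \<in> carrier M \<Longrightarrow> f v = g v" for f g
    using that by (intro extensionalityI[of f "carrier M" g]) (simp_all add: C)
   show "\<zero>\<^bsub>ualg_hom_space q M N\<^esub> \<in> carrier (ualg_hom_space q M N)"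
    using linear_maps_zero[OF L[OF M] L[OF N]] by (simp add: ualg_hom_space_def)
   show "f \<oplus>\<^bsub>ualg_hom_space q M N\<^esub> g \<in> carrier (ualg_hom_space q M N)"
    if "f \<in> carrier (ualg_hom_space q M N)" "g \<in> carrier (ualg_hom_space q M N)" for f g
    using linear_maps_add[OF L[OF M] L[OF N], of f g] that by (simp add: ualg_hom_space_def)
   show "c \<odot>\<^bsub>ualg_hom_space q M N\<^esub> f \<in> carrier (ualg_hom_space q M N)"
    if "f \<in> carrier (ualg_hom_space q M N)" for c f
    using lc[OF M N] that by (simp add: ualg_hom_space_def)
  qed (simp_all add: ualg_hom_space_def vector_space_of_def)
 next
  fix M assume "M \<in> \<M>"
  then interpret M: left_module "U q" M by (rule L)
  show "(\<lambda>v\<in>carrier M. v) \<in> carrier (ualg_hom_space q M M)" by (simp add: C linear_maps_def)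
 next
  fix K M N f assume a: "K \<in> \<M>" "M \<in> \<M>" "N \<in> \<M>" "f \<in> carrier (ualg_hom_space q K M)"
  have fc: "f v \<in> carrier M" if "v \<in> carrier K" for v using a(4) that unfolding C by (blast intro: linear_mapsD(1))
  show "(\<lambda>g. \<lambda>v\<in>carrier K. g (f v)) \<in> linear_maps complex_field (ualg_hom_space q M N) (ualg_hom_space q K N)"
   unfolding linear_maps_def
   using co[OF a(1,4)] fc by (auto simp: ualg_hom_space_def intro!: restrict_ext)
 next
  fix K M N g assume a: "K \<in> \<M>" "M \<in> \<M>" "N \<in> \<M>" "g \<in> carrier (ualg_hom_space q M N)"
  have g: "g \<in> linear_maps (U q) M N" using a(4) by (simp add: C)
  have fc: "f v \<in> carrier M" if "f \<in> carrier (ualg_hom_space q K M)" "v \<in> carrier K" for f v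
   using that unfolding C by (blast intro: linear_mapsD(1))
  show "(\<lambda>f. \<lambda>v\<in>carrier K. g (f v)) \<in> linear_maps complex_field (ualg_hom_space q K M) (ualg_hom_space q K N)"
   unfolding linear_maps_def
  proof (intro CollectI conjI ballI Pi_I)
   fix f assume f: "f \<in> carrier (ualg_hom_space q K M)"
   show "(\<lambda>v\<in>carrier K. g (f v)) \<in> carrier (ualg_hom_space q K N)" by (rule co[OF a(1) f a(4)])
  qed (auto simp: ualg_hom_space_def linear_mapsD(2,3)[OF g] fc[unfolded ualg_hom_space_def, simplified] cls_simps(1) intro!: restrict_ext)
 next
  fix K M f assume a: "K \<in> \<M>" "M \<in> \<M>" "f \<in> carrier (ualg_hom_space q K M)"
  have fc: "f v \<in> carrier M" if "v \<in> carrier K" for v using a(3) that unfolding C by (blast intro: linear_mapsD(1))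
  show "(\<lambda>v\<in>carrier K. (\<lambda>v\<in>carrier M. v) (f v)) = f" "(\<lambda>v\<in>carrier K. f ((\<lambda>v\<in>carrier K. v) v)) = f"
   using a(3) fc by (auto simp: C extensional_def restrict_def fun_eq_iff)
 next
  fix J K M N f g h
  assume a: "J \<in> \<M>" "K \<in> \<M>" "M \<in> \<M>" "N \<in> \<M>" "f \<in> carrier (ualg_hom_space q J K)"
   "g \<in> carrier (ualg_hom_space q K M)" "h \<in> carrier (ualg_hom_space q M N)"
  have fc: "f v \<in> carrier K" if "v \<in> carrier J" for v using a(5) that unfolding C by (blast intro: linear_mapsD(1))
  show "(\<lambda>v\<in>carrier J. (\<lambda>v\<in>carrier K. h (g v)) (f v)) = (\<lambda>v\<in>carrier J. h ((\<lambda>v\<in>carrier J. g (f v)) v))"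
   using fc by (auto intro!: restrict_ext)
 qed
qed

definition qhom :: "'w quiver_rep \<Rightarrow> 'w quiver_rep \<Rightarrow> ('w \<Rightarrow> 'w) \<Rightarrow> ('w \<Rightarrow> 'w) \<Rightarrow> bool" where
 "qhom V W f1 f2 \<longleftrightarrow> f1 \<in> linear_maps complex_field (sp1 V) (sp1 W) \<and> f1 \<in> extensional (carrier (sp1 V)) \<and>
   f2 \<in> linear_maps complex_field (sp2 V) (sp2 W) \<and> f2 \<in> extensional (carrier (sp2 V)) \<and>
   (\<forall>v\<in>carrier (sp1 V). f2 (arr_a V v) = arr_a W (f1 v)) \<and>
   (\<forall>v\<in>carrier (sp2 V). f1 (arr_b V v) = arr_b W (f2 v))"

lemma qhom_carrier: "f \<in> carrier (quiver_hom_space V W) \<longleftrightarrow> qhom V W (fst f) (snd f)"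
 by (cases f) (auto simp: quiver_hom_space_def qhom_def)

lemma quiver_repsD:
 assumes "V \<in> quiver_reps"
 shows "Module.module complex_field (sp1 V)" "Module.module complex_field (sp2 V)"
  "left_module complex_field (sp1 V)" "left_module complex_field (sp2 V)"
  "arr_a V \<in> linear_maps complex_field (sp1 V) (sp2 V)" "arr_b V \<in> linear_maps complex_field (sp2 V) (sp1 V)"
 using assms left_module_of_module by (auto simp: quiver_reps_def)

lemma qhomD:
 assumes "qhom V W f1 f2"
 shows "f1 \<in> linear_maps complex_field (sp1 V) (sp1 W)" "f1 \<in> extensional (carrier (sp1 V))"
  "f2 \<in> linear_maps complex_field (sp2 V) (sp2 W)" "f2 \<in> extensional (carrier (sp2 V))"
  "v \<in> carrier (sp1 V) \<Longrightarrow> f2 (arr_a V v) = arr_a W (f1 v)"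
  "v \<in> carrier (sp2 V) \<Longrightarrow> f1 (arr_b V v) = arr_b W (f2 v)"
  "v \<in> carrier (sp1 V) \<Longrightarrow> f1 v \<in> carrier (sp1 W)" "v \<in> carrier (sp2 V) \<Longrightarrow> f2 v \<in> carrier (sp2 W)"
proof -
 show 1: "f1 \<in> linear_maps complex_field (sp1 V) (sp1 W)" "f1 \<in> extensional (carrier (sp1 V))"
  "f2 \<in> linear_maps complex_field (sp2 V) (sp2 W)" "f2 \<in> extensional (carrier (sp2 V))"
  "v \<in> carrier (sp1 V) \<Longrightarrow> f2 (arr_a V v) = arr_a W (f1 v)"
  "v \<in> carrier (sp2 V) \<Longrightarrow> f1 (arr_b V v) = arr_b W (f2 v)"
  using assms unfolding qhom_def by blast+
 show "v \<in> carrier (sp1 V) \<Longrightarrow> f1 v \<in> carrier (sp1 W)" "v \<in> carrier (sp2 V) \<Longrightarrow> f2 v \<in> carrier (sp2 W)"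
  using linear_mapsD(1)[OF 1(1)] linear_mapsD(1)[OF 1(3)] by blast+
qed

lemma qhom_ops:
 assumes V: "V \<in> quiver_reps" and W: "W \<in> quiver_reps"
 shows "qhom V W (\<lambda>v\<in>carrier (sp1 V). \<zero>\<^bsub>sp1 W\<^esub>) (\<lambda>v\<in>carrier (sp2 V). \<zero>\<^bsub>sp2 W\<^esub>)"
  "qhom V W f1 f2 \<Longrightarrow> qhom V W g1 g2 \<Longrightarrow>
   qhom V W (\<lambda>v\<in>carrier (sp1 V). f1 v \<oplus>\<^bsub>sp1 W\<^esub> g1 v) (\<lambda>v\<in>carrier (sp2 V). f2 v \<oplus>\<^bsub>sp2 W\<^esub> g2 v)"
  "qhom V W f1 f2 \<Longrightarrow> qhom V W (\<lambda>v\<in>carrier (sp1 V). c \<odot>\<^bsub>sp1 W\<^esub> f1 v) (\<lambda>v\<in>carrier (sp2 V). c \<odot>\<^bsub>sp2 W\<^esub> f2 v)"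
  "qhom W X g1 g2 \<Longrightarrow> qhom V W f1 f2 \<Longrightarrow> qhom V X (\<lambda>v\<in>carrier (sp1 V). g1 (f1 v)) (\<lambda>v\<in>carrier (sp2 V). g2 (f2 v))"
  "qhom V V (\<lambda>v\<in>carrier (sp1 V). v) (\<lambda>v\<in>carrier (sp2 V). v)"
proof -
 note v = quiver_repsD[OF V] and w = quiver_repsD[OF W]
 note va = linear_mapsD[OF v(5)] linear_mapsD[OF v(6)] and wa = linear_mapsD[OF w(5)] linear_mapsD[OF w(6)]
 note z = linear_map_zero_neg(1)[OF w(5) left_module.axioms(2)[OF w(3)] left_module.axioms(2)[OF w(4)]]
  linear_map_zero_neg(1)[OF w(6) left_module.axioms(2)[OF w(4)] left_module.axioms(2)[OF w(3)]]
 show "qhom V W (\<lambda>v\<in>carrier (sp1 V). \<zero>\<^bsub>sp1 W\<^esub>) (\<lambda>v\<in>carrier (sp2 V). \<zero>\<^bsub>sp2 W\<^esub>)"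
  using linear_maps_zero[OF v(3) w(3)] linear_maps_zero[OF v(4) w(4)] va(1,4) z by (simp add: qhom_def)
 show "qhom V W (\<lambda>v\<in>carrier (sp1 V). f1 v \<oplus>\<^bsub>sp1 W\<^esub> g1 v) (\<lambda>v\<in>carrier (sp2 V). f2 v \<oplus>\<^bsub>sp2 W\<^esub> g2 v)"
  if f: "qhom V W f1 f2" and g: "qhom V W g1 g2"
  using linear_maps_add[OF v(3) w(3) qhomD(1)[OF f] qhomD(1)[OF g]] linear_maps_add[OF v(4) w(4) qhomD(3)[OF f] qhomD(3)[OF g]]
   va(1,4) qhomD(5-8)[OF f] qhomD(5-8)[OF g] wa(2,5) by (simp add: qhom_def)
 show "qhom V W (\<lambda>v\<in>carrier (sp1 V). c \<odot>\<^bsub>sp1 W\<^esub> f1 v) (\<lambda>v\<in>carrier (sp2 V). c \<odot>\<^bsub>sp2 W\<^esub> f2 v)"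
  if f: "qhom V W f1 f2"
  using linear_maps_compose[OF v(3) qhomD(1)[OF f] complex_scalar_linear[OF w(1)]]
   linear_maps_compose[OF v(4) qhomD(3)[OF f] complex_scalar_linear[OF w(2)]]
   va(1,4) qhomD(5-8)[OF f] wa(3,6) by (simp add: qhom_def)
 show "qhom V X (\<lambda>v\<in>carrier (sp1 V). g1 (f1 v)) (\<lambda>v\<in>carrier (sp2 V). g2 (f2 v))"
  if g: "qhom W X g1 g2" and f: "qhom V W f1 f2"
  using linear_maps_compose[OF v(3) qhomD(1)[OF f] qhomD(1)[OF g]] linear_maps_compose[OF v(4) qhomD(3)[OF f] qhomD(3)[OF g]]
   va(1,4) qhomD(5-8)[OF f] qhomD(5-8)[OF g] by (simp add: qhom_def)
 show "qhom V V (\<lambda>v\<in>carrier (sp1 V). v) (\<lambda>v\<in>carrier (sp2 V). v)"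
 proof -
  interpret V1: left_module complex_field "sp1 V" by (rule v(3))
  interpret V2: left_module complex_field "sp2 V" by (rule v(4))
  show ?thesis using va V1.smult_closed V2.smult_closed by (simp add: qhom_def linear_maps_def)
 qed
qed

lemma linear_quiver_category: "linear_category (quiver_category :: ('w quiver_rep, ('w \<Rightarrow> 'w) \<times> ('w \<Rightarrow> 'w)) lin_cat)"
proof -
 have cp: "compose A g f = (\<lambda>v\<in>A. g (f v))" for A and g f :: "'w \<Rightarrow> 'w" by (simp add: compose_def)
 note hs = quiver_hom_space_def
 show ?thesis
 proof (rule linear_category.intro, unfold quiver_category_def lin_cat.simps cp)
  fix V W :: "'w quiver_rep" assume V: "V \<in> quiver_reps" and W: "W \<in> quiver_reps"
  show "Module.module complex_field (quiver_hom_space V W)"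
  proof (rule module_by_evaluations[where I = "carrier (sp1 V) <+> carrier (sp2 V)"
     and e = "\<lambda>i f. case i of Inl v \<Rightarrow> fst f v | Inr v \<Rightarrow> snd f v"
     and W = "\<lambda>i. case i of Inl v \<Rightarrow> sp1 W | Inr v \<Rightarrow> sp2 W"])
   show "Module.module complex_field (case i of Inl v \<Rightarrow> sp1 W | Inr v \<Rightarrow> sp2 W)" for i :: "'w + 'w"
    using quiver_repsD(1,2)[OF W] by (simp split: sum.split)
   show "(case i of Inl v \<Rightarrow> fst f v | Inr v \<Rightarrow> snd f v) \<in> carrier (case i of Inl v \<Rightarrow> sp1 W | Inr v \<Rightarrow> sp2 W)"
    if "i \<in> carrier (sp1 V) <+> carrier (sp2 V)" "f \<in> carrier (quiver_hom_space V W)" for i f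
    using that qhomD(7,8) by (auto simp: qhom_carrier)
   show "f = g" if "f \<in> carrier (quiver_hom_space V W)" "g \<in> carrier (quiver_hom_space V W)"
    "\<And>i. i \<in> carrier (sp1 V) <+> carrier (sp2 V) \<Longrightarrow>
     (case i of Inl v \<Rightarrow> fst f v | Inr v \<Rightarrow> snd f v) = (case i of Inl v \<Rightarrow> fst g v | Inr v \<Rightarrow> snd g v)" for f g
   proof (rule prod_eqI)
    show "fst f = fst g"
     by (rule extensionalityI[of _ "carrier (sp1 V)"])
      (use that(1,2) that(3)[OF InlI] qhomD(2) in \<open>auto simp: qhom_carrier\<close>)
    show "snd f = snd g"
     by (rule extensionalityI[of _ "carrier (sp2 V)"])
      (use that(1,2) that(3)[OF InrI] qhomD(4) in \<open>auto simp: qhom_carrier\<close>)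
   qed
   show "\<zero>\<^bsub>quiver_hom_space V W\<^esub> \<in> carrier (quiver_hom_space V W)"
    using qhom_ops(1)[OF V W] unfolding qhom_carrier by (simp add: hs)
   show "f \<oplus>\<^bsub>quiver_hom_space V W\<^esub> g \<in> carrier (quiver_hom_space V W)"
    if "f \<in> carrier (quiver_hom_space V W)" "g \<in> carrier (quiver_hom_space V W)" for f g
    using qhom_ops(2)[OF V W] that unfolding qhom_carrier by (simp add: hs)
   show "c \<odot>\<^bsub>quiver_hom_space V W\<^esub> f \<in> carrier (quiver_hom_space V W)"
    if "f \<in> carrier (quiver_hom_space V W)" for c f
    using qhom_ops(3)[OF V W] that unfolding qhom_carrier by (simp add: hs)
  qed (auto simp: hs)
 next
  fix V :: "'w quiver_rep" assume V: "V \<in> quiver_reps"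
  show "(\<lambda>v\<in>carrier (sp1 V). v, \<lambda>v\<in>carrier (sp2 V). v) \<in> carrier (quiver_hom_space V V)"
   using qhom_ops(5)[OF V V] unfolding qhom_carrier by simp
 next
  fix V W X :: "'w quiver_rep" and f assume a: "V \<in> quiver_reps" "W \<in> quiver_reps" "X \<in> quiver_reps" "f \<in> carrier (quiver_hom_space V W)"
  note f = a(4)[unfolded qhom_carrier]
  let ?c = "\<lambda>g. (\<lambda>v\<in>carrier (sp1 V). fst g (fst f v), \<lambda>v\<in>carrier (sp2 V). snd g (snd f v))"
  have 1: "?c g \<in> carrier (quiver_hom_space V X)" if "g \<in> carrier (quiver_hom_space W X)" for g
   using qhom_ops(4)[OF a(1,2) _ f] that unfolding qhom_carrier by simp
  show "?c \<in> linear_maps complex_field (quiver_hom_space W X) (quiver_hom_space V X)"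
   unfolding linear_maps_def
   using 1 qhomD(7,8)[OF f] by (simp add: Pi_iff) (simp add: hs cong: restrict_cong)
 next
  fix V W X :: "'w quiver_rep" and g assume a: "V \<in> quiver_reps" "W \<in> quiver_reps" "X \<in> quiver_reps" "g \<in> carrier (quiver_hom_space W X)"
  note g = a(4)[unfolded qhom_carrier]
  let ?c = "\<lambda>f. (\<lambda>v\<in>carrier (sp1 V). fst g (fst f v), \<lambda>v\<in>carrier (sp2 V). snd g (snd f v))"
  let ?H = "quiver_hom_space V W" and ?H' = "quiver_hom_space V X"
  note L1 = linear_mapsD[OF qhomD(1)[OF g]] and L2 = linear_mapsD[OF qhomD(3)[OF g]]
  show "?c \<in> linear_maps complex_field ?H ?H'"
   unfolding linear_maps_def
  proof (intro CollectI conjI ballI Pi_I)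
   fix f assume ff: "f \<in> carrier ?H"
   note F = ff[unfolded qhom_carrier]
   show "?c f \<in> carrier ?H'" using qhom_ops(4)[OF a(1,2) g F] unfolding qhom_carrier by simp
   show "?c (f \<oplus>\<^bsub>?H\<^esub> f') = ?c f \<oplus>\<^bsub>?H'\<^esub> ?c f'" if f': "f' \<in> carrier ?H" for f'
    by (simp add: hs L1(2) L2(2) qhomD(7,8)[OF F] qhomD(7,8)[OF f'[unfolded qhom_carrier]] cong: restrict_cong)
   show "?c (k \<odot>\<^bsub>?H\<^esub> f) = k \<odot>\<^bsub>?H'\<^esub> ?c f" for k
    by (simp add: hs L1(3) L2(3) qhomD(7,8)[OF F] cong: restrict_cong)
  qed
 next
  fix V W :: "'w quiver_rep" and f assume a: "V \<in> quiver_reps" "W \<in> quiver_reps" "f \<in> carrier (quiver_hom_space V W)"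
  note f = qhomD[OF a(3)[unfolded qhom_carrier]]
  show "(\<lambda>v\<in>carrier (sp1 V). fst (\<lambda>v\<in>carrier (sp1 W). v, \<lambda>v\<in>carrier (sp2 W). v) (fst f v),
    \<lambda>v\<in>carrier (sp2 V). snd (\<lambda>v\<in>carrier (sp1 W). v, \<lambda>v\<in>carrier (sp2 W). v) (snd f v)) = f"
   "(\<lambda>v\<in>carrier (sp1 V). fst f (fst (\<lambda>v\<in>carrier (sp1 V). v, \<lambda>v\<in>carrier (sp2 V). v) v),
    \<lambda>v\<in>carrier (sp2 V). snd f (snd (\<lambda>v\<in>carrier (sp1 V). v, \<lambda>v\<in>carrier (sp2 V). v) v)) = f"
   using f(2,4,7,8) by (auto simp: extensional_def restrict_def fun_eq_iff intro!: prod_eqI)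
 next
  fix V W X Y :: "'w quiver_rep" and f g h assume a: "V \<in> quiver_reps" "W \<in> quiver_reps" "X \<in> quiver_reps" "Y \<in> quiver_reps"
   "f \<in> carrier (quiver_hom_space V W)" "g \<in> carrier (quiver_hom_space W X)" "h \<in> carrier (quiver_hom_space X Y)"
  note f = qhomD(7,8)[OF a(5)[unfolded qhom_carrier]]
  show "(\<lambda>v\<in>carrier (sp1 V). fst (\<lambda>v\<in>carrier (sp1 W). fst h (fst g v), \<lambda>v\<in>carrier (sp2 W). snd h (snd g v)) (fst f v),
    \<lambda>v\<in>carrier (sp2 V). snd (\<lambda>v\<in>carrier (sp1 W). fst h (fst g v), \<lambda>v\<in>carrier (sp2 W). snd h (snd g v)) (snd f v)) =
   (\<lambda>v\<in>carrier (sp1 V). fst h (fst (\<lambda>v\<in>carrier (sp1 V). fst g (fst f v), \<lambda>v\<in>carrier (sp2 V). snd g (snd f v)) v),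
    \<lambda>v\<in>carrier (sp2 V). snd h (snd (\<lambda>v\<in>carrier (sp1 V). fst g (fst f v), \<lambda>v\<in>carrier (sp2 V). snd g (snd f v)) v))"
   using f by (simp cong: restrict_cong)
 qed
qed

text \<open>An equivalence before any choice: each framing links an object of \<open>C\<close> to
  one of \<open>D\<close>, and \<phi> transports morphisms between linked objects. An object may
  have many framings, none of them distinguished.\<close>

locale framing = C: linear_category C + D: linear_category D
 for C :: "('o, 'm) lin_cat" and D :: "('p, 'n) lin_cat" +
 fixes T :: "'t set" and src :: "'t \<Rightarrow> 'o" and tgt :: "'t \<Rightarrow> 'p" and \<phi> :: "'t \<Rightarrow> 't \<Rightarrow> 'm \<Rightarrow> 'n"
 assumes src: "t \<in> T \<Longrightarrow> src t \<in> Ob C" and tgt: "t \<in> T \<Longrightarrow> tgt t \<in> Ob D"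
  and src_onto: "x \<in> Ob C \<Longrightarrow> \<exists>t\<in>T. src t = x" and tgt_onto: "y \<in> Ob D \<Longrightarrow> \<exists>t\<in>T. tgt t = y"
  and lin: "\<lbrakk>t \<in> T; t' \<in> T\<rbrakk> \<Longrightarrow> \<phi> t t' \<in> linear_maps complex_field (Hom C (src t) (src t')) (Hom D (tgt t) (tgt t'))"
  and bij: "\<lbrakk>t \<in> T; t' \<in> T\<rbrakk> \<Longrightarrow> bij_betw (\<phi> t t') (carrier (Hom C (src t) (src t'))) (carrier (Hom D (tgt t) (tgt t')))"
  and ident: "t \<in> T \<Longrightarrow> \<phi> t t (Id C (src t)) = Id D (tgt t)"
  and comp: "\<lbrakk>t \<in> T; t' \<in> T; t'' \<in> T; f \<in> carrier (Hom C (src t) (src t')); g \<in> carrier (Hom C (src t') (src t''))\<rbrakk> \<Longrightarrow>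
   \<phi> t t'' (Comp C (src t) (src t') (src t'') g f) = Comp D (tgt t) (tgt t') (tgt t'') (\<phi> t' t'' g) (\<phi> t t' f)"
begin

definition \<psi> where "\<psi> t t' = the_inv_into (carrier (Hom C (src t) (src t'))) (\<phi> t t')"

lemma phi_hom: "t \<in> T \<Longrightarrow> t' \<in> T \<Longrightarrow> f \<in> carrier (Hom C (src t) (src t')) \<Longrightarrow> \<phi> t t' f \<in> carrier (Hom D (tgt t) (tgt t'))"
 using bij by (meson bij_betwE)

lemma psi: assumes "t \<in> T" "t' \<in> T"
 shows "g \<in> carrier (Hom D (tgt t) (tgt t')) \<Longrightarrow> \<psi> t t' g \<in> carrier (Hom C (src t) (src t'))"
  "g \<in> carrier (Hom D (tgt t) (tgt t')) \<Longrightarrow> \<phi> t t' (\<psi> t t' g) = g"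
  "f \<in> carrier (Hom C (src t) (src t')) \<Longrightarrow> \<psi> t t' (\<phi> t t' f) = f"
 unfolding \<psi>_def
 by (rule bij_betwE[OF bij_betw_the_inv_into[OF bij[OF assms]], rule_format], assumption)
  (rule f_the_inv_into_f_bij_betw[OF bij[OF assms]], simp,
   rule the_inv_into_f_f[OF bij_betw_imp_inj_on[OF bij[OF assms]]])

lemma phi_inj:
 assumes "t \<in> T" "t' \<in> T" "f \<in> carrier (Hom C (src t) (src t'))" "g \<in> carrier (Hom C (src t) (src t'))" "\<phi> t t' f = \<phi> t t' g"
 shows "f = g"
 by (rule trans[OF psi(3)[OF assms(1,2,3), symmetric] trans[OF arg_cong[OF assms(5), of "\<psi> t t'"] psi(3)[OF assms(1,2,4)]]])

lemma C_comp: "\<lbrakk>x \<in> Ob C; y \<in> Ob C; z \<in> Ob C; f \<in> carrier (Hom C x y); g \<in> carrier (Hom C y z)\<rbrakk> \<Longrightarrow>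
  Comp C x y z g f \<in> carrier (Hom C x z)"
 using linear_mapsD(1)[OF C.comp_left_linear] by blast

lemma psi_linear: assumes t: "t \<in> T" "t' \<in> T"
 shows "\<psi> t t' \<in> linear_maps complex_field (Hom D (tgt t) (tgt t')) (Hom C (src t) (src t'))"
proof -
 interpret H: Module.module complex_field "Hom C (src t) (src t')" by (rule C.hom_space[OF src src]) (use t in blast)+
 interpret H': Module.module complex_field "Hom D (tgt t) (tgt t')" by (rule D.hom_space[OF tgt tgt]) (use t in blast)+
 note L = linear_mapsD[OF lin[OF t]]
 show ?thesis
  unfolding linear_maps_def
 proof (intro CollectI conjI ballI Pi_I)
  show "\<psi> t t' g \<in> carrier (Hom C (src t) (src t'))" if "g \<in> carrier (Hom D (tgt t) (tgt t'))" for g by (rule psi(1)[OF t that])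
  fix g h assume g: "g \<in> carrier (Hom D (tgt t) (tgt t'))" and h: "h \<in> carrier (Hom D (tgt t) (tgt t'))"
  show "\<psi> t t' (g \<oplus>\<^bsub>Hom D (tgt t) (tgt t')\<^esub> h) = \<psi> t t' g \<oplus>\<^bsub>Hom C (src t) (src t')\<^esub> \<psi> t t' h"
   by (rule phi_inj[OF t]) (simp_all add: psi[OF t] g h L)
 next
  fix c g assume g: "g \<in> carrier (Hom D (tgt t) (tgt t'))"
  show "\<psi> t t' (c \<odot>\<^bsub>Hom D (tgt t) (tgt t')\<^esub> g) = c \<odot>\<^bsub>Hom C (src t) (src t')\<^esub> \<psi> t t' g"
   by (rule phi_inj[OF t]) (use H.smult_closed H'.smult_closed in \<open>simp_all add: psi[OF t] g L\<close>)
 qed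
qed

definition "\<sigma> x = (SOME t. t \<in> T \<and> src t = x)"
definition "\<tau> y = (SOME t. t \<in> T \<and> tgt t = y)"

lemma sg: assumes "x \<in> Ob C" shows "\<sigma> x \<in> T" "src (\<sigma> x) = x"
 using someI_ex[of "\<lambda>t. t \<in> T \<and> src t = x"] src_onto[OF assms] unfolding \<sigma>_def by blast+

lemma ta: assumes "y \<in> Ob D" shows "\<tau> y \<in> T" "tgt (\<tau> y) = y"
 using someI_ex[of "\<lambda>t. t \<in> T \<and> tgt t = y"] tgt_onto[OF assms] unfolding \<tau>_def by blast+

text \<open>Two framings of one object of \<open>C\<close> lead to isomorphic objects of
  \<open>D\<close>: the identity transported from each framing to the other gives mutually inverse
  morphisms.\<close>

lemma iso_D:
 assumes t: "t \<in> T" "t' \<in> T" and s: "src t' = src t"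
 shows "cat_iso D (tgt t) (tgt t') (\<phi> t t' (Id C (src t)))"
proof -
 note I = C.id_in_hom[OF src[OF t(1)]]
 have II: "Comp C (src t) (src t) (src t) (Id C (src t)) (Id C (src t)) = Id C (src t)"
  by (rule C.comp_id_left[OF src src I]) (rule t(1))+
 have 1: "\<phi> t t' (Id C (src t)) \<in> carrier (Hom D (tgt t) (tgt t'))" "\<phi> t' t (Id C (src t)) \<in> carrier (Hom D (tgt t') (tgt t))"
  using phi_hom[OF t, unfolded s, OF I] phi_hom[OF t(2,1), unfolded s, OF I] .
 have 2: "Comp D (tgt t) (tgt t') (tgt t) (\<phi> t' t (Id C (src t))) (\<phi> t t' (Id C (src t))) = Id D (tgt t)"
  using comp[OF t(1,2,1), unfolded s, OF I I] II ident[OF t(1)] by simp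
 have 3: "Comp D (tgt t') (tgt t) (tgt t') (\<phi> t t' (Id C (src t))) (\<phi> t' t (Id C (src t))) = Id D (tgt t')"
  using comp[OF t(2,1,2), unfolded s, OF I I] II ident[OF t(2), unfolded s] by simp
 show ?thesis unfolding cat_iso_def using 1 2 3 by blast
qed

lemma iso_C:
 assumes t: "t \<in> T" "t' \<in> T" and s: "tgt t' = tgt t"
 shows "cat_iso C (src t) (src t') (\<psi> t t' (Id D (tgt t)))"
proof -
 note o = src[OF t(1)] src[OF t(2)]
 note I = D.id_in_hom[OF tgt[OF t(1)]]
 have II: "Comp D (tgt t) (tgt t) (tgt t) (Id D (tgt t)) (Id D (tgt t)) = Id D (tgt t)"
  by (rule D.comp_id_left[OF tgt tgt I]) (rule t(1))+
 note p = psi[OF t, unfolded s] and p' = psi[OF t(2,1), unfolded s]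
 let ?f = "\<psi> t t' (Id D (tgt t))" and ?g = "\<psi> t' t (Id D (tgt t))"
 have 2: "Comp C (src t) (src t') (src t) ?g ?f = Id C (src t)"
  by (rule phi_inj[OF t(1,1) C_comp[OF o(1,2,1) p(1)[OF I] p'(1)[OF I]] C.id_in_hom[OF o(1)]])
   (use comp[OF t(1,2,1) p(1)[OF I] p'(1)[OF I]] p(2)[OF I] p'(2)[OF I] II ident[OF t(1)] s in simp)
 have 3: "Comp C (src t') (src t) (src t') ?f ?g = Id C (src t')"
  by (rule phi_inj[OF t(2,2) C_comp[OF o(2,1,2) p'(1)[OF I] p(1)[OF I]] C.id_in_hom[OF o(2)]])
   (use comp[OF t(2,1,2) p'(1)[OF I] p(1)[OF I]] p(2)[OF I] p'(2)[OF I] II ident[OF t(2)] s in simp)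
 show ?thesis unfolding cat_iso_def using p(1)[OF I] p'(1)[OF I] 2 3 by blast
qed

definition "Fo x = tgt (\<sigma> x)"
definition "Fm x y = \<phi> (\<sigma> x) (\<sigma> y)"
definition "Go x = src (\<tau> x)"
definition "Gm x y = \<psi> (\<tau> x) (\<tau> y)"

lemma FoGo: "x \<in> Ob C \<Longrightarrow> Fo x \<in> Ob D" "y \<in> Ob D \<Longrightarrow> Go y \<in> Ob C"
 using sg tgt ta src by (auto simp: Fo_def Go_def)

lemma Fm_hom: "\<lbrakk>x \<in> Ob C; y \<in> Ob C; f \<in> carrier (Hom C x y)\<rbrakk> \<Longrightarrow> Fm x y f \<in> carrier (Hom D (Fo x) (Fo y))"
 using phi_hom[of "\<sigma> x" "\<sigma> y" f] sg by (simp add: Fm_def Fo_def)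

lemma Gm_hom: assumes "x \<in> Ob D" "y \<in> Ob D" "g \<in> carrier (Hom D x y)"
 shows "Gm x y g \<in> carrier (Hom C (Go x) (Go y))" "\<phi> (\<tau> x) (\<tau> y) (Gm x y g) = g"
 using psi(1,2)[OF ta(1)[OF assms(1)] ta(1)[OF assms(2)], of g] ta(2) assms by (simp_all add: Gm_def Go_def)

text \<open>Choosing a framing of each object on either side defines both functors. Equations
  between morphisms of \<open>C\<close> are verified after applying the injective map
  \<phi>.\<close>

theorem equivalent: "equivalent_categories C D"
proof -
 have F: "linear_functor C D Fo Fm"
  unfolding linear_functor_def
 proof (intro conjI ballI)
  show "Fo ` Ob C \<subseteq> Ob D" using FoGo by blast
  show "Fm x y \<in> linear_maps complex_field (Hom C x y) (Hom D (Fo x) (Fo y))" if "x \<in> Ob C" "y \<in> Ob C" for x y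
   using lin[of "\<sigma> x" "\<sigma> y"] sg that by (simp add: Fm_def Fo_def)
  show "Fm x x (Id C x) = Id D (Fo x)" if "x \<in> Ob C" for x
   using ident[of "\<sigma> x"] sg[OF that] by (simp add: Fm_def Fo_def)
  show "Fm x z (Comp C x y z g f) = Comp D (Fo x) (Fo y) (Fo z) (Fm y z g) (Fm x y f)"
   if "x \<in> Ob C" "y \<in> Ob C" "z \<in> Ob C" "f \<in> carrier (Hom C x y)" "g \<in> carrier (Hom C y z)" for x y z f g
   using comp[of "\<sigma> x" "\<sigma> y" "\<sigma> z" f g] sg that by (simp add: Fm_def Fo_def)
 qed
 have G: "linear_functor D C Go Gm"
  unfolding linear_functor_def
 proof (intro conjI ballI)
  show "Go ` Ob D \<subseteq> Ob C" using FoGo by blast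
  show "Gm x y \<in> linear_maps complex_field (Hom D x y) (Hom C (Go x) (Go y))" if "x \<in> Ob D" "y \<in> Ob D" for x y
   using psi_linear[of "\<tau> x" "\<tau> y"] ta that by (simp add: Gm_def Go_def)
  show "Gm x x (Id D x) = Id C (Go x)" if x: "x \<in> Ob D" for x
   by (rule phi_inj[OF ta(1)[OF x] ta(1)[OF x]])
    (use Gm_hom[OF x x D.id_in_hom[OF x]] C.id_in_hom[OF FoGo(2)[OF x]] ident[OF ta(1)[OF x]] ta(2)[OF x] in \<open>simp_all add: Go_def\<close>)
  show "Gm x z (Comp D x y z g f) = Comp C (Go x) (Go y) (Go z) (Gm y z g) (Gm x y f)"
   if xyz: "x \<in> Ob D" "y \<in> Ob D" "z \<in> Ob D" and fg: "f \<in> carrier (Hom D x y)" "g \<in> carrier (Hom D y z)" for x y z f g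
  proof (rule phi_inj[OF ta(1)[OF xyz(1)] ta(1)[OF xyz(3)]])
   have c: "Comp D x y z g f \<in> carrier (Hom D x z)" using linear_mapsD(1)[OF D.comp_left_linear] xyz fg by blast
   note h = Gm_hom[OF xyz(1,3) c] Gm_hom[OF xyz(1,2) fg(1)] Gm_hom[OF xyz(2,3) fg(2)]
   show "Gm x z (Comp D x y z g f) \<in> carrier (Hom C (src (\<tau> x)) (src (\<tau> z)))" using h(1) by (simp add: Go_def)
   show "Comp C (Go x) (Go y) (Go z) (Gm y z g) (Gm x y f) \<in> carrier (Hom C (src (\<tau> x)) (src (\<tau> z)))"
    using C_comp[OF FoGo(2)[OF xyz(1)] FoGo(2)[OF xyz(2)] FoGo(2)[OF xyz(3)] h(3,5)] by (simp add: Go_def)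
   show "\<phi> (\<tau> x) (\<tau> z) (Gm x z (Comp D x y z g f)) = \<phi> (\<tau> x) (\<tau> z) (Comp C (Go x) (Go y) (Go z) (Gm y z g) (Gm x y f))"
    using comp[OF ta(1)[OF xyz(1)] ta(1)[OF xyz(2)] ta(1)[OF xyz(3)], folded Go_def, OF h(3,5)] h(2,4,6) ta(2) xyz by simp
  qed
 qed
 \<comment> \<open>The framings \<open>\<sigma> x\<close> and \<open>\<tau> (Fo x)\<close> share the
   target \<open>Fo x\<close>, whose identity therefore lifts to an isomorphism of their sources;
   dually for \<open>?\<epsilon>\<close>.\<close>
 let ?\<eta> = "\<lambda>x. \<psi> (\<sigma> x) (\<tau> (Fo x)) (Id D (Fo x))"
 let ?\<epsilon> = "\<lambda>y. \<phi> (\<sigma> (Go y)) (\<tau> y) (Id C (Go y))"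
 have e: "natural_iso C C (\<lambda>x. x) (\<lambda>x y f. f) (\<lambda>x. Go (Fo x)) (\<lambda>x y f. Gm (Fo x) (Fo y) (Fm x y f)) ?\<eta>"
  unfolding natural_iso_def
 proof (intro conjI ballI)
  show "cat_iso C x (Go (Fo x)) (?\<eta> x)" if x: "x \<in> Ob C" for x
   using iso_C[OF sg(1)[OF x] ta(1)[OF FoGo(1)[OF x]]] ta(2)[OF FoGo(1)[OF x]] sg(2)[OF x] by (simp add: Fo_def Go_def)
  fix x y f assume x: "x \<in> Ob C" and y: "y \<in> Ob C" and f: "f \<in> carrier (Hom C x y)"
  note o = FoGo(1)[OF x] FoGo(1)[OF y]
  note t = sg(1)[OF x] sg(1)[OF y] ta(1)[OF o(1)] ta(1)[OF o(2)]
  note e = sg(2)[OF x] sg(2)[OF y] ta(2)[OF o(1)] ta(2)[OF o(2)]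
  note F = Fm_hom[OF x y f]
  note G = Gm_hom[OF o F]
  have ex: "?\<eta> x \<in> carrier (Hom C x (Go (Fo x)))" "\<phi> (\<sigma> x) (\<tau> (Fo x)) (?\<eta> x) = Id D (Fo x)"
   using psi(1,2)[OF t(1,3), of "Id D (Fo x)"] D.id_in_hom[OF o(1)] e by (simp_all add: Fo_def Go_def)
  have ey: "?\<eta> y \<in> carrier (Hom C y (Go (Fo y)))" "\<phi> (\<sigma> y) (\<tau> (Fo y)) (?\<eta> y) = Id D (Fo y)"
   using psi(1,2)[OF t(2,4), of "Id D (Fo y)"] D.id_in_hom[OF o(2)] e by (simp_all add: Fo_def Go_def)
  note g = FoGo(2)[OF o(1)] FoGo(2)[OF o(2)]
  show "Comp C x y (Go (Fo y)) (?\<eta> y) f = Comp C x (Go (Fo x)) (Go (Fo y)) (Gm (Fo x) (Fo y) (Fm x y f)) (?\<eta> x)"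
  proof (rule phi_inj[OF t(1,4)])
   show "Comp C x y (Go (Fo y)) (?\<eta> y) f \<in> carrier (Hom C (src (\<sigma> x)) (src (\<tau> (Fo y))))"
    using C_comp[OF x y g(2) f ey(1)] e by (simp add: Go_def)
   show "Comp C x (Go (Fo x)) (Go (Fo y)) (Gm (Fo x) (Fo y) (Fm x y f)) (?\<eta> x) \<in> carrier (Hom C (src (\<sigma> x)) (src (\<tau> (Fo y))))"
    using C_comp[OF x g ex(1) G(1)] e by (simp add: Go_def)
   have l: "\<phi> (\<sigma> x) (\<tau> (Fo y)) (Comp C x y (Go (Fo y)) (?\<eta> y) f) = Comp D (Fo x) (Fo y) (Fo y) (Id D (Fo y)) (Fm x y f)"
    using comp[OF t(1,2,4), unfolded e, folded Go_def, OF f ey(1)] ey(2) by (simp add: Fm_def Fo_def)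
   have r: "\<phi> (\<sigma> x) (\<tau> (Fo y)) (Comp C x (Go (Fo x)) (Go (Fo y)) (Gm (Fo x) (Fo y) (Fm x y f)) (?\<eta> x)) =
     Comp D (Fo x) (Fo x) (Fo y) (Fm x y f) (Id D (Fo x))"
    using comp[OF t(1,3,4), unfolded e, folded Go_def, OF ex(1) G(1)] ex(2) G(2) by (simp flip: Fo_def)
   show "\<phi> (\<sigma> x) (\<tau> (Fo y)) (Comp C x y (Go (Fo y)) (?\<eta> y) f) =
     \<phi> (\<sigma> x) (\<tau> (Fo y)) (Comp C x (Go (Fo x)) (Go (Fo y)) (Gm (Fo x) (Fo y) (Fm x y f)) (?\<eta> x))"
    unfolding l r D.comp_id_left[OF o F] D.comp_id_right[OF o F] ..
  qed
 qed
 have d: "natural_iso D D (\<lambda>y. Fo (Go y)) (\<lambda>x y g. Fm (Go x) (Go y) (Gm x y g)) (\<lambda>y. y) (\<lambda>x y g. g) ?\<epsilon>"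
  unfolding natural_iso_def
 proof (intro conjI ballI)
  show "cat_iso D (Fo (Go y)) y (?\<epsilon> y)" if y: "y \<in> Ob D" for y
   using iso_D[OF sg(1)[OF FoGo(2)[OF y]] ta(1)[OF y]] sg(2)[OF FoGo(2)[OF y]] ta(2)[OF y] by (simp add: Fo_def flip: Go_def)
  fix x y g assume x: "x \<in> Ob D" and y: "y \<in> Ob D" and g: "g \<in> carrier (Hom D x y)"
  note o = FoGo(2)[OF x] FoGo(2)[OF y]
  note t = sg(1)[OF o(1)] sg(1)[OF o(2)] ta(1)[OF x] ta(1)[OF y]
  note e = sg(2)[OF o(1)] sg(2)[OF o(2)] ta(2)[OF x] ta(2)[OF y]
  note G = Gm_hom[OF x y g]
  have l: "\<phi> (\<sigma> (Go x)) (\<tau> y) (Comp C (Go x) (Go y) (Go y) (Id C (Go y)) (Gm x y g)) =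
    Comp D (Fo (Go x)) (Fo (Go y)) y (?\<epsilon> y) (Fm (Go x) (Go y) (Gm x y g))"
   using comp[OF t(1,2,4), unfolded e, folded Go_def, OF G(1) C.id_in_hom[OF o(2)]] by (simp add: Fm_def Fo_def)
  have r: "\<phi> (\<sigma> (Go x)) (\<tau> y) (Comp C (Go x) (Go x) (Go y) (Gm x y g) (Id C (Go x))) =
    Comp D (Fo (Go x)) x y g (?\<epsilon> x)"
   using comp[OF t(1,3,4), unfolded e, folded Go_def, OF C.id_in_hom[OF o(1)] G(1)] G(2) by (simp add: Fo_def)
  show "Comp D (Fo (Go x)) (Fo (Go y)) y (?\<epsilon> y) (Fm (Go x) (Go y) (Gm x y g)) = Comp D (Fo (Go x)) x y g (?\<epsilon> x)"
   unfolding l[symmetric] r[symmetric] C.comp_id_left[OF o G(1)] C.comp_id_right[OF o G(1)] ..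
 qed
 show ?thesis
  unfolding equivalent_categories_def
  using C.linear_category_axioms D.linear_category_axioms F G e d by blast
qed

end

section \<open>Modules as representations of the quiver\<close>

lemma cscale_Pair: "c *s (x, y) = (c *s x, c *s y)" by (simp add: cscale_prod_def)

lemma map_prod_pow:
 fixes f :: "'a \<Rightarrow> 'a" and g :: "'b \<Rightarrow> 'b"
 shows "(map_prod f g ^^ k) (x, y) = ((f ^^ k) x, (g ^^ k) y)" by (induction k) auto

lemma clinear_map_prod:
 assumes "clinear (f :: 'a::cvec \<Rightarrow> 'a)" "clinear (g :: 'b::cvec \<Rightarrow> 'b)" shows "clinear (map_prod f g)"
proof (rule clinearI)
 show "map_prod f g (x + y) = map_prod f g x + map_prod f g y" for x y
  by (cases x; cases y) (simp add: clin[OF assms(1)] clin[OF assms(2)])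
 show "map_prod f g (c *s x) = c *s map_prod f g x" for c x
  by (cases x) (simp add: cscale_Pair clin[OF assms(1)] clin[OF assms(2)])
qed

text \<open>The block conditions are left out, so that the product of two modules is an instance
  without verifying them for it.\<close>

locale qsq = qs q z S E F K Ki X Y + qsp q z s N for q z :: complex and S :: "'a::cvec set" and E F K Ki X Y s N
begin

text \<open>On the chain of a generator of weight \<open>l0\<close> the weight \<open>l1\<close>
  occurs exactly at step \<open>N\<close>, and for \<open>N > 0\<close> the chain of one of weight
  \<open>l1\<close> never returns to \<open>l0\<close>.\<close>

lemma l01_component:
 assumes B: "B \<subseteq> ww l0 \<union> ww l1" and x: "x \<in> cv.span (fam B)"
 shows "N > 0 \<Longrightarrow> x \<in> ww l0 \<Longrightarrow> x \<in> cv.span (B \<inter> ww l0)"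
  "x \<in> ww l1 \<Longrightarrow> x \<in> cv.span ((B \<inter> ww l1) \<union> (F' ^^ N) ` (B \<inter> ww l0))"
proof -
 have Bl: "\<exists>l. l \<noteq> 0 \<and> b \<in> ww l" if "b \<in> B" for b using that B l0_nz l1_nz by blast
 have cases: "(m = l0 \<and> b \<in> ww l0) \<or> (m = l1 \<and> b \<in> ww l1)" if "b \<in> B" "b \<noteq> 0" "b \<in> ww m" for b m
 proof -
  have u: "m = n" if "b \<in> ww n" for n
  proof -
   have "m *s b = n *s b" by (rule trans[OF wwD(3)[OF \<open>b \<in> ww m\<close>, symmetric] wwD(3)[OF that]])
   then show ?thesis unfolding cv.scale_cancel_right using \<open>b \<noteq> 0\<close> by blast
  qed
  show ?thesis using B that(1) u by blast
 qed
 have gen: "x \<in> cv.span T"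
  if xl: "x \<in> ww l" and T: "\<And>b i m. b \<in> B \<Longrightarrow> (m = l0 \<and> b \<in> ww l0) \<or> (m = l1 \<and> b \<in> ww l1) \<Longrightarrow> m / q ^ (2 * i) = l \<Longrightarrow> (F' ^^ i) b \<in> T" for l T
 proof -
  have "{(F' ^^ i) b | i b m. b \<in> B \<and> b \<noteq> 0 \<and> b \<in> ww m \<and> m / q ^ (2 * i) = l} \<subseteq> T" (is "?A \<subseteq> T")
  proof
   fix y assume "y \<in> ?A"
   then obtain i b m where y: "y = (F' ^^ i) b" "b \<in> B" "b \<noteq> 0" "b \<in> ww m" "m / q ^ (2 * i) = l" by blast
   show "y \<in> T" unfolding y(1) by (rule T[OF y(2) cases[OF y(2,3,4)] y(5)])
  qed
  then show ?thesis using fam_component[OF Bl x xl] cv.span_mono by blast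
 qed
 have e: "l1 / q ^ (2 * i) = l0 / q ^ (2 * (N + i))" for i by (simp add: l1_l0 power_add algebra_simps)
 show "x \<in> cv.span (B \<inter> ww l0)" if N: "N > 0" and xl: "x \<in> ww l0"
 proof (rule gen[OF xl])
  fix b i m assume b: "b \<in> B" "(m = l0 \<and> b \<in> ww l0) \<or> (m = l1 \<and> b \<in> ww l1)" "m / q ^ (2 * i) = l0"
  from b(2) show "(F' ^^ i) b \<in> B \<inter> ww l0"
  proof
   assume m: "m = l0 \<and> b \<in> ww l0"
   then have "l0 / q ^ (2 * i) = l0 / q ^ 0" using b(3) by simp
   then have "i = 0" unfolding l0_div by simp
   then show ?thesis using b(1) m by simp
  next
   assume m: "m = l1 \<and> b \<in> ww l1"
   then have "l0 / q ^ (2 * (N + i)) = l0 / q ^ 0" using b(3) e[of i] by simp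
   then show ?thesis using N unfolding l0_div by simp
  qed
 qed
 show "x \<in> cv.span ((B \<inter> ww l1) \<union> (F' ^^ N) ` (B \<inter> ww l0))" if xl: "x \<in> ww l1"
 proof (rule gen[OF xl])
  fix b i m assume b: "b \<in> B" "(m = l0 \<and> b \<in> ww l0) \<or> (m = l1 \<and> b \<in> ww l1)" "m / q ^ (2 * i) = l1"
  from b(2) show "(F' ^^ i) b \<in> (B \<inter> ww l1) \<union> (F' ^^ N) ` (B \<inter> ww l0)"
  proof
   assume m: "m = l0 \<and> b \<in> ww l0"
   then have "l0 / q ^ (2 * i) = l0 / q ^ (2 * N)" using b(3) l1_l0 by simp
   then have "i = N" unfolding l0_div by simp
   then show ?thesis using b(1) m by blast
  next
   assume m: "m = l1 \<and> b \<in> ww l1"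
   then have "l0 / q ^ (2 * (N + i)) = l1" using b(3) unfolding e[symmetric] by simp
   then have "l0 / q ^ (2 * (N + i)) = l0 / q ^ (2 * N)" by (rule trans[OF _ l1_l0])
   then have "i = 0" unfolding l0_div by simp
   then show ?thesis using b(1) m by simp
  qed
 qed
qed

end

lemma (in qsb) qsq: "qsq q z S E F K Ki X Y s"
 by (intro qsq.intro qs_axioms qsp_axioms)

text \<open>A finite generating set involves only finitely many vectors of \<open>VV\<close>.
  Enlarged to span a submodule, they generate everything, and \<open>l01_component\<close> bounds
  the two weight spaces by them.\<close>

lemma (in qsb) VV_finite:
 assumes N: "N > 0" and G: "finite G" "G \<subseteq> S" "\<And>P. stable P \<Longrightarrow> G \<subseteq> P \<Longrightarrow> S \<subseteq> P"
 shows "\<exists>A. finite A \<and> ww l0 \<subseteq> cv.span A" "\<exists>A. finite A \<and> ww l1 \<subseteq> cv.span A"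
proof -
 interpret Q: qsq q z S E F K Ki X Y s N by (rule qsq)
 have "G \<subseteq> cv.span (fam VV)" using G(2) S_fam by blast
 then obtain A where A: "finite A" "A \<subseteq> fam VV" "G \<subseteq> cv.span A" using span_finite_subset_set[OF G(1)] by blast
 have "A \<subseteq> (\<lambda>(k, i, b). (Y ^^ k) ((F' ^^ i) b)) ` (UNIV \<times> UNIV \<times> VV)"
 proof
  fix a assume "a \<in> A"
  then obtain k i b where "a = (Y ^^ k) ((F' ^^ i) b)" "b \<in> VV" using A(2) unfolding fam_def by blast
  then show "a \<in> (\<lambda>(k, i, b). (Y ^^ k) ((F' ^^ i) b)) ` (UNIV \<times> UNIV \<times> VV)" by (intro image_eqI[of _ _ "(k, i, b)"]) auto
 qed
 from finite_subset_image[OF A(1) this] obtain C where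
  C: "C \<subseteq> UNIV \<times> UNIV \<times> VV" "finite C" "A = (\<lambda>(k, i, b). (Y ^^ k) ((F' ^^ i) b)) ` C" by blast
 define B0 where "B0 = (\<lambda>(k, i, b). b) ` C"
 \<comment> \<open>By \<open>E_l1\<close> the span of the translates is stable under
   \<open>E\<close> once the vectors \<open>(E ^^ N) b\<close> are included.\<close>
 define B where "B = B0 \<union> (E ^^ N) ` (B0 \<inter> ww l1)"
 have B0: "finite B0" "B0 \<subseteq> VV" using C(1,2) unfolding B0_def by auto
 have B: "finite B" "B \<subseteq> ww l0 \<union> ww l1" using B0 EN_l1 unfolding B_def VV_def by auto
 have "stable (cv.span (fam B))"
 proof (rule fam_stable)
  show "\<exists>l. l \<noteq> 0 \<and> b \<in> ww l" if "b \<in> B" for b using that B(2) l0_nz l1_nz by blast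
  show "E b \<in> cv.span (chain B)" if b: "b \<in> B" for b
  proof (cases "b \<in> ww l0")
   case True
   then show ?thesis using E_l0[OF True] by (simp add: cv.span_zero)
  next
   case False
   then have b1: "b \<in> B0 \<inter> ww l1" using b B(2) EN_l1 unfolding B_def by blast
   then have "(E ^^ N) b \<in> B" unfolding B_def by blast
   then have "(F' ^^ (N - 1)) ((E ^^ N) b) \<in> cv.span (chain B)" by (intro cv.span_base chainI)
   moreover have "E b = (1 / gam) *s (F' ^^ (N - 1)) ((E ^^ N) b)" using E_l1[OF _ N] b1 by blast
   ultimately show ?thesis using cv.span_scale by metis
  qed
 qed
 moreover have "A \<subseteq> fam B"
 proof
  fix a assume "a \<in> A"
  then obtain k i b where a: "(k, i, b) \<in> C" "a = (Y ^^ k) ((F' ^^ i) b)" using C(3) by auto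
  then have "b \<in> B" unfolding B_def B0_def by force
  then show "a \<in> fam B" unfolding a(2) by (rule famI)
 qed
 then have "G \<subseteq> cv.span (fam B)" using A(3) cv.span_mono by blast
 ultimately have S: "S \<subseteq> cv.span (fam B)" by (rule G(3))
 have "w \<in> cv.span B" if w: "w \<in> ww l0" for w
 proof -
  have "w \<in> cv.span (B \<inter> ww l0)" by (rule Q.l01_component(1)[OF B(2) _ N w]) (use S wwD(1)[OF w] in blast)
  then show ?thesis using cv.span_mono[of "B \<inter> ww l0" B] by blast
 qed
 then show "\<exists>A. finite A \<and> ww l0 \<subseteq> cv.span A" using B(1) by blast
 have "w \<in> cv.span (B \<union> (F' ^^ N) ` B)" if w: "w \<in> ww l1" for w
 proof -
  have "w \<in> cv.span ((B \<inter> ww l1) \<union> (F' ^^ N) ` (B \<inter> ww l0))"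
   by (rule Q.l01_component(2)[OF B(2) _ w]) (use S wwD(1)[OF w] in blast)
  moreover have "(B \<inter> ww l1) \<union> (F' ^^ N) ` (B \<inter> ww l0) \<subseteq> B \<union> (F' ^^ N) ` B" by blast
  ultimately show ?thesis using cv.span_mono by blast
 qed
 then show "\<exists>A. finite A \<and> ww l1 \<subseteq> cv.span A" using B(1) by (intro exI[of _ "B \<union> (F' ^^ N) ` B"]) auto
qed

text \<open>A pair of maps on the two spaces of singular vectors extends to a module map: its graph
 generates a submodule of the product, which meets \<open>0 \<times> S'\<close> trivially because a nonzero
 submodule contains a singular vector.\<close>

locale pairq = A: qsb q z S E F K Ki X Y s N + B: qsb q z S' E' F1 K' Ki' X' Y' s N
 for q z :: complex and S :: "'a::cvec set" and E F K Ki X Y s N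
  and S' :: "'b::cvec set" and E' F1 K' Ki' X' Y' +
 fixes g0 g1 :: "'a \<Rightarrow> 'b"
 assumes N: "N > 0"
  and g0: "\<And>x. x \<in> A.ww A.l0 \<Longrightarrow> g0 x \<in> B.ww A.l0"
   "\<And>x y. x \<in> A.ww A.l0 \<Longrightarrow> y \<in> A.ww A.l0 \<Longrightarrow> g0 (x + y) = g0 x + g0 y"
   "\<And>c x. x \<in> A.ww A.l0 \<Longrightarrow> g0 (c *s x) = c *s g0 x"
  and g1: "\<And>x. x \<in> A.ww A.l1 \<Longrightarrow> g1 x \<in> B.ww A.l1"
   "\<And>x y. x \<in> A.ww A.l1 \<Longrightarrow> y \<in> A.ww A.l1 \<Longrightarrow> g1 (x + y) = g1 x + g1 y"
   "\<And>c x. x \<in> A.ww A.l1 \<Longrightarrow> g1 (c *s x) = c *s g1 x"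
  and gE: "\<And>x. x \<in> A.ww A.l1 \<Longrightarrow> (E' ^^ N) (g1 x) = g0 ((E ^^ N) x)"
  and gF: "\<And>x. x \<in> A.ww A.l0 \<Longrightarrow> (B.F' ^^ N) (g0 x) = g1 ((A.F' ^^ N) x)"
begin

lemma product: "qs q z (S \<times> S') (map_prod E E') (map_prod F F1) (map_prod K K') (map_prod Ki Ki') (map_prod X X') (map_prod Y Y')"
proof (intro qs.intro A.qparam_axioms qs_axioms.intro)
 show "cv.subspace (S \<times> S')"
  by (rule cv.subspaceI) (auto simp: zero_prod_def cscale_Pair)
qed (auto simp: cscale_Pair A.clo B.clo A.KKi B.KKi A.KiK B.KiK A.EF B.EF A.KE B.KE A.KF B.KF A.KX B.KX A.KY B.KY
  A.XY B.XY A.EX B.EX A.EY B.EY A.FX B.FX A.FY B.FY intro!: clinear_map_prod A.lin B.lin)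

sublocale P: qsq q z "S \<times> S'" "map_prod E E'" "map_prod F F1" "map_prod K K'" "map_prod Ki Ki'" "map_prod X X'" "map_prod Y Y'" s N
 by (intro qsq.intro product A.qsp_axioms)

lemma P_ww: "(x, y) \<in> P.ww l \<longleftrightarrow> x \<in> A.ww l \<and> y \<in> B.ww l"
 by (auto simp: P.ww_def A.ww_def B.ww_def zero_prod_def cscale_Pair)

lemma P_F': "P.F' = map_prod A.F' B.F'"
 by (rule ext) (auto simp: P.F'_def A.F'_def B.F'_def cscale_Pair)

lemma g_0: "g0 0 = 0" "g1 0 = 0"
 using g0(3)[of 0 0] g1(3)[of 0 0] cv.subspace_0[OF A.sub_ww] by auto

definition R where "R = (\<lambda>v. (v, g0 v)) ` A.ww A.l0 \<union> (\<lambda>v. (v, g1 v)) ` A.ww A.l1"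
definition \<rho> where "\<rho> = cv.span (P.fam R)"

lemma R_ww: "R \<subseteq> P.ww A.l0 \<union> P.ww A.l1"
 using g0(1) g1(1) by (auto simp: R_def P_ww)

text \<open>By \<open>E_l1\<close>, in both modules and with the same scalar, \<open>E\<close> of a
  pair \<open>(v, g1 v)\<close> is a multiple of \<open>F' ^^ (N - 1)\<close> of its image under
  \<open>E ^^ N\<close>, and \<open>gE\<close> says that this image is a point of the graph of
  \<open>g0\<close>.\<close>

lemma rho_stable: "P.stable \<rho>"
 unfolding \<rho>_def
proof (rule P.fam_stable)
 show "\<exists>l. l \<noteq> 0 \<and> b \<in> P.ww l" if "b \<in> R" for b using that R_ww A.l0_nz A.l1_nz by blast
 show "map_prod E E' b \<in> cv.span (P.chain R)" if b: "b \<in> R" for b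
 proof -
  consider v where "v \<in> A.ww A.l0" "b = (v, g0 v)" | v where "v \<in> A.ww A.l1" "b = (v, g1 v)"
   using b unfolding R_def by blast
  then show ?thesis
  proof cases
   case 1
   have "map_prod E E' b = 0"
    unfolding 1(2) map_prod_simp A.E_l0[OF 1(1)] B.E_l0[OF g0(1)[OF 1(1)]] zero_prod_def ..
   then show ?thesis by (simp add: cv.span_zero)
  next
   case 2
   let ?u = "(E ^^ N) v"
   have "E v = (1 / A.gam) *s (A.F' ^^ (N - 1)) ?u" by (rule A.E_l1[OF 2(1) N])
   moreover have "E' (g1 v) = (1 / A.gam) *s (B.F' ^^ (N - 1)) (g0 ?u)"
    using B.E_l1[OF g1(1)[OF 2(1)] N] unfolding gE[OF 2(1)] .
   ultimately have e: "map_prod E E' b = (1 / A.gam) *s (P.F' ^^ (N - 1)) (?u, g0 ?u)"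
    unfolding 2(2) by (simp add: P_F' map_prod_pow cscale_Pair)
   have "(?u, g0 ?u) \<in> R" using A.EN_l1[OF 2(1)] unfolding R_def by blast
   then show ?thesis unfolding e by (intro cv.span_scale cv.span_base P.chainI)
  qed
 qed
qed

lemmas rho_sub = P.stableD(1)[OF rho_stable]

lemma rho_SS: "(x, y) \<in> \<rho> \<Longrightarrow> x \<in> S" "(x, y) \<in> \<rho> \<Longrightarrow> y \<in> S'"
 using P.stableD(2)[OF rho_stable] by blast+

lemma rho_ops:
 assumes "(x, y) \<in> \<rho>"
 shows "(E x, E' y) \<in> \<rho>" "(F x, F1 y) \<in> \<rho>" "(K x, K' y) \<in> \<rho>" "(Ki x, Ki' y) \<in> \<rho>" "(X x, X' y) \<in> \<rho>" "(Y x, Y' y) \<in> \<rho>"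
 using P.stableD(3-8)[OF rho_stable assms] by simp_all

lemma rho_add: "(x, y) \<in> \<rho> \<Longrightarrow> (x', y') \<in> \<rho> \<Longrightarrow> (x + x', y + y') \<in> \<rho>"
 using cv.subspace_add[OF rho_sub] by fastforce

lemma rho_scale: "(x, y) \<in> \<rho> \<Longrightarrow> (c *s x, c *s y) \<in> \<rho>"
 using cv.subspace_scale[OF rho_sub] by (fastforce simp: cscale_Pair)

lemma rho_R: "R \<subseteq> \<rho>" unfolding \<rho>_def using P.subset_fam[of R] cv.span_superset by blast

lemma rho_zero: assumes "(0, w) \<in> \<rho>" shows "w = 0"
proof (rule ccontr)
 assume nz: "w \<noteq> 0"
 let ?Q = "{w. (0, w) \<in> \<rho>}"
 have "B.stable ?Q"
  unfolding B.stable_def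
 proof (intro conjI ballI)
  show "cv.subspace ?Q"
  proof (rule cv.subspaceI)
   show "0 \<in> ?Q" using cv.subspace_0[OF rho_sub] by (simp add: zero_prod_def)
   show "x + y \<in> ?Q" if "x \<in> ?Q" "y \<in> ?Q" for x y using rho_add[of 0 x 0 y] that by simp
   show "c *s x \<in> ?Q" if "x \<in> ?Q" for c x using rho_scale[of 0 x c] that by simp
  qed
  show "?Q \<subseteq> S'" using rho_SS(2) by blast
  fix x assume "x \<in> ?Q"
  then have x: "(0, x) \<in> \<rho>" by simp
  show "E' x \<in> ?Q" "F1 x \<in> ?Q" "K' x \<in> ?Q" "Ki' x \<in> ?Q" "X' x \<in> ?Q" "Y' x \<in> ?Q"
   using rho_ops[OF x] by (simp_all add: A.lins)
 qed
 then obtain u where u: "(0, u) \<in> \<rho>" "u \<noteq> 0" "u \<in> B.ww A.l0 \<or> u \<in> B.ww A.l1"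
  using B.stable_has_vec[of ?Q w] assms nz by blast
 have z: "0 \<in> A.ww l" for l by (rule cv.subspace_0[OF A.sub_ww])
 have d: "v = 0" if "v \<in> A.ww A.l0" "v \<in> A.ww A.l1" for v
 proof -
  have "A.l0 *s v = A.l1 *s v" by (rule trans[OF A.wwD(3)[OF that(1), symmetric] A.wwD(3)[OF that(2)]])
  moreover have "A.l0 \<noteq> A.l1" using A.l1_eq_l0 N by auto
  ultimately show ?thesis unfolding cv.scale_cancel_right by blast
 qed
 \<comment> \<open>The generated submodule is still the graph of \<open>g0\<close> on weight
   \<open>l0\<close> and of \<open>g1\<close> on weight \<open>l1\<close>. On \<open>l1\<close>
   there are also the vectors \<open>F' ^^ N\<close> of the graph of \<open>g0\<close>, and
   \<open>gF\<close> places them in the graph of \<open>g1\<close>.\<close>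
 let ?G = "\<lambda>g l. {(x, y). x \<in> A.ww l \<and> y = g x}"
 have G0: "cv.subspace (?G g0 A.l0)"
  by (rule cv.subspaceI)
   (auto simp: zero_prod_def cscale_Pair g_0 z g0(2,3) intro: cv.subspace_add[OF A.sub_ww] cv.subspace_scale[OF A.sub_ww])
 have G1: "cv.subspace (?G g1 A.l1)"
  by (rule cv.subspaceI)
   (auto simp: zero_prod_def cscale_Pair g_0 z g1(2,3) intro: cv.subspace_add[OF A.sub_ww] cv.subspace_scale[OF A.sub_ww])
 have R0: "R \<inter> P.ww A.l0 \<subseteq> ?G g0 A.l0"
 proof
  fix r assume r: "r \<in> R \<inter> P.ww A.l0"
  then consider v where "v \<in> A.ww A.l0" "r = (v, g0 v)" | v where "v \<in> A.ww A.l1" "r = (v, g1 v)" unfolding R_def by blast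
  then show "r \<in> ?G g0 A.l0"
  proof cases
   case 1 then show ?thesis by simp
  next
   case 2
   then have "v = 0" using d r by (simp add: P_ww)
   then show ?thesis using 2 g_0 z by simp
  qed
 qed
 have R1: "R \<inter> P.ww A.l1 \<subseteq> ?G g1 A.l1"
 proof
  fix r assume r: "r \<in> R \<inter> P.ww A.l1"
  then consider v where "v \<in> A.ww A.l0" "r = (v, g0 v)" | v where "v \<in> A.ww A.l1" "r = (v, g1 v)" unfolding R_def by blast
  then show "r \<in> ?G g1 A.l1"
  proof cases
   case 1
   then have "v = 0" using d r by (simp add: P_ww)
   then show ?thesis using 1 g_0 z by simp
  next
   case 2 then show ?thesis by simp
  qed
 qed
 have "(P.F' ^^ N) ` (R \<inter> P.ww A.l0) \<subseteq> ?G g1 A.l1"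
 proof
  fix r assume "r \<in> (P.F' ^^ N) ` (R \<inter> P.ww A.l0)"
  then obtain v where v: "v \<in> A.ww A.l0" "r = (P.F' ^^ N) (v, g0 v)" using R0 by blast
  show "r \<in> ?G g1 A.l1" using A.F'N_l0[OF v(1)] gF[OF v(1)] unfolding v(2) by (simp add: P_F' map_prod_pow)
 qed
 then have R1': "(R \<inter> P.ww A.l1) \<union> (P.F' ^^ N) ` (R \<inter> P.ww A.l0) \<subseteq> ?G g1 A.l1" using R1 by blast
 have uf: "(0, u) \<in> cv.span (P.fam R)" using u(1) unfolding \<rho>_def .
 from u(3) show False
 proof
  assume "u \<in> B.ww A.l0"
  then have "(0, u) \<in> cv.span (R \<inter> P.ww A.l0)" by (intro P.l01_component(1)[OF R_ww uf N]) (simp add: P_ww z)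
  then have "(0, u) \<in> ?G g0 A.l0" using span_subset_subspace[OF R0 G0] by blast
  then show False using u(2) g_0 by simp
 next
  assume "u \<in> B.ww A.l1"
  then have "(0, u) \<in> cv.span ((R \<inter> P.ww A.l1) \<union> (P.F' ^^ N) ` (R \<inter> P.ww A.l0))"
   by (intro P.l01_component(2)[OF R_ww uf]) (simp add: P_ww z)
  then have "(0, u) \<in> ?G g1 A.l1" using span_subset_subspace[OF R1' G1] by blast
  then show False using u(2) g_0 by simp
 qed
qed

text \<open>The first components form a submodule containing \<open>VV\<close>, which generates
  \<open>S\<close>.\<close>

lemma rho_total: assumes "x \<in> S" shows "\<exists>y. (x, y) \<in> \<rho>"
proof -
 let ?T = "{x. \<exists>y. (x, y) \<in> \<rho>}"
 have "A.stable ?T"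
  unfolding A.stable_def
 proof (intro conjI ballI)
  show "cv.subspace ?T"
  proof (rule cv.subspaceI)
   show "0 \<in> ?T" using cv.subspace_0[OF rho_sub] by (auto simp: zero_prod_def)
   show "x + y \<in> ?T" if "x \<in> ?T" "y \<in> ?T" for x y using rho_add that by blast
   show "c *s x \<in> ?T" if "x \<in> ?T" for c x using rho_scale that by blast
  qed
  show "?T \<subseteq> S" using rho_SS(1) by blast
  fix x assume "x \<in> ?T"
  then obtain y where x: "(x, y) \<in> \<rho>" by blast
  show "E x \<in> ?T" "F x \<in> ?T" "K x \<in> ?T" "Ki x \<in> ?T" "X x \<in> ?T" "Y x \<in> ?T"
   using rho_ops[OF x] by blast+
 qed
 moreover have "A.VV \<subseteq> ?T" using rho_R unfolding A.VV_def R_def by blast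
 ultimately have "S \<subseteq> ?T" using A.stable_fam A.S_fam by blast
 then show ?thesis using assms by blast
qed

lemma rho_unique: assumes "(x, y) \<in> \<rho>" "(x, y') \<in> \<rho>" shows "y = y'"
proof -
 have "(0, y - y') \<in> \<rho>" using cv.subspace_diff[OF rho_sub assms] by simp
 then show ?thesis using rho_zero by fastforce
qed

theorem extension:
 "\<exists>h. (\<forall>x\<in>S. h x \<in> S') \<and> (\<forall>x\<in>S. \<forall>y\<in>S. h (x + y) = h x + h y) \<and> (\<forall>c. \<forall>x\<in>S. h (c *s x) = c *s h x) \<and>
  (\<forall>x\<in>S. h (E x) = E' (h x) \<and> h (F x) = F1 (h x) \<and> h (K x) = K' (h x) \<and> h (Ki x) = Ki' (h x) \<and>
    h (X x) = X' (h x) \<and> h (Y x) = Y' (h x)) \<and>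
  (\<forall>x\<in>A.ww A.l0. h x = g0 x) \<and> (\<forall>x\<in>A.ww A.l1. h x = g1 x)"
proof -
 define h where "h x = (THE y. (x, y) \<in> \<rho>)" for x
 have u: "h x = y" if "(x, y) \<in> \<rho>" for x y
  unfolding h_def by (rule the_equality[of "\<lambda>y. (x, y) \<in> \<rho>", OF that]) (rule rho_unique[OF _ that])
 have h: "(x, h x) \<in> \<rho>" if "x \<in> S" for x using rho_total[OF that] u by blast
 show ?thesis
 proof (intro exI[of _ h] conjI ballI allI)
  show "h x \<in> S'" if "x \<in> S" for x by (rule rho_SS(2)[OF h[OF that]])
  show "h (x + y) = h x + h y" if "x \<in> S" "y \<in> S" for x y by (rule u[OF rho_add[OF h[OF that(1)] h[OF that(2)]]])
  show "h (c *s x) = c *s h x" if "x \<in> S" for c x by (rule u[OF rho_scale[OF h[OF that]]])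
  show "h (E x) = E' (h x)" "h (F x) = F1 (h x)" "h (K x) = K' (h x)" "h (Ki x) = Ki' (h x)" "h (X x) = X' (h x)" "h (Y x) = Y' (h x)"
   if "x \<in> S" for x using rho_ops[OF h[OF that]] u by blast+
  show "h x = g0 x" if "x \<in> A.ww A.l0" for x using rho_R that by (intro u) (auto simp: R_def)
  show "h x = g1 x" if "x \<in> A.ww A.l1" for x using rho_R that by (intro u) (auto simp: R_def)
 qed
qed

end

section \<open>Singular vectors without reference to a presentation\<close>

lemma linear_map_by_letters:
 assumes M: "left_module (U q) M" and M': "left_module (U q) M'" and f: "\<And>v. v \<in> carrier M \<Longrightarrow> f v \<in> carrier M'"
  and add: "\<And>v w. v \<in> carrier M \<Longrightarrow> w \<in> carrier M \<Longrightarrow> f (v \<oplus>\<^bsub>M\<^esub> w) = f v \<oplus>\<^bsub>M'\<^esub> f w"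
  and scale: "\<And>c v. v \<in> carrier M \<Longrightarrow> f (cls q (scalar c) \<odot>\<^bsub>M\<^esub> v) = cls q (scalar c) \<odot>\<^bsub>M'\<^esub> f v"
  and lett: "\<And>g v. v \<in> carrier M \<Longrightarrow> f (cls q (letter g) \<odot>\<^bsub>M\<^esub> v) = cls q (letter g) \<odot>\<^bsub>M'\<^esub> f v"
 shows "f \<in> linear_maps (U q) M M'"
proof -
 interpret M: left_module "U q" M by (rule M)
 interpret M': left_module "U q" M' by (rule M')
 have mu: "cls q (a * b) \<odot>\<^bsub>M\<^esub> v = cls q a \<odot>\<^bsub>M\<^esub> (cls q b \<odot>\<^bsub>M\<^esub> v)" if "v \<in> carrier M" for a b v
  using that by (simp add: cls_simps M.smult_assoc1)
 have mu': "cls q (a * b) \<odot>\<^bsub>M'\<^esub> v = cls q a \<odot>\<^bsub>M'\<^esub> (cls q b \<odot>\<^bsub>M'\<^esub> v)" if "v \<in> carrier M'" for a b v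
  using that by (simp add: cls_simps M'.smult_assoc1)
 have ad: "cls q (a + b) \<odot>\<^bsub>M\<^esub> v = cls q a \<odot>\<^bsub>M\<^esub> v \<oplus>\<^bsub>M\<^esub> cls q b \<odot>\<^bsub>M\<^esub> v" if "v \<in> carrier M" for a b v
  using that by (simp add: cls_simps M.smult_l_distr)
 have ad': "cls q (a + b) \<odot>\<^bsub>M'\<^esub> v = cls q a \<odot>\<^bsub>M'\<^esub> v \<oplus>\<^bsub>M'\<^esub> cls q b \<odot>\<^bsub>M'\<^esub> v" if "v \<in> carrier M'" for a b v
  using that by (simp add: cls_simps M'.smult_l_distr)
 have c: "cls q a \<odot>\<^bsub>M\<^esub> v \<in> carrier M" if "v \<in> carrier M" for a v using that by (simp add: cls_simps)
 have words: "f (cls q (foldr (\<lambda>g a. letter g * a) gs 1) \<odot>\<^bsub>M\<^esub> v) = cls q (foldr (\<lambda>g a. letter g * a) gs 1) \<odot>\<^bsub>M'\<^esub> f v"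
  if v: "v \<in> carrier M" for gs v
 proof (induction gs)
  case Nil
  show ?case using v f[OF v] by (simp add: cls_simps)
 next
  case (Cons g gs)
  then show ?case using v by (simp add: mu mu' lett c f)
 qed
 have "f (cls q a \<odot>\<^bsub>M\<^esub> v) = cls q a \<odot>\<^bsub>M'\<^esub> f v" if v: "v \<in> carrier M" for a v
 proof (induction a rule: free_alg_induct)
  case zero
  have z: "scalar 0 = 0" by (simp add: scalar_def)
  show ?case using scale[OF v, of 0] by (simp only: z)
 next
  case (add w k a)
  obtain gs where w: "w = Word gs" by (cases w)
  show ?case using v add by (simp add: ad ad' assms(4) c f w single_word mu mu' scale words)
 qed
 then show ?thesis using f add by (auto simp: linear_maps_def carrier_U)
qed

text \<open>The counterpart of \<open>ww l\<close> in the module itself. A presentation is merely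
  known to exist, so notions relating several modules have to be independent of it.\<close>

definition vec :: "complex \<Rightarrow> complex \<Rightarrow> (ualg, 'v) module \<Rightarrow> 'v set" where
 "vec q l M = {m \<in> carrier M. cls q eX \<odot>\<^bsub>M\<^esub> m = \<zero>\<^bsub>M\<^esub> \<and> cls q eK \<odot>\<^bsub>M\<^esub> m = cls q (scalar l) \<odot>\<^bsub>M\<^esub> m}"

text \<open>The element of the free algebra that acts as \<open>F'\<close>.\<close>

definition (in qparam) lowF :: free_alg where "lowF = eF - scalar kap * (eY * (eY * eKi))"

lemma (in pres) vec_ev: "x \<in> S \<Longrightarrow> ev x \<in> vec q l M \<longleftrightarrow> op gX x = 0 \<and> op gK x = l *s x"
 unfolding vec_def by (simp add: ev_eq_0 ev_inj op_S flip: ev_op ev_scale)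

lemma (in pres) pow_ev:
 assumes "x \<in> S" shows "cls q (letter g ^ k) \<odot>\<^bsub>M\<^esub> ev x = ev ((op g ^^ k) x)"
  "qparam q z \<Longrightarrow> cls q (qparam.lowF q z ^ k) \<odot>\<^bsub>M\<^esub> ev x = ev (((\<lambda>m. op gF m - qparam.kap q z *s op gY (op gY (op gKi m))) ^^ k) x)"
proof -
 have "act op (letter g) = op g" by (rule ext) (simp add: act_simps)
 then show "cls q (letter g ^ k) \<odot>\<^bsub>M\<^esub> ev x = ev ((op g ^^ k) x)"
  using ev_act[OF assms, of "letter g ^ k"] by (simp add: act_pow)
 assume "qparam q z"
 then interpret qparam q z .
 have "act op lowF = (\<lambda>m. op gF m - kap *s op gY (op gY (op gKi m)))"
  by (rule ext) (simp add: lowF_def act_simps act_mult[OF lop])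
 then show "cls q (lowF ^ k) \<odot>\<^bsub>M\<^esub> ev x = ev (((\<lambda>m. op gF m - kap *s op gY (op gY (op gKi m))) ^^ k) x)"
  using ev_act[OF assms, of "lowF ^ k"] by (simp add: act_pow)
qed

context cps
begin

lemma vec_ww: "x \<in> S \<Longrightarrow> ev x \<in> vec q l M \<longleftrightarrow> x \<in> ww l" by (simp add: vec_ev ww_def)

lemma vec_eq: "vec q l M = ev ` ww l"
proof
 show "vec q l M \<subseteq> ev ` ww l"
 proof
  fix v assume v: "v \<in> vec q l M"
  then obtain x where "x \<in> S" "v = ev x" using ev_surj by (auto simp: vec_def)
  then show "v \<in> ev ` ww l" using v vec_ww by blast
 qed
 show "ev ` ww l \<subseteq> vec q l M" using vec_ww wwD(1) by blast
qed

lemma F'_fun: "F' = (\<lambda>m. op gF m - kap *s op gY (op gY (op gKi m)))" by (rule ext) (rule F'_def)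

lemma E_ev: "x \<in> S \<Longrightarrow> cls q (eE ^ k) \<odot>\<^bsub>M\<^esub> ev x = ev ((op gE ^^ k) x)" by (rule pow_ev(1))

lemma F_ev: "x \<in> S \<Longrightarrow> cls q (lowF ^ k) \<odot>\<^bsub>M\<^esub> ev x = ev ((F' ^^ k) x)"
 unfolding F'_fun by (rule pow_ev(2)[OF _ qparam_axioms])

end

context qsp
begin

abbreviation CB :: "(ualg, 'v) module set" where
 "CB \<equiv> charged_block q (half_coset q s) (ctilde q z l0) z"

lemma CB_left: "M \<in> CB \<Longrightarrow> left_module (U q) M"
 by (simp add: charged_block_def block_def category_O_def)

lemma CB_bridge:
 assumes "(M :: (ualg, 'v) module) \<in> CB"
 shows "\<exists>(S :: ('v \<Rightarrow>\<^sub>0 complex) set) op ev. cps q z M S op ev s \<and>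
  qsb q z S (op gE) (op gF) (op gK) (op gKi) (op gX) (op gY) s N"
proof -
 have M: "M \<in> block q (half_coset q s) (ctilde q z l0) z"
  and Z: "\<And>v. v \<in> carrier M \<Longrightarrow> cls q eZ \<odot>\<^bsub>M\<^esub> v = cls q (scalar z) \<odot>\<^bsub>M\<^esub> v"
  using assms by (auto simp: charged_block_def)
 obtain S :: "('v \<Rightarrow>\<^sub>0 complex) set" and op ev where pr: "presents q M S op ev"
  using pres_exists[OF CB_left[OF assms]] by blast
 interpret pres q M S op ev by (rule pres.intro[OF pr])
 interpret cpres q z M S op ev by (intro cpres.intro pres_axioms qparam cpres_axioms.intro Z)
 interpret cps q z M S op ev s N by (intro cps.intro cpres_axioms qsp_axioms)
 show ?thesis using cps_axioms block_dest[OF M] by blast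
qed

text \<open>This is what makes a module map determined by its values on the two spaces of singular
  vectors.\<close>

lemma CB_generated:
 assumes M: "(M :: (ualg, 'v) module) \<in> CB" and H: "submodule H (U q) M" "vec q l0 M \<subseteq> H" "vec q l1 M \<subseteq> H"
 shows "H = carrier M"
proof -
 obtain S :: "('v \<Rightarrow>\<^sub>0 complex) set" and op ev where c: "cps q z M S op ev s"
  and b: "qsb q z S (op gE) (op gF) (op gK) (op gKi) (op gX) (op gY) s N" using CB_bridge[OF M] by blast
 interpret cps q z M S op ev s N by (rule c)
 interpret Q: qsb q z S "op gE" "op gF" "op gK" "op gKi" "op gX" "op gY" s N by (rule b)
 let ?P = "{x \<in> S. ev x \<in> H}"
 have P: "stable ?P" using submodule_opstable(1)[OF H(1)] by (simp add: opstable_iff)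
 have "Q.VV \<subseteq> ?P" using H(2,3) vec_ww wwD(1) unfolding Q.VV_def by blast
 then have "S \<subseteq> ?P" using stable_fam[OF P] Q.S_fam by blast
 then have "carrier M \<subseteq> H" using ev_surj by blast
 then show ?thesis using submoduleD(1)[OF H(1)] by blast
qed

definition veclin :: "complex \<Rightarrow> (ualg, 'v) module \<Rightarrow> (ualg, 'v) module \<Rightarrow> ('v \<Rightarrow> 'v) \<Rightarrow> bool" where
 "veclin l M M' g \<longleftrightarrow> (\<forall>m\<in>vec q l M. g m \<in> vec q l M') \<and>
   (\<forall>m\<in>vec q l M. \<forall>m'\<in>vec q l M. g (m \<oplus>\<^bsub>M\<^esub> m') = g m \<oplus>\<^bsub>M'\<^esub> g m') \<and>
   (\<forall>c. \<forall>m\<in>vec q l M. g (cls q (scalar c) \<odot>\<^bsub>M\<^esub> m) = cls q (scalar c) \<odot>\<^bsub>M'\<^esub> g m)"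

text \<open>The maps \<open>g0\<close> and \<open>g1\<close> are carried to presentations of the two
  modules, extended there by the graph construction of \<open>pairq\<close>, and the extension is
  carried back.\<close>

lemma CB_full:
 assumes M: "(M :: (ualg, 'v) module) \<in> CB" and M': "(M' :: (ualg, 'v) module) \<in> CB" and N: "N > 0"
  and g0: "veclin l0 M M' g0" and g1: "veclin l1 M M' g1"
  and gE: "\<And>m. m \<in> vec q l1 M \<Longrightarrow> g0 (cls q (eE ^ N) \<odot>\<^bsub>M\<^esub> m) = cls q (eE ^ N) \<odot>\<^bsub>M'\<^esub> g1 m"
  and gF: "\<And>m. m \<in> vec q l0 M \<Longrightarrow> g1 (cls q (lowF ^ N) \<odot>\<^bsub>M\<^esub> m) = cls q (lowF ^ N) \<odot>\<^bsub>M'\<^esub> g0 m"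
 shows "\<exists>f\<in>linear_maps (U q) M M'. (\<forall>m\<in>vec q l0 M. f m = g0 m) \<and> (\<forall>m\<in>vec q l1 M. f m = g1 m)"
proof -
 obtain S :: "('v \<Rightarrow>\<^sub>0 complex) set" and op ev where c: "cps q z M S op ev s"
  and b: "qsb q z S (op gE) (op gF) (op gK) (op gKi) (op gX) (op gY) s N" using CB_bridge[OF M] by blast
 obtain S' :: "('v \<Rightarrow>\<^sub>0 complex) set" and op' ev' where c': "cps q z M' S' op' ev' s"
  and b': "qsb q z S' (op' gE) (op' gF) (op' gK) (op' gKi) (op' gX) (op' gY) s N" using CB_bridge[OF M'] by blast
 interpret c: cps q z M S op ev s N by (rule c)
 interpret d: cps q z M' S' op' ev' s N by (rule c')
 interpret Q: qsb q z S "op gE" "op gF" "op gK" "op gKi" "op gX" "op gY" s N by (rule b)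
 interpret Q': qsb q z S' "op' gE" "op' gF" "op' gK" "op' gKi" "op' gX" "op' gY" s N by (rule b')
 define iv where "iv = the_inv_into S' ev'"
 have iv: "iv v \<in> S'" "ev' (iv v) = v" if "v \<in> carrier M'" for v
  using bij_betwE[OF bij_betw_the_inv_into[OF d.ev_bij]] f_the_inv_into_f_bij_betw[OF d.ev_bij] that unfolding iv_def by auto
 have ivw: "iv v \<in> d.ww l" if "v \<in> vec q l M'" for v l
 proof -
  have vC: "v \<in> carrier M'" using that by (simp add: vec_def)
  show ?thesis using that d.vec_ww[OF iv(1)[OF vC], of l] unfolding iv(2)[OF vC] by blast
 qed
 have lift: "iv (g (ev x)) \<in> d.ww l" "ev' (iv (g (ev x))) = g (ev x)"
  "y \<in> c.ww l \<Longrightarrow> iv (g (ev (x + y))) = iv (g (ev x)) + iv (g (ev y))"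
  "iv (g (ev (k *s x))) = k *s iv (g (ev x))"
  if g: "veclin l M M' g" and x: "x \<in> c.ww l" for g l x y k
 proof -
  have ex: "ev y \<in> vec q l M" if "y \<in> c.ww l" for y using that c.vec_ww[OF c.wwD(1)[OF that]] by blast
  have gx: "g (ev y) \<in> vec q l M'" if "y \<in> c.ww l" for y using g ex[OF that] unfolding veclin_def by blast
  show 1: "iv (g (ev x)) \<in> d.ww l" by (rule ivw[OF gx[OF x]])
  have eg: "ev' (iv (g (ev y))) = g (ev y)" if "y \<in> c.ww l" for y using gx[OF that] by (intro iv(2)) (simp add: vec_def)
  show "ev' (iv (g (ev x))) = g (ev x)" by (rule eg[OF x])
  have inj: "a = b" if "a \<in> S'" "b \<in> S'" "ev' a = ev' b" for a b using d.ev_inj[OF that(1,2)] that(3) by blast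
  show "iv (g (ev (x + y))) = iv (g (ev x)) + iv (g (ev y))" if y: "y \<in> c.ww l"
  proof (rule inj)
   have xy: "x + y \<in> c.ww l" by (rule cv.subspace_add[OF c.sub_ww x y])
   have S': "iv (g (ev x)) \<in> S'" "iv (g (ev y)) \<in> S'" "iv (g (ev (x + y))) \<in> S'"
    using d.wwD(1)[OF ivw[OF gx[OF x]]] d.wwD(1)[OF ivw[OF gx[OF y]]] d.wwD(1)[OF ivw[OF gx[OF xy]]] .
   show "iv (g (ev (x + y))) \<in> S'" "iv (g (ev x)) + iv (g (ev y)) \<in> S'" using S' by simp_all
   have "ev' (iv (g (ev (x + y)))) = g (ev (x + y))" by (rule eg[OF xy])
   also have "\<dots> = g (ev x \<oplus>\<^bsub>M\<^esub> ev y)" unfolding c.ev_add[OF c.wwD(1)[OF x] c.wwD(1)[OF y]] ..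
   also have "\<dots> = g (ev x) \<oplus>\<^bsub>M'\<^esub> g (ev y)" using g ex[OF x] ex[OF y] unfolding veclin_def by blast
   also have "\<dots> = ev' (iv (g (ev x)) + iv (g (ev y)))" unfolding d.ev_add[OF S'(1,2)] eg[OF x] eg[OF y] ..
   finally show "ev' (iv (g (ev (x + y)))) = ev' (iv (g (ev x)) + iv (g (ev y)))" .
  qed
  show "iv (g (ev (k *s x))) = k *s iv (g (ev x))"
  proof (rule inj)
   have kx: "k *s x \<in> c.ww l" by (rule cv.subspace_scale[OF c.sub_ww x])
   have S': "iv (g (ev x)) \<in> S'" "iv (g (ev (k *s x))) \<in> S'"
    using d.wwD(1)[OF ivw[OF gx[OF x]]] d.wwD(1)[OF ivw[OF gx[OF kx]]] .
   show "iv (g (ev (k *s x))) \<in> S'" "k *s iv (g (ev x)) \<in> S'" using S' by simp_all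
   have "ev' (iv (g (ev (k *s x)))) = g (ev (k *s x))" by (rule eg[OF kx])
   also have "\<dots> = g (cls q (scalar k) \<odot>\<^bsub>M\<^esub> ev x)" unfolding c.ev_scale[OF c.wwD(1)[OF x]] ..
   also have "\<dots> = cls q (scalar k) \<odot>\<^bsub>M'\<^esub> g (ev x)" using g ex[OF x] unfolding veclin_def by blast
   also have "\<dots> = ev' (k *s iv (g (ev x)))" unfolding d.ev_scale[OF S'(1)] eg[OF x] ..
   finally show "ev' (iv (g (ev (k *s x)))) = ev' (k *s iv (g (ev x)))" .
  qed
 qed
 have ex: "ev y \<in> vec q l M" if "y \<in> c.ww l" for y l using that c.vec_ww[OF c.wwD(1)[OF that]] by blast
 have inj: "a = b" if "a \<in> S'" "b \<in> S'" "ev' a = ev' b" for a b using d.ev_inj[OF that(1,2)] that(3) by blast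
 interpret P: pairq q z S "op gE" "op gF" "op gK" "op gKi" "op gX" "op gY" s N
  S' "op' gE" "op' gF" "op' gK" "op' gKi" "op' gX" "op' gY" "\<lambda>x. iv (g0 (ev x))" "\<lambda>x. iv (g1 (ev x))"
 proof (intro pairq.intro b b' pairq_axioms.intro N)
  show "(op' gE ^^ N) (iv (g1 (ev x))) = iv (g0 (ev ((op gE ^^ N) x)))" if x: "x \<in> c.ww l1" for x
  proof (rule inj)
   have s: "iv (g1 (ev x)) \<in> S'" by (rule d.wwD(1)[OF lift(1)[OF g1 x]])
   have y: "(op gE ^^ N) x \<in> c.ww l0" by (rule Q.EN_l1[OF x])
   show "(op' gE ^^ N) (iv (g1 (ev x))) \<in> S'" using s by simp
   show "iv (g0 (ev ((op gE ^^ N) x))) \<in> S'" by (rule d.wwD(1)[OF lift(1)[OF g0 y]])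
   have "ev' ((op' gE ^^ N) (iv (g1 (ev x)))) = cls q (eE ^ N) \<odot>\<^bsub>M'\<^esub> g1 (ev x)"
    unfolding d.E_ev[OF s, symmetric] lift(2)[OF g1 x] ..
   also have "\<dots> = g0 (cls q (eE ^ N) \<odot>\<^bsub>M\<^esub> ev x)" by (rule gE[OF ex[OF x], symmetric])
   also have "\<dots> = ev' (iv (g0 (ev ((op gE ^^ N) x))))"
    unfolding lift(2)[OF g0 y] unfolding c.E_ev[OF c.wwD(1)[OF x]] ..
   finally show "ev' ((op' gE ^^ N) (iv (g1 (ev x)))) = ev' (iv (g0 (ev ((op gE ^^ N) x))))" .
  qed
  show "(d.F' ^^ N) (iv (g0 (ev x))) = iv (g1 (ev ((c.F' ^^ N) x)))" if x: "x \<in> c.ww l0" for x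
  proof (rule inj)
   have s: "iv (g0 (ev x)) \<in> S'" by (rule d.wwD(1)[OF lift(1)[OF g0 x]])
   have y: "(c.F' ^^ N) x \<in> c.ww l1" by (rule Q.F'N_l0[OF x])
   show "(d.F' ^^ N) (iv (g0 (ev x))) \<in> S'" using s by simp
   show "iv (g1 (ev ((c.F' ^^ N) x))) \<in> S'" by (rule d.wwD(1)[OF lift(1)[OF g1 y]])
   have "ev' ((d.F' ^^ N) (iv (g0 (ev x)))) = cls q (lowF ^ N) \<odot>\<^bsub>M'\<^esub> g0 (ev x)"
    unfolding d.F_ev[OF s, symmetric] lift(2)[OF g0 x] ..
   also have "\<dots> = g1 (cls q (lowF ^ N) \<odot>\<^bsub>M\<^esub> ev x)" by (rule gF[OF ex[OF x], symmetric])
   also have "\<dots> = ev' (iv (g1 (ev ((c.F' ^^ N) x))))"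
    unfolding lift(2)[OF g1 y] unfolding c.F_ev[OF c.wwD(1)[OF x]] ..
   finally show "ev' ((d.F' ^^ N) (iv (g0 (ev x)))) = ev' (iv (g1 (ev ((c.F' ^^ N) x))))" .
  qed
 qed (rule lift[OF g0] lift[OF g1], assumption+)+
 obtain h where hS: "\<And>x. x \<in> S \<Longrightarrow> h x \<in> S'" and hadd: "\<And>x y. x \<in> S \<Longrightarrow> y \<in> S \<Longrightarrow> h (x + y) = h x + h y"
  and hscale: "\<And>c x. x \<in> S \<Longrightarrow> h (c *s x) = c *s h x"
  and hop: "\<And>x. x \<in> S \<Longrightarrow> h (op gE x) = op' gE (h x) \<and> h (op gF x) = op' gF (h x) \<and> h (op gK x) = op' gK (h x) \<and>
   h (op gKi x) = op' gKi (h x) \<and> h (op gX x) = op' gX (h x) \<and> h (op gY x) = op' gY (h x)"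
  and h0: "\<And>x. x \<in> c.ww l0 \<Longrightarrow> h x = iv (g0 (ev x))" and h1: "\<And>x. x \<in> c.ww l1 \<Longrightarrow> h x = iv (g1 (ev x))"
  using P.extension by (elim exE conjE) (rule that, blast+)
 have hl: "h (op g x) = op' g (h x)" if x: "x \<in> S" for g x
  using hop[OF x] hscale[OF x] c.opZ[OF x] d.opZ[OF hS[OF x]] by (cases g) simp_all
 define f where "f m = ev' (h (the_inv_into S ev m))" for m
 have fe: "f (ev x) = ev' (h x)" if "x \<in> S" for x
  unfolding f_def the_inv_into_f_f[OF bij_betw_imp_inj_on[OF c.ev_bij] that] ..
 show ?thesis
 proof (intro bexI[of _ f] conjI ballI linear_map_by_letters CB_left M M')
  show "f m = g0 m" if "m \<in> vec q l0 M" for m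
  proof -
   obtain x where x: "x \<in> c.ww l0" "m = ev x" using \<open>m \<in> vec q l0 M\<close> unfolding c.vec_eq by blast
   show ?thesis unfolding x(2) fe[OF c.wwD(1)[OF x(1)]] h0[OF x(1)] by (rule lift(2)[OF g0 x(1)])
  qed
  show "f m = g1 m" if "m \<in> vec q l1 M" for m
  proof -
   obtain x where x: "x \<in> c.ww l1" "m = ev x" using \<open>m \<in> vec q l1 M\<close> unfolding c.vec_eq by blast
   show ?thesis unfolding x(2) fe[OF c.wwD(1)[OF x(1)]] h1[OF x(1)] by (rule lift(2)[OF g1 x(1)])
  qed
  fix v assume v: "v \<in> carrier M"
  then obtain x where x: "x \<in> S" "v = ev x" using c.ev_surj by blast
  show "f v \<in> carrier M'" unfolding x(2) fe[OF x(1)] by (rule d.ev_carrier[OF hS[OF x(1)]])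
  show "f (cls q (scalar k) \<odot>\<^bsub>M\<^esub> v) = cls q (scalar k) \<odot>\<^bsub>M'\<^esub> f v" for k
   unfolding x(2) fe[OF x(1)] c.ev_scale[OF x(1), symmetric] d.ev_scale[OF hS[OF x(1)], symmetric]
   using fe[of "k *s x"] hscale[OF x(1)] x(1) by simp
  show "f (cls q (letter g) \<odot>\<^bsub>M\<^esub> v) = cls q (letter g) \<odot>\<^bsub>M'\<^esub> f v" for g
   unfolding x(2) fe[OF x(1)] c.ev_op[OF x(1), symmetric] d.ev_op[OF hS[OF x(1)], symmetric]
   using fe[OF c.op_S[OF x(1)]] hl[OF x(1)] by simp
  fix w assume "w \<in> carrier M"
  then obtain y where y: "y \<in> S" "w = ev y" using c.ev_surj by blast
  show "f (v \<oplus>\<^bsub>M\<^esub> w) = f v \<oplus>\<^bsub>M'\<^esub> f w"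
   unfolding x(2) y(2) fe[OF x(1)] fe[OF y(1)] c.ev_add[OF x(1) y(1), symmetric] d.ev_add[OF hS[OF x(1)] hS[OF y(1)], symmetric]
   using fe[of "x + y"] hadd[OF x(1) y(1)] x(1) y(1) by simp
 qed
qed

end

section \<open>The equivalence with quiver representations\<close>

lemma complex_pair_surj: "\<exists>p :: complex \<Rightarrow> complex \<times> complex. surj p"
proof -
 have "infinite (UNIV :: complex set)" by (rule infinite_UNIV_char_0)
 from card_of_ordIso[THEN iffD2, OF card_of_Times_same_infinite[OF this]]
 obtain f :: "complex \<times> complex \<Rightarrow> complex" where f: "bij_betw f (UNIV \<times> UNIV) UNIV" by blast
 then have "bij f" by simp
 then show ?thesis by (intro exI[of _ "inv_into UNIV f"]) (rule bij_is_surj[OF bij_imp_bij_inv])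
qed

text \<open>Since the complex numbers map onto their own square, induction on the generators makes
  them map onto any finite-dimensional space.\<close>

lemma span_range:
 assumes "finite (G :: 'a::cvec set)" shows "\<exists>h :: complex \<Rightarrow> 'a. cv.span G \<subseteq> range h"
 using assms
proof induction
 case empty
 show ?case by (intro exI[of _ "\<lambda>_. 0"]) simp
next
 case (insert a G)
 obtain h :: "complex \<Rightarrow> 'a" where h: "cv.span G \<subseteq> range h" using insert.IH by blast
 obtain p :: "complex \<Rightarrow> complex \<times> complex" where p: "surj p" using complex_pair_surj by blast
 have "x \<in> range (\<lambda>t. fst (p t) *s a + h (snd (p t)))" if x: "x \<in> cv.span (insert a G)" for x
 proof -
  obtain k where "x - k *s a \<in> cv.span G" using x unfolding cv.span_breakdown_eq by blast
  then obtain u where u: "x - k *s a = h u" using h by blast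
  obtain t where "p t = (k, u)" using p by (metis surjD)
  then have "x = fst (p t) *s a + h (snd (p t))" using u by (simp add: algebra_simps)
  then show ?thesis by blast
 qed
 then show ?case by blast
qed

lemma inj_from_range:
 assumes "X \<subseteq> range (h :: complex \<Rightarrow> 'a)" "inj (g :: complex \<Rightarrow> 'w)" shows "\<exists>j :: 'a \<Rightarrow> 'w. inj_on j X"
proof -
 have "inj_on (inv_into UNIV h) X" by (rule inj_on_inv_into[OF assms(1)])
 then have "inj_on (g \<circ> inv_into UNIV h) X" using assms(2) by (auto simp: inj_on_def)
 then show ?thesis by blast
qed

text \<open>The analogue of \<open>rec_mod\<close> for vector spaces: a subspace \<open>W\<close> of
  a vector space type, renamed by the injection \<open>j\<close> into another type.\<close>

definition vs_rec :: "'a::cvec set \<Rightarrow> ('a \<Rightarrow> 'w) \<Rightarrow> (complex, 'w) module" where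
 "vs_rec W j = \<lparr>carrier = j ` W, mult = undefined, one = undefined, zero = j 0,
   add = (\<lambda>u v. j (the_inv_into W j u + the_inv_into W j v)), smult = (\<lambda>c u. j (c *s the_inv_into W j u))\<rparr>"

context
 fixes W :: "'a::cvec set" and j :: "'a \<Rightarrow> 'w"
 assumes W: "cv.subspace W" and j: "inj_on j W"
begin

lemma vs_inv: "w \<in> W \<Longrightarrow> the_inv_into W j (j w) = w" by (rule the_inv_into_f_f[OF j])

lemma vs_simps:
 "carrier (vs_rec W j) = j ` W" "\<zero>\<^bsub>vs_rec W j\<^esub> = j 0"
 "w \<in> W \<Longrightarrow> w' \<in> W \<Longrightarrow> j w \<oplus>\<^bsub>vs_rec W j\<^esub> j w' = j (w + w')" "w \<in> W \<Longrightarrow> c \<odot>\<^bsub>vs_rec W j\<^esub> j w = j (c *s w)"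
 by (simp_all add: vs_rec_def vs_inv)

lemma vs_clo: "0 \<in> W" "w \<in> W \<Longrightarrow> w' \<in> W \<Longrightarrow> w + w' \<in> W" "w \<in> W \<Longrightarrow> c *s w \<in> W" "w \<in> W \<Longrightarrow> - w \<in> W"
 using W by (auto intro: cv.subspace_0 cv.subspace_add cv.subspace_scale cv.subspace_neg)

lemma vs_rec_module: "Module.module complex_field (vs_rec W j)"
proof (rule moduleI[OF complex_field_cring])
 show "abelian_group (vs_rec W j)"
 proof (rule abelian_groupI)
  fix x assume "x \<in> carrier (vs_rec W j)"
  then obtain w where w: "w \<in> W" "x = j w" by (auto simp: vs_simps)
  show "\<exists>y\<in>carrier (vs_rec W j). y \<oplus>\<^bsub>vs_rec W j\<^esub> x = \<zero>\<^bsub>vs_rec W j\<^esub>"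
   by (rule bexI[of _ "j (- w)"]) (use w vs_clo in \<open>auto simp: vs_simps\<close>)
 qed (auto simp: vs_simps vs_clo add_ac)
qed (auto simp: vs_simps vs_clo vs)

lemma vs_rec_fg:
 assumes G: "finite G" "W \<subseteq> cv.span G" shows "finitely_generated complex_field (vs_rec W j)"
proof -
 obtain B where B: "B \<subseteq> W" "cv.independent B" "W \<subseteq> cv.span B" using cv.maximal_independent_subset[of W] by blast
 have "finite B" using cv.independent_span_bound[OF G(1) B(2)] B(1) G(2) by blast
 moreover have "j ` B \<subseteq> carrier (vs_rec W j)" using B(1) by (auto simp: vs_simps)
 moreover have "generated_submodule complex_field (vs_rec W j) (j ` B) = carrier (vs_rec W j)"
 proof
  have L: "left_module complex_field (vs_rec W j)" by (rule left_module_of_module[OF vs_rec_module])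
  have c: "j ` B \<subseteq> carrier (vs_rec W j)" using B(1) by (auto simp: vs_simps)
  note g = generated_submodule_submodule[OF L c]
  show "generated_submodule complex_field (vs_rec W j) (j ` B) \<subseteq> carrier (vs_rec W j)" by (rule submoduleD(1)[OF g(1)])
  let ?H = "generated_submodule complex_field (vs_rec W j) (j ` B)"
  note D = submoduleD[OF g(1)]
  have "cv.subspace {w \<in> W. j w \<in> ?H}"
  proof (rule cv.subspaceI)
   show "0 \<in> {w \<in> W. j w \<in> ?H}" using vs_clo D(2) by (simp add: vs_simps)
   show "x + y \<in> {w \<in> W. j w \<in> ?H}" if "x \<in> {w \<in> W. j w \<in> ?H}" "y \<in> {w \<in> W. j w \<in> ?H}" for x y
    using that vs_clo(2) D(3)[of "j x" "j y"] by (simp add: vs_simps)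
   show "c *s x \<in> {w \<in> W. j w \<in> ?H}" if "x \<in> {w \<in> W. j w \<in> ?H}" for c x
    using that vs_clo(3) D(5)[of c "j x"] by (simp add: vs_simps)
  qed
  moreover have "B \<subseteq> {w \<in> W. j w \<in> ?H}" using B(1) g(2) by blast
  ultimately have "cv.span B \<subseteq> {w \<in> W. j w \<in> ?H}" by (intro span_subset_subspace)
  then show "carrier (vs_rec W j) \<subseteq> ?H" using B(3) unfolding vs_simps(1) by blast
 qed
 ultimately show ?thesis unfolding finitely_generated_def by blast
qed

lemma vs_rec_linear:
 assumes "\<And>w. w \<in> W \<Longrightarrow> f (j w) = \<phi> w" "\<And>w. w \<in> W \<Longrightarrow> \<phi> w \<in> carrier X"
  "\<And>w w'. w \<in> W \<Longrightarrow> w' \<in> W \<Longrightarrow> \<phi> (w + w') = \<phi> w \<oplus>\<^bsub>X\<^esub> \<phi> w'" "\<And>c w. w \<in> W \<Longrightarrow> \<phi> (c *s w) = c \<odot>\<^bsub>X\<^esub> \<phi> w"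
 shows "f \<in> linear_maps complex_field (vs_rec W j) X"
 using assms by (auto simp: linear_maps_def vs_simps vs_clo)

lemma vs_rec_bij:
 assumes "\<And>w. w \<in> W \<Longrightarrow> f (j w) = \<phi> w" "inj_on \<phi> W"
 shows "bij_betw f (carrier (vs_rec W j)) (\<phi> ` W)"
proof (rule bij_betw_imageI)
 show "inj_on f (carrier (vs_rec W j))"
  unfolding vs_simps(1)
 proof (rule inj_onI)
  fix x y assume xy: "x \<in> j ` W" "y \<in> j ` W" "f x = f y"
  then obtain w w' where w: "w \<in> W" "x = j w" "w' \<in> W" "y = j w'" by blast
  have "\<phi> w = \<phi> w'" using xy(3) assms(1)[OF w(1)] assms(1)[OF w(3)] unfolding w(2,4) by simp
  then show "x = y" using inj_onD[OF assms(2) _ w(1,3)] unfolding w(2,4) by simp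
 qed
 show "f ` carrier (vs_rec W j) = \<phi> ` W"
  unfolding vs_simps(1) image_image by (rule image_cong[OF refl assms(1)])
qed

end

text \<open>Sections of the generators of \<open>V\<close> span the copy \<open>S\<close>: the image
  of their span under \<open>ev\<close> is a submodule containing the generators.\<close>

lemma typed_space_fg:
 assumes V: "Module.module complex_field (V :: (complex, 'v) module)" "finitely_generated complex_field V"
  and S: "cv.subspace (S :: 'a::cvec set)" and ev: "\<And>f. ev f \<in> carrier V"
   "\<And>f g. ev (f + g) = ev f \<oplus>\<^bsub>V\<^esub> ev g" "\<And>c f. ev (c *s f) = c \<odot>\<^bsub>V\<^esub> ev f"
  and sect: "\<And>x. x \<in> carrier V \<Longrightarrow> sect x \<in> S \<and> ev (sect x) = x" "\<And>f. f \<in> S \<Longrightarrow> sect (ev f) = f"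
 shows "\<exists>G. finite G \<and> G \<subseteq> S \<and> S \<subseteq> cv.span G"
proof -
 interpret V: Module.module complex_field V by (rule V(1))
 have L: "left_module complex_field V" by (rule left_module_of_module[OF V(1)])
 obtain A where A: "finite A" "A \<subseteq> carrier V" "generated_submodule complex_field V A = carrier V"
  using V(2) unfolding finitely_generated_def by blast
 let ?G = "sect ` A"
 have GS: "?G \<subseteq> S" using A(2) sect(1) by blast
 have spS: "cv.span ?G \<subseteq> S" by (rule span_subset_subspace[OF GS S])
 have e0: "ev 0 = \<zero>\<^bsub>V\<^esub>" using ev(3)[of 0 0] V.smult_l_null[OF ev(1)[of 0]] by simp
 have em: "\<ominus>\<^bsub>V\<^esub> ev x = ev (- x)" for x
  by (rule V.minus_equality) (use ev(2)[of "- x" x] e0 ev(1) in simp_all)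
 have "submodule (ev ` cv.span ?G) complex_field V"
 proof (rule submodule_by_closure[OF L])
  show "ev ` cv.span ?G \<subseteq> carrier V" using ev(1) by blast
  show "\<zero>\<^bsub>V\<^esub> \<in> ev ` cv.span ?G" unfolding e0[symmetric] by (rule imageI[OF cv.span_zero])
  show "\<ominus>\<^bsub>V\<^esub> x \<in> ev ` cv.span ?G" if x: "x \<in> ev ` cv.span ?G" for x
  proof -
   obtain y where y: "y \<in> cv.span ?G" "x = ev y" using x by blast
   show ?thesis unfolding y(2) em by (rule imageI[OF cv.span_neg[OF y(1)]])
  qed
  show "x \<oplus>\<^bsub>V\<^esub> y \<in> ev ` cv.span ?G" if xy: "x \<in> ev ` cv.span ?G" "y \<in> ev ` cv.span ?G" for x y
  proof -
   obtain u v where u: "u \<in> cv.span ?G" "x = ev u" "v \<in> cv.span ?G" "y = ev v" using xy by blast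
   show ?thesis unfolding u(2,4) ev(2)[symmetric] by (rule imageI[OF cv.span_add[OF u(1,3)]])
  qed
  show "c \<odot>\<^bsub>V\<^esub> x \<in> ev ` cv.span ?G" if x: "x \<in> ev ` cv.span ?G" for c x
  proof -
   obtain y where y: "y \<in> cv.span ?G" "x = ev y" using x by blast
   show ?thesis unfolding y(2) ev(3)[symmetric] by (rule imageI[OF cv.span_scale[OF y(1)]])
  qed
 qed
 moreover have "A \<subseteq> ev ` cv.span ?G"
 proof
  fix a assume a: "a \<in> A"
  then have "ev (sect a) = a" using A(2) sect(1) by blast
  then show "a \<in> ev ` cv.span ?G" using a cv.span_base[of "sect a" ?G] by (metis imageI)
 qed
 ultimately have cV: "carrier V \<subseteq> ev ` cv.span ?G"
  using generated_submodule_submodule(3)[OF L A(2)] unfolding A(3) by blast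
 have "x \<in> cv.span ?G" if x: "x \<in> S" for x
 proof -
  obtain y where y: "y \<in> cv.span ?G" "ev x = ev y" using cV ev(1)[of x] by blast
  have "sect (ev x) = sect (ev y)" using y(2) by (rule arg_cong)
  then have "x = y" using sect(2) x y(1) spS by (metis subsetD)
  then show ?thesis using y(1) by simp
 qed
 then show ?thesis using A(1) GS by blast
qed

definition typed :: "(complex, 'v) module \<Rightarrow> 'a::cvec set \<Rightarrow> ('a \<Rightarrow> 'v) \<Rightarrow> ('v \<Rightarrow> 'a) \<Rightarrow> bool" where
 "typed V S ev sect \<longleftrightarrow> cv.subspace S \<and> (\<forall>f. ev f \<in> carrier V) \<and>
  (\<forall>f g. ev (f + g) = ev f \<oplus>\<^bsub>V\<^esub> ev g) \<and> (\<forall>c f. ev (c *s f) = c \<odot>\<^bsub>V\<^esub> ev f) \<and>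
  (\<forall>x\<in>carrier V. sect x \<in> S \<and> ev (sect x) = x) \<and> (\<forall>f\<in>S. sect (ev f) = f) \<and>
  (\<forall>x\<in>carrier V. \<forall>y\<in>carrier V. sect (x \<oplus>\<^bsub>V\<^esub> y) = sect x + sect y) \<and>
  (\<forall>c. \<forall>x\<in>carrier V. sect (c \<odot>\<^bsub>V\<^esub> x) = c *s sect x)"

lemma typedD:
 assumes "typed V S ev sect"
 shows "cv.subspace S" "ev f \<in> carrier V" "ev (f + g) = ev f \<oplus>\<^bsub>V\<^esub> ev g" "ev (c *s f) = c \<odot>\<^bsub>V\<^esub> ev f"
  "x \<in> carrier V \<Longrightarrow> sect x \<in> S \<and> ev (sect x) = x" "f \<in> S \<Longrightarrow> sect (ev f) = f"
  "x \<in> carrier V \<Longrightarrow> y \<in> carrier V \<Longrightarrow> sect (x \<oplus>\<^bsub>V\<^esub> y) = sect x + sect y"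
  "x \<in> carrier V \<Longrightarrow> sect (c \<odot>\<^bsub>V\<^esub> x) = c *s sect x"
 using assms unfolding typed_def by blast+

text \<open>\<alpha> identifies a vector space in another type with the singular vectors of weight
  \<open>l\<close> in \<open>M\<close>.\<close>

definition vtx :: "complex \<Rightarrow> complex \<Rightarrow> (ualg, 'v) module \<Rightarrow> (complex, 'w) module \<Rightarrow> ('w \<Rightarrow> 'v) \<Rightarrow> bool" where
 "vtx q l M W \<alpha> \<longleftrightarrow> Module.module complex_field W \<and> \<alpha> \<in> linear_maps complex_field W (vector_space_of q M) \<and>
   bij_betw \<alpha> (carrier W) (vec q l M)"

lemma vtxD:
 assumes "vtx q l M W \<alpha>"
 shows "x \<in> carrier W \<Longrightarrow> \<alpha> x \<in> vec q l M" "x \<in> carrier W \<Longrightarrow> \<alpha> x \<in> carrier M"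
  "x \<in> carrier W \<Longrightarrow> y \<in> carrier W \<Longrightarrow> \<alpha> (x \<oplus>\<^bsub>W\<^esub> y) = \<alpha> x \<oplus>\<^bsub>M\<^esub> \<alpha> y"
  "x \<in> carrier W \<Longrightarrow> \<alpha> (c \<odot>\<^bsub>W\<^esub> x) = cls q (scalar c) \<odot>\<^bsub>M\<^esub> \<alpha> x"
  "x \<in> carrier W \<Longrightarrow> y \<in> carrier W \<Longrightarrow> \<alpha> x = \<alpha> y \<Longrightarrow> x = y"
  "m \<in> vec q l M \<Longrightarrow> \<exists>x\<in>carrier W. m = \<alpha> x"
  "x \<in> carrier W \<Longrightarrow> y \<in> carrier W \<Longrightarrow> x \<oplus>\<^bsub>W\<^esub> y \<in> carrier W" "x \<in> carrier W \<Longrightarrow> c \<odot>\<^bsub>W\<^esub> x \<in> carrier W"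
proof -
 interpret Module.module complex_field W using assms by (simp add: vtx_def)
 have l: "\<alpha> \<in> linear_maps complex_field W (vector_space_of q M)" and b: "bij_betw \<alpha> (carrier W) (vec q l M)"
  using assms by (simp_all add: vtx_def)
 show "x \<in> carrier W \<Longrightarrow> \<alpha> x \<in> vec q l M" using bij_betwE[OF b] by blast
 then show "x \<in> carrier W \<Longrightarrow> \<alpha> x \<in> carrier M" by (simp add: vec_def)
 show "x \<in> carrier W \<Longrightarrow> y \<in> carrier W \<Longrightarrow> \<alpha> (x \<oplus>\<^bsub>W\<^esub> y) = \<alpha> x \<oplus>\<^bsub>M\<^esub> \<alpha> y"
  using linear_mapsD(2)[OF l] by (simp add: vector_space_of_def)
 show "x \<in> carrier W \<Longrightarrow> \<alpha> (c \<odot>\<^bsub>W\<^esub> x) = cls q (scalar c) \<odot>\<^bsub>M\<^esub> \<alpha> x"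
  using linear_mapsD(3)[OF l] by (simp add: vector_space_of_def)
 show "x \<in> carrier W \<Longrightarrow> y \<in> carrier W \<Longrightarrow> \<alpha> x = \<alpha> y \<Longrightarrow> x = y"
  using inj_onD[OF bij_betw_imp_inj_on[OF b]] by blast
 show "m \<in> vec q l M \<Longrightarrow> \<exists>x\<in>carrier W. m = \<alpha> x" using bij_betw_imp_surj_on[OF b] by blast
 show "x \<in> carrier W \<Longrightarrow> y \<in> carrier W \<Longrightarrow> x \<oplus>\<^bsub>W\<^esub> y \<in> carrier W" by simp
 show "x \<in> carrier W \<Longrightarrow> c \<odot>\<^bsub>W\<^esub> x \<in> carrier W" by simp
qed

lemma vec_map:
 assumes "left_module (U q) M" "left_module (U q) M'" "f \<in> linear_maps (U q) M M'" "m \<in> vec q l M"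
 shows "f m \<in> vec q l M'"
proof -
 note D = linear_mapsD[OF assms(3)]
 have z: "f \<zero>\<^bsub>M\<^esub> = \<zero>\<^bsub>M'\<^esub>"
  by (rule linear_map_zero_neg(1)[OF assms(3) left_module.axioms(2)[OF assms(1)] left_module.axioms(2)[OF assms(2)]])
 have m: "m \<in> carrier M" "cls q eX \<odot>\<^bsub>M\<^esub> m = \<zero>\<^bsub>M\<^esub>" "cls q eK \<odot>\<^bsub>M\<^esub> m = cls q (scalar l) \<odot>\<^bsub>M\<^esub> m"
  using assms(4) by (simp_all add: vec_def)
 show ?thesis
  unfolding vec_def using D(1)[OF m(1)] D(3)[OF cls_simps(1) m(1)] z m(2,3) by (metis (mono_tags, lifting) mem_Collect_eq)
qed

text \<open>The map \<open>f\<close> seen through the identifications \<alpha> and \<alpha>'. It is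
  undefined outside the carrier, as morphisms of the quiver category are.\<close>

definition cj :: "(complex, 'w) module \<Rightarrow> ('w \<Rightarrow> 'v) \<Rightarrow> (complex, 'w) module \<Rightarrow> ('w \<Rightarrow> 'v) \<Rightarrow> ('v \<Rightarrow> 'v) \<Rightarrow> 'w \<Rightarrow> 'w" where
 "cj W \<alpha> W' \<alpha>' f = (\<lambda>x\<in>carrier W. the_inv_into (carrier W') \<alpha>' (f (\<alpha> x)))"

lemma cj_ext: "cj W \<alpha> W' \<alpha>' f \<in> extensional (carrier W)" by (simp add: cj_def)

lemma cj_eq:
 assumes "vtx q l M' W' \<alpha>'" "x \<in> carrier W" "y \<in> carrier W'" "\<alpha>' y = f (\<alpha> x)"
 shows "cj W \<alpha> W' \<alpha>' f x = y"
proof -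
 have "inj_on \<alpha>' (carrier W')" using assms(1) by (simp add: vtx_def bij_betw_def)
 then show ?thesis using the_inv_into_f_f[of \<alpha>' "carrier W'" y] assms(2-4) by (simp add: cj_def)
qed

lemma cj:
 assumes M: "left_module (U q) M" "left_module (U q) M'" and v: "vtx q l M W \<alpha>" and v': "vtx q l M' W' \<alpha>'"
  and f: "f \<in> linear_maps (U q) M M'"
 shows "x \<in> carrier W \<Longrightarrow> cj W \<alpha> W' \<alpha>' f x \<in> carrier W'" "x \<in> carrier W \<Longrightarrow> \<alpha>' (cj W \<alpha> W' \<alpha>' f x) = f (\<alpha> x)"
  "cj W \<alpha> W' \<alpha>' f \<in> linear_maps complex_field W W'"
proof -
 let ?h = "cj W \<alpha> W' \<alpha>' f"
 note D = linear_mapsD[OF f] and A = vtxD[OF v] and A' = vtxD[OF v']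
 have 1: "?h x \<in> carrier W' \<and> \<alpha>' (?h x) = f (\<alpha> x)" if x: "x \<in> carrier W" for x
 proof -
  obtain y where y: "y \<in> carrier W'" "f (\<alpha> x) = \<alpha>' y" using A'(6)[OF vec_map[OF M f A(1)[OF x]]] by blast
  have "?h x = y" by (rule cj_eq[where f = f and \<alpha> = \<alpha>, OF v' x y(1) y(2)[symmetric]])
  then show ?thesis using y by simp
 qed
 then show "x \<in> carrier W \<Longrightarrow> ?h x \<in> carrier W'" "x \<in> carrier W \<Longrightarrow> \<alpha>' (?h x) = f (\<alpha> x)" by blast+
 show "?h \<in> linear_maps complex_field W W'"
  unfolding linear_maps_def
 proof (intro CollectI conjI ballI Pi_I)
  show "?h x \<in> carrier W'" if "x \<in> carrier W" for x using 1[OF that] by blast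
  show "?h (x \<oplus>\<^bsub>W\<^esub> y) = ?h x \<oplus>\<^bsub>W'\<^esub> ?h y" if x: "x \<in> carrier W" and y: "y \<in> carrier W" for x y
  proof (rule cj_eq[OF v' A(7)[OF x y]])
   show "?h x \<oplus>\<^bsub>W'\<^esub> ?h y \<in> carrier W'" using A'(7) 1[OF x] 1[OF y] by blast
   show "\<alpha>' (?h x \<oplus>\<^bsub>W'\<^esub> ?h y) = f (\<alpha> (x \<oplus>\<^bsub>W\<^esub> y))"
    using A'(3)[of "?h x" "?h y"] 1[OF x] 1[OF y] A(3)[OF x y] D(2)[OF A(2)[OF x] A(2)[OF y]] by simp
  qed
  show "?h (c \<odot>\<^bsub>W\<^esub> x) = c \<odot>\<^bsub>W'\<^esub> ?h x" if x: "x \<in> carrier W" for c x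
  proof (rule cj_eq[OF v' A(8)[OF x]])
   show "c \<odot>\<^bsub>W'\<^esub> ?h x \<in> carrier W'" using A'(8) 1[OF x] by blast
   show "\<alpha>' (c \<odot>\<^bsub>W'\<^esub> ?h x) = f (\<alpha> (c \<odot>\<^bsub>W\<^esub> x))"
    using A'(4)[of "?h x" c] 1[OF x] A(4)[OF x, of c] D(3)[OF cls_simps(1) A(2)[OF x]] by simp
  qed
 qed
qed

context qsp
begin

lemma veclin_conj:
 assumes v: "vtx q l M W \<alpha>" and v': "vtx q l M' W' \<alpha>'" and g: "g \<in> linear_maps complex_field W W'"
 shows "\<exists>h. veclin l M M' h \<and> (\<forall>x\<in>carrier W. h (\<alpha> x) = \<alpha>' (g x))"
proof -
 note A = vtxD[OF v] and A' = vtxD[OF v'] and D = linear_mapsD[OF g]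
 define h where "h m = \<alpha>' (g (the_inv_into (carrier W) \<alpha> m))" for m
 have h: "h (\<alpha> x) = \<alpha>' (g x)" if "x \<in> carrier W" for x
  using v that the_inv_into_f_f[of \<alpha> "carrier W" x] by (simp add: h_def vtx_def bij_betw_def)
 have "veclin l M M' h"
  unfolding veclin_def
 proof (intro conjI ballI allI)
  show "h m \<in> vec q l M'" if m: "m \<in> vec q l M" for m
  proof -
   obtain x where x: "x \<in> carrier W" "m = \<alpha> x" using A(6)[OF m] by blast
   show ?thesis unfolding x(2) h[OF x(1)] by (rule A'(1)[OF D(1)[OF x(1)]])
  qed
  show "h (m \<oplus>\<^bsub>M\<^esub> m') = h m \<oplus>\<^bsub>M'\<^esub> h m'" if m: "m \<in> vec q l M" "m' \<in> vec q l M" for m m'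
  proof -
   obtain x y where x: "x \<in> carrier W" "m = \<alpha> x" "y \<in> carrier W" "m' = \<alpha> y" using A(6)[OF m(1)] A(6)[OF m(2)] by blast
   show ?thesis
    unfolding x(2,4) A(3)[OF x(1,3), symmetric] h[OF A(7)[OF x(1,3)]] h[OF x(1)] h[OF x(3)] D(2)[OF x(1,3)]
    by (rule A'(3)[OF D(1)[OF x(1)] D(1)[OF x(3)]])
  qed
  show "h (cls q (scalar c) \<odot>\<^bsub>M\<^esub> m) = cls q (scalar c) \<odot>\<^bsub>M'\<^esub> h m" if m: "m \<in> vec q l M" for c m
  proof -
   obtain x where x: "x \<in> carrier W" "m = \<alpha> x" using A(6)[OF m] by blast
   have "g (c \<odot>\<^bsub>W\<^esub> x) = c \<odot>\<^bsub>W'\<^esub> g x" by (rule D(3)[OF _ x(1)]) simp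
   then show ?thesis
    unfolding x(2) A(4)[OF x(1), symmetric] h[OF A(8)[OF x(1)]] h[OF x(1)] using A'(4)[OF D(1)[OF x(1)]] by simp
  qed
 qed
 then show ?thesis using h by blast
qed

text \<open>Vertex 1 carries weight \<open>l1\<close> and vertex 2 weight \<open>l0\<close>, so the
  arrow \<open>a\<close> climbs by \<open>E ^ N\<close> and \<open>b\<close> descends by
  \<open>F' ^ N\<close>. The relation is that descending from \<open>l0\<close> and climbing back
  gives zero.\<close>

definition frame :: "(ualg, 'v) module \<Rightarrow> 'w quiver_rep \<Rightarrow> ('w \<Rightarrow> 'v) \<Rightarrow> ('w \<Rightarrow> 'v) \<Rightarrow> bool" where
 "frame M V \<alpha> \<beta> \<longleftrightarrow> M \<in> CB \<and> V \<in> quiver_reps \<and> vtx q l1 M (sp1 V) \<alpha> \<and> vtx q l0 M (sp2 V) \<beta> \<and>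
   (\<forall>x\<in>carrier (sp1 V). \<beta> (arr_a V x) = cls q (eE ^ N) \<odot>\<^bsub>M\<^esub> \<alpha> x) \<and>
   (\<forall>x\<in>carrier (sp2 V). \<alpha> (arr_b V x) = cls q (lowF ^ N) \<odot>\<^bsub>M\<^esub> \<beta> x)"

text \<open>The two weight spaces are finite-dimensional, hence inject into \<open>'w\<close>; their
  images with the transported maps form the representation.\<close>

lemma frame_of_module:
 assumes M: "(M :: (ualg, 'v) module) \<in> CB" and N: "N > 0" and g: "inj (g :: complex \<Rightarrow> 'w)"
 shows "\<exists>(V :: 'w quiver_rep) \<alpha> \<beta>. frame M V \<alpha> \<beta>"
proof -
 obtain S :: "('v \<Rightarrow>\<^sub>0 complex) set" and op ev where c: "cps q z M S op ev s"
  and b: "qsb q z S (op gE) (op gF) (op gK) (op gKi) (op gX) (op gY) s N" using CB_bridge[OF M] by blast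
 interpret cps q z M S op ev s N by (rule c)
 interpret Q: qsb q z S "op gE" "op gF" "op gK" "op gKi" "op gX" "op gY" s N by (rule b)
 have "finitely_generated (U q) M" using M by (simp add: charged_block_def block_def category_O_def)
 then obtain G where G: "finite G" "G \<subseteq> S" "\<And>P. opstable P \<Longrightarrow> G \<subseteq> P \<Longrightarrow> S \<subseteq> P" using fg_dest by blast
 note fin = Q.VV_finite[OF N G(1,2) G(3)[unfolded opstable_iff]]
 obtain A0 A1 where A: "finite A0" "ww l0 \<subseteq> cv.span A0" "finite A1" "ww l1 \<subseteq> cv.span A1" using fin by blast
 have "\<exists>j :: ('v \<Rightarrow>\<^sub>0 complex) \<Rightarrow> 'w. inj_on j X" if "finite A" "X \<subseteq> cv.span A" for X A
  using span_range[OF that(1)] inj_from_range[OF _ g, of X] that(2) by (metis subset_trans)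
 then obtain j1 j2 :: "('v \<Rightarrow>\<^sub>0 complex) \<Rightarrow> 'w" where j: "inj_on j1 (ww l1)" "inj_on j2 (ww l0)" using A by metis
 note r1 = sub_ww[of l1] j(1) and r2 = sub_ww[of l0] j(2)
 define i1 where "i1 = the_inv_into (ww l1) j1"
 define i2 where "i2 = the_inv_into (ww l0) j2"
 have i: "i1 (j1 x) = x" if "x \<in> ww l1" for x using vs_inv[OF r1 that] by (simp add: i1_def)
 have i': "i2 (j2 x) = x" if "x \<in> ww l0" for x using vs_inv[OF r2 that] by (simp add: i2_def)
 define V where "V = \<lparr>sp1 = vs_rec (ww l1) j1, sp2 = vs_rec (ww l0) j2,
  arr_a = (\<lambda>x. j2 ((op gE ^^ N) (i1 x))), arr_b = (\<lambda>x. j1 ((F' ^^ N) (i2 x)))\<rparr>"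
 have V: "sp1 V = vs_rec (ww l1) j1" "sp2 V = vs_rec (ww l0) j2" "arr_a V x = j2 ((op gE ^^ N) (i1 x))"
  "arr_b V x = j1 ((F' ^^ N) (i2 x))" for x by (simp_all add: V_def)
 have a: "arr_a V \<in> linear_maps complex_field (vs_rec (ww l1) j1) (vs_rec (ww l0) j2)"
  by (rule vs_rec_linear[OF r1, where \<phi> = "\<lambda>x. j2 ((op gE ^^ N) x)"])
   (use Q.EN_l1 in \<open>simp_all add: V i vs_simps[OF r2] clin[OF linEk]\<close>)
 have b: "arr_b V \<in> linear_maps complex_field (vs_rec (ww l0) j2) (vs_rec (ww l1) j1)"
  by (rule vs_rec_linear[OF r2, where \<phi> = "\<lambda>x. j1 ((F' ^^ N) x)"])
   (use Q.F'N_l0 in \<open>simp_all add: V i' vs_simps[OF r1] clin[OF linF'k]\<close>)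
 have ab: "arr_a V (arr_b V x) = \<zero>\<^bsub>sp2 V\<^esub>" if x: "x \<in> carrier (sp2 V)" for x
 proof -
  obtain w where w: "w \<in> ww l0" "x = j2 w" using x by (auto simp: V vs_simps[OF r2])
  show ?thesis using i[OF Q.F'N_l0[OF w(1)]] Q.EN_F'N[OF w(1) N] by (simp add: V w(2) i'[OF w(1)] vs_simps[OF r2])
 qed
 have q: "V \<in> quiver_reps"
  unfolding quiver_reps_def
  using vs_rec_module[OF r1] vs_rec_module[OF r2] vs_rec_fg[OF r1 A(3,4)] vs_rec_fg[OF r2 A(1,2)] a b ab
  by (simp add: V(1,2))
 have vt: "vtx q l M (vs_rec (ww l) j) (\<lambda>x. ev (the_inv_into (ww l) j x))" if r: "inj_on j (ww l)" for l and j :: "('v \<Rightarrow>\<^sub>0 complex) \<Rightarrow> 'w"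
  unfolding vtx_def
 proof (intro conjI vs_rec_module sub_ww r)
  show "(\<lambda>x. ev (the_inv_into (ww l) j x)) \<in> linear_maps complex_field (vs_rec (ww l) j) (vector_space_of q M)"
   by (rule vs_rec_linear[OF sub_ww r, where \<phi> = ev])
    (use wwD(1) in \<open>simp_all add: vs_inv[OF sub_ww r] vector_space_of_def ev_add ev_scale\<close>)
  show "bij_betw (\<lambda>x. ev (the_inv_into (ww l) j x)) (carrier (vs_rec (ww l) j)) (vec q l M)"
   unfolding vec_eq
   by (rule vs_rec_bij[OF sub_ww r])
    (simp add: vs_inv[OF sub_ww r], meson bij_betw_imp_inj_on[OF ev_bij] inj_on_subset subsetI wwD(1))
 qed
 have "frame M V (\<lambda>x. ev (i1 x)) (\<lambda>x. ev (i2 x))"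
  unfolding frame_def
 proof (intro conjI ballI M q)
  show "vtx q l1 M (sp1 V) (\<lambda>x. ev (i1 x))" unfolding V(1) i1_def by (rule vt[OF j(1)])
  show "vtx q l0 M (sp2 V) (\<lambda>x. ev (i2 x))" unfolding V(2) i2_def by (rule vt[OF j(2)])
  show "ev (i2 (arr_a V x)) = cls q (eE ^ N) \<odot>\<^bsub>M\<^esub> ev (i1 x)" if x: "x \<in> carrier (sp1 V)" for x
  proof -
   obtain w where w: "w \<in> ww l1" "x = j1 w" using x by (auto simp: V vs_simps[OF r1])
   show ?thesis unfolding V(3) w(2) i[OF w(1)] i'[OF Q.EN_l1[OF w(1)]] E_ev[OF wwD(1)[OF w(1)]] ..
  qed
  show "ev (i1 (arr_b V x)) = cls q (lowF ^ N) \<odot>\<^bsub>M\<^esub> ev (i2 x)" if x: "x \<in> carrier (sp2 V)" for x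
  proof -
   obtain w where w: "w \<in> ww l0" "x = j2 w" using x by (auto simp: V vs_simps[OF r2])
   show ?thesis unfolding V(4) w(2) i'[OF w(1)] i[OF Q.F'N_l0[OF w(1)]] F_ev[OF wwD(1)[OF w(1)]] ..
  qed
 qed
 then show ?thesis by blast
qed

text \<open>The representation is copied into a vector space type, the model of \<open>quiv\<close>
  is built from the copy, and its underlying set is injected into \<open>'v\<close>.\<close>

lemma frame_of_quiver:
 assumes V: "(V :: 'w quiver_rep) \<in> quiver_reps" and N: "N > 0" and g: "inj (g :: complex \<Rightarrow> 'v)"
 shows "\<exists>(M :: (ualg, 'v) module) \<alpha> \<beta>. frame M V \<alpha> \<beta>"
proof -
 note v = quiver_repsD[OF V] and La = linear_mapsD[OF quiver_repsD(5)[OF V]] and Lb = linear_mapsD[OF quiver_repsD(6)[OF V]]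
 have fg: "finitely_generated complex_field (sp1 V)" "finitely_generated complex_field (sp2 V)"
  and ab: "\<And>x. x \<in> carrier (sp2 V) \<Longrightarrow> arr_a V (arr_b V x) = \<zero>\<^bsub>sp2 V\<^esub>"
  using V by (auto simp: quiver_reps_def)
 obtain S1 :: "('w \<Rightarrow>\<^sub>0 complex) set" and ev1 sect1 where t1: "typed (sp1 V) S1 ev1 sect1"
  using typed_space[OF v(1), folded typed_def] by blast
 obtain S2 :: "('w \<Rightarrow>\<^sub>0 complex) set" and ev2 sect2 where t2: "typed (sp2 V) S2 ev2 sect2"
  using typed_space[OF v(2), folded typed_def] by blast
 note S1 = typedD(1)[OF t1] and e1 = typedD(2-4)[OF t1] and s1 = typedD(5-8)[OF t1]
 note S2 = typedD(1)[OF t2] and e2 = typedD(2-4)[OF t2] and s2 = typedD(5-8)[OF t2]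
 obtain G1 where G1: "finite G1" "G1 \<subseteq> S1" "S1 \<subseteq> cv.span G1" using typed_space_fg[OF v(1) fg(1) S1 e1 s1(1,2)] by blast
 obtain G2 where G2: "finite G2" "G2 \<subseteq> S2" "S2 \<subseteq> cv.span G2" using typed_space_fg[OF v(2) fg(2) S2 e2 s2(1,2)] by blast
 define a where "a x = sect2 (arr_a V (ev1 x))" for x
 define b where "b x = sect1 (arr_b V (ev2 x))" for x
 have la: "clinear a"
  by (rule clinearI) (simp_all add: a_def e1 La s2)
 have lb: "clinear b"
  by (rule clinearI) (simp_all add: b_def e2 Lb s1)
 have z2: "sect2 \<zero>\<^bsub>sp2 V\<^esub> = 0"
 proof -
  interpret V2: left_module complex_field "sp2 V" by (rule v(4))
  have "sect2 \<zero>\<^bsub>sp2 V\<^esub> = sect2 \<zero>\<^bsub>sp2 V\<^esub> + sect2 \<zero>\<^bsub>sp2 V\<^esub>" using s2(3)[of "\<zero>\<^bsub>sp2 V\<^esub>" "\<zero>\<^bsub>sp2 V\<^esub>"] by simp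
  then show ?thesis by simp
 qed
 have aba: "a (b x) = 0" for x
  using s1(1)[OF Lb(1)[OF e2(1)]] ab[OF e2(1)] by (simp add: a_def b_def z2)
 interpret Q: quiv q z s N S1 S2 a b G1 G2
  by (intro quiv.intro qsp_axioms quiv_axioms.intro S1 S2 la lb G1 G2)
   (use s1(1)[OF Lb(1)[OF e2(1)]] s2(1)[OF La(1)[OF e1(1)]] aba N in \<open>simp_all add: a_def b_def\<close>)
 have "\<exists>h :: nat \<Rightarrow> complex \<Rightarrow> nat \<Rightarrow> nat \<Rightarrow> 'w \<Rightarrow>\<^sub>0 complex. \<forall>D. cv.span (Q.M.GG D) \<subseteq> range (h D)"
  using span_range[OF Q.M.finite_GG] by (intro choice) blast
 then obtain h :: "nat \<Rightarrow> complex \<Rightarrow> nat \<Rightarrow> nat \<Rightarrow> 'w \<Rightarrow>\<^sub>0 complex" where h: "\<And>D. cv.span (Q.M.GG D) \<subseteq> range (h D)" by blast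
 obtain p :: "complex \<Rightarrow> complex \<times> complex" where p: "surj p" using complex_pair_surj by blast
 \<comment> \<open>The model is a countable union of the spans of the finite sets
   \<open>Q.M.GG D\<close>, each an image of the complex numbers. A pair of complex numbers encodes
   the stage \<open>D\<close>, as the floor of a real part, and a point of its span.\<close>
 have "Q.SS \<subseteq> range (\<lambda>t. h (nat \<lfloor>Re (fst (p t))\<rfloor>) (snd (p t)))"
 proof
  fix x assume "x \<in> Q.SS"
  then obtain D where "x \<in> cv.span (Q.M.GG D)" using Q.SS_fam Q.M.S_GG by blast
  then obtain u where u: "x = h D u" using h by blast
  obtain t where "p t = (of_nat D, u)" using p by (metis surjD)
  then have "x = h (nat \<lfloor>Re (fst (p t))\<rfloor>) (snd (p t))" using u by simp
  then show "x \<in> range (\<lambda>t. h (nat \<lfloor>Re (fst (p t))\<rfloor>) (snd (p t)))" by blast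
 qed
 then obtain j :: "(nat \<Rightarrow> nat \<Rightarrow> 'w \<Rightarrow>\<^sub>0 complex) \<Rightarrow> 'v" where j: "inj_on j Q.SS" using inj_from_range[OF _ g] by blast
 define M where "M = rec_mod q Q.SS Q.M.opf j"
 have pr: "presents q M Q.SS Q.M.opf j"
  unfolding M_def by (rule presents_rec_mod) (use Q.M.subS Q.M.lopf Q.M.opf_S Q.M.opf_relators j in auto)
 interpret p: pres q M Q.SS Q.M.opf j by (rule pres.intro[OF pr])
 interpret c: cpres q z M Q.SS Q.M.opf j by (rule p.cpres_intro[OF qparam]) simp
 interpret c: cps q z M Q.SS Q.M.opf j s N by (intro cps.intro c.cpres_axioms qsp_axioms)
 have cw: "c.ww l = Q.M.ww l" for l unfolding c.ww_def Q.M.ww_def by simp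
 have cF: "c.F' = Q.M.F'" by (rule ext) (simp add: c.F'_def Q.M.F'_def)
 have "M \<in> block q (half_coset q s) (ctilde q z l0) z"
  by (rule c.block_intro[where B = Q.BB]) (simp add: Q.M.qsh_axioms)
 then have M: "M \<in> CB" using c.charge by (simp add: charged_block_def)
 have N1: "v \<in> S1 \<Longrightarrow> Q.un 0 N v \<in> Q.SS" for v by (rule Q.un_SS) (simp add: Q.CC_def)
 have N2: "v \<in> S2 \<Longrightarrow> Q.un 0 0 v \<in> Q.SS" for v by (rule Q.un_SS) (use N in \<open>simp add: Q.CC_def\<close>)
 have vt: "vtx q l M W (\<lambda>x. j (Q.un 0 i (sect x)))"
  if W: "Module.module complex_field W" and sect: "\<And>x. x \<in> carrier W \<Longrightarrow> sect x \<in> C"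
   "\<And>x y. x \<in> carrier W \<Longrightarrow> y \<in> carrier W \<Longrightarrow> sect (x \<oplus>\<^bsub>W\<^esub> y) = sect x + sect y"
   "\<And>c x. x \<in> carrier W \<Longrightarrow> sect (c \<odot>\<^bsub>W\<^esub> x) = c *s sect x" and b: "bij_betw sect (carrier W) C"
   and u: "\<And>v. v \<in> C \<Longrightarrow> Q.un 0 i v \<in> Q.SS" "Q.M.ww l = Q.un 0 i ` C"
  for W l i C and sect :: "'w \<Rightarrow> 'w \<Rightarrow>\<^sub>0 complex"
  unfolding vtx_def
 proof (intro conjI W)
  show "(\<lambda>x. j (Q.un 0 i (sect x))) \<in> linear_maps complex_field W (vector_space_of q M)"
   using u(1)[OF sect(1)] by (auto simp: linear_maps_def vector_space_of_def sect(2,3) clin[OF Q.lin_un] p.ev_add p.ev_scale)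
  have 1: "bij_betw (Q.un 0 i) C (Q.un 0 i ` C)" using Q.un_inj by (intro inj_on_imp_bij_betw inj_onI) blast
  have "inj_on j (Q.un 0 i ` C)" using u(1) by (intro inj_on_subset[OF j]) blast
  then have 2: "bij_betw j (Q.un 0 i ` C) (vec q l M)" unfolding c.vec_eq cw u(2) by (rule inj_on_imp_bij_betw)
  show "bij_betw (\<lambda>x. j (Q.un 0 i (sect x))) (carrier W) (vec q l M)"
   using bij_betw_trans[OF bij_betw_trans[OF b 1] 2] by (simp add: o_def)
 qed
 have b1: "bij_betw sect1 (carrier (sp1 V)) S1"
  by (rule bij_betw_byWitness[of _ ev1]) (use s1(1,2) e1(1) in auto)
 have b2: "bij_betw sect2 (carrier (sp2 V)) S2"
  by (rule bij_betw_byWitness[of _ ev2]) (use s2(1,2) e2(1) in auto)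
 have "frame M V (\<lambda>x. j (Q.un 0 N (sect1 x))) (\<lambda>x. j (Q.un 0 0 (sect2 x)))"
  unfolding frame_def
 proof (intro conjI ballI M V)
  show "vtx q l1 M (sp1 V) (\<lambda>x. j (Q.un 0 N (sect1 x)))"
   by (rule vt[OF v(1) _ s1(3,4) b1 N1 Q.ww_l1_un]) (use s1(1) in auto)
  show "vtx q l0 M (sp2 V) (\<lambda>x. j (Q.un 0 0 (sect2 x)))"
   by (rule vt[OF v(2) _ s2(3,4) b2 N2 Q.ww_l0_un[OF N]]) (use s2(1) in auto)
  show "j (Q.un 0 0 (sect2 (arr_a V x))) = cls q (eE ^ N) \<odot>\<^bsub>M\<^esub> j (Q.un 0 N (sect1 x))" if x: "x \<in> carrier (sp1 V)" for x
  proof -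
   have s: "sect1 x \<in> S1" "ev1 (sect1 x) = x" using s1(1)[OF x] by auto
   show ?thesis unfolding c.E_ev[OF N1[OF s(1)]] ops_simps Q.EN_un1[OF N s(1)] a_def s(2) ..
  qed
  show "j (Q.un 0 N (sect1 (arr_b V x))) = cls q (lowF ^ N) \<odot>\<^bsub>M\<^esub> j (Q.un 0 0 (sect2 x))" if x: "x \<in> carrier (sp2 V)" for x
  proof -
   have s: "sect2 x \<in> S2" "ev2 (sect2 x) = x" using s2(1)[OF x] by auto
   show ?thesis unfolding c.F_ev[OF N2[OF s(1)]] cF Q.F'N_un2[OF N] b_def s(2) ..
  qed
 qed
 then show ?thesis by blast
qed

end

section \<open>Bijectivity on morphisms and the equivalence\<close>

lemma cj_restrict:
 assumes "vtx q l M W \<alpha>" shows "cj W \<alpha> W' \<alpha>' (restrict f (carrier M)) = cj W \<alpha> W' \<alpha>' f"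
 unfolding cj_def using vtxD(2)[OF assms] by (intro restrict_ext) simp

lemma linear_maps_restrict:
 assumes "left_module R M" "f \<in> linear_maps R M M'" shows "restrict f (carrier M) \<in> linear_maps R M M'"
proof -
 interpret left_module R M by (rule assms)
 show ?thesis using linear_mapsD[OF assms(2)] by (auto simp: linear_maps_def)
qed

lemma cj_eqI:
 assumes "vtx q l M' W' \<alpha>'" "h \<in> extensional (carrier W)"
  "\<And>x. x \<in> carrier W \<Longrightarrow> h x \<in> carrier W' \<and> \<alpha>' (h x) = f (\<alpha> x)"
 shows "cj W \<alpha> W' \<alpha>' f = h"
 by (rule extensionalityI[OF cj_ext assms(2)]) (use cj_eq[OF assms(1)] assms(3) in blast)

lemma cj_id: assumes "vtx q l M W \<alpha>" shows "cj W \<alpha> W \<alpha> (\<lambda>v\<in>carrier M. v) = (\<lambda>v\<in>carrier W. v)"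
 by (rule cj_eqI[OF assms]) (simp_all add: vtxD[OF assms])

lemma cj_ops:
 assumes M: "left_module (U q) M" "left_module (U q) M'" and v: "vtx q l M W \<alpha>" and v': "vtx q l M' W' \<alpha>'"
  and f: "f \<in> linear_maps (U q) M M'"
 shows "g \<in> linear_maps (U q) M M' \<Longrightarrow> cj W \<alpha> W' \<alpha>' (\<lambda>v\<in>carrier M. f v \<oplus>\<^bsub>M'\<^esub> g v) =
   (\<lambda>x\<in>carrier W. cj W \<alpha> W' \<alpha>' f x \<oplus>\<^bsub>W'\<^esub> cj W \<alpha> W' \<alpha>' g x)"
  "cj W \<alpha> W' \<alpha>' (\<lambda>v\<in>carrier M. cls q (scalar c) \<odot>\<^bsub>M'\<^esub> f v) = (\<lambda>x\<in>carrier W. c \<odot>\<^bsub>W'\<^esub> cj W \<alpha> W' \<alpha>' f x)"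
  "vtx q l M'' W'' \<alpha>'' \<Longrightarrow> left_module (U q) M'' \<Longrightarrow> g \<in> linear_maps (U q) M' M'' \<Longrightarrow>
   cj W \<alpha> W'' \<alpha>'' (compose (carrier M) g f) = compose (carrier W) (cj W' \<alpha>' W'' \<alpha>'' g) (cj W \<alpha> W' \<alpha>' f)"
proof -
 note A = vtxD(2)[OF v] and A' = vtxD[OF v'] and c = cj[OF M v v' f]
 show "cj W \<alpha> W' \<alpha>' (\<lambda>v\<in>carrier M. f v \<oplus>\<^bsub>M'\<^esub> g v) = (\<lambda>x\<in>carrier W. cj W \<alpha> W' \<alpha>' f x \<oplus>\<^bsub>W'\<^esub> cj W \<alpha> W' \<alpha>' g x)"
  if "g \<in> linear_maps (U q) M M'"
  by (rule cj_eqI[OF v']) (simp_all add: A A' c cj[OF M v v' that])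
 show "cj W \<alpha> W' \<alpha>' (\<lambda>v\<in>carrier M. cls q (scalar c) \<odot>\<^bsub>M'\<^esub> f v) = (\<lambda>x\<in>carrier W. c \<odot>\<^bsub>W'\<^esub> cj W \<alpha> W' \<alpha>' f x)"
  by (rule cj_eqI[OF v']) (simp_all add: A A' c)
 show "cj W \<alpha> W'' \<alpha>'' (compose (carrier M) g f) = compose (carrier W) (cj W' \<alpha>' W'' \<alpha>'' g) (cj W \<alpha> W' \<alpha>' f)"
  if "vtx q l M'' W'' \<alpha>''" "left_module (U q) M''" "g \<in> linear_maps (U q) M' M''"
  by (rule cj_eqI[OF that(1)]) (simp_all add: A c cj[OF M(2) that(2) v' that(1,3)] compose_def)
qed

context qsp
begin

lemma frameD:
 assumes "frame M V \<alpha> \<beta>"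
 shows "M \<in> CB" "V \<in> quiver_reps" "vtx q l1 M (sp1 V) \<alpha>" "vtx q l0 M (sp2 V) \<beta>" "left_module (U q) M"
  "x \<in> carrier (sp1 V) \<Longrightarrow> \<beta> (arr_a V x) = cls q (eE ^ N) \<odot>\<^bsub>M\<^esub> \<alpha> x"
  "x \<in> carrier (sp2 V) \<Longrightarrow> \<alpha> (arr_b V x) = cls q (lowF ^ N) \<odot>\<^bsub>M\<^esub> \<beta> x"
  "x \<in> carrier (sp1 V) \<Longrightarrow> arr_a V x \<in> carrier (sp2 V)" "x \<in> carrier (sp2 V) \<Longrightarrow> arr_b V x \<in> carrier (sp1 V)"
proof -
 show M: "M \<in> CB" "V \<in> quiver_reps" "vtx q l1 M (sp1 V) \<alpha>" "vtx q l0 M (sp2 V) \<beta>"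
  "x \<in> carrier (sp1 V) \<Longrightarrow> \<beta> (arr_a V x) = cls q (eE ^ N) \<odot>\<^bsub>M\<^esub> \<alpha> x"
  "x \<in> carrier (sp2 V) \<Longrightarrow> \<alpha> (arr_b V x) = cls q (lowF ^ N) \<odot>\<^bsub>M\<^esub> \<beta> x"
  using assms unfolding frame_def by blast+
 show "left_module (U q) M" by (rule CB_left[OF M(1)])
 show "x \<in> carrier (sp1 V) \<Longrightarrow> arr_a V x \<in> carrier (sp2 V)" "x \<in> carrier (sp2 V) \<Longrightarrow> arr_b V x \<in> carrier (sp1 V)"
  using linear_mapsD(1)[OF quiver_repsD(5)[OF M(2)]] linear_mapsD(1)[OF quiver_repsD(6)[OF M(2)]] by blast+
qed

lemma frame_map:
 assumes t: "frame M V \<alpha> \<beta>" and t': "frame M' V' \<alpha>' \<beta>'" and f: "f \<in> linear_maps (U q) M M'"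
 shows "qhom V V' (cj (sp1 V) \<alpha> (sp1 V') \<alpha>' f) (cj (sp2 V) \<beta> (sp2 V') \<beta>' f)"
proof -
 note D = frameD[OF t] and D' = frameD[OF t'] and L = linear_mapsD(3)[OF f cls_simps(1)]
 note c1 = cj[OF D(5) D'(5) D(3) D'(3) f] and c2 = cj[OF D(5) D'(5) D(4) D'(4) f]
 show ?thesis
  unfolding qhom_def
 proof (intro conjI ballI c1(3) c2(3) cj_ext)
  fix v assume v: "v \<in> carrier (sp1 V)"
  have "f (\<beta> (arr_a V v)) = cls q (eE ^ N) \<odot>\<^bsub>M'\<^esub> f (\<alpha> v)"
   unfolding D(6)[OF v] by (rule L[OF vtxD(2)[OF D(3) v]])
  also have "\<dots> = \<beta>' (arr_a V' (cj (sp1 V) \<alpha> (sp1 V') \<alpha>' f v))"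
   unfolding D'(6)[OF c1(1)[OF v]] c1(2)[OF v] ..
  finally show "cj (sp2 V) \<beta> (sp2 V') \<beta>' f (arr_a V v) = arr_a V' (cj (sp1 V) \<alpha> (sp1 V') \<alpha>' f v)"
   by (intro cj_eq[where f = f and \<alpha> = \<beta>, OF D'(4) D(8)[OF v] D'(8)[OF c1(1)[OF v]]]) simp
 next
  fix v assume v: "v \<in> carrier (sp2 V)"
  have "f (\<alpha> (arr_b V v)) = cls q (lowF ^ N) \<odot>\<^bsub>M'\<^esub> f (\<beta> v)"
   unfolding D(7)[OF v] by (rule L[OF vtxD(2)[OF D(4) v]])
  also have "\<dots> = \<alpha>' (arr_b V' (cj (sp2 V) \<beta> (sp2 V') \<beta>' f v))"
   unfolding D'(7)[OF c2(1)[OF v]] c2(2)[OF v] ..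
  finally show "cj (sp1 V) \<alpha> (sp1 V') \<alpha>' f (arr_b V v) = arr_b V' (cj (sp2 V) \<beta> (sp2 V') \<beta>' f v)"
   by (intro cj_eq[where f = f and \<alpha> = \<alpha>, OF D'(3) D(9)[OF v] D'(9)[OF c2(1)[OF v]]]) simp
 qed
qed

text \<open>The equalizer of the two maps is a submodule containing the singular vectors of both
  weights, hence everything.\<close>

lemma frame_faithful:
 assumes t: "frame M V \<alpha> \<beta>" and t': "frame M' V' \<alpha>' \<beta>'"
  and f: "f \<in> linear_maps (U q) M M'" and g: "g \<in> linear_maps (U q) M M'"
  and e: "cj (sp1 V) \<alpha> (sp1 V') \<alpha>' f = cj (sp1 V) \<alpha> (sp1 V') \<alpha>' g" "cj (sp2 V) \<beta> (sp2 V') \<beta>' f = cj (sp2 V) \<beta> (sp2 V') \<beta>' g"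
  and m: "m \<in> carrier M"
 shows "f m = g m"
proof -
 note D = frameD[OF t] and D' = frameD[OF t']
 let ?H = "{x \<in> carrier M. f x = g x}"
 have "?H = carrier M"
 proof (rule CB_generated[OF D(1) equalizer_submodule[OF D(5) D'(5) f g]])
  show "vec q l0 M \<subseteq> ?H"
  proof
   fix v assume v: "v \<in> vec q l0 M"
   obtain x where x: "x \<in> carrier (sp2 V)" "v = \<beta> x" using vtxD(6)[OF D(4) v] by blast
   have "f v = g v"
    unfolding x(2) cj(2)[OF D(5) D'(5) D(4) D'(4) f x(1), symmetric] cj(2)[OF D(5) D'(5) D(4) D'(4) g x(1), symmetric] e(2) ..
   then show "v \<in> ?H" using v by (simp add: vec_def)
  qed
  show "vec q l1 M \<subseteq> ?H"
  proof
   fix v assume v: "v \<in> vec q l1 M"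
   obtain x where x: "x \<in> carrier (sp1 V)" "v = \<alpha> x" using vtxD(6)[OF D(3) v] by blast
   have "f v = g v"
    unfolding x(2) cj(2)[OF D(5) D'(5) D(3) D'(3) f x(1), symmetric] cj(2)[OF D(5) D'(5) D(3) D'(3) g x(1), symmetric] e(1) ..
   then show "v \<in> ?H" using v by (simp add: vec_def)
  qed
 qed
 then show ?thesis using m by blast
qed

text \<open>The two squares of a morphism of representations are exactly the compatibilities with
  \<open>E ^ N\<close> and \<open>F' ^ N\<close> that \<open>CB_full\<close> asks for.\<close>

lemma frame_full:
 assumes t: "frame M V \<alpha> \<beta>" and t': "frame M' V' \<alpha>' \<beta>'" and N: "N > 0" and h: "qhom V V' h1 h2"
 shows "\<exists>f\<in>linear_maps (U q) M M'. cj (sp1 V) \<alpha> (sp1 V') \<alpha>' f = h1 \<and> cj (sp2 V) \<beta> (sp2 V') \<beta>' f = h2"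
proof -
 note D = frameD[OF t] and D' = frameD[OF t'] and H = qhomD[OF h]
 obtain g1 where g1: "veclin l1 M M' g1" "\<And>x. x \<in> carrier (sp1 V) \<Longrightarrow> g1 (\<alpha> x) = \<alpha>' (h1 x)"
  using veclin_conj[OF D(3) D'(3) H(1)] by blast
 obtain g0 where g0: "veclin l0 M M' g0" "\<And>x. x \<in> carrier (sp2 V) \<Longrightarrow> g0 (\<beta> x) = \<beta>' (h2 x)"
  using veclin_conj[OF D(4) D'(4) H(3)] by blast
 have "\<exists>f\<in>linear_maps (U q) M M'. (\<forall>m\<in>vec q l0 M. f m = g0 m) \<and> (\<forall>m\<in>vec q l1 M. f m = g1 m)"
 proof (rule CB_full[OF D(1) D'(1) N g0(1) g1(1)])
  fix m assume "m \<in> vec q l1 M"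
  then obtain x where x: "x \<in> carrier (sp1 V)" "m = \<alpha> x" using vtxD(6)[OF D(3)] by blast
  show "g0 (cls q (eE ^ N) \<odot>\<^bsub>M\<^esub> m) = cls q (eE ^ N) \<odot>\<^bsub>M'\<^esub> g1 m"
   unfolding x(2) D(6)[OF x(1), symmetric] g0(2)[OF D(8)[OF x(1)]] g1(2)[OF x(1)] D'(6)[OF H(7)[OF x(1)], symmetric] H(5)[OF x(1)] ..
 next
  fix m assume "m \<in> vec q l0 M"
  then obtain x where x: "x \<in> carrier (sp2 V)" "m = \<beta> x" using vtxD(6)[OF D(4)] by blast
  show "g1 (cls q (lowF ^ N) \<odot>\<^bsub>M\<^esub> m) = cls q (lowF ^ N) \<odot>\<^bsub>M'\<^esub> g0 m"
   unfolding x(2) D(7)[OF x(1), symmetric] g1(2)[OF D(9)[OF x(1)]] g0(2)[OF x(1)] D'(7)[OF H(8)[OF x(1)], symmetric] H(6)[OF x(1)] ..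
 qed
 then obtain f where f: "f \<in> linear_maps (U q) M M'" "\<And>m. m \<in> vec q l0 M \<Longrightarrow> f m = g0 m" "\<And>m. m \<in> vec q l1 M \<Longrightarrow> f m = g1 m" by blast
 have "cj (sp1 V) \<alpha> (sp1 V') \<alpha>' f = h1"
  by (rule cj_eqI[OF D'(3) H(2)]) (simp add: f(3)[OF vtxD(1)[OF D(3)]] g1(2) H(7))
 moreover have "cj (sp2 V) \<beta> (sp2 V') \<beta>' f = h2"
  by (rule cj_eqI[OF D'(4) H(4)]) (simp add: f(2)[OF vtxD(1)[OF D(4)]] g0(2) H(8))
 ultimately show ?thesis using f(1) by blast
qed

text \<open>All framings together form the set of the locale \<open>framing\<close>. The injection
  into \<open>'w\<close> gives every module a framing, the one into \<open>'v\<close> every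
  representation.\<close>

theorem equivalence:
 assumes N: "N > 0" and f: "inj (f :: complex \<Rightarrow> 'v)" and g: "inj (g :: complex \<Rightarrow> 'w)"
 shows "equivalent_categories (full_module_category q (CB :: (ualg, 'v) module set))
  (quiver_category :: ('w quiver_rep, ('w \<Rightarrow> 'w) \<times> ('w \<Rightarrow> 'w)) lin_cat)"
proof -
 let ?C = "full_module_category q (CB :: (ualg, 'v) module set)"
 let ?D = "quiver_category :: ('w quiver_rep, ('w \<Rightarrow> 'w) \<times> ('w \<Rightarrow> 'w)) lin_cat"
 let ?T = "{(M :: (ualg, 'v) module, V :: 'w quiver_rep, \<alpha>, \<beta>). frame M V \<alpha> \<beta>}"
 let ?\<phi> = "\<lambda>(M :: (ualg, 'v) module, V :: 'w quiver_rep, \<alpha>, \<beta>) (M' :: (ualg, 'v) module, V' :: 'w quiver_rep, \<alpha>', \<beta>') f.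
   (cj (sp1 V) \<alpha> (sp1 V') \<alpha>' f, cj (sp2 V) \<beta> (sp2 V') \<beta>' f)"
 have C: "Ob ?C = CB" "Hom ?C = ualg_hom_space q" "Id ?C M = (\<lambda>v\<in>carrier M. v)"
  "Comp ?C M M' M'' k h = compose (carrier M) k h" for M M' M'' k h by (simp_all add: full_module_category_def)
 have D: "Ob ?D = quiver_reps" "Hom ?D = quiver_hom_space" "Id ?D V = (\<lambda>v\<in>carrier (sp1 V). v, \<lambda>v\<in>carrier (sp2 V). v)"
  "Comp ?D V V' V'' k h = (compose (carrier (sp1 V)) (fst k) (fst h), compose (carrier (sp2 V)) (snd k) (snd h))"
  for V V' V'' k h by (simp_all add: quiver_category_def)
 have Hc: "h \<in> carrier (ualg_hom_space q M M') \<longleftrightarrow> h \<in> linear_maps (U q) M M' \<and> h \<in> extensional (carrier M)"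
  for h and M M' :: "(ualg, 'v) module" by (simp add: ualg_hom_space_def)
 have "framing ?C ?D ?T fst (\<lambda>(M, V, \<alpha>, \<beta>). V) ?\<phi>"
 proof (intro framing.intro framing_axioms.intro linear_module_category linear_quiver_category CB_left)
  fix t assume "t \<in> ?T"
  then obtain M V \<alpha> \<beta> where t: "t = (M, V, \<alpha>, \<beta>)" "frame M V \<alpha> \<beta>" by blast
  note F = frameD[OF t(2)]
  show "fst t \<in> Ob ?C" using F(1) by (simp add: t(1) C)
  show "(case t of (M, V, \<alpha>, \<beta>) \<Rightarrow> V) \<in> Ob ?D" using F(2) by (simp add: t(1) D)
  show "?\<phi> t t (Id ?C (fst t)) = Id ?D (case t of (M, V, \<alpha>, \<beta>) \<Rightarrow> V)"
   by (simp add: t(1) C D cj_id[OF F(3)] cj_id[OF F(4)])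
  fix t' assume "t' \<in> ?T"
  then obtain M' V' \<alpha>' \<beta>' where t': "t' = (M', V', \<alpha>', \<beta>')" "frame M' V' \<alpha>' \<beta>'" by blast
  note F' = frameD[OF t'(2)]
  let ?a = "cj (sp1 V) \<alpha> (sp1 V') \<alpha>'" and ?b = "cj (sp2 V) \<beta> (sp2 V') \<beta>'"
  let ?H = "ualg_hom_space q M M'" and ?Q = "quiver_hom_space V V'"
  note o1 = cj_ops[OF F(5) F'(5) F(3) F'(3)] and o2 = cj_ops[OF F(5) F'(5) F(4) F'(4)]
  have \<phi>: "?\<phi> t t' = (\<lambda>h. (?a h, ?b h))" by (simp add: t(1) t'(1))
  have car: "(?a h, ?b h) \<in> carrier ?Q" if "h \<in> carrier ?H" for h
   using frame_map[OF t(2) t'(2)] that unfolding qhom_carrier Hc by simp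
  have Hom: "Hom ?C (fst t) (fst t') = ?H"
   "Hom ?D (case t of (M, V, \<alpha>, \<beta>) \<Rightarrow> V) (case t' of (M, V, \<alpha>, \<beta>) \<Rightarrow> V) = ?Q"
   by (simp_all add: t(1) t'(1) C D)
  show "?\<phi> t t' \<in> linear_maps complex_field (Hom ?C (fst t) (fst t')) (Hom ?D (case t of (M, V, \<alpha>, \<beta>) \<Rightarrow> V) (case t' of (M, V, \<alpha>, \<beta>) \<Rightarrow> V))"
   unfolding linear_maps_def Hom \<phi>
  proof (intro CollectI conjI ballI Pi_I)
   fix h assume h: "h \<in> carrier ?H"
   note hl = h[unfolded Hc, THEN conjunct1]
   show "(?a h, ?b h) \<in> carrier ?Q" by (rule car[OF h])
   show "(?a (h \<oplus>\<^bsub>?H\<^esub> k), ?b (h \<oplus>\<^bsub>?H\<^esub> k)) = (?a h, ?b h) \<oplus>\<^bsub>?Q\<^esub> (?a k, ?b k)" if k: "k \<in> carrier ?H" for k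
    using o1(1)[OF hl, of k] o2(1)[OF hl, of k] k[unfolded Hc] by (simp add: ualg_hom_space_def quiver_hom_space_def)
   show "(?a (c \<odot>\<^bsub>?H\<^esub> h), ?b (c \<odot>\<^bsub>?H\<^esub> h)) = c \<odot>\<^bsub>?Q\<^esub> (?a h, ?b h)" for c
    using o1(2)[OF hl, of c] o2(2)[OF hl, of c] by (simp add: ualg_hom_space_def quiver_hom_space_def)
  qed
  show "bij_betw (?\<phi> t t') (carrier (Hom ?C (fst t) (fst t')))
    (carrier (Hom ?D (case t of (M, V, \<alpha>, \<beta>) \<Rightarrow> V) (case t' of (M, V, \<alpha>, \<beta>) \<Rightarrow> V)))"
   unfolding Hom \<phi>
  proof (rule bij_betw_imageI)
   show "inj_on (\<lambda>h. (?a h, ?b h)) (carrier ?H)"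
   proof (rule inj_onI)
    fix h k assume h: "h \<in> carrier ?H" and k: "k \<in> carrier ?H" and e: "(?a h, ?b h) = (?a k, ?b k)"
    note hk = h[unfolded Hc] k[unfolded Hc]
    show "h = k"
    proof (rule extensionalityI[of _ "carrier M"])
     show "h m = k m" if "m \<in> carrier M" for m
      by (rule frame_faithful[OF t(2) t'(2) _ _ _ _ that]) (use hk e in simp_all)
    qed (use hk in simp_all)
   qed
   show "(\<lambda>h. (?a h, ?b h)) ` carrier ?H = carrier ?Q"
   proof
    show "(\<lambda>h. (?a h, ?b h)) ` carrier ?H \<subseteq> carrier ?Q" using car by (rule image_subsetI)
    show "carrier ?Q \<subseteq> (\<lambda>h. (?a h, ?b h)) ` carrier ?H"
    proof
     fix k assume "k \<in> carrier ?Q"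
     then have "qhom V V' (fst k) (snd k)" by (simp only: qhom_carrier)
     then obtain h where h: "h \<in> linear_maps (U q) M M'" "?a h = fst k" "?b h = snd k"
      using frame_full[OF t(2) t'(2) N] by blast
     have A: "restrict h (carrier M) \<in> carrier ?H"
      unfolding Hc using linear_maps_restrict[OF F(5) h(1)] by simp
     have B: "k = (?a (restrict h (carrier M)), ?b (restrict h (carrier M)))"
      unfolding cj_restrict[OF F(3)] cj_restrict[OF F(4)] h(2,3) by simp
     show "k \<in> (\<lambda>h. (?a h, ?b h)) ` carrier ?H" by (rule image_eqI[OF _ A]) (rule B)
    qed
   qed
  qed
  fix t'' h k assume "t'' \<in> ?T" and "h \<in> carrier (Hom ?C (fst t) (fst t'))" "k \<in> carrier (Hom ?C (fst t') (fst t''))"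
  then obtain M'' V'' \<alpha>'' \<beta>'' where t'': "t'' = (M'', V'', \<alpha>'', \<beta>'')" "frame M'' V'' \<alpha>'' \<beta>''"
   and h: "h \<in> linear_maps (U q) M M'" and k: "k \<in> linear_maps (U q) M' M''"
   by (auto simp: t(1) t'(1) C Hc)
  note F'' = frameD[OF t''(2)]
  show "?\<phi> t t'' (Comp ?C (fst t) (fst t') (fst t'') k h) =
    Comp ?D (case t of (M, V, \<alpha>, \<beta>) \<Rightarrow> V) (case t' of (M, V, \<alpha>, \<beta>) \<Rightarrow> V) (case t'' of (M, V, \<alpha>, \<beta>) \<Rightarrow> V) (?\<phi> t' t'' k) (?\<phi> t t' h)"
   by (simp add: t(1) t'(1) t''(1) C D o1(3)[OF h F''(3) F''(5) k] o2(3)[OF h F''(4) F''(5) k])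
 next
  fix M assume "M \<in> Ob ?C"
  then have "M \<in> CB" by (simp add: C)
  from frame_of_module[OF this N g] show "\<exists>t\<in>?T. fst t = M" by force
 next
  fix V assume "V \<in> Ob ?D"
  then have "V \<in> quiver_reps" by (simp add: D)
  from frame_of_quiver[OF this N f] show "\<exists>t\<in>?T. (case t of (M, V, \<alpha>, \<beta>) \<Rightarrow> V) = V" by force
 qed
 then show ?thesis by (rule framing.equivalent)
qed

end

text \<open>Simple objects are classified in the whole block, since \<open>Z\<close> acts on them by
  \<open>z\<close>. Semisimplicity and the equivalence concern the modules on which \<open>Z\<close>
  is the scalar \<open>z\<close>: the block also contains self-extensions of Verma modules on which
  \<open>Z\<close> acts as \<open>z\<close> plus a nonzero nilpotent.\<close>

theorem proposition12:
 fixes q s z :: complex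
 assumes "q \<noteq> 0"
  and "\<forall>n::nat. n > 0 \<longrightarrow> q ^ n \<noteq> 1"
  and "s ^ 2 = q"
  and "z \<noteq> 0"
  \<comment> \<open>the types carrying the modules, resp. the quiver representations, have room for sets of the cardinality of the continuum\<close>
  and "\<exists>f :: complex \<Rightarrow> 'v. inj f"
  and "\<exists>g :: complex \<Rightarrow> 'w. inj g"
 shows
  "(verma q (s powi (- 3)) z \<in> block q (half_coset q s) (ctilde q z (s powi (- 3))) z \<and>
   simple_module (U q) (verma q (s powi (- 3)) z) \<and>
   (\<forall>M \<in> (block q (half_coset q s) (ctilde q z (s powi (- 3))) z :: (ualg, 'v) module set).
     simple_module (U q) M \<longrightarrow> module_iso (U q) M (verma q (s powi (- 3)) z)) \<and>
   (\<forall>M \<in> (charged_block q (half_coset q s) (ctilde q z (s powi (- 3))) z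
        :: (ualg, 'v) module set).
     semisimple_module (U q) M))
   \<and>
   (\<forall>n::nat.
    verma q (s powi (- 2 * int n - 5)) z
     \<in> block q (half_coset q s) (ctilde q z (s powi (2 * int n - 1))) z \<and>
    simple_module (U q) (verma q (s powi (- 2 * int n - 5)) z) \<and>
    simple_quotient q (s powi (2 * int n - 1)) z
     \<in> block q (half_coset q s) (ctilde q z (s powi (2 * int n - 1))) z \<and>
    simple_module (U q) (simple_quotient q (s powi (2 * int n - 1)) z) \<and>
    \<not> module_iso (U q) (verma q (s powi (- 2 * int n - 5)) z)
      (simple_quotient q (s powi (2 * int n - 1)) z) \<and>
    (\<forall>M \<in> (block q (half_coset q s) (ctilde q z (s powi (2 * int n - 1))) z
         :: (ualg, 'v) module set).
      simple_module (U q) M \<longrightarrow>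
       module_iso (U q) M (verma q (s powi (- 2 * int n - 5)) z) \<or>
       module_iso (U q) M (simple_quotient q (s powi (2 * int n - 1)) z)))
   \<and>
   (\<forall>n::nat.
    equivalent_categories
     (full_module_category q
       (charged_block q (half_coset q s) (ctilde q z (s powi (2 * int n - 1))) z
        :: (ualg, 'v) module set))
     (quiver_category :: ('w quiver_rep, ('w \<Rightarrow> 'w) \<times> ('w \<Rightarrow> 'w)) lin_cat))"
proof -
 have qsp: "qsp q z s" using assms(1-4) by unfold_locales auto
 obtain f :: "complex \<Rightarrow> 'v" and g :: "complex \<Rightarrow> 'w" where fg: "inj f" "inj g" using assms(5,6) by blast
 \<comment> \<open>For \<open>N = 0\<close> both weights are \<open>s powi (- 3)\<close>; for
   \<open>N = Suc n\<close> the exponents \<open>2 * N - 3\<close> and \<open>- 2 * N - 3\<close>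
   become \<open>2 * n - 1\<close> and \<open>- 2 * n - 5\<close>.\<close>
 have l: "qsp.l0 s 0 = s powi (- 3)" "qsp.l1 s 0 = s powi (- 3)"
  "qsp.l0 s (Suc n) = s powi (2 * int n - 1)" "qsp.l1 s (Suc n) = s powi (- 2 * int n - 5)" for n
 proof -
  have e: "2 * int (Suc n) - 3 = 2 * int n - 1" "- 2 * int (Suc n) - 3 = - 2 * int n - 5" by simp_all
  show "qsp.l0 s 0 = s powi (- 3)" "qsp.l1 s 0 = s powi (- 3)"
   by (simp_all add: qsp.l0_def[OF qsp] qsp.l1_def[OF qsp])
  show "qsp.l0 s (Suc n) = s powi (2 * int n - 1)" "qsp.l1 s (Suc n) = s powi (- 2 * int n - 5)"
   unfolding qsp.l0_def[OF qsp] qsp.l1_def[OF qsp] e by (rule refl)+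
 qed
 have c0: "module_iso (U q) M (verma q (s powi (- 3)) z)"
  if "M \<in> block q (half_coset q s) (ctilde q z (s powi (- 3))) z" "simple_module (U q) M" for M :: "(ualg, 'v) module"
  using qsp.simple_classify[OF qsp, of M 0] that unfolding l by blast
 have c1: "module_iso (U q) M (verma q (s powi (- 2 * int n - 5)) z) \<or> module_iso (U q) M (simple_quotient q (s powi (2 * int n - 1)) z)"
  if "M \<in> block q (half_coset q s) (ctilde q z (s powi (2 * int n - 1))) z" "simple_module (U q) M" for M :: "(ualg, 'v) module" and n
  using qsp.simple_classify[OF qsp, of M "Suc n"] that unfolding l by blast
 show ?thesis
  using qsp.verma_l1_block[OF qsp, of 0, unfolded l] qsp.verma_l1_simple[OF qsp, of 0, unfolded l] c0
   qsp.semisimple[OF qsp refl, unfolded l]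
   qsp.verma_l1_block[OF qsp, of "Suc _", unfolded l] qsp.verma_l1_simple[OF qsp, of "Suc _", unfolded l]
   qsp.simple_quotient_props(2-4)[OF qsp zero_less_Suc, unfolded l] c1
   qsp.equivalence[OF qsp zero_less_Suc fg, unfolded l]
  by (intro conjI allI ballI impI)
qed

end
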